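(* Let $\lambda\vdash n$, $\mu\vdash n-1$ with $\mu\nearrow\lambda$. Then $$S^{\lambda,\mu\nearrow\lambda}(t;x_1,x_2,\dots)=\sum_{\nu\subseteq\mu}\varphi_{\mu/\nu,\lambda/\nu}\,t^{|\lambda/\nu|-1}s_\nu(x_1,x_2,\dots),$$ where $s_\nu$ is the Schur function and $$\varphi_{\mu/\nu,\lambda/\nu}=\begin{cases}(-1)^{\langle\lambda/\nu\rangle}\prod_{s\in SC}[c(\lambda/\mu)-c(s)]\prod_{d\in DB,\,d\ne\lambda/\mu}[c(\lambda/\mu)-c(d)]^{-1},&\lambda/\nu\text{ a broken border strip},\\0,&\text{otherwise},\end{cases}$$ with $SC$, $DB$ the sets of sharp corners and dull boxes of $\lambda/\nu$ and $\langle\lambda/\nu\rangle$ its height.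
   Context: $S(n)$ is the symmetric group on $\{1,\dots,n\}$, $S(n-1)$ its subgroup fixing $n$; $\chi^\lambda$ is the irreducible character indexed by $\lambda$; $\mu\nearrow\lambda$ means $\lambda$ is obtained from $\mu$ by adding one box. The generalized character is $\Gamma^{\lambda,\mu\nearrow\lambda}(x)=\frac{\chi^\mu(e)}{(n-1)!}\sum_{y\in S(n-1)}\chi^\lambda(xy^{-1})\chi^\mu(y)$. For $w\in S(n)$ whose cycle containing $n$ has length $j$ and whose other cycles have type $\rho\vdash n-j$, set $\psi(w)=t^{j-1}p_\rho$ ($p_\rho$ power sums); for $g$ on $S(n)$ invariant under conjugation by $S(n-1)$, $\mathrm{Ch}'(g)=\frac{1}{(n-1)!}\sum_{w\in S(n)}g(w)\psi(w)$. The generalized Schur function is $S^{\lambda,\mu\nearrow\lambda}=\mathrm{Ch}'(\Gamma^{\lambda,\mu\nearrow\lambda})$. The content $c(b)$ of a box in row $i$, column $j$ is $j-i$; $c(\lambda/\mu)$ is the content of the box $\lambda/\mu$. A broken border strip is a skew diagram with no $2\times2$ block of boxes; a sharp corner of it is a box with a box of the strip directly below and one directly to its right; a dull box is a box with none directly to its right and none directly below. The height of a connected border strip is its number of rows minus one, and $\langle\lambda/\nu\rangle$ is the sum of heights of the connected components. *)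

theory Defs
  imports
    Complex_Main
    "HOL-Library.Function_Algebras"
    "HOL-Library.Multiset"
    "HOL-Computational_Algebra.Polynomial"
    "HOL-Combinatorics.Permutations"
    "HOL-Combinatorics.Orbits"
begin

section \<open>Partitions and skew diagrams\<close>

definition partition_of :: "nat list \<Rightarrow> nat \<Rightarrow> bool"  (infix "\<turnstile>\<^sub>p" 50) where
  "la \<turnstile>\<^sub>p n \<longleftrightarrow> sorted_wrt (\<ge>) la \<and> 0 \<notin> set la \<and> sum_list la = n"

text \<open>Boxes are pairs (row, column), numbered from 0; contents are unaffected by this shift.\<close>

definition diagram :: "nat list \<Rightarrow> (nat \<times> nat) set" where
  "diagram la = {(i, j). i < length la \<and> j < la ! i}"

definition add_box :: "nat list \<Rightarrow> nat list \<Rightarrow> bool"  (infix "\<nearrow>" 50) where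
  "mu \<nearrow> la \<longleftrightarrow> (\<exists>b. b \<notin> diagram mu \<and> diagram la = insert b (diagram mu))"

definition skew :: "nat list \<Rightarrow> nat list \<Rightarrow> (nat \<times> nat) set" where
  "skew la nu = diagram la - diagram nu"

definition skew_diagram :: "(nat \<times> nat) set \<Rightarrow> bool" where
  "skew_diagram D \<longleftrightarrow> (\<exists>la nu m k. la \<turnstile>\<^sub>p m \<and> nu \<turnstile>\<^sub>p k \<and> diagram nu \<subseteq> diagram la \<and> D = skew la nu)"

definition box_content :: "nat \<times> nat \<Rightarrow> int" where
  "box_content b = int (snd b) - int (fst b)"

definition broken_border_strip :: "(nat \<times> nat) set \<Rightarrow> bool" where
  "broken_border_strip D \<longleftrightarrow> skew_diagram D \<and>
     (\<nexists>i j. {(i, j), (Suc i, j), (i, Suc j), (Suc i, Suc j)} \<subseteq> D)"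

definition sharp_corners :: "(nat \<times> nat) set \<Rightarrow> (nat \<times> nat) set" where
  "sharp_corners D = {(i, j). (i, j) \<in> D \<and> (Suc i, j) \<in> D \<and> (i, Suc j) \<in> D}"

definition dull_boxes :: "(nat \<times> nat) set \<Rightarrow> (nat \<times> nat) set" where
  "dull_boxes D = {(i, j). (i, j) \<in> D \<and> (Suc i, j) \<notin> D \<and> (i, Suc j) \<notin> D}"

text \<open>Two boxes are adjacent if they share an edge.\<close>

definition adjacent :: "(nat \<times> nat) set \<Rightarrow> ((nat \<times> nat) \<times> (nat \<times> nat)) set" where
  "adjacent D = {((i, j), (k, l)) | i j k l. (i, j) \<in> D \<and> (k, l) \<in> D \<and>
     (i = k \<and> (l = Suc j \<or> j = Suc l) \<or> j = l \<and> (k = Suc i \<or> i = Suc k))}"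

definition strip_components :: "(nat \<times> nat) set \<Rightarrow> (nat \<times> nat) set set" where
  "strip_components D = D // (adjacent D)\<^sup>*"

definition strip_height :: "(nat \<times> nat) set \<Rightarrow> nat" where
  "strip_height D = (\<Sum>C\<in>strip_components D. card (fst ` C) - 1)"

text \<open>In \<open>phi la mu nu\<close> the set \<open>skew la mu\<close> consists of one box when \<open>mu \<nearrow> la\<close>.\<close>

definition phi :: "nat list \<Rightarrow> nat list \<Rightarrow> nat list \<Rightarrow> complex" where
  "phi la mu nu =
     (let b = the_elem (skew la mu); D = skew la nu in
      if broken_border_strip D then
        (-1) ^ strip_height D
          * (\<Prod>s\<in>sharp_corners D. of_int (box_content b - box_content s))
          * (\<Prod>d\<in>dull_boxes D - {b}. inverse (of_int (box_content b - box_content d)))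
      else 0)"

section \<open>Irreducible characters of the symmetric groups\<close>

abbreviation Sym :: "nat \<Rightarrow> (nat \<Rightarrow> nat) set" where
  "Sym n \<equiv> {w. w permutes {1..n}}"

text \<open>
  The group algebra of \<open>Sym n\<close> consists of the functions \<open>f\<close> vanishing outside \<open>Sym n\<close>, read as
  the formal sums of the \<open>f w\<close> times \<open>w\<close>. The group acts by left multiplication.
\<close>

definition fscale :: "complex \<Rightarrow> ('a \<Rightarrow> complex) \<Rightarrow> 'a \<Rightarrow> complex" where
  "fscale a f = (\<lambda>w. a * f w)"

interpretation fun_vs: vector_space "fscale :: complex \<Rightarrow> ('a \<Rightarrow> complex) \<Rightarrow> 'a \<Rightarrow> complex"
  by unfold_locales (auto simp: fscale_def fun_eq_iff algebra_simps)

definition left_mult :: "(nat \<Rightarrow> nat) \<Rightarrow> ((nat \<Rightarrow> nat) \<Rightarrow> complex) \<Rightarrow> (nat \<Rightarrow> nat) \<Rightarrow> complex" where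
  "left_mult u f = (\<lambda>w. f (inv u \<circ> w))"

text \<open>The trace of a linear endomorphism of a finite-dimensional space \<open>V\<close>, in any basis of \<open>V\<close>.\<close>

definition trace_on :: "('a \<Rightarrow> complex) set \<Rightarrow> (('a \<Rightarrow> complex) \<Rightarrow> 'a \<Rightarrow> complex) \<Rightarrow> complex" where
  "trace_on V T =
     (let B = (SOME B. fun_vs.independent B \<and> fun_vs.span B = V)
      in \<Sum>b\<in>B. fun_vs.representation B (T b) b)"

text \<open>The standard tableau with entries \<open>1, 2, 3, \<dots>\<close> in reading order, row by row.\<close>

definition row_tableau :: "nat list \<Rightarrow> nat \<times> nat \<Rightarrow> nat" where
  "row_tableau la = (\<lambda>(i, j). sum_list (take i la) + j + 1)"

definition row_group :: "nat list \<Rightarrow> (nat \<Rightarrow> nat) set" where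
  "row_group la = {p \<in> Sym (sum_list la). \<forall>(i, j)\<in>diagram la.
     \<exists>k. (i, k) \<in> diagram la \<and> p (row_tableau la (i, j)) = row_tableau la (i, k)}"

definition column_group :: "nat list \<Rightarrow> (nat \<Rightarrow> nat) set" where
  "column_group la = {q \<in> Sym (sum_list la). \<forall>(i, j)\<in>diagram la.
     \<exists>k. (k, j) \<in> diagram la \<and> q (row_tableau la (i, j)) = row_tableau la (k, j)}"

text \<open>The sum of \<open>sign q\<close> times \<open>p \<circ> q\<close> over the row group and the column group.\<close>

definition young_symmetrizer :: "nat list \<Rightarrow> (nat \<Rightarrow> nat) \<Rightarrow> complex" where
  "young_symmetrizer la = (\<lambda>w. \<Sum>p\<in>row_group la. \<Sum>q\<in>column_group la.
     if p \<circ> q = w then of_int (sign q) else 0)"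

text \<open>The left ideal of the group algebra generated by the Young symmetrizer.\<close>

definition specht_module :: "nat list \<Rightarrow> ((nat \<Rightarrow> nat) \<Rightarrow> complex) set" where
  "specht_module la =
     fun_vs.span ((\<lambda>u. left_mult u (young_symmetrizer la)) ` Sym (sum_list la))"

definition irr_char :: "nat list \<Rightarrow> (nat \<Rightarrow> nat) \<Rightarrow> complex" where
  "irr_char la w = trace_on (specht_module la) (left_mult w)"

definition gen_char :: "nat \<Rightarrow> nat list \<Rightarrow> nat list \<Rightarrow> (nat \<Rightarrow> nat) \<Rightarrow> complex" where
  "gen_char n la mu x = irr_char mu id / fact (n - 1)
     * (\<Sum>y\<in>Sym (n - 1). irr_char la (x \<circ> inv y) * irr_char mu y)"

section \<open>Formal power series in countably many variables\<close>

text \<open>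
  A monomial in the variables \<open>x\<^sub>0, x\<^sub>1, x\<^sub>2, \<dots>\<close> is the multiset of the indices of its factors;
  a series is the family of its coefficients. Symmetric functions are elements of this ring.
\<close>

typedef 'a mfps = "UNIV :: (nat multiset \<Rightarrow> 'a) set"
  morphisms mcoeff Abs_mfps ..

setup_lifting type_definition_mfps

lemma mfps_eq_iff: "f = g \<longleftrightarrow> (\<forall>m. mcoeff f m = mcoeff g m)"
  by transfer auto

lemma finite_mset_splits: "finite {(a, b). a + b = (m :: 'b multiset)}"
proof (rule finite_subset)
  let ?S = "\<Union>n\<le>size m. multisets_of_size (set_mset m) n"
  show "{(a, b). a + b = m} \<subseteq> ?S \<times> ?S"
    by (auto simp: multisets_of_size_def)
  show "finite (?S \<times> ?S)"
    by auto
qed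

lemma finite_mset_splits': "finite {p. fst p + snd p = (m :: 'b multiset)}"
  using finite_mset_splits [of m] by (simp add: split_def)

instantiation mfps :: (comm_ring_1) comm_ring_1
begin

lift_definition zero_mfps :: "'a mfps" is "\<lambda>_. 0" .
lift_definition one_mfps :: "'a mfps" is "\<lambda>m. if m = {#} then 1 else 0" .
lift_definition plus_mfps :: "'a mfps \<Rightarrow> 'a mfps \<Rightarrow> 'a mfps" is "\<lambda>f g m. f m + g m" .
lift_definition minus_mfps :: "'a mfps \<Rightarrow> 'a mfps \<Rightarrow> 'a mfps" is "\<lambda>f g m. f m - g m" .
lift_definition uminus_mfps :: "'a mfps \<Rightarrow> 'a mfps" is "\<lambda>f m. - f m" .
lift_definition times_mfps :: "'a mfps \<Rightarrow> 'a mfps \<Rightarrow> 'a mfps"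
  is "\<lambda>f g m. \<Sum>(a, b)\<in>{(a, b). a + b = m}. f a * g b" .

instance
proof
  fix f g h :: "'a mfps"
  show "f * g * h = f * (g * h)"
  proof transfer
    fix f g h :: "nat multiset \<Rightarrow> 'a"
    show "(\<lambda>m. \<Sum>(a, b)\<in>{(a, b). a + b = m}.
             (\<Sum>(a', b')\<in>{(a', b'). a' + b' = a}. f a' * g b') * h b) =
          (\<lambda>m. \<Sum>(a, b)\<in>{(a, b). a + b = m}.
             f a * (\<Sum>(a', b')\<in>{(a', b'). a' + b' = b}. g a' * h b'))"
    proof
      fix m :: "nat multiset"
      have "(\<Sum>(a, b)\<in>{(a, b). a + b = m}.
               (\<Sum>(a', b')\<in>{(a', b'). a' + b' = a}. f a' * g b') * h b) =
            (\<Sum>((a, b), (a', b'))\<in>(SIGMA ab:{(a, b). a + b = m}. {(a', b'). a' + b' = fst ab}).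
               f a' * g b' * h b)"
        by (subst sum.Sigma [symmetric])
           (auto simp: finite_mset_splits' sum_distrib_right split_def intro!: sum.cong)
      also have "\<dots> =
            (\<Sum>((a, b), (a', b'))\<in>(SIGMA ab:{(a, b). a + b = m}. {(a', b'). a' + b' = snd ab}).
               f a * (g a' * h b'))"
        by (rule sum.reindex_bij_witness
              [of _ "\<lambda>((a, b), (a', b')). ((a + a', b'), (a, a'))"
                    "\<lambda>((a, b), (a', b')). ((a', b' + b), (b', b))"])
           (auto simp: ac_simps)
      also have "\<dots> = (\<Sum>(a, b)\<in>{(a, b). a + b = m}.
             f a * (\<Sum>(a', b')\<in>{(a', b'). a' + b' = b}. g a' * h b'))"
        by (subst sum.Sigma [symmetric])
           (auto simp: finite_mset_splits' sum_distrib_left split_def intro!: sum.cong)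
      finally show "(\<Sum>(a, b)\<in>{(a, b). a + b = m}.
               (\<Sum>(a', b')\<in>{(a', b'). a' + b' = a}. f a' * g b') * h b) =
            (\<Sum>(a, b)\<in>{(a, b). a + b = m}.
             f a * (\<Sum>(a', b')\<in>{(a', b'). a' + b' = b}. g a' * h b'))" .
    qed
  qed
  show "f * g = g * f"
  proof transfer
    fix f g :: "nat multiset \<Rightarrow> 'a"
    show "(\<lambda>m. \<Sum>(a, b)\<in>{(a, b). a + b = m}. f a * g b) =
          (\<lambda>m. \<Sum>(a, b)\<in>{(a, b). a + b = m}. g a * f b)"
      by (rule ext, rule sum.reindex_bij_witness [of _ prod.swap prod.swap])
         (auto simp: ac_simps)
  qed
  show "1 * f = f"
  proof transfer
    fix f :: "nat multiset \<Rightarrow> 'a"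
    show "(\<lambda>m. \<Sum>(a, b)\<in>{(a, b). a + b = m}. (if a = {#} then 1 else 0) * f b) = f"
    proof
      fix m :: "nat multiset"
      have "(\<Sum>(a, b)\<in>{(a, b). a + b = m}. (if a = {#} then 1 else 0) * f b) =
            (\<Sum>(a, b)\<in>{({#} :: nat multiset, m)}. (if a = {#} then 1 else 0) * f b)"
        by (rule sum.mono_neutral_right) (auto simp: finite_mset_splits split: if_splits)
      then show "(\<Sum>(a, b)\<in>{(a, b). a + b = m}. (if a = {#} then 1 else 0) * f b) = f m"
        by simp
    qed
  qed
  show "(f + g) * h = f * h + g * h"
    by transfer (simp add: fun_eq_iff algebra_simps sum.distrib split_def)
  show "(0 :: 'a mfps) \<noteq> 1"
    by transfer (auto simp: fun_eq_iff)
qed (transfer; simp add: fun_eq_iff algebra_simps)+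

end

lift_definition mfps_const :: "'a::zero \<Rightarrow> 'a mfps" is "\<lambda>c m. if m = {#} then c else 0" .

section \<open>Symmetric functions and the generalized characteristic map\<close>

lift_definition power_sum :: "nat \<Rightarrow> complex mfps"
  is "\<lambda>k m. if \<exists>i. m = replicate_mset k i then 1 else 0" .

definition power_sum_mset :: "nat multiset \<Rightarrow> complex mfps" where
  "power_sum_mset rho = (\<Prod>k\<in>#rho. power_sum k)"

text \<open>
  Semistandard tableaux, set to 0 outside the diagram. Entries start at 0, in accordance with
  the numbering of the variables.
\<close>

definition ssyt :: "nat list \<Rightarrow> (nat \<times> nat \<Rightarrow> nat) set" where
  "ssyt nu = {T. (\<forall>b. b \<notin> diagram nu \<longrightarrow> T b = 0) \<and>
     (\<forall>i j. (i, Suc j) \<in> diagram nu \<longrightarrow> T (i, j) \<le> T (i, Suc j)) \<and>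
     (\<forall>i j. (Suc i, j) \<in> diagram nu \<longrightarrow> T (i, j) < T (Suc i, j))}"

lift_definition schur :: "nat list \<Rightarrow> complex mfps"
  is "\<lambda>nu m. of_nat (card {T \<in> ssyt nu. image_mset T (mset_set (diagram nu)) = m})" .

text \<open>The cycles of \<open>w \<in> Sym n\<close>, including fixed points, are the orbits of \<open>w\<close> on \<open>{1..n}\<close>.\<close>

definition other_cycle_type :: "nat \<Rightarrow> (nat \<Rightarrow> nat) \<Rightarrow> nat multiset" where
  "other_cycle_type n w = image_mset card (mset_set (orbit w ` {1..n} - {orbit w n}))"

text \<open>The polynomial variable is \<open>t\<close>.\<close>

definition psi :: "nat \<Rightarrow> (nat \<Rightarrow> nat) \<Rightarrow> complex mfps poly" where
  "psi n w = monom (power_sum_mset (other_cycle_type n w)) (card (orbit w n) - 1)"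

definition Ch' :: "nat \<Rightarrow> ((nat \<Rightarrow> nat) \<Rightarrow> complex) \<Rightarrow> complex mfps poly" where
  "Ch' n g = smult (mfps_const (1 / fact (n - 1)))
     (\<Sum>w\<in>Sym n. smult (mfps_const (g w)) (psi n w))"

definition gen_schur :: "nat \<Rightarrow> nat list \<Rightarrow> nat list \<Rightarrow> complex mfps poly" where
  "gen_schur n la mu = Ch' n (gen_char n la mu)"

end

theory Submission imports Defs begin

text \<open>
  Everything takes place in the group algebra. There \<open>\<Gamma>\<close> is the product of \<open>\<chi>\<^sup>\<lambda>\<close> with the central
  idempotent \<open>e\<^sub>\<mu>\<close>, on which the Jucys-Murphy element acts by the scalar \<open>c(\<lambda>/\<mu>)\<close>. For the transposition
  \<open>s = (n-1 n)\<close> and \<open>w \<in> S(n-1)\<close>, inserting \<open>1 = \<Sum>\<^sub>\<kappa> e\<^sub>\<kappa>\<close> and using the relation between \<open>s\<close> and the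
  last two Jucys-Murphy elements gives
  \<open>\<Gamma>(s w) = \<Sum>\<^sub>\<kappa> \<Gamma>'(w) / (c(\<lambda>/\<mu>) - c(\<mu>/\<kappa>))\<close>, with \<open>\<Gamma>'\<close> the generalized character of
  \<open>\<mu>, \<kappa>\<nearrow>\<mu>\<close>. Since \<open>\<Gamma>\<close> restricts to \<open>\<chi>\<^sup>\<mu>\<close> on \<open>S(n-1)\<close>, this yields
  \<open>S\<^sup>\<lambda>\<^sup>,\<^sup>\<mu> = s\<^sub>\<mu> + t \<Sum>\<^sub>\<kappa> S\<^sup>\<mu>\<^sup>,\<^sup>\<kappa> / (c(\<lambda>/\<mu>) - c(\<mu>/\<kappa>))\<close>.
  The coefficients \<open>\<phi>\<close> satisfy the same recursion: it is the partial fraction expansion of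
  \<open>\<Prod>(z - c(s)) / \<Prod>(z - c(d))\<close>, the dull boxes of \<open>\<mu>/\<nu>\<close> being those that can be removed.

  The characteristic of \<open>\<chi>\<^sup>\<nu>\<close> is the semistandard generating function \<open>s\<^sub>\<nu>\<close> because both satisfy the Pieri
  rule, which for the characters follows from the above recursion and another partial fraction identity.
\<close>

text \<open>The division comes from \<open>s X_n = X_(n-1) s + 1\<close>. In the trace of
  \<open>\<Gamma> e_\<kappa> s X_n w\<close> the element \<open>X_n\<close> moves cyclically to
  \<open>\<Gamma>\<close> and gives c(\<lambda>/\<mu>); moved left through \<open>s\<close>, it
  gives c(\<mu>/\<kappa>) and an extra trace on S(n-1). An addable and a removable corner of one
  shape never have equal content, so the difference can be divided out. The n-1 nontrivial cosets of
  S(n-1) contribute equally by conjugation, which turns 1/(n-1)! into 1/(n-2)!. The main obstacle is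
  the completeness of the \<open>e_\<kappa>\<close>. Positivity of the trace form on real elements
  bounds the sum of squared dimensions by n! and shows that equality means completeness; counting
  paths in the Young graph gives the opposite bound. The same squeeze makes branching
  multiplicity-free. The two partial fraction identities differ in degree. A nonempty strip has
  fewer sharp corners than dull boxes, so no polynomial part appears. For the Pieri rule zeros and
  poles are equally many, and the resulting constant 1 accounts for the Pieri rule of \<mu>
  itself.\<close>

declare One_nat_def [simp del]

section \<open>The group algebra of the finitary symmetric group\<close>

lemma Sym_mono: "w permutes {1..n::nat} \<Longrightarrow> n \<le> m \<Longrightarrow> w permutes {1..m}"
  by (erule permutes_subset) (auto intro: order.trans)

lemma finite_Sym [simp]: "finite (Sym n)"
  by (simp add: finite_permutations)

lemma card_Sym: "card (Sym n) = fact n"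
  by (simp add: card_permutations)

text \<open>Finitely supported functions on the union of all \<open>S(n)\<close>, so that the algebras of the groups
  \<open>S(n)\<close> are subrings of one type and restriction needs no coercions.\<close>

typedef galg = "{f :: (nat \<Rightarrow> nat) \<Rightarrow> complex. \<exists>n. \<forall>w. f w \<noteq> 0 \<longrightarrow> w permutes {1..n}}"
  morphisms coef Galg
  by (rule exI[of _ "\<lambda>_. 0"]) auto

setup_lifting type_definition_galg

lemma galg_eqI: "(\<And>w. coef x w = coef y w) \<Longrightarrow> x = y"
  by transfer auto

text \<open>Convolution sums over the support of the left factor, so that no rank enters its
  definition. Here that sum becomes one over any S(n) containing the support.\<close>

lemma conv_Sym:
  assumes "\<forall>u. f u \<noteq> (0::complex) \<longrightarrow> u permutes {1..n}"
  shows "(\<Sum>u | f u \<noteq> 0. f u * g u) = (\<Sum>u\<in>Sym n. f u * g u)"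
  using assms by (intro sum.mono_neutral_left) auto

lemma Sym_inv_comp: "u permutes {1..n} \<Longrightarrow> inv u \<circ> (u \<circ> w) = w" "u permutes {1..n} \<Longrightarrow> u \<circ> (inv u \<circ> w) = w"
  by (auto simp: o_assoc permutes_inv_o)

lemma Sym_comp_cancel: "u permutes {1..n} \<Longrightarrow> (w \<circ> u) \<circ> inv u = w" "u permutes {1..n} \<Longrightarrow> (w \<circ> inv u) \<circ> u = w"
  by (auto simp: o_assoc[symmetric] permutes_inv_o)

instantiation galg :: ring_1
begin

lift_definition zero_galg :: galg is "\<lambda>_. 0" by auto
lift_definition one_galg :: galg is "\<lambda>w. if w = id then 1 else 0"
  by (rule exI[of _ 0]) auto
lift_definition plus_galg :: "galg \<Rightarrow> galg \<Rightarrow> galg" is "\<lambda>f g w. f w + g w"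
proof (elim exE)
  fix f g :: "(nat \<Rightarrow> nat) \<Rightarrow> complex" and n m
  assume "\<forall>w. f w \<noteq> 0 \<longrightarrow> w permutes {1..n}" "\<forall>w. g w \<noteq> 0 \<longrightarrow> w permutes {1..m}"
  then show "\<exists>k. \<forall>w. f w + g w \<noteq> 0 \<longrightarrow> w permutes {1..k}"
    by (intro exI[of _ "max n m"]) (metis Sym_mono add.right_neutral max.cobounded1 max.cobounded2)
qed
lift_definition minus_galg :: "galg \<Rightarrow> galg \<Rightarrow> galg" is "\<lambda>f g w. f w - g w"
proof (elim exE)
  fix f g :: "(nat \<Rightarrow> nat) \<Rightarrow> complex" and n m
  assume "\<forall>w. f w \<noteq> 0 \<longrightarrow> w permutes {1..n}" "\<forall>w. g w \<noteq> 0 \<longrightarrow> w permutes {1..m}"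
  then show "\<exists>k. \<forall>w. f w - g w \<noteq> 0 \<longrightarrow> w permutes {1..k}"
    by (intro exI[of _ "max n m"]) (metis Sym_mono diff_self max.cobounded1 max.cobounded2)
qed
lift_definition uminus_galg :: "galg \<Rightarrow> galg" is "\<lambda>f w. - f w" by simp
lift_definition times_galg :: "galg \<Rightarrow> galg \<Rightarrow> galg" is
  "\<lambda>f g w. \<Sum>u | f u \<noteq> 0. f u * g (inv u \<circ> w)"
proof (elim exE)
  fix f g :: "(nat \<Rightarrow> nat) \<Rightarrow> complex" and n m
  assume f: "\<forall>w. f w \<noteq> 0 \<longrightarrow> w permutes {1..n}" and g: "\<forall>w. g w \<noteq> 0 \<longrightarrow> w permutes {1..m}"
  show "\<exists>k. \<forall>w. (\<Sum>u | f u \<noteq> 0. f u * g (inv u \<circ> w)) \<noteq> 0 \<longrightarrow> w permutes {1..k}"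
  proof (intro exI[of _ "max n m"] allI impI)
    fix w assume "(\<Sum>u | f u \<noteq> 0. f u * g (inv u \<circ> w)) \<noteq> 0"
    then obtain u where u: "f u \<noteq> 0" "g (inv u \<circ> w) \<noteq> 0"
      by (metis (mono_tags, lifting) mem_Collect_eq mult_eq_0_iff sum.neutral)
    have "u permutes {1..max n m}" "inv u \<circ> w permutes {1..max n m}"
      using f g u by (meson Sym_mono max.cobounded1 max.cobounded2)+
    from permutes_compose[OF this(2,1)] show "w permutes {1..max n m}"
      using Sym_inv_comp \<open>u permutes {1..max n m}\<close> by metis
  qed
qed

instance
proof
  fix x y z :: galg
  show "x * y * z = x * (y * z)"
  proof transfer
    fix f g h :: "(nat \<Rightarrow> nat) \<Rightarrow> complex"
    assume "\<exists>n. \<forall>w. f w \<noteq> 0 \<longrightarrow> w permutes {1..n}" "\<exists>n. \<forall>w. g w \<noteq> 0 \<longrightarrow> w permutes {1..n}"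
    then obtain n m where nm: "\<forall>w. f w \<noteq> 0 \<longrightarrow> w permutes {1..n}" "\<forall>w. g w \<noteq> 0 \<longrightarrow> w permutes {1..m}"
      by auto
    \<comment> \<open>A common rank for the two factors that are summed over.\<close>
    define k where "k = max n m"
    have f: "\<forall>w. f w \<noteq> 0 \<longrightarrow> w permutes {1..k}" and g: "\<forall>w. g w \<noteq> 0 \<longrightarrow> w permutes {1..k}"
      using nm unfolding k_def by (meson Sym_mono max.cobounded1 max.cobounded2)+
    let ?fg = "\<lambda>w. \<Sum>u\<in>Sym k. f u * g (inv u \<circ> w)"
    have fg: "\<forall>w. ?fg w \<noteq> 0 \<longrightarrow> w permutes {1..k}"
    proof (intro allI impI)
      fix w assume "?fg w \<noteq> 0"
      then obtain u where u: "u permutes {1..k}" "g (inv u \<circ> w) \<noteq> 0"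
        by (metis (mono_tags, lifting) mem_Collect_eq mult_eq_0_iff sum.neutral)
      then have "inv u \<circ> w permutes {1..k}" using g by auto
      from permutes_compose[OF this u(1)] show "w permutes {1..k}"
        using Sym_inv_comp u(1) by metis
    qed
    have "(\<Sum>u | ?fg u \<noteq> 0. ?fg u * h (inv u \<circ> w)) = (\<Sum>u\<in>Sym k. f u * (\<Sum>v\<in>Sym k. g v * h (inv v \<circ> (inv u \<circ> w))))" for w
    proof -
      have "(\<Sum>u | ?fg u \<noteq> 0. ?fg u * h (inv u \<circ> w)) = (\<Sum>v\<in>Sym k. \<Sum>u\<in>Sym k. f u * g (inv u \<circ> v) * h (inv v \<circ> w))"
        by (subst conv_Sym[OF fg]) (simp add: sum_distrib_right)
      also have "\<dots> = (\<Sum>u\<in>Sym k. \<Sum>v\<in>Sym k. f u * g (inv u \<circ> v) * h (inv v \<circ> w))"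
        by (rule sum.swap)
      also have "\<dots> = (\<Sum>u\<in>Sym k. \<Sum>v\<in>Sym k. f u * g v * h (inv v \<circ> (inv u \<circ> w)))"
      proof (rule sum.cong[OF refl])
        fix u assume u: "u \<in> Sym k"
        show "(\<Sum>v\<in>Sym k. f u * g (inv u \<circ> v) * h (inv v \<circ> w)) = (\<Sum>v\<in>Sym k. f u * g v * h (inv v \<circ> (inv u \<circ> w)))"
        proof (rule sum.reindex_bij_witness[of _ "\<lambda>v. u \<circ> v" "\<lambda>v. inv u \<circ> v"])
          fix v assume "v \<in> Sym k"
          with u have uv: "u permutes {1..k}" "v permutes {1..k}" by auto
          have "inv (inv u \<circ> v) = inv v \<circ> u"
            using uv by (metis o_inv_distrib permutes_bij permutes_inv permutes_inv_inv)
          then have "inv (inv u \<circ> v) \<circ> (inv u \<circ> w) = inv v \<circ> w"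
            by (simp add: o_assoc[symmetric] Sym_inv_comp[OF uv(1)])
          then show "f u * g (inv u \<circ> v) * h (inv (inv u \<circ> v) \<circ> (inv u \<circ> w)) = f u * g (inv u \<circ> v) * h (inv v \<circ> w)"
            by simp
        qed (use u in \<open>auto simp: Sym_inv_comp intro!: permutes_compose permutes_inv\<close>)
      qed
      finally show ?thesis by (simp add: sum_distrib_left mult.assoc)
    qed
    then show "(\<lambda>w. \<Sum>u | (\<Sum>ua | f ua \<noteq> 0. f ua * g (inv ua \<circ> u)) \<noteq> 0. (\<Sum>ua | f ua \<noteq> 0. f ua * g (inv ua \<circ> u)) * h (inv u \<circ> w)) =
       (\<lambda>w. \<Sum>u | f u \<noteq> 0. f u * (\<Sum>ua | g ua \<noteq> 0. g ua * h (inv ua \<circ> (inv u \<circ> w))))"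
      by (simp only: conv_Sym[OF f] conv_Sym[OF g])
  qed
  show "x + y + z = x + (y + z)" by transfer (simp add: fun_eq_iff)
  show "x + y = y + x" by transfer (simp add: fun_eq_iff)
  show "0 + x = x" by transfer (simp add: fun_eq_iff)
  show "- x + x = 0" by transfer (simp add: fun_eq_iff)
  show "x - y = x + - y" by transfer (simp add: fun_eq_iff)
  show "1 * x = x"
  proof transfer
    fix f :: "(nat \<Rightarrow> nat) \<Rightarrow> complex"
    have "{u. (if u = id then 1 else 0::complex) \<noteq> 0} = {id :: nat \<Rightarrow> nat}" by auto
    then show "(\<lambda>w. \<Sum>u | (if u = id then 1 else 0::complex) \<noteq> 0. (if u = id then 1 else 0) * f (inv u \<circ> w)) = f"
      by simp
  qed
  show "x * 1 = x"
  proof transfer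
    fix f :: "(nat \<Rightarrow> nat) \<Rightarrow> complex"
    assume "\<exists>n. \<forall>w. f w \<noteq> 0 \<longrightarrow> w permutes {1..n}"
    then obtain n where f: "\<forall>w. f w \<noteq> 0 \<longrightarrow> w permutes {1..n}" by auto
    have "(\<Sum>u\<in>Sym n. f u * (if inv u \<circ> w = id then 1 else 0)) = f w" for w
    proof -
      have "(\<Sum>u\<in>Sym n. f u * (if inv u \<circ> w = id then 1 else 0)) = (\<Sum>u\<in>Sym n. if u = w then f w else 0)"
      proof (rule sum.cong[OF refl])
        fix u assume "u \<in> Sym n"
        then have "(inv u \<circ> w = id) = (u = w)"
          by (metis Sym_inv_comp(2) comp_id mem_Collect_eq permutes_inv_o(2))
        then show "f u * (if inv u \<circ> w = id then 1 else 0) = (if u = w then f w else 0)" by auto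
      qed
      also have "\<dots> = f w" using f by (auto simp: sum.delta)
      finally show ?thesis .
    qed
    then show "(\<lambda>w. \<Sum>u | f u \<noteq> 0. f u * (if inv u \<circ> w = id then 1 else 0)) = f"
      by (simp only: conv_Sym[OF f])
  qed
  show "(x + y) * z = x * z + y * z"
  proof transfer
    fix f g h :: "(nat \<Rightarrow> nat) \<Rightarrow> complex"
    assume "\<exists>n. \<forall>w. f w \<noteq> 0 \<longrightarrow> w permutes {1..n}" "\<exists>n. \<forall>w. g w \<noteq> 0 \<longrightarrow> w permutes {1..n}"
    then obtain n m where nm: "\<forall>w. f w \<noteq> 0 \<longrightarrow> w permutes {1..n}" "\<forall>w. g w \<noteq> 0 \<longrightarrow> w permutes {1..m}"
      by auto
    define k where "k = max n m"
    have f: "\<forall>w. f w \<noteq> 0 \<longrightarrow> w permutes {1..k}" and g: "\<forall>w. g w \<noteq> 0 \<longrightarrow> w permutes {1..k}"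
      using nm unfolding k_def by (meson Sym_mono max.cobounded1 max.cobounded2)+
    have fg: "\<forall>w. f w + g w \<noteq> 0 \<longrightarrow> w permutes {1..k}"
      using f g by (metis add.right_neutral)
    show "(\<lambda>w. \<Sum>u | f u + g u \<noteq> 0. (f u + g u) * h (inv u \<circ> w)) =
       (\<lambda>w. (\<Sum>u | f u \<noteq> 0. f u * h (inv u \<circ> w)) + (\<Sum>u | g u \<noteq> 0. g u * h (inv u \<circ> w)))"
      by (simp only: conv_Sym[OF f] conv_Sym[OF g] conv_Sym[OF fg])
         (simp add: sum.distrib algebra_simps)
  qed
  show "x * (y + z) = x * y + x * z"
    by transfer (simp add: fun_eq_iff sum.distrib algebra_simps)
  show "(0::galg) \<noteq> 1" by transfer (auto simp: fun_eq_iff)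
qed

end

lift_definition gscale :: "complex \<Rightarrow> galg \<Rightarrow> galg"  (infixr "\<cdot>\<^sub>g" 75) is "\<lambda>a f w. a * f w"
  by auto

lemma coef_simps [simp]:
  "coef 0 w = 0" "coef (x + y) w = coef x w + coef y w" "coef (x - y) w = coef x w - coef y w"
  "coef (- x) w = - coef x w" "coef (a \<cdot>\<^sub>g x) w = a * coef x w" "coef 1 w = (if w = id then 1 else 0)"
  by (transfer; simp)+

lemma coef_sum [simp]: "coef (\<Sum>i\<in>I. f i) w = (\<Sum>i\<in>I. coef (f i) w)"
  by (induction I rule: infinite_finite_induct) auto

lemma gscale_simps [simp]:
  "a \<cdot>\<^sub>g b \<cdot>\<^sub>g x = (a * b) \<cdot>\<^sub>g x" "1 \<cdot>\<^sub>g x = x" "0 \<cdot>\<^sub>g x = 0" "a \<cdot>\<^sub>g 0 = 0"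
  by (auto intro!: galg_eqI)

lemma gscale_distrib:
  "a \<cdot>\<^sub>g (x + y) = a \<cdot>\<^sub>g x + a \<cdot>\<^sub>g y" "(a + b) \<cdot>\<^sub>g x = a \<cdot>\<^sub>g x + b \<cdot>\<^sub>g x"
  "a \<cdot>\<^sub>g (x - y) = a \<cdot>\<^sub>g x - a \<cdot>\<^sub>g y" "(a - b) \<cdot>\<^sub>g x = a \<cdot>\<^sub>g x - b \<cdot>\<^sub>g x"
  by (auto intro!: galg_eqI simp: algebra_simps)

lemma gscale_sum: "a \<cdot>\<^sub>g (\<Sum>i\<in>I. f i) = (\<Sum>i\<in>I. a \<cdot>\<^sub>g f i)" "(\<Sum>i\<in>I. c i) \<cdot>\<^sub>g x = (\<Sum>i\<in>I. c i \<cdot>\<^sub>g x)"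
  by (auto intro!: galg_eqI simp: sum_distrib_left sum_distrib_right)

text \<open>Membership in the group algebra of S(n), one of an ascending chain of subrings; elements
  of different ranks can therefore be multiplied directly.\<close>

definition supp_in :: "nat \<Rightarrow> galg \<Rightarrow> bool" where
  "supp_in n x \<longleftrightarrow> (\<forall>w. coef x w \<noteq> 0 \<longrightarrow> w permutes {1..n})"

lemma supp_in_ex: "\<exists>n. supp_in n x"
  unfolding supp_in_def by transfer auto

lemma supp_in_mono: "supp_in n x \<Longrightarrow> n \<le> m \<Longrightarrow> supp_in m x"
  unfolding supp_in_def using Sym_mono by blast

lemma supp_in_0D: "supp_in n x \<Longrightarrow> \<not> w permutes {1..n} \<Longrightarrow> coef x w = 0"
  unfolding supp_in_def by blast

lemma coef_mult: "supp_in n x \<Longrightarrow> coef (x * y) w = (\<Sum>u\<in>Sym n. coef x u * coef y (inv u \<circ> w))"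
  unfolding supp_in_def by transfer (rule conv_Sym)

lemma gscale_mult [simp]: "(a \<cdot>\<^sub>g x) * y = a \<cdot>\<^sub>g (x * y)" "x * (a \<cdot>\<^sub>g y) = a \<cdot>\<^sub>g (x * y)"
proof -
  obtain n where n: "supp_in n x" using supp_in_ex by blast
  then have "supp_in n (a \<cdot>\<^sub>g x)" by (auto simp: supp_in_def)
  from n this show "(a \<cdot>\<^sub>g x) * y = a \<cdot>\<^sub>g (x * y)" "x * (a \<cdot>\<^sub>g y) = a \<cdot>\<^sub>g (x * y)"
    by (auto intro!: galg_eqI simp: coef_mult sum_distrib_left ac_simps)
qed

lemma supp_in_intros [intro, simp]:
  "supp_in n 0" "supp_in n 1" "supp_in n x \<Longrightarrow> supp_in n y \<Longrightarrow> supp_in n (x + y)"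
  "supp_in n x \<Longrightarrow> supp_in n y \<Longrightarrow> supp_in n (x - y)" "supp_in n x \<Longrightarrow> supp_in n (- x)"
  "supp_in n x \<Longrightarrow> supp_in n (a \<cdot>\<^sub>g x)"
  unfolding supp_in_def by (auto simp: permutes_id[unfolded id_def])
     (metis add.right_neutral, metis diff_self)

lemma supp_in_sum [intro]: "(\<And>i. i \<in> I \<Longrightarrow> supp_in n (f i)) \<Longrightarrow> supp_in n (\<Sum>i\<in>I. f i)"
  by (induction I rule: infinite_finite_induct) auto

lemma supp_in_mult [intro, simp]: "supp_in n x \<Longrightarrow> supp_in n y \<Longrightarrow> supp_in n (x * y)"
  unfolding supp_in_def[of n "x * y"]
proof (intro allI impI)
  fix w assume x: "supp_in n x" and y: "supp_in n y" and "coef (x * y) w \<noteq> 0"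
  then have "(\<Sum>u\<in>Sym n. coef x u * coef y (inv u \<circ> w)) \<noteq> 0" by (simp add: coef_mult)
  then obtain u where u: "u permutes {1..n}" "coef y (inv u \<circ> w) \<noteq> 0"
    by (metis (mono_tags, lifting) mem_Collect_eq mult_eq_0_iff sum.neutral)
  then have "inv u \<circ> w permutes {1..n}" using y by (auto simp: supp_in_def)
  from permutes_compose[OF this u(1)] show "w permutes {1..n}"
    using Sym_inv_comp u(1) by metis
qed

text \<open>The condition makes the function total: at a function that is no finitary permutation
  its value is 0.\<close>

lift_definition gdelta :: "(nat \<Rightarrow> nat) \<Rightarrow> galg"  ("\<delta>") is
  "\<lambda>u w. if w = u \<and> (\<exists>n. u permutes {1..n}) then 1 else 0"
  by auto

lemma coef_delta: "u permutes {1..n} \<Longrightarrow> coef (\<delta> u) w = (if w = u then 1 else 0)"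
  by transfer auto

lemma supp_in_delta [intro, simp]: "u permutes {1..n} \<Longrightarrow> supp_in n (\<delta> u)"
  by (auto simp: supp_in_def coef_delta split: if_splits)

lemma delta_id [simp]: "\<delta> id = 1"
  by (rule galg_eqI) (subst coef_delta[of _ 0], auto)

lemma coef_delta_mult: "u permutes {1..n} \<Longrightarrow> coef (\<delta> u * x) w = coef x (inv u \<circ> w)"
proof -
  assume u: "u permutes {1..n}"
  have "coef (\<delta> u * x) w = (\<Sum>v\<in>Sym n. (if v = u then coef x (inv u \<circ> w) else 0))"
    unfolding coef_mult[OF supp_in_delta[OF u]]
    by (rule sum.cong) (auto simp: coef_delta[OF u])
  then show ?thesis using u by simp
qed

lemma inv_comp_eq_iff: "u permutes {1..n} \<Longrightarrow> inv u \<circ> w = v \<longleftrightarrow> w = u \<circ> v"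
  using Sym_inv_comp by metis

lemma comp_inv_eq_iff: "u permutes {1..n} \<Longrightarrow> w \<circ> inv u = v \<longleftrightarrow> w = v \<circ> u"
  using Sym_comp_cancel by metis

lemma delta_mult: "u permutes {1..n} \<Longrightarrow> v permutes {1..n} \<Longrightarrow> \<delta> u * \<delta> v = \<delta> (u \<circ> v)"
  by (rule galg_eqI) (auto simp: coef_delta_mult coef_delta permutes_compose[of v "{1..n}" u]
       coef_delta[OF permutes_compose] inv_comp_eq_iff)

text \<open>Reduces every identity that is linear in \<open>x\<close> to group elements.\<close>

lemma galg_expand: "supp_in n x \<Longrightarrow> x = (\<Sum>w\<in>Sym n. coef x w \<cdot>\<^sub>g \<delta> w)"
proof (rule galg_eqI)
  fix v assume x: "supp_in n x"
  have "(\<Sum>w\<in>Sym n. coef x w * coef (\<delta> w) v) = (\<Sum>w\<in>Sym n. if w = v then coef x v else 0)"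
    by (rule sum.cong) (auto simp: coef_delta)
  then show "coef x v = coef (\<Sum>w\<in>Sym n. coef x w \<cdot>\<^sub>g \<delta> w) v"
    using x by (auto simp: supp_in_def)
qed

lemma coef_mult_delta: "u permutes {1..n} \<Longrightarrow> coef (x * \<delta> u) w = coef x (w \<circ> inv u)"
proof -
  assume u: "u permutes {1..n}"
  obtain m where "supp_in m x" using supp_in_ex by blast
  define k where "k = max n m"
  have k: "supp_in k x" "u permutes {1..k}"
    using supp_in_mono[OF \<open>supp_in m x\<close>, of k] Sym_mono[OF u, of k] by (auto simp: k_def)
  have "coef (x * \<delta> u) w = (\<Sum>v\<in>Sym k. coef x v * coef (\<delta> u) (inv v \<circ> w))"
    by (simp add: coef_mult k)
  also have "\<dots> = (\<Sum>v\<in>Sym k. if v = w \<circ> inv u then coef x v else 0)"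
  proof (rule sum.cong[OF refl])
    fix v assume "v \<in> Sym k"
    then have "inv v \<circ> w = u \<longleftrightarrow> v = w \<circ> inv u"
      using k by (metis inv_comp_eq_iff comp_inv_eq_iff mem_Collect_eq)
    then show "coef x v * coef (\<delta> u) (inv v \<circ> w) = (if v = w \<circ> inv u then coef x v else 0)"
      using k by (auto simp: coef_delta)
  qed
  also have "\<dots> = coef x (w \<circ> inv u)"
    using k by (auto simp: supp_in_def)
  finally show ?thesis .
qed

text \<open>The canonical trace: on the algebra of S(n), \<open>fact n\<close> times it is the trace
  of the regular representation. It is independent of the rank and unchanged by restriction.\<close>

abbreviation ctr :: "galg \<Rightarrow> complex" where "ctr x \<equiv> coef x id"

lemma ctr_mult: "supp_in n x \<Longrightarrow> ctr (x * y) = (\<Sum>u\<in>Sym n. coef x u * coef y (inv u))"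
  by (simp add: coef_mult)

lemma ctr_commute: "ctr (x * y) = ctr (y * x)"
proof -
  obtain n m where nm: "supp_in n x" "supp_in m y" using supp_in_ex by blast
  define k where "k = max n m"
  have k: "supp_in k x" "supp_in k y" using nm supp_in_mono by (auto simp: k_def)
  show ?thesis
    unfolding ctr_mult[OF k(1)] ctr_mult[OF k(2)]
    by (rule sum.reindex_bij_witness[of _ inv inv]) (auto simp: permutes_inv permutes_inv_inv)
qed

lemma coef_eq_ctr: "w permutes {1..n} \<Longrightarrow> coef x w = ctr (x * \<delta> (inv w))"
  by (simp add: coef_mult_delta[OF permutes_inv] permutes_inv_inv)

lemma delta_inv_mult [simp]: "w permutes {1..n} \<Longrightarrow> \<delta> (inv w) * \<delta> w = 1"
  "w permutes {1..n} \<Longrightarrow> \<delta> w * \<delta> (inv w) = 1"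
  by (simp_all add: delta_mult[of _ n] permutes_inv permutes_inv_o)

lemma supp_in_eqI: "supp_in n x \<Longrightarrow> supp_in n y \<Longrightarrow> (\<And>w. w permutes {1..n} \<Longrightarrow> coef x w = coef y w) \<Longrightarrow> x = y"
  by (metis galg_eqI supp_in_0D)

text \<open>The centre of the algebra of S(n). Centrality is the form needed in products;
  \<open>class_fun_iff\<close> translates it into invariance of the coefficients.\<close>

definition class_fun :: "nat \<Rightarrow> galg \<Rightarrow> bool" where
  "class_fun n x \<longleftrightarrow> supp_in n x \<and> (\<forall>w. w permutes {1..n} \<longrightarrow> \<delta> w * x = x * \<delta> w)"

lemma class_fun_commute:
  assumes "class_fun n x" "supp_in n y" shows "x * y = y * x"
proof -
  have "x * y = (\<Sum>w\<in>Sym n. coef y w \<cdot>\<^sub>g (x * \<delta> w))"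
    by (subst galg_expand[OF assms(2)]) (simp add: sum_distrib_left)
  also have "\<dots> = (\<Sum>w\<in>Sym n. coef y w \<cdot>\<^sub>g (\<delta> w * x))"
    using assms(1) by (auto simp: class_fun_def intro!: sum.cong)
  also have "\<dots> = y * x"
    by (subst (2) galg_expand[OF assms(2)]) (simp add: sum_distrib_right)
  finally show ?thesis .
qed

lemma class_fun_coef:
  assumes "class_fun n x" "u permutes {1..n}" shows "coef x (u \<circ> v \<circ> inv u) = coef x v"
proof -
  have "coef (x * \<delta> u) (u \<circ> v) = coef (\<delta> u * x) (u \<circ> v)"
    using assms by (simp add: class_fun_def)
  then show ?thesis
    using assms(2) by (simp add: coef_delta_mult coef_mult_delta Sym_inv_comp)
qed

lemma class_fun_iff:
  "class_fun n x \<longleftrightarrow> supp_in n x \<and> (\<forall>u v. u permutes {1..n} \<longrightarrow> v permutes {1..n} \<longrightarrow> coef x (u \<circ> v \<circ> inv u) = coef x v)"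
proof (safe intro!: class_fun_coef)
  assume "class_fun n x"
  then show "supp_in n x" by (simp add: class_fun_def)
next
  assume x: "supp_in n x"
    and *: "\<forall>u v. u permutes {1..n} \<longrightarrow> v permutes {1..n} \<longrightarrow> coef x (u \<circ> v \<circ> inv u) = coef x v"
  show "class_fun n x" unfolding class_fun_def
  proof (intro conjI x allI impI supp_in_eqI[of n])
    fix u w assume u: "u permutes {1..n}" and w: "w permutes {1..n}"
    have "coef x (u \<circ> (inv u \<circ> w) \<circ> inv u) = coef x (inv u \<circ> w)"
      using * u w by (auto intro!: permutes_compose permutes_inv)
    then show "coef (\<delta> u * x) w = coef (x * \<delta> u) w"
      using u by (simp add: coef_delta_mult coef_mult_delta Sym_inv_comp)
  qed (use x in auto)
qed

text \<open>Left unnormalized: for an idempotent, the sum of its conjugates has as coefficients the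
  values of the character of its left ideal, up to inversion of the argument.\<close>

definition avg :: "nat \<Rightarrow> galg \<Rightarrow> galg" where
  "avg n x = (\<Sum>g\<in>Sym n. \<delta> g * x * \<delta> (inv g))"

lemma supp_in_avg: "supp_in n x \<Longrightarrow> supp_in n (avg n x)"
  unfolding avg_def by (auto intro!: permutes_inv)

lemma class_fun_avg: "supp_in n x \<Longrightarrow> class_fun n (avg n x)"
  unfolding class_fun_def
proof (intro conjI allI impI)
  fix w assume w: "w permutes {1..n}"
  have "\<delta> w * avg n x = (\<Sum>g\<in>Sym n. \<delta> (w \<circ> g) * x * \<delta> (inv g))"
    using w by (auto simp: avg_def sum_distrib_left mult.assoc[symmetric] delta_mult intro!: sum.cong)
  also have "\<dots> = (\<Sum>g\<in>Sym n. \<delta> g * x * \<delta> (inv g \<circ> w))"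
    using w by (intro sum.reindex_bij_witness[of _ "\<lambda>g. inv w \<circ> g" "\<lambda>g. w \<circ> g"])
      (auto simp: Sym_inv_comp Sym_comp_cancel o_inv_distrib permutes_bij intro!: permutes_compose permutes_inv)
  also have "\<dots> = avg n x * \<delta> w"
    using w by (auto simp: avg_def sum_distrib_right mult.assoc delta_mult[OF permutes_inv] intro!: sum.cong)
  finally show "\<delta> w * avg n x = avg n x * \<delta> w" .
qed (rule supp_in_avg)

lemma avg_sum: "avg n (\<Sum>i\<in>I. f i) = (\<Sum>i\<in>I. avg n (f i))"
  unfolding avg_def by (subst sum.swap) (simp add: sum_distrib_left sum_distrib_right)

lemma avg_gscale: "avg n (a \<cdot>\<^sub>g x) = a \<cdot>\<^sub>g avg n x"
  unfolding avg_def by (simp add: gscale_sum)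

lemma coef_avg: "coef (avg n x) w = (\<Sum>g\<in>Sym n. coef x (inv g \<circ> w \<circ> g))"
  unfolding avg_def coef_sum
proof (rule sum.cong[OF refl])
  fix g assume "g \<in> Sym n"
  then have g: "g permutes {1..n}" by simp
  show "coef (\<delta> g * x * \<delta> (inv g)) w = coef x (inv g \<circ> w \<circ> g)"
    using g by (simp add: coef_mult_delta[OF permutes_inv[OF g]] coef_delta_mult permutes_inv_inv o_assoc)
qed

text \<open>Translating the summation variable by \<open>u\<close> moves a group element from one
  side of \<open>y\<close> to the other, so \<open>avg\<close> vanishes on commutators.\<close>

lemma avg_commute:
  assumes "supp_in n x" "supp_in n y"
  shows "avg n (x * y) = avg n (y * x)"
proof -
  have *: "avg n (\<delta> u * y) = avg n (y * \<delta> u)" if u: "u permutes {1..n}" for u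
  proof -
    have "avg n (\<delta> u * y) = (\<Sum>g\<in>Sym n. \<delta> (g \<circ> u) * y * \<delta> (inv g))"
      using u by (auto simp: avg_def mult.assoc[symmetric] delta_mult intro!: sum.cong)
    also have "\<dots> = (\<Sum>g\<in>Sym n. \<delta> g * y * \<delta> (u \<circ> inv g))"
      using u by (intro sum.reindex_bij_witness[of _ "\<lambda>g. g \<circ> inv u" "\<lambda>g. g \<circ> u"])
        (auto simp: Sym_inv_comp Sym_comp_cancel o_inv_distrib permutes_bij intro!: permutes_compose permutes_inv)
    also have "\<dots> = avg n (y * \<delta> u)"
      using u by (auto simp: avg_def mult.assoc delta_mult permutes_inv intro!: sum.cong)
    finally show ?thesis .
  qed
  have "avg n (x * y) = (\<Sum>u\<in>Sym n. coef x u \<cdot>\<^sub>g avg n (\<delta> u * y))"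
    by (subst galg_expand[OF assms(1)]) (simp add: sum_distrib_right avg_sum avg_gscale)
  also have "\<dots> = (\<Sum>u\<in>Sym n. coef x u \<cdot>\<^sub>g avg n (y * \<delta> u))"
    using * by (auto intro!: sum.cong)
  also have "\<dots> = avg n (y * x)"
    by (subst (2) galg_expand[OF assms(1)]) (simp add: sum_distrib_left avg_sum avg_gscale)
  finally show ?thesis .
qed

section \<open>Young diagrams and tableaux\<close>

definition young :: "(nat \<times> nat) set \<Rightarrow> bool" where
  "young D \<longleftrightarrow> finite D \<and> (\<forall>i j i' j'. (i, j) \<in> D \<longrightarrow> i' \<le> i \<longrightarrow> j' \<le> j \<longrightarrow> (i', j') \<in> D)"

lemma youngD: "young D \<Longrightarrow> (i, j) \<in> D \<Longrightarrow> i' \<le> i \<Longrightarrow> j' \<le> j \<Longrightarrow> (i', j') \<in> D"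
  unfolding young_def by blast

lemma finite_diagram [simp]: "finite (diagram la)"
proof (rule finite_subset)
  show "diagram la \<subseteq> (SIGMA i:{..<length la}. {..<la ! i})" by (auto simp: diagram_def)
qed auto

lemma diagram_Nil [simp]: "diagram [] = {}"
  by (auto simp: diagram_def)

lemma diagram_Cons: "diagram (a # la) = Pair 0 ` {..<a} \<union> map_prod Suc id ` diagram la"
proof (rule set_eqI, clarify)
  fix i j show "(i, j) \<in> diagram (a # la) \<longleftrightarrow> (i, j) \<in> Pair 0 ` {..<a} \<union> map_prod Suc id ` diagram la"
    by (cases i) (auto simp: diagram_def image_iff)
qed

lemma partition_nth_mono: "la \<turnstile>\<^sub>p n \<Longrightarrow> i \<le> i' \<Longrightarrow> i' < length la \<Longrightarrow> la ! i' \<le> la ! i"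
  unfolding partition_of_def by (metis le_eq_less_or_eq sorted_wrt_iff_nth_less)

lemma partition_nth_pos: "la \<turnstile>\<^sub>p n \<Longrightarrow> i < length la \<Longrightarrow> 0 < la ! i"
  unfolding partition_of_def by (metis gr0I nth_mem)

lemma young_diagram: "la \<turnstile>\<^sub>p n \<Longrightarrow> young (diagram la)"
  unfolding young_def
proof (intro conjI allI impI)
  fix i j i' j' assume la: "la \<turnstile>\<^sub>p n" and "(i, j) \<in> diagram la" "i' \<le> i" "j' \<le> j"
  then show "(i', j') \<in> diagram la"
    using partition_nth_mono[OF la, of i' i] by (simp add: diagram_def)
qed simp

lemma row_tableau_bij: "bij_betw (row_tableau la) (diagram la) {1..sum_list la}"
proof (induction la)
  case Nil then show ?case by (simp add: bij_betw_def)
next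
  case (Cons a la)
  have 1: "bij_betw (row_tableau (a # la)) (Pair 0 ` {..<a}) {1..a}"
    by (rule bij_betw_byWitness[of _ "\<lambda>x. (0, x - 1)"]) (auto simp: row_tableau_def image_iff)
  have 2: "row_tableau (a # la) (map_prod Suc id b) = a + row_tableau la b" for b
    by (cases b) (simp add: row_tableau_def)
  have "bij_betw (map_prod Suc id) (diagram la) (map_prod Suc id ` diagram la)"
    by (auto simp: bij_betw_def inj_on_def)
  moreover have "bij_betw ((+) a \<circ> row_tableau la) (diagram la) ((+) a ` {1..sum_list la})"
    by (rule bij_betw_trans[OF Cons.IH]) (auto simp: bij_betw_def)
  ultimately have "bij_betw (row_tableau (a # la)) (map_prod Suc id ` diagram la) ((+) a ` {1..sum_list la})"
    unfolding bij_betw_def inj_on_def by (auto simp: 2 image_image)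
  from bij_betw_combine[OF 1 this]
  have "bij_betw (row_tableau (a # la)) (diagram (a # la)) ({1..a} \<union> (+) a ` {1..sum_list la})"
    by (auto simp: diagram_Cons)
  also have "{1..a} \<union> (+) a ` {1..sum_list la} = {1..sum_list (a # la)}"
    by auto
  finally show ?case .
qed

lemma card_diagram: "card (diagram la) = sum_list la"
  using bij_betw_same_card[OF row_tableau_bij] by simp

text \<open>Extended by 0 beyond the last row, so that shapes are compared row by row without
  reference to their lengths.\<close>

definition row_len :: "nat list \<Rightarrow> nat \<Rightarrow> nat" where
  "row_len la i = (if i < length la then la ! i else 0)"

lemma diagram_iff: "(i, j) \<in> diagram la \<longleftrightarrow> j < row_len la i"
  by (auto simp: diagram_def row_len_def)

lemma partition_eqI:
  assumes "la \<turnstile>\<^sub>p n" "la' \<turnstile>\<^sub>p n'" "\<And>i. row_len la i = row_len la' i"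
  shows "la = la'"
proof -
  have "length la = length la'"
    using assms partition_nth_pos unfolding row_len_def
    by (metis linorder_neqE_nat less_irrefl)
  then show ?thesis using assms(3) by (intro nth_equalityI) (auto simp: row_len_def, metis)
qed

lemma diagram_inj: "la \<turnstile>\<^sub>p n \<Longrightarrow> la' \<turnstile>\<^sub>p n' \<Longrightarrow> diagram la = diagram la' \<Longrightarrow> la = la'"
proof (rule partition_eqI)
  fix i assume "diagram la = diagram la'"
  then have "\<And>j. j < row_len la i \<longleftrightarrow> j < row_len la' i" by (metis diagram_iff)
  then show "row_len la i = row_len la' i" by (metis linorder_neqE_nat less_irrefl)
qed

text \<open>Young subgroups, given by a labelling instead of a set partition. Row groups, column
  groups, the group of the last letters and the symmetries of a colouring are all of this form, and
  relabelling by a permutation conjugates the group.\<close>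

definition stab :: "nat \<Rightarrow> (nat \<Rightarrow> 'a) \<Rightarrow> (nat \<Rightarrow> nat) set" where
  "stab n f = {p \<in> Sym n. \<forall>x\<in>{1..n}. f (p x) = f x}"

lemma stabD: "p \<in> stab n f \<Longrightarrow> p permutes {1..n}"
  by (simp add: stab_def)

lemma finite_stab [simp]: "finite (stab n f)"
  by (rule finite_subset[OF _ finite_Sym[of n]]) (auto simp: stab_def)

lemma id_in_stab [simp]: "id \<in> stab n f"
  by (simp add: stab_def permutes_id)

lemma stab_comp: "p \<in> stab n f \<Longrightarrow> q \<in> stab n f \<Longrightarrow> p \<circ> q \<in> stab n f"
  unfolding stab_def
  by (auto intro!: permutes_compose) (metis atLeastAtMost_iff permutes_in_image)

lemma stab_inv: "p \<in> stab n f \<Longrightarrow> inv p \<in> stab n f"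
  unfolding stab_def
  by (auto intro!: permutes_inv) (metis atLeastAtMost_iff permutes_in_image permutes_inv permutes_inverses(1))

lemma delta_mult_stab: "p \<in> stab n f \<Longrightarrow> q \<in> stab n f \<Longrightarrow> \<delta> p * \<delta> q = \<delta> (p \<circ> q)"
  by (rule delta_mult) (erule stabD)+

lemma of_nat_galg: "of_nat k * x = of_nat k \<cdot>\<^sub>g (x :: galg)"
  by (induction k) (simp_all add: distrib_right gscale_distrib)

lemma card_stab_pos: "card (stab n f) > 0"
  using id_in_stab finite_stab card_gt_0_iff by blast

lemma transpose_stab:
  "x \<in> {1..n} \<Longrightarrow> y \<in> {1..n} \<Longrightarrow> f x = f y \<Longrightarrow> transpose x y \<in> stab n f"
  unfolding stab_def by (auto intro: permutes_swap_id simp: transpose_def)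

definition row_sum :: "nat \<Rightarrow> (nat \<Rightarrow> 'a) \<Rightarrow> galg" where
  "row_sum n f = (\<Sum>p\<in>stab n f. \<delta> p)"

definition col_sum :: "nat \<Rightarrow> (nat \<Rightarrow> 'a) \<Rightarrow> galg" where
  "col_sum n f = (\<Sum>q\<in>stab n f. of_int (sign q) \<cdot>\<^sub>g \<delta> q)"

lemma supp_in_row_sum [simp, intro]: "supp_in n (row_sum n f)"
  unfolding row_sum_def by (auto dest: stabD)

lemma supp_in_col_sum [simp, intro]: "supp_in n (col_sum n f)"
  unfolding col_sum_def by (auto dest: stabD)

lemma stab_reindex:
  assumes "p \<in> stab n f"
  shows "(\<Sum>q\<in>stab n f. F (p \<circ> q)) = (\<Sum>q\<in>stab n f. F q)"
    "(\<Sum>q\<in>stab n f. F (q \<circ> p)) = (\<Sum>q\<in>stab n f. F q)"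
  using assms stab_inv[OF assms] stabD[OF assms]
  by (intro sum.reindex_bij_witness[of _ "\<lambda>q. inv p \<circ> q" "\<lambda>q. p \<circ> q"]
            sum.reindex_bij_witness[of _ "\<lambda>q. q \<circ> inv p" "\<lambda>q. q \<circ> p"];
      auto simp: Sym_inv_comp Sym_comp_cancel intro: stab_comp)+

lemma row_sum_absorb:
  assumes "p \<in> stab n f"
  shows "\<delta> p * row_sum n f = row_sum n f" "row_sum n f * \<delta> p = row_sum n f"
proof -
  have "\<delta> p * row_sum n f = (\<Sum>q\<in>stab n f. \<delta> (p \<circ> q))"
    unfolding row_sum_def sum_distrib_left using assms
    by (intro sum.cong) (auto simp: delta_mult_stab)
  then show "\<delta> p * row_sum n f = row_sum n f" by (simp add: stab_reindex[OF assms] row_sum_def)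
  have "row_sum n f * \<delta> p = (\<Sum>q\<in>stab n f. \<delta> (q \<circ> p))"
    unfolding row_sum_def sum_distrib_right using assms
    by (intro sum.cong) (auto simp: delta_mult_stab)
  then show "row_sum n f * \<delta> p = row_sum n f" by (simp add: stab_reindex[OF assms] row_sum_def)
qed

lemma Sym_sign_comp: "p permutes {1..n::nat} \<Longrightarrow> q permutes {1..n} \<Longrightarrow> sign (p \<circ> q) = sign p * sign q"
  by (rule sign_compose) (auto simp: permutation_permutes)

lemma sign_sq_complex [simp]: "(of_int (sign p) :: complex) * of_int (sign p) = 1"
  by (simp add: sign_def)

lemma col_sum_absorb:
  assumes "p \<in> stab n f"
  shows "\<delta> p * col_sum n f = of_int (sign p) \<cdot>\<^sub>g col_sum n f"
    "col_sum n f * \<delta> p = of_int (sign p) \<cdot>\<^sub>g col_sum n f"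
proof -
  have "\<delta> p * col_sum n f = (\<Sum>q\<in>stab n f. of_int (sign q) \<cdot>\<^sub>g \<delta> (p \<circ> q))"
    unfolding col_sum_def sum_distrib_left using assms
    by (intro sum.cong) (auto simp: delta_mult_stab)
  also have "\<dots> = (\<Sum>q\<in>stab n f. of_int (sign p) \<cdot>\<^sub>g of_int (sign (p \<circ> q)) \<cdot>\<^sub>g \<delta> (p \<circ> q))"
    using stabD assms by (intro sum.cong) (auto simp: Sym_sign_comp[OF stabD stabD] mult.assoc[symmetric])
  also have "\<dots> = of_int (sign p) \<cdot>\<^sub>g col_sum n f"
    unfolding stab_reindex(1)[OF assms, where F = "\<lambda>q. of_int (sign p) \<cdot>\<^sub>g of_int (sign q) \<cdot>\<^sub>g \<delta> q"]
    by (simp add: gscale_sum col_sum_def)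
  finally show "\<delta> p * col_sum n f = of_int (sign p) \<cdot>\<^sub>g col_sum n f" .
  have "col_sum n f * \<delta> p = (\<Sum>q\<in>stab n f. of_int (sign q) \<cdot>\<^sub>g \<delta> (q \<circ> p))"
    unfolding col_sum_def sum_distrib_right using assms
    by (intro sum.cong) (auto simp: delta_mult_stab)
  also have "\<dots> = (\<Sum>q\<in>stab n f. of_int (sign p) \<cdot>\<^sub>g of_int (sign (q \<circ> p)) \<cdot>\<^sub>g \<delta> (q \<circ> p))"
    using stabD assms by (intro sum.cong) (auto simp: Sym_sign_comp[OF stabD stabD] mult.left_commute)
  also have "\<dots> = of_int (sign p) \<cdot>\<^sub>g col_sum n f"
    unfolding stab_reindex(2)[OF assms, where F = "\<lambda>q. of_int (sign p) \<cdot>\<^sub>g of_int (sign q) \<cdot>\<^sub>g \<delta> q"]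
    by (simp add: gscale_sum col_sum_def)
  finally show "col_sum n f * \<delta> p = of_int (sign p) \<cdot>\<^sub>g col_sum n f" .
qed

text \<open>The ranks may differ, so this covers both the square of a row sum and the absorption of
  the row group of a subtableau into that of a larger tableau.\<close>

lemma row_sum_mult_sub:
  assumes "stab m g \<subseteq> stab n f"
  shows "row_sum m g * row_sum n f = of_nat (card (stab m g)) \<cdot>\<^sub>g row_sum n f"
proof -
  have "row_sum m g * row_sum n f = (\<Sum>p\<in>stab m g. row_sum n f)"
    unfolding row_sum_def[of m] sum_distrib_right using assms
    by (intro sum.cong) (auto simp: row_sum_absorb)
  then show ?thesis by (simp add: of_nat_galg)
qed

lemma col_sum_mult_sub:
  assumes "stab m g \<subseteq> stab n f"
  shows "col_sum n f * col_sum m g = of_nat (card (stab m g)) \<cdot>\<^sub>g col_sum n f"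
proof -
  have "col_sum n f * col_sum m g = (\<Sum>p\<in>stab m g. col_sum n f)"
    unfolding col_sum_def[of m] sum_distrib_left using assms
    by (intro sum.cong) (auto simp: col_sum_absorb)
  then show ?thesis by (simp add: of_nat_galg)
qed

text \<open>A filling is given by the row and the column of each entry. In this direction the row
  and column groups are the stabilizers of \<open>r\<close> and \<open>c\<close>, and relabelling is
  composition.\<close>

definition tableau :: "nat \<Rightarrow> (nat \<times> nat) set \<Rightarrow> (nat \<Rightarrow> nat) \<Rightarrow> (nat \<Rightarrow> nat) \<Rightarrow> bool" where
  "tableau n D r c \<longleftrightarrow> bij_betw (\<lambda>x. (r x, c x)) {1..n} D"

lemma tableau_inj:
  "tableau n D r c \<Longrightarrow> x \<in> {1..n} \<Longrightarrow> y \<in> {1..n} \<Longrightarrow> r x = r y \<Longrightarrow> c x = c y \<Longrightarrow> x = y"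
  using inj_onD[of "\<lambda>x. (r x, c x)" "{1..n}" x y] by (simp add: tableau_def bij_betw_def)

lemma tableau_in: "tableau n D r c \<Longrightarrow> x \<in> {1..n} \<Longrightarrow> (r x, c x) \<in> D"
  unfolding tableau_def bij_betw_def by blast

lemma tableau_ex:
  assumes "tableau n D r c" "(i, j) \<in> D" obtains x where "x \<in> {1..n}" "r x = i" "c x = j"
proof -
  have "(i, j) \<in> (\<lambda>x. (r x, c x)) ` {1..n}"
    using assms by (simp add: tableau_def bij_betw_def)
  with that show ?thesis by blast
qed

lemma tableau_comp: "tableau n D r c \<Longrightarrow> g permutes {1..n} \<Longrightarrow> tableau n D (r \<circ> g) (c \<circ> g)"
  unfolding tableau_def comp_def
  using bij_betw_trans[OF permutes_imp_bij, of g "{1..n}" "\<lambda>x. (r x, c x)" D]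
  unfolding comp_def by blast

text \<open>The partial sums that the dominance order compares.\<close>

definition rows_below :: "(nat \<times> nat) set \<Rightarrow> nat \<Rightarrow> nat" where
  "rows_below D k = card {b \<in> D. fst b < k}"

lemma tableau_rows_below: "tableau n D r c \<Longrightarrow> rows_below D k = card {x \<in> {1..n}. r x < k}"
proof -
  assume "tableau n D r c"
  then have inj: "inj_on (\<lambda>x. (r x, c x)) {x \<in> {1..n}. r x < k}"
    and im: "(\<lambda>x. (r x, c x)) ` {1..n} = D"
    unfolding tableau_def bij_betw_def by (auto elim: inj_on_subset)
  have "(\<lambda>x. (r x, c x)) ` {x \<in> {1..n}. r x < k} = {b \<in> D. fst b < k}"
    unfolding im[symmetric] by auto
  then show ?thesis using card_image[OF inj] by (simp add: rows_below_def)
qed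

lemma downclosed_nat:
  assumes "finite (A :: nat set)" "\<And>i i'. i \<in> A \<Longrightarrow> i' \<le> i \<Longrightarrow> i' \<in> A"
  shows "A = {..<card A}"
proof -
  have "x < card A" if "x \<in> A" for x
  proof -
    have "{..x} \<subseteq> A" using assms(2) that by auto
    from card_mono[OF assms(1) this] show ?thesis by simp
  qed
  then have "A \<subseteq> {..<card A}" by auto
  then show ?thesis using card_subset_eq[of "{..<card A}" A] by auto
qed

lemma tableau_column_rows:
  assumes "young D" "tableau n D r c"
  shows "bij_betw r {x \<in> {1..n}. c x = j} {..<card {x \<in> {1..n}. c x = j}}"
proof -
  let ?X = "{x \<in> {1..n}. c x = j}"
  have inj: "inj_on r ?X"
    by (rule inj_onI) (auto intro: tableau_inj[OF assms(2)])
  have "r ` ?X = {..<card (r ` ?X)}"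
  proof (rule downclosed_nat)
    fix i i' assume "i \<in> r ` ?X" and "i' \<le> i"
    then have "(i, j) \<in> D" using tableau_in[OF assms(2)] by auto
    then have "(i', j) \<in> D" using youngD[OF assms(1)] \<open>i' \<le> i\<close> by blast
    then show "i' \<in> r ` ?X" using tableau_ex[OF assms(2)] by blast
  qed auto
  then show ?thesis using inj by (simp add: bij_betw_def card_image)
qed

text \<open>Entries of one column of the second tableau lie in different rows of the first, so at
  most \<open>k\<close> of them are in its first \<open>k\<close> rows. In the second tableau they
  are stacked from the top and attain the minimum of \<open>k\<close> and the column length.\<close>

lemma no_pair_columns:
  assumes "young D'" "tableau n D' r' c'"
    and no_pair: "\<And>x y. x \<in> {1..n} \<Longrightarrow> y \<in> {1..n} \<Longrightarrow> x \<noteq> y \<Longrightarrow> r x = r y \<Longrightarrow> c' x \<noteq> c' y"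
  shows "card {x \<in> {1..n}. r x < (k::nat) \<and> c' x = j} \<le> card {x \<in> {1..n}. r' x < k \<and> c' x = j}"
    and "card {x \<in> {1..n}. r' x < k \<and> c' x = j} = min k (card {x \<in> {1..n}. c' x = j})"
proof -
  let ?l = "card {x \<in> {1..n}. c' x = j}"
  have "bij_betw r' {x \<in> {1..n}. r' x < k \<and> c' x = j} {..<min k ?l}"
  proof -
    note b = tableau_column_rows[OF assms(1,2), of j]
    have "r' ` {x \<in> {1..n}. r' x < k \<and> c' x = j} = r' ` {x \<in> {1..n}. c' x = j} \<inter> {..<k}" by blast
    also have "\<dots> = {..<min k ?l}" using bij_betw_imp_surj_on[OF b] by auto
    finally show ?thesis
      using bij_betw_imp_inj_on[OF b] unfolding bij_betw_def by (blast intro: inj_on_subset)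
  qed
  from bij_betw_same_card[OF this]
  show 1: "card {x \<in> {1..n}. r' x < k \<and> c' x = j} = min k ?l" by simp
  have "card {x \<in> {1..n}. r x < k \<and> c' x = j} \<le> card {..<k}"
  proof (rule card_inj_on_le[of r])
    show "inj_on r {x \<in> {1..n}. r x < k \<and> c' x = j}"
    proof (rule inj_onI)
      fix x y assume "x \<in> {x \<in> {1..n}. r x < k \<and> c' x = j}" "y \<in> {x \<in> {1..n}. r x < k \<and> c' x = j}" "r x = r y"
      then show "x = y" using no_pair[of x y] by auto
    qed
  qed auto
  moreover have "card {x \<in> {1..n}. r x < k \<and> c' x = j} \<le> ?l"
    by (rule card_mono) auto
  ultimately show "card {x \<in> {1..n}. r x < k \<and> c' x = j} \<le> card {x \<in> {1..n}. r' x < k \<and> c' x = j}"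
    unfolding 1 by simp
qed

lemma card_by_columns:
  "card {x \<in> {1..n::nat}. P x} = (\<Sum>j\<in>c ` {1..n}. card {x \<in> {1..n}. P x \<and> c x = j})"
proof -
  have "card {x \<in> {1..n}. P x} = card (\<Union>j\<in>c ` {1..n}. {x \<in> {1..n}. P x \<and> c x = j})"
    by (rule arg_cong[where f = card]) auto
  also have "\<dots> = (\<Sum>j\<in>c ` {1..n}. card {x \<in> {1..n}. P x \<and> c x = j})"
    by (rule card_UN_disjoint) auto
  finally show ?thesis .
qed

text \<open>Column by column, the first \<open>k\<close> rows of the second tableau hold at least as
  many entries as those of the first; summing over the columns compares the shapes.\<close>

lemma no_pair_dominance:
  assumes "young D'" "tableau n D r c" "tableau n D' r' c'"
    and "\<And>x y. x \<in> {1..n} \<Longrightarrow> y \<in> {1..n} \<Longrightarrow> x \<noteq> y \<Longrightarrow> r x = r y \<Longrightarrow> c' x \<noteq> c' y"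
  shows "rows_below D k \<le> rows_below D' k"
  unfolding tableau_rows_below[OF assms(2)] tableau_rows_below[OF assms(3)]
  unfolding card_by_columns[of n "\<lambda>x. r x < k" c'] card_by_columns[of n "\<lambda>x. r' x < k" c']
  by (intro sum_mono no_pair_columns(1)[OF assms(1,3,4)])

lemma no_pair_same_shape:
  assumes "young D" "tableau n D r c" "tableau n D r' c'"
    and no_pair: "\<And>x y. x \<in> {1..n} \<Longrightarrow> y \<in> {1..n} \<Longrightarrow> x \<noteq> y \<Longrightarrow> r x = r y \<Longrightarrow> c' x \<noteq> c' y"
    and x: "x \<in> {1..n}"
  shows "(r x, c' x) \<in> D"
proof (rule ccontr)
  let ?j = "c' x" and ?X = "{y \<in> {1..n}. c' y = c' x}"
  assume "(r x, c' x) \<notin> D"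
  moreover have "(i, ?j) \<in> D" if "i < card ?X" for i
  proof -
    have "i \<in> r' ` ?X"
      using bij_betw_imp_surj_on[OF tableau_column_rows[OF assms(1,3), of ?j]] that by blast
    then obtain y where "y \<in> {1..n}" "c' y = ?j" "i = r' y" by blast
    then show ?thesis using tableau_in[OF assms(3), of y] by simp
  qed
  ultimately have le: "card ?X \<le> r x" by (meson not_le)
  have "card {y \<in> {1..n}. r y < r x} = card {y \<in> {1..n}. r' y < r x}"
    using tableau_rows_below[OF assms(2)] tableau_rows_below[OF assms(3)] by metis
  \<comment> \<open>The shapes agree, so the totals over all columns agree, and the columnwise
    inequality must be an equality in every column.\<close>
  then have "card {y \<in> {1..n}. r y < r x \<and> c' y = ?j} = card {y \<in> {1..n}. r' y < r x \<and> c' y = ?j}"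
    unfolding card_by_columns[of n "\<lambda>y. r y < r x" c'] card_by_columns[of n "\<lambda>y. r' y < r x" c']
    by (rule sum_mono_inv) (use no_pair_columns(1)[OF assms(1,3,4)] x in auto)
  also have "\<dots> = card ?X"
    using no_pair_columns(2)[OF assms(1,3,4)] le by simp
  \<comment> \<open>The whole column of \<open>x\<close> would lie strictly above the row of
    \<open>x\<close>, which excludes \<open>x\<close> itself.\<close>
  finally have "{y \<in> {1..n}. r y < r x \<and> c' y = ?j} = ?X"
    by (intro card_subset_eq) auto
  then show False using x by blast
qed

text \<open>The row in the tableau and the column in its translate by \<open>g\<close> together
  place the entries bijectively on the shape. Sorting each row to this placement is a row
  permutation \<open>p\<close>, and what remains of \<open>g\<close> preserves columns.\<close>

lemma no_pair_factor:
  assumes "young D" "tableau n D r c" "g permutes {1..n}"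
    and no_pair: "\<And>x y. x \<in> {1..n} \<Longrightarrow> y \<in> {1..n} \<Longrightarrow> x \<noteq> y \<Longrightarrow> r x = r y \<Longrightarrow> c (inv g x) \<noteq> c (inv g y)"
  shows "\<exists>p\<in>stab n r. \<exists>q\<in>stab n c. g = p \<circ> q"
proof -
  define U where "U = (\<lambda>x. (r x, c (inv g x)))"
  have tab': "tableau n D (r \<circ> inv g) (c \<circ> inv g)"
    using tableau_comp[OF assms(2) permutes_inv[OF assms(3)]] .
  have UD: "U ` {1..n} \<subseteq> D"
    using no_pair_same_shape[OF assms(1,2) tab'] no_pair by (auto simp: U_def)
  have injU: "inj_on U {1..n}"
  proof (rule inj_onI)
    fix x y assume "x \<in> {1..n}" "y \<in> {1..n}" "U x = U y"
    then show "x = y" using no_pair[of x y] by (auto simp: U_def)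
  qed
  have "card D = n" using bij_betw_same_card[OF assms(2)[unfolded tableau_def]] by simp
  then have U: "bij_betw U {1..n} D"
    using injU UD assms(1) by (simp add: bij_betw_def card_image card_subset_eq young_def)
  \<comment> \<open>\<open>p\<close> sends an entry to the one that \<open>U\<close> places in the
    box of that entry; the two have the same row under \<open>r\<close>.\<close>
  define p where "p = (\<lambda>x. if x \<in> {1..n} then inv_into {1..n} U (r x, c x) else x)"
  have "bij_betw (inv_into {1..n} U \<circ> (\<lambda>x. (r x, c x))) {1..n} {1..n}"
    using assms(2) U unfolding tableau_def by (blast intro: bij_betw_trans bij_betw_inv_into)
  then have "bij_betw p {1..n} {1..n}"
    by (rule bij_betw_cong[THEN iffD1, rotated]) (auto simp: p_def)
  then have p: "p permutes {1..n}"
    by (rule bij_imp_permutes) (auto simp: p_def)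
  have Up: "U (p x) = (r x, c x)" if "x \<in> {1..n}" for x
    using that assms(2) U f_inv_into_f[of "(r x, c x)" U "{1..n}"]
    by (auto simp: p_def bij_betw_def tableau_def)
  have pr: "p \<in> stab n r" using p Up by (auto simp: stab_def U_def)
  have "inv g \<circ> p \<in> stab n c" using p Up assms(3)
    by (auto simp: stab_def U_def intro!: permutes_compose permutes_inv)
  then have "inv (inv g \<circ> p) \<in> stab n c" by (rule stab_inv)
  moreover have "inv (inv g \<circ> p) = inv p \<circ> g"
    using p assms(3) by (metis o_inv_distrib permutes_bij permutes_inv permutes_inv_inv)
  ultimately show ?thesis using pr Sym_inv_comp(2)[OF p] by metis
qed

lemma tableau_stab_Int:
  assumes "tableau n D r c" "p \<in> stab n r" "p \<in> stab n c" shows "p = id"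
proof
  fix x show "p x = id x"
  proof (cases "x \<in> {1..n}")
    case True
    then have "p x \<in> {1..n}" using permutes_in_image[OF stabD[OF assms(2)]] by simp
    then show ?thesis using tableau_inj[OF assms(1), of "p x" x] assms(2,3) True by (auto simp: stab_def)
  next
    case False then show ?thesis using stabD[OF assms(2)] by (simp add: permutes_def)
  qed
qed

section \<open>Vanishing of products of row and column sums, and uniqueness of the Young
  symmetrizer\<close>

lemma galg_eq_neg_zero: "x = - x \<Longrightarrow> x = (0 :: galg)"
proof (rule galg_eqI)
  fix w assume "x = - x"
  then have "coef x w = coef (- x) w" by (rule arg_cong)
  then show "coef x w = coef 0 w" by simp
qed

text \<open>The transposition of the two entries is absorbed with sign -1 by the column sum and,
  after passing \<open>g\<close>, with sign 1 by the row sum; the product equals its own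
  negative.\<close>

lemma pair_col_row_zero:
  assumes "g permutes {1..n}" "x \<in> {1..n}" "y \<in> {1..n}" "x \<noteq> y" "r (inv g x) = r (inv g y)" "c x = c y"
  shows "col_sum n c * \<delta> g * row_sum n r = 0"
proof -
  let ?t = "transpose x y" and ?t' = "transpose (inv g x) (inv g y)"
  have t: "?t \<in> stab n c" "?t' \<in> stab n r"
    using assms permutes_in_image[OF permutes_inv[OF assms(1)]] by (auto intro!: transpose_stab)
  have gt: "?t \<circ> g = g \<circ> ?t'" by (rule transpose_comp_eq[OF permutes_bij[OF assms(1)]])
  have "col_sum n c * \<delta> g * row_sum n r = col_sum n c * \<delta> g * (\<delta> ?t' * row_sum n r)"
    by (simp add: row_sum_absorb t)
  also have "\<dots> = col_sum n c * (\<delta> ?t * \<delta> g) * row_sum n r"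
    unfolding delta_mult[OF stabD[OF t(1)] assms(1)] gt delta_mult[OF assms(1) stabD[OF t(2)], symmetric]
    by (simp add: mult.assoc)
  also have "\<dots> = - (col_sum n c * \<delta> g * row_sum n r)"
    using assms(4) by (simp add: mult.assoc[symmetric] col_sum_absorb[OF t(1)] sign_swap_id)
      (auto intro!: galg_eqI)
  finally show ?thesis by (rule galg_eq_neg_zero)
qed

text \<open>A group element without an obstructing pair would imply dominance. Without dominance
  every group element between the two sums therefore contributes 0.\<close>

lemma col_row_zero:
  assumes "young D" "tableau n D r c" "tableau n D' r' c'" "\<not> (\<forall>k. rows_below D' k \<le> rows_below D k)"
    "supp_in n x"
  shows "col_sum n c * x * row_sum n r' = 0"
proof -
  have "col_sum n c * \<delta> g * row_sum n r' = 0" if g: "g permutes {1..n}" for g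
  proof (rule ccontr)
    assume "col_sum n c * \<delta> g * row_sum n r' \<noteq> 0"
    then have "\<And>x y. x \<in> {1..n} \<Longrightarrow> y \<in> {1..n} \<Longrightarrow> x \<noteq> y \<Longrightarrow> (r' \<circ> inv g) x = (r' \<circ> inv g) y \<Longrightarrow> c x \<noteq> c y"
      using pair_col_row_zero[OF g] by fastforce
    from no_pair_dominance[OF assms(1) tableau_comp[OF assms(3) permutes_inv[OF g]] assms(2) this]
    show False using assms(4) by blast
  qed
  then show ?thesis
    by (subst galg_expand[OF assms(5)]) (simp add: sum_distrib_left sum_distrib_right)
qed

text \<open>Row and column group meet only in the identity, so \<open>p \<circ> q = id\<close> has a
  single solution.\<close>

lemma ctr_row_col:
  assumes "tableau n D r c" shows "ctr (row_sum n r * col_sum n c) = 1"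
proof -
  have "ctr (row_sum n r * col_sum n c) = (\<Sum>p\<in>stab n r. \<Sum>q\<in>stab n c. of_int (sign q) * ctr (\<delta> p * \<delta> q))"
    unfolding row_sum_def col_sum_def by (simp add: sum_distrib_left sum_distrib_right, subst sum.swap) simp
  also have "\<dots> = (\<Sum>p\<in>stab n r. if p = id then 1 else 0)"
  proof (rule sum.cong[OF refl])
    fix p assume p: "p \<in> stab n r"
    have "(\<Sum>q\<in>stab n c. of_int (sign q) * ctr (\<delta> p * \<delta> q)) = (\<Sum>q\<in>stab n c. if q = id \<and> p = id then 1 else 0 :: complex)"
    proof (rule sum.cong[OF refl])
      fix q assume q: "q \<in> stab n c"
      have "ctr (\<delta> p * \<delta> q) = (if p \<circ> q = id then 1 else 0)"
        using stabD[OF p] stabD[OF q]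
        by (simp add: delta_mult coef_delta[OF permutes_compose] eq_commute[of id])
      moreover have "p \<circ> q = id \<longleftrightarrow> q = id \<and> p = id"
      proof
        assume pq: "p \<circ> q = id"
        then have "q = inv p" using stabD[OF p] by (metis Sym_inv_comp(1) comp_id)
        then have "q \<in> stab n r" using stab_inv[OF p] by simp
        then have "q = id" using tableau_stab_Int[OF assms _ q] by simp
        with pq show "q = id \<and> p = id" by simp
      qed simp
      ultimately show "of_int (sign q) * ctr (\<delta> p * \<delta> q) = (if q = id \<and> p = id then 1 else 0)"
        by (auto simp: sign_id)
    qed
    also have "\<dots> = (if p = id then 1 else 0)" by (simp add: if_distrib sum.delta cong: if_cong)
    finally show "(\<Sum>q\<in>stab n c. of_int (sign q) * ctr (\<delta> p * \<delta> q)) = (if p = id then 1 else 0)" .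
  qed
  also have "\<dots> = 1" by simp
  finally show ?thesis .
qed

text \<open>The same sign argument for coefficients. It is stated for any \<open>y\<close> with the
  two symmetries, to be applied to differences of such elements and to the Young symmetrizer
  itself.\<close>

lemma pair_coef_zero:
  assumes g: "g permutes {1..n}"
    and yl: "\<And>p. p \<in> stab n r \<Longrightarrow> \<delta> p * y = y"
    and yr: "\<And>q. q \<in> stab n c \<Longrightarrow> y * \<delta> q = of_int (sign q) \<cdot>\<^sub>g y"
    and uv: "u \<in> {1..n}" "v \<in> {1..n}" "u \<noteq> v" "r u = r v" "c (inv g u) = c (inv g v)"
  shows "coef y g = 0"
proof -
  let ?t = "transpose u v" and ?t' = "transpose (inv g u) (inv g v)"
  have t: "?t \<in> stab n r" "?t' \<in> stab n c"
    using uv permutes_in_image[OF permutes_inv[OF g]] by (auto intro!: transpose_stab)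
  have ne: "inv g u \<noteq> inv g v" using uv(3) permutes_inverses(1)[OF g] by metis
  have gt: "?t \<circ> g = g \<circ> ?t'" by (rule transpose_comp_eq[OF permutes_bij[OF g]])
  have "coef y g = coef (\<delta> ?t * y) g" by (simp add: yl t)
  also have "\<dots> = coef y (?t \<circ> g)" using stabD[OF t(1)] by (simp add: coef_delta_mult)
  also have "\<dots> = coef (y * \<delta> ?t') g" using stabD[OF t(2)] by (simp add: coef_mult_delta gt)
  also have "\<dots> = - coef y g" using ne by (simp add: yr t sign_swap_id)
  finally show ?thesis by simp
qed

text \<open>Elements with these two symmetries form a line: a coefficient at
  \<open>p \<circ> q\<close> is determined by that at the identity, and every other \<open>g\<close>
  has an obstructing pair.\<close>

lemma young_unique:
  assumes D: "young D" "tableau n D r c" and x: "supp_in n x"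
    and left: "\<And>p. p \<in> stab n r \<Longrightarrow> \<delta> p * x = x"
    and right: "\<And>q. q \<in> stab n c \<Longrightarrow> x * \<delta> q = of_int (sign q) \<cdot>\<^sub>g x"
  shows "x = ctr x \<cdot>\<^sub>g (row_sum n r * col_sum n c)"
proof -
  \<comment> \<open>Subtracting the multiple with the same identity coefficient keeps both
    symmetries; the difference is then shown to be 0.\<close>
  define y where "y = x - ctr x \<cdot>\<^sub>g (row_sum n r * col_sum n c)"
  have y0: "ctr y = 0" by (simp add: y_def ctr_row_col[OF D(2)])
  have ysupp: "supp_in n y" using x by (auto simp: y_def)
  have yl: "\<delta> p * y = y" if "p \<in> stab n r" for p
    using that left by (simp add: y_def algebra_simps) (simp add: mult.assoc[symmetric] row_sum_absorb)
  have yr: "y * \<delta> q = of_int (sign q) \<cdot>\<^sub>g y" if "q \<in> stab n c" for q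
    using that right by (simp add: y_def algebra_simps col_sum_absorb gscale_distrib)
  have "coef y g = 0" if g: "g permutes {1..n}" for g
  proof (cases "\<exists>x\<in>{1..n}. \<exists>y\<in>{1..n}. x \<noteq> y \<and> r x = r y \<and> c (inv g x) = c (inv g y)")
    case True
    then show ?thesis using pair_coef_zero[OF g yl yr] by blast
  next
    case False
    then have "\<exists>p\<in>stab n r. \<exists>q\<in>stab n c. g = p \<circ> q"
      by (intro no_pair_factor[OF D g]) blast
    then obtain p q where pq: "p \<in> stab n r" "q \<in> stab n c" "g = p \<circ> q" by blast
    have "coef y g = coef (\<delta> p * y) g" by (simp add: yl pq)
    also have "\<dots> = coef y (id \<circ> q)" using stabD[OF pq(1)] by (simp add: coef_delta_mult pq Sym_inv_comp)
    also have "\<dots> = coef (y * \<delta> (inv q)) id"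
      using stabD[OF pq(2)] by (simp add: coef_mult_delta[OF permutes_inv] permutes_inv_inv)
    also have "\<dots> = 0" by (simp add: yr stab_inv pq y0)
    finally show ?thesis .
  qed
  then have "y = 0" using ysupp by (intro supp_in_eqI[of n]) auto
  then show ?thesis by (simp add: y_def)
qed

section \<open>Traces\<close>

lemma coef_fun:
  "coef (x + y) = coef x + coef y" "coef (a \<cdot>\<^sub>g x) = fscale a (coef x)" "coef 0 = 0"
  "coef (\<Sum>i\<in>I. f i) = (\<Sum>i\<in>I. coef (f i))"
proof -
  show 1: "coef (x + y) = coef x + coef y" for x y by (simp add: fun_eq_iff)
  show "coef (a \<cdot>\<^sub>g x) = fscale a (coef x)" by (simp add: fun_eq_iff fscale_def)
  show 0: "coef 0 = 0" by (simp add: fun_eq_iff)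
  show "coef (\<Sum>i\<in>I. f i) = (\<Sum>i\<in>I. coef (f i))"
    by (induction I rule: infinite_finite_induct) (simp_all add: 0 1 del: coef_simps coef_sum)
qed

definition galg_linear :: "(galg \<Rightarrow> galg) \<Rightarrow> bool" where
  "galg_linear T \<longleftrightarrow> (\<forall>x y. T (x + y) = T x + T y) \<and> (\<forall>a x. T (a \<cdot>\<^sub>g x) = a \<cdot>\<^sub>g T x)"

lemma galg_linear_sum: "galg_linear T \<Longrightarrow> T (\<Sum>i\<in>I. a i \<cdot>\<^sub>g x i) = (\<Sum>i\<in>I. a i \<cdot>\<^sub>g T (x i))"
proof -
  assume T: "galg_linear T"
  then have "T 0 = 0" unfolding galg_linear_def by (metis gscale_simps(3))
  then show ?thesis
    using T by (induction I rule: infinite_finite_induct) (auto simp: galg_linear_def)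
qed

lemma galg_linear_mult: "galg_linear (\<lambda>x. a * x * b)"
  by (simp add: galg_linear_def algebra_simps)

text \<open>The given trace is taken in an unspecified basis of \<open>V\<close>. A linear
  projection onto \<open>V\<close> replaces that basis by the group elements. \<open>V\<close>
  consists of functions because the Specht modules do.\<close>

locale galg_projection =
  fixes n :: nat and P :: "galg \<Rightarrow> galg" and V :: "((nat \<Rightarrow> nat) \<Rightarrow> complex) set"
  assumes lin: "galg_linear P"
    and supp: "supp_in n x \<Longrightarrow> supp_in n (P x)"
    and idem: "supp_in n x \<Longrightarrow> P (P x) = P x"
    and image: "V = coef ` P ` {x. supp_in n x}"
begin

lemma subspace_V: "fun_vs.subspace V"
proof (rule fun_vs.subspaceI)
  have "P 0 = 0" using lin unfolding galg_linear_def by (metis gscale_simps(3))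
  then show "0 \<in> V" unfolding image by (auto simp: image_iff coef_fun(3) intro!: bexI[of _ 0] exI[of _ 0])
next
  fix f g assume "f \<in> V" "g \<in> V"
  then obtain x y where xy: "supp_in n x" "supp_in n y" "f = coef (P x)" "g = coef (P y)"
    unfolding image by blast
  then have "f + g = coef (P (x + y))" using lin by (simp add: galg_linear_def coef_fun(1))
  then show "f + g \<in> V" unfolding image using xy by blast
next
  fix c f assume "f \<in> V"
  then obtain x where x: "supp_in n x" "f = coef (P x)" unfolding image by blast
  then have "fscale c f = coef (P (c \<cdot>\<^sub>g x))" using lin by (simp add: galg_linear_def coef_fun(2))
  then show "fscale c f \<in> V" unfolding image using x by blast
qed

lemma basis_some:
  defines "B \<equiv> SOME B. fun_vs.independent B \<and> fun_vs.span B = V"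
  shows "fun_vs.independent B" "fun_vs.span B = V" "finite B"
proof -
  obtain B' where B': "B' \<subseteq> V" "fun_vs.independent B'" "V \<subseteq> fun_vs.span B'"
    using fun_vs.maximal_independent_subset by blast
  have "fun_vs.span B' \<subseteq> V" using fun_vs.span_minimal[OF B'(1) subspace_V] .
  with B' have "\<exists>B. fun_vs.independent B \<and> fun_vs.span B = V" by blast
  from someI_ex[OF this] show ind: "fun_vs.independent B" and sp: "fun_vs.span B = V"
    unfolding B_def by auto
  \<comment> \<open>All of \<open>V\<close> lies in the span of finitely many group elements, which
    bounds every independent set.\<close>
  have "B \<subseteq> fun_vs.span ((\<lambda>g. coef (\<delta> g)) ` Sym n)"
  proof
    fix b assume "b \<in> B"
    then have "b \<in> V" using sp fun_vs.span_superset by blast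
    then obtain x where x: "supp_in n (P x)" "b = coef (P x)"
      unfolding image using supp by blast
    have "b = (\<Sum>w\<in>Sym n. fscale (coef (P x) w) (coef (\<delta> w)))"
      using arg_cong[OF galg_expand[OF x(1)], of coef] x(2) by (simp add: coef_fun del: coef_simps)
    also have "\<dots> \<in> fun_vs.span ((\<lambda>g. coef (\<delta> g)) ` Sym n)"
      by (intro fun_vs.span_sum fun_vs.span_scale fun_vs.span_base imageI)
    finally show "b \<in> fun_vs.span ((\<lambda>g. coef (\<delta> g)) ` Sym n)" .
  qed
  then show "finite B"
    using fun_vs.independent_span_bound[OF _ ind] finite_Sym by blast
qed

text \<open>The trace of \<open>T\<close> on \<open>V\<close> is the trace of
  \<open>T \<circ> P\<close> on the whole algebra. Expanding \<open>P\<close> in the chosen basis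
  and exchanging the sums turns the diagonal coefficients at group elements into those of
  \<open>T'\<close> in that basis.\<close>

lemma trace_sum:
  assumes T: "galg_linear T" "\<And>x. supp_in n x \<Longrightarrow> supp_in n (T x)"
    and TP: "\<And>x. supp_in n x \<Longrightarrow> P (T (P x)) = T (P x)"
    and T': "\<And>x. supp_in n x \<Longrightarrow> T' (coef x) = coef (T x)"
  shows "trace_on V T' = (\<Sum>g\<in>Sym n. coef (T (P (\<delta> g))) g)"
proof -
  define B where "B = (SOME B. fun_vs.independent B \<and> fun_vs.span B = V)"
  note B = basis_some[folded B_def]
  define r where "r = fun_vs.representation B"
  have "\<forall>b\<in>B. \<exists>x. supp_in n x \<and> P x = x \<and> b = coef x"
  proof
    fix b assume "b \<in> B"
    then have "b \<in> V" using B(2) fun_vs.span_superset by blast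
    then show "\<exists>x. supp_in n x \<and> P x = x \<and> b = coef x"
      unfolding image using supp idem by blast
  qed
  then obtain G where G: "\<And>b. b \<in> B \<Longrightarrow> supp_in n (G b) \<and> P (G b) = G b \<and> b = coef (G b)"
    by metis
  have PV: "coef (P x) \<in> fun_vs.span B" if "supp_in n x" for x
    unfolding B(2) image using that by blast
  have expand: "P x = (\<Sum>b\<in>B. r (coef (P x)) b \<cdot>\<^sub>g G b)" if "supp_in n x" for x
  proof (rule galg_eqI)
    fix w
    have "coef (P x) = (\<Sum>b\<in>B. fscale (r (coef (P x)) b) b)"
      unfolding r_def using fun_vs.sum_representation_eq[OF B(1) PV[OF that] B(3) subset_refl] by simp
    also have "\<dots> = coef (\<Sum>b\<in>B. r (coef (P x)) b \<cdot>\<^sub>g G b)"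
      unfolding coef_fun using G by (intro sum.cong) auto
    finally show "coef (P x) w = coef (\<Sum>b\<in>B. r (coef (P x)) b \<cdot>\<^sub>g G b) w" by simp
  qed
  have "(\<Sum>g\<in>Sym n. coef (T (P (\<delta> g))) g) =
      (\<Sum>g\<in>Sym n. \<Sum>b\<in>B. coef (T (G b)) g * r (coef (P (\<delta> g))) b)"
  proof (rule sum.cong[OF refl])
    fix g assume "g \<in> Sym n"
    then have "T (P (\<delta> g)) = (\<Sum>b\<in>B. r (coef (P (\<delta> g))) b \<cdot>\<^sub>g T (G b))"
      by (subst expand) (simp_all add: galg_linear_sum[OF T(1)])
    then show "coef (T (P (\<delta> g))) g = (\<Sum>b\<in>B. coef (T (G b)) g * r (coef (P (\<delta> g))) b)"
      by (simp add: mult.commute)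
  qed
  also have "\<dots> = (\<Sum>b\<in>B. \<Sum>g\<in>Sym n. coef (T (G b)) g * r (coef (P (\<delta> g))) b)"
    by (rule sum.swap)
  also have "\<dots> = (\<Sum>b\<in>B. r (T' b) b)"
  proof (rule sum.cong[OF refl])
    fix b assume b: "b \<in> B"
    have TG: "supp_in n (T (G b))" "P (T (G b)) = T (G b)"
      using G[OF b] T(2) TP[of "G b"] by auto
    have "T' b = coef (P (\<Sum>g\<in>Sym n. coef (T (G b)) g \<cdot>\<^sub>g \<delta> g))"
      using T'[of "G b"] G[OF b] TG galg_expand[OF TG(1)] by metis
    also have "\<dots> = (\<Sum>g\<in>Sym n. fscale (coef (T (G b)) g) (coef (P (\<delta> g))))"
      by (simp only: galg_linear_sum[OF lin] coef_fun)
    finally have eq: "T' b = (\<Sum>g\<in>Sym n. fscale (coef (T (G b)) g) (coef (P (\<delta> g))))" .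
    have "r (T' b) = (\<lambda>c. \<Sum>g\<in>Sym n. coef (T (G b)) g * r (coef (P (\<delta> g))) c)"
      unfolding r_def eq
      by (subst fun_vs.representation_sum[OF B(1)])
         (auto intro!: fun_vs.span_scale PV sum.cong simp: fun_vs.representation_scale[OF B(1) PV])
    then show "(\<Sum>g\<in>Sym n. coef (T (G b)) g * r (coef (P (\<delta> g))) b) = r (T' b) b" by simp
  qed
  finally show ?thesis by (simp add: trace_on_def B_def r_def Let_def)
qed

text \<open>The trace of a projection is its rank, here the size of a basis; rank 0 means that the
  projection vanishes.\<close>

lemma trace_id: "\<exists>k::nat. (\<Sum>g\<in>Sym n. coef (P (\<delta> g)) g) = of_nat k \<and> (k = 0 \<longrightarrow> (\<forall>x. supp_in n x \<longrightarrow> P x = 0))"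
proof -
  define B where "B = (SOME B. fun_vs.independent B \<and> fun_vs.span B = V)"
  note B = basis_some[folded B_def]
  have "(\<Sum>g\<in>Sym n. coef (P (\<delta> g)) g) = trace_on V (\<lambda>f. f)"
    by (subst trace_sum[of "\<lambda>x. x"]) (auto simp: galg_linear_def idem)
  also have "\<dots> = (\<Sum>b\<in>B. 1)"
    unfolding trace_on_def Let_def B_def[symmetric]
    by (intro sum.cong refl) (simp add: fun_vs.representation_basis[OF B(1)])
  finally have "(\<Sum>g\<in>Sym n. coef (P (\<delta> g)) g) = of_nat (card B)" by simp
  moreover have "P x = 0" if "card B = 0" "supp_in n x" for x
  proof -
    have "V \<subseteq> {0}" using that(1) B by auto
    moreover have "coef (P x) \<in> V" using that(2) unfolding image by blast
    ultimately have "coef (P x) = 0" by auto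
    then show ?thesis by (metis coef_fun(3) coef_inject)
  qed
  ultimately show ?thesis by blast
qed

end

text \<open>Both sides are the trace of the map that sends \<open>x\<close> to
  \<open>a * x * b\<close>.\<close>

lemma sum_coef_sandwich:
  "(\<Sum>g\<in>Sym n. coef (a * \<delta> g * b) g) = ctr (a * avg n b)"
proof -
  have "coef (a * \<delta> g * b) g = ctr (a * (\<delta> g * b * \<delta> (inv g)))" if "g \<in> Sym n" for g
    using that by (simp add: coef_eq_ctr[of g n] mult.assoc)
  then show ?thesis by (simp add: avg_def sum_distrib_left)
qed

text \<open>Multiplication by idempotents on both sides is a projection, so its trace is a natural
  number. This is the source of integrality and positivity for dimensions and for branching
  multiplicities.\<close>

lemma trace_idempotents:
  assumes "supp_in n a" "supp_in n b" "a * a = a" "b * b = b"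
  shows "\<exists>k::nat. ctr (a * avg n b) = of_nat k \<and> (k = 0 \<longrightarrow> (\<forall>x. supp_in n x \<longrightarrow> a * x * b = 0))"
proof -
  interpret galg_projection n "\<lambda>x. a * x * b" "coef ` (\<lambda>x. a * x * b) ` {x. supp_in n x}"
  proof
    fix x show "a * (a * x * b) * b = a * x * b" using assms(3,4)
      by (metis mult.assoc)
  qed (use assms in \<open>auto intro: galg_linear_mult\<close>)
  show ?thesis using trace_id by (simp only: sum_coef_sandwich)
qed

section \<open>Irreducible characters\<close>

text \<open>The anti-involution induced by inversion. It does not conjugate the coefficients, so the
  associated form is used on real elements only.\<close>

lift_definition star :: "galg \<Rightarrow> galg" is "\<lambda>f w. if \<exists>n. w permutes {1..n} then f (inv w) else 0"
proof (elim exE)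
  fix f :: "(nat \<Rightarrow> nat) \<Rightarrow> complex" and n assume f: "\<forall>w. f w \<noteq> 0 \<longrightarrow> w permutes {1..n}"
  show "\<exists>n. \<forall>w. (if \<exists>n. w permutes {1..n} then f (inv w) else 0) \<noteq> 0 \<longrightarrow> w permutes {1..n}"
    by (rule exI[of _ n]) (use f permutes_inv permutes_inv_inv in \<open>metis\<close>)
qed

lemma coef_star: "w permutes {1..n} \<Longrightarrow> coef (star x) w = coef x (inv w)"
  by transfer auto

lemma supp_in_star [intro, simp]: "supp_in n x \<Longrightarrow> supp_in n (star x)"
  unfolding supp_in_def
  by transfer (metis permutes_inv permutes_inv_inv)

lemma star_linear: "star (x + y) = star x + star y" "star (a \<cdot>\<^sub>g x) = a \<cdot>\<^sub>g star x" "star 0 = 0"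
  by (transfer; auto)+

lemma star_sum: "star (\<Sum>i\<in>I. f i) = (\<Sum>i\<in>I. star (f i))"
  by (induction I rule: infinite_finite_induct) (auto simp: star_linear)

lemma star_delta: "w permutes {1..n} \<Longrightarrow> star (\<delta> w) = \<delta> (inv w)"
proof -
  assume w: "w permutes {1..n}"
  show ?thesis
  proof (rule supp_in_eqI[of n])
    fix v assume v: "v permutes {1..n}"
    have "inv v = w \<longleftrightarrow> v = inv w" using v w permutes_inv_inv by metis
    then show "coef (star (\<delta> w)) v = coef (\<delta> (inv w)) v"
      using v w by (simp add: coef_star coef_delta[OF w] coef_delta[OF permutes_inv[OF w]])
  qed (use w in \<open>auto intro: permutes_inv\<close>)
qed

lemma star_mult: "star (x * y) = star y * star x"
proof -
  obtain n m where nm: "supp_in n x" "supp_in m y" using supp_in_ex by blast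
  define k where "k = max n m"
  have k: "supp_in k x" "supp_in k y" using nm supp_in_mono by (auto simp: k_def)
  show ?thesis
  proof (rule supp_in_eqI[of k])
    fix w assume w: "w permutes {1..k}"
    have "coef (star (x * y)) w = (\<Sum>u\<in>Sym k. coef x u * coef y (inv u \<circ> inv w))"
      using w by (simp add: coef_star coef_mult[OF k(1)])
    also have "\<dots> = (\<Sum>u\<in>Sym k. coef (star y) (w \<circ> u) * coef (star x) (inv u))"
    proof (rule sum.cong[OF refl])
      fix u assume "u \<in> Sym k"
      then have u: "u permutes {1..k}" by simp
      have "inv u \<circ> inv w = inv (w \<circ> u)" using u w by (simp add: o_inv_distrib permutes_bij)
      then show "coef x u * coef y (inv u \<circ> inv w) = coef (star y) (w \<circ> u) * coef (star x) (inv u)"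
        using u w by (simp add: coef_star[OF permutes_compose[OF u w]] coef_star[OF permutes_inv[OF u]] permutes_inv_inv)
    qed
    also have "\<dots> = (\<Sum>v\<in>Sym k. coef (star y) v * coef (star x) (inv v \<circ> w))"
      using w by (intro sum.reindex_bij_witness[of _ "\<lambda>v. inv w \<circ> v" "\<lambda>u. w \<circ> u"])
        (auto simp: Sym_inv_comp Sym_comp_cancel o_inv_distrib permutes_bij intro!: permutes_compose permutes_inv)
    also have "\<dots> = coef (star y * star x) w"
      using k by (simp add: coef_mult[OF supp_in_star])
    finally show "coef (star (x * y)) w = coef (star y * star x) w" .
  qed (use k in auto)
qed

lemma star_row_sum: "star (row_sum n f) = row_sum n f"
  unfolding row_sum_def star_sum
  by (rule sum.reindex_bij_witness[of _ inv inv])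
     (auto simp: stab_inv permutes_inv_inv[OF stabD] star_delta[OF stabD])

lemma sign_inv_Sym: "p permutes {1..n::nat} \<Longrightarrow> sign (inv p) = sign p"
  by (rule sign_inverse) (auto simp: permutation_permutes)

lemma star_col_sum: "star (col_sum n f) = col_sum n f"
  unfolding col_sum_def star_sum star_linear
  by (rule sum.reindex_bij_witness[of _ inv inv])
     (auto simp: stab_inv permutes_inv_inv[OF stabD] star_delta[OF stabD] sign_inv_Sym[OF stabD])

definition real_galg :: "galg \<Rightarrow> bool" where "real_galg x \<longleftrightarrow> (\<forall>w. coef x w \<in> \<real>)"

lemma real_galg_mult: "real_galg x \<Longrightarrow> real_galg y \<Longrightarrow> real_galg (x * y)"
proof -
  assume *: "real_galg x" "real_galg y"
  obtain n where "supp_in n x" using supp_in_ex by blast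
  then show ?thesis using * unfolding real_galg_def by (auto simp: coef_mult)
qed

lemma real_galg_simps:
  "real_galg 0" "real_galg 1" "real_galg x \<Longrightarrow> real_galg y \<Longrightarrow> real_galg (x + y)"
  "real_galg x \<Longrightarrow> real_galg y \<Longrightarrow> real_galg (x - y)" "a \<in> \<real> \<Longrightarrow> real_galg x \<Longrightarrow> real_galg (a \<cdot>\<^sub>g x)"
  by (auto simp: real_galg_def)

lemma real_galg_sum: "(\<And>i. i \<in> I \<Longrightarrow> real_galg (f i)) \<Longrightarrow> real_galg (\<Sum>i\<in>I. f i)"
  by (auto simp: real_galg_def)

lemma real_galg_delta: "w permutes {1..n} \<Longrightarrow> real_galg (\<delta> w)"
  by (auto simp: real_galg_def coef_delta)

lemma real_galg_row_sum: "real_galg (row_sum n f)"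
  unfolding row_sum_def by (intro real_galg_sum real_galg_delta stabD)

lemma real_galg_col_sum: "real_galg (col_sum n f)"
  unfolding col_sum_def by (intro real_galg_sum real_galg_simps real_galg_delta stabD) auto

lemma real_galg_avg: "real_galg x \<Longrightarrow> real_galg (avg n x)"
  by (auto simp: real_galg_def coef_avg)

lemma ctr_mult_star: "supp_in n x \<Longrightarrow> ctr (x * star x) = (\<Sum>u\<in>Sym n. (coef x u)\<^sup>2)"
  unfolding ctr_mult
  by (intro sum.cong) (auto simp: coef_star[OF permutes_inv] permutes_inv_inv power2_eq_square)

text \<open>With real coefficients the trace is a sum of squares, so it detects 0.\<close>

lemma ctr_mult_star_real:
  assumes "supp_in n x" "real_galg x"
  shows "ctr (x * star x) \<in> \<real>" "Re (ctr (x * star x)) \<ge> 0" "ctr (x * star x) = 0 \<longleftrightarrow> x = 0"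
proof -
  have eq: "ctr (x * star x) = of_real (\<Sum>u\<in>Sym n. (Re (coef x u))\<^sup>2)"
    unfolding ctr_mult_star[OF assms(1)] of_real_sum
    by (intro sum.cong refl) (use assms(2) in \<open>auto simp: real_galg_def complex_is_Real_iff complex_eq_iff power2_eq_square\<close>)
  then show "ctr (x * star x) \<in> \<real>" "Re (ctr (x * star x)) \<ge> 0" by (auto intro: sum_nonneg)
  have "x = 0" if "ctr (x * star x) = 0"
  proof (rule supp_in_eqI[OF assms(1)])
    fix w assume "w permutes {1..n}"
    then have "(Re (coef x w))\<^sup>2 = 0"
      using that unfolding eq of_real_eq_0_iff by (subst (asm) sum_nonneg_eq_0_iff) auto
    then show "coef x w = coef 0 w"
      using assms(2) by (auto simp: real_galg_def complex_is_Real_iff complex_eq_iff)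
  qed auto
  then show "ctr (x * star x) = 0 \<longleftrightarrow> x = 0" by (auto simp: star_linear)
qed

text \<open>Reading the standard filling from entries to boxes turns the row and column groups,
  which are defined through boxes, into stabilizers.\<close>

definition box_of :: "nat list \<Rightarrow> nat \<Rightarrow> nat \<times> nat" where
  "box_of la = inv_into (diagram la) (row_tableau la)"

abbreviation row_of :: "nat list \<Rightarrow> nat \<Rightarrow> nat" where "row_of la x \<equiv> fst (box_of la x)"
abbreviation col_of :: "nat list \<Rightarrow> nat \<Rightarrow> nat" where "col_of la x \<equiv> snd (box_of la x)"

lemma tableau_box_of: "tableau (sum_list la) (diagram la) (row_of la) (col_of la)"
  unfolding tableau_def box_of_def using bij_betw_inv_into[OF row_tableau_bij] by simp

lemma box_of_row_tableau: "b \<in> diagram la \<Longrightarrow> box_of la (row_tableau la b) = b"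
  unfolding box_of_def using bij_betw_inv_into_left[OF row_tableau_bij] .

lemma row_tableau_box_of: "x \<in> {1..sum_list la} \<Longrightarrow> row_tableau la (box_of la x) = x"
  unfolding box_of_def using bij_betw_inv_into_right[OF row_tableau_bij] .

lemma row_tableau_in: "b \<in> diagram la \<Longrightarrow> row_tableau la b \<in> {1..sum_list la}"
  using bij_betwE[OF row_tableau_bij] by blast

lemma box_of_in: "x \<in> {1..sum_list la} \<Longrightarrow> box_of la x \<in> diagram la"
  using bij_betwE[OF bij_betw_inv_into[OF row_tableau_bij]] unfolding box_of_def by blast

lemma row_group_eq: "row_group la = stab (sum_list la) (row_of la)"
proof -
  have "(\<forall>(i, j)\<in>diagram la. \<exists>k. (i, k) \<in> diagram la \<and> p (row_tableau la (i, j)) = row_tableau la (i, k))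
     \<longleftrightarrow> (\<forall>x\<in>{1..sum_list la}. row_of la (p x) = row_of la x)" (is "?L \<longleftrightarrow> ?R")
    if p: "p permutes {1..sum_list la}" for p
  proof
    assume L: ?L
    show ?R
    proof
      fix x assume x: "x \<in> {1..sum_list la}"
      obtain i j where ij: "box_of la x = (i, j)" by (cases "box_of la x")
      then obtain k where "(i, k) \<in> diagram la" "p x = row_tableau la (i, k)"
        using L box_of_in[OF x] row_tableau_box_of[OF x] by fastforce
      then show "row_of la (p x) = row_of la x" using ij by (simp add: box_of_row_tableau)
    qed
  next
    assume R: ?R
    show ?L
    proof clarify
      fix i j assume ij: "(i, j) \<in> diagram la"
      let ?y = "p (row_tableau la (i, j))"
      have y: "?y \<in> {1..sum_list la}" using row_tableau_in[OF ij] permutes_in_image[OF p] by simp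
      have "row_of la ?y = i" using R row_tableau_in[OF ij] box_of_row_tableau[OF ij] by simp
      then have "box_of la ?y = (i, col_of la ?y)" by (metis prod.collapse)
      then show "\<exists>k. (i, k) \<in> diagram la \<and> ?y = row_tableau la (i, k)"
        using box_of_in[OF y] row_tableau_box_of[OF y] by metis
    qed
  qed
  then show ?thesis unfolding row_group_def stab_def by blast
qed

lemma column_group_eq: "column_group la = stab (sum_list la) (col_of la)"
proof -
  have "(\<forall>(i, j)\<in>diagram la. \<exists>k. (k, j) \<in> diagram la \<and> p (row_tableau la (i, j)) = row_tableau la (k, j))
     \<longleftrightarrow> (\<forall>x\<in>{1..sum_list la}. col_of la (p x) = col_of la x)" (is "?L \<longleftrightarrow> ?R")
    if p: "p permutes {1..sum_list la}" for p
  proof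
    assume L: ?L
    show ?R
    proof
      fix x assume x: "x \<in> {1..sum_list la}"
      obtain i j where ij: "box_of la x = (i, j)" by (cases "box_of la x")
      then obtain k where "(k, j) \<in> diagram la" "p x = row_tableau la (k, j)"
        using L box_of_in[OF x] row_tableau_box_of[OF x] by fastforce
      then show "col_of la (p x) = col_of la x" using ij by (simp add: box_of_row_tableau)
    qed
  next
    assume R: ?R
    show ?L
    proof clarify
      fix i j assume ij: "(i, j) \<in> diagram la"
      let ?y = "p (row_tableau la (i, j))"
      have y: "?y \<in> {1..sum_list la}" using row_tableau_in[OF ij] permutes_in_image[OF p] by simp
      have "col_of la ?y = j" using R row_tableau_in[OF ij] box_of_row_tableau[OF ij] by simp
      then have "box_of la ?y = (row_of la ?y, j)" by (metis prod.collapse)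
      then show "\<exists>k. (k, j) \<in> diagram la \<and> ?y = row_tableau la (k, j)"
        using box_of_in[OF y] row_tableau_box_of[OF y] by metis
    qed
  qed
  then show ?thesis unfolding column_group_def stab_def by blast
qed

definition ysym :: "nat list \<Rightarrow> galg" where
  "ysym la = row_sum (sum_list la) (row_of la) * col_sum (sum_list la) (col_of la)"

lemma supp_in_ysym [simp, intro]: "supp_in (sum_list la) (ysym la)"
  by (auto simp: ysym_def)

lemma coef_ysym: "coef (ysym la) = young_symmetrizer la"
proof
  fix w
  have "coef (ysym la) w = (\<Sum>p\<in>row_group la. \<Sum>q\<in>column_group la. of_int (sign q) * coef (\<delta> p * \<delta> q) w)"
    unfolding ysym_def row_sum_def col_sum_def row_group_eq column_group_eq
    by (simp add: sum_distrib_left sum_distrib_right, subst sum.swap) simp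
  also have "\<dots> = young_symmetrizer la w"
    unfolding young_symmetrizer_def row_group_eq column_group_eq
  proof (intro sum.cong refl)
    fix p q assume p: "p \<in> stab (sum_list la) (row_of la)" and q: "q \<in> stab (sum_list la) (col_of la)"
    show "of_int (sign q) * coef (\<delta> p * \<delta> q) w = (if p \<circ> q = w then of_int (sign q) else 0)"
      using stabD[OF p] stabD[OF q]
      by (auto simp: delta_mult[of _ "sum_list la"] coef_delta[OF permutes_compose])
  qed
  finally show "coef (ysym la) w = young_symmetrizer la w" .
qed

text \<open>The left factor supplies row invariance and the right factor the column sign, so
  \<open>young_unique\<close> applies whatever stands between them.\<close>

lemma ysym_sandwich:
  assumes la: "la \<turnstile>\<^sub>p n" and x: "supp_in n x"
  shows "ysym la * x * ysym la = ctr (ysym la * x * ysym la) \<cdot>\<^sub>g ysym la"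
proof -
  have n: "sum_list la = n" using la by (simp add: partition_of_def)
  show ?thesis
    unfolding ysym_def n
  proof (rule young_unique[OF young_diagram[OF la]])
    show "tableau n (diagram la) (row_of la) (col_of la)" using tableau_box_of[of la] by (simp add: n)
  next
    fix p assume "p \<in> stab n (row_of la)"
    then show "\<delta> p * (row_sum n (row_of la) * col_sum n (col_of la) * x * (row_sum n (row_of la) * col_sum n (col_of la))) =
      row_sum n (row_of la) * col_sum n (col_of la) * x * (row_sum n (row_of la) * col_sum n (col_of la))"
      by (simp add: mult.assoc[symmetric] row_sum_absorb)
  next
    fix q assume "q \<in> stab n (col_of la)"
    then show "row_sum n (row_of la) * col_sum n (col_of la) * x * (row_sum n (row_of la) * col_sum n (col_of la)) * \<delta> q =
      of_int (sign q) \<cdot>\<^sub>g (row_sum n (row_of la) * col_sum n (col_of la) * x * (row_sum n (row_of la) * col_sum n (col_of la)))"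
      by (simp add: mult.assoc col_sum_absorb)
  qed (use x in auto)
qed

text \<open>Classically the product of the hook lengths of \<open>la\<close>.\<close>

definition yscal :: "nat list \<Rightarrow> complex" where
  "yscal la = ctr (ysym la * ysym la)"

lemma ysym_square: "la \<turnstile>\<^sub>p n \<Longrightarrow> ysym la * ysym la = yscal la \<cdot>\<^sub>g ysym la"
  using ysym_sandwich[of la n 1] by (simp add: yscal_def)

lemma real_ysym: "real_galg (ysym la)"
  unfolding ysym_def by (intro real_galg_mult real_galg_row_sum real_galg_col_sum)

lemma yscal_real: "yscal la \<in> \<real>"
  using real_galg_mult[OF real_ysym real_ysym] by (auto simp: yscal_def real_galg_def)

text \<open>Positivity of \<open>x \<mapsto> ctr (x * star x)\<close> on real elements, applied first to \<open>a b a\<close> and then to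
  \<open>a b\<close>, shows that \<open>(a b)\<^sup>2 \<noteq> 0\<close>.\<close>

lemma yscal_nonzero: assumes la: "la \<turnstile>\<^sub>p n" shows "yscal la \<noteq> 0"
proof
  assume 0: "yscal la = 0"
  have n: "sum_list la = n" using la by (simp add: partition_of_def)
  define a where "a = row_sum n (row_of la)"
  define b where "b = col_sum n (col_of la)"
  have y: "ysym la = a * b" by (simp add: ysym_def a_def b_def n)
  have ab: "a * b * (a * b) = 0" using ysym_square[OF la] 0 by (simp add: y)
  have st: "star a = a" "star b = b" by (simp_all add: a_def b_def star_row_sum star_col_sum)
  have aa: "a * a = of_nat (card (stab n (row_of la))) \<cdot>\<^sub>g a"
    unfolding a_def by (rule row_sum_mult_sub) simp
  have bb: "b * b = of_nat (card (stab n (col_of la))) \<cdot>\<^sub>g b"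
    unfolding b_def by (rule col_sum_mult_sub) simp
  have supp: "supp_in n a" "supp_in n b" by (auto simp: a_def b_def)
  have real: "real_galg a" "real_galg b" by (auto simp: a_def b_def real_galg_row_sum real_galg_col_sum)
  have "(a * b * a) * star (a * b * a) = a * b * (a * a) * (b * a)" by (simp add: star_mult st mult.assoc)
  also have "\<dots> = of_nat (card (stab n (row_of la))) \<cdot>\<^sub>g (a * b * (a * b) * a)" by (simp add: aa mult.assoc)
  finally have "(a * b * a) * star (a * b * a) = 0" by (simp add: ab)
  then have "a * b * a = 0"
    using ctr_mult_star_real(3)[of n "a * b * a"] supp real by (simp add: real_galg_mult)
  moreover have "(a * b) * star (a * b) = of_nat (card (stab n (col_of la))) \<cdot>\<^sub>g (a * b * a)"
  proof -
    have "(a * b) * star (a * b) = a * (b * b) * a" by (simp add: star_mult st mult.assoc)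
    then show ?thesis by (simp add: bb)
  qed
  ultimately have "a * b = 0"
    using ctr_mult_star_real(3)[of n "a * b"] supp real by (simp add: real_galg_mult)
  then have "ctr (ysym la) = 0" by (simp add: y)
  moreover have "ctr (ysym la) = 1" unfolding ysym_def by (rule ctr_row_col[OF tableau_box_of])
  ultimately show False by simp
qed

definition yidem :: "nat list \<Rightarrow> galg" where
  "yidem la = inverse (yscal la) \<cdot>\<^sub>g ysym la"

lemma supp_in_yidem: "la \<turnstile>\<^sub>p n \<Longrightarrow> supp_in n (yidem la)"
  using supp_in_ysym[of la] by (auto simp: yidem_def partition_of_def)

lemma yidem_idem: "la \<turnstile>\<^sub>p n \<Longrightarrow> yidem la * yidem la = yidem la"
  using yscal_nonzero[of la n] by (simp add: yidem_def ysym_square)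

lemma real_yidem: "real_galg (yidem la)"
  unfolding yidem_def by (intro real_galg_simps real_ysym Reals_inverse yscal_real)

text \<open>Primitivity: the corner algebra cut out by the idempotent is one-dimensional.\<close>

lemma yidem_sandwich: "la \<turnstile>\<^sub>p n \<Longrightarrow> supp_in n x \<Longrightarrow> \<exists>c. yidem la * x * yidem la = c \<cdot>\<^sub>g yidem la"
proof -
  assume la: "la \<turnstile>\<^sub>p n" and x: "supp_in n x"
  have "yidem la * x * yidem la = (inverse (yscal la) * inverse (yscal la)) \<cdot>\<^sub>g (ysym la * x * ysym la)"
    by (simp add: yidem_def)
  also have "\<dots> = (inverse (yscal la) * inverse (yscal la) * ctr (ysym la * x * ysym la)) \<cdot>\<^sub>g ysym la"
    by (subst ysym_sandwich[OF la x]) simp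
  finally show ?thesis
    by (intro exI[of _ "inverse (yscal la) * ctr (ysym la * x * ysym la)"]) (simp add: yidem_def ac_simps)
qed

text \<open>By \<open>irr_char_eq\<close> the coefficients are the values of the irreducible
  character. As elements of the group algebra, characters can be multiplied, restricted and
  traced.\<close>

definition chi :: "nat list \<Rightarrow> galg" where
  "chi la = avg (sum_list la) (yidem la)"

lemma class_fun_chi: "la \<turnstile>\<^sub>p n \<Longrightarrow> class_fun n (chi la)"
  using class_fun_avg[OF supp_in_yidem] by (auto simp: chi_def partition_of_def)

lemma supp_in_chi: "la \<turnstile>\<^sub>p n \<Longrightarrow> supp_in n (chi la)"
  using class_fun_chi by (simp add: class_fun_def)

lemma real_chi: "real_galg (chi la)"
  unfolding chi_def by (intro real_galg_avg real_yidem)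

lemma star_avg: "supp_in n x \<Longrightarrow> star (avg n x) = avg n (star x)"
proof -
  assume x: "supp_in n x"
  have "star (avg n x) = (\<Sum>g\<in>Sym n. \<delta> g * star x * \<delta> (inv g))"
    unfolding avg_def star_sum
    by (intro sum.cong refl) (simp add: star_mult star_delta[of _ n] permutes_inv permutes_inv_inv mult.assoc)
  then show ?thesis by (simp add: avg_def)
qed

text \<open>Inversion fixes row and column sums but exchanges their order, which \<open>avg\<close>
  does not see.\<close>

lemma avg_star_yidem: assumes la: "la \<turnstile>\<^sub>p n" shows "avg n (star (yidem la)) = avg n (yidem la)"
proof -
  have n: "sum_list la = n" using la by (simp add: partition_of_def)
  show ?thesis
    unfolding yidem_def ysym_def n star_linear star_mult star_row_sum star_col_sum avg_gscale
    by (subst avg_commute) auto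
qed

lemma star_chi: assumes la: "la \<turnstile>\<^sub>p n" shows "star (chi la) = chi la"
proof -
  have n: "sum_list la = n" using la by (simp add: partition_of_def)
  show ?thesis
    unfolding chi_def n star_avg[OF supp_in_yidem[OF la]] by (rule avg_star_yidem[OF la])
qed

section \<open>Specht modules as left ideals, and their characters\<close>

lemma left_mult_coef: "w permutes {1..n} \<Longrightarrow> left_mult w (coef x) = coef (\<delta> w * x)"
  by (auto simp: left_mult_def coef_delta_mult)

text \<open>Up to the nonzero scalar \<open>yscal la\<close>, the left translates of the Young
  symmetrizer are those of the idempotent, and they span the image of right multiplication by
  it.\<close>

lemma specht_module_eq:
  assumes la: "la \<turnstile>\<^sub>p n"
  shows "specht_module la = coef ` (\<lambda>x. x * yidem la) ` {x. supp_in n x}"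
proof -
  have n: "sum_list la = n" using la by (simp add: partition_of_def)
  have c: "ysym la = yscal la \<cdot>\<^sub>g yidem la" using yscal_nonzero[OF la] by (simp add: yidem_def)
  let ?S = "(\<lambda>u. left_mult u (young_symmetrizer la)) ` Sym n"
  have S: "?S = (\<lambda>u. coef (\<delta> u * ysym la)) ` Sym n"
    by (intro image_cong refl) (simp add: left_mult_coef[symmetric] coef_ysym)
  interpret galg_projection n "\<lambda>x. x * yidem la" "coef ` (\<lambda>x. x * yidem la) ` {x. supp_in n x}"
    using galg_linear_mult[of 1 "yidem la"] supp_in_yidem[OF la]
    by unfold_locales (auto simp: mult.assoc yidem_idem[OF la])
  have "fun_vs.span ?S = coef ` (\<lambda>x. x * yidem la) ` {x. supp_in n x}"
  proof
    show "fun_vs.span ?S \<subseteq> coef ` (\<lambda>x. x * yidem la) ` {x. supp_in n x}"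
    proof (rule fun_vs.span_minimal[OF _ subspace_V], unfold S, clarify)
      fix u assume u: "u permutes {1..n}"
      have "\<delta> u * ysym la = (yscal la \<cdot>\<^sub>g \<delta> u) * yidem la" by (simp add: c)
      then show "coef (\<delta> u * ysym la) \<in> coef ` (\<lambda>x. x * yidem la) ` {x. supp_in n x}"
        using u by (metis (mono_tags, lifting) image_eqI mem_Collect_eq supp_in_delta supp_in_intros(6))
    qed
    show "coef ` (\<lambda>x. x * yidem la) ` {x. supp_in n x} \<subseteq> fun_vs.span ?S"
    proof clarify
      fix x assume x: "supp_in n x"
      have "x * yidem la = (\<Sum>u\<in>Sym n. (coef x u * inverse (yscal la)) \<cdot>\<^sub>g (\<delta> u * ysym la))"
        by (subst galg_expand[OF x]) (simp add: sum_distrib_right yidem_def gscale_sum mult.commute)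
      then have "coef (x * yidem la) = (\<Sum>u\<in>Sym n. fscale (coef x u * inverse (yscal la)) (coef (\<delta> u * ysym la)))"
        by (simp only: coef_fun)
      also have "\<dots> \<in> fun_vs.span ?S"
        unfolding S by (intro fun_vs.span_sum fun_vs.span_scale fun_vs.span_base imageI)
      finally show "coef (x * yidem la) \<in> fun_vs.span ?S" .
    qed
  qed
  then show ?thesis by (simp add: specht_module_def n)
qed

text \<open>On the left ideal of an idempotent \<open>e\<close> the trace of \<open>w\<close> is the
  sum of the coefficients of \<open>w g e\<close> at \<open>g\<close>, that is, the identity
  coefficient of \<open>w\<close> times the averaged \<open>e\<close>. This is a value at the
  inverse of \<open>w\<close>, and \<open>star_chi\<close> removes the inversion.\<close>

lemma irr_char_eq:
  assumes la: "la \<turnstile>\<^sub>p n" and w: "w permutes {1..n}"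
  shows "irr_char la w = coef (chi la) w"
proof -
  have n: "sum_list la = n" using la by (simp add: partition_of_def)
  interpret galg_projection n "\<lambda>x. x * yidem la" "specht_module la"
    using galg_linear_mult[of 1 "yidem la"] supp_in_yidem[OF la]
    by unfold_locales (auto simp: mult.assoc yidem_idem[OF la] specht_module_eq[OF la])
  have "irr_char la w = (\<Sum>g\<in>Sym n. coef (\<delta> w * (\<delta> g * yidem la)) g)"
    unfolding irr_char_def
    by (rule trace_sum) (use w supp_in_yidem[OF la] galg_linear_mult[of "\<delta> w" 1] in
       \<open>auto simp: mult.assoc yidem_idem[OF la] left_mult_coef\<close>)
  also have "\<dots> = ctr (\<delta> w * avg n (yidem la))"
    using sum_coef_sandwich[where n = n and a = "\<delta> w" and b = "yidem la"] by (simp add: mult.assoc)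
  also have "\<dots> = coef (chi la) (inv w)"
    using w by (simp add: coef_delta_mult chi_def n)
  also have "\<dots> = coef (star (chi la)) w"
    using w by (simp add: coef_star)
  finally show ?thesis by (simp add: star_chi[OF la])
qed

section \<open>The Young graph\<close>

definition parts :: "nat \<Rightarrow> nat list set" where
  "parts n = {la. la \<turnstile>\<^sub>p n}"

lemma parts_iff [simp]: "la \<in> parts n \<longleftrightarrow> la \<turnstile>\<^sub>p n"
  by (simp add: parts_def)

lemma finite_parts [simp]: "finite (parts n)"
proof (rule finite_subset)
  show "parts n \<subseteq> {xs. set xs \<subseteq> {..n} \<and> length xs \<le> n}"
  proof
    fix la assume "la \<in> parts n"
    then have la: "0 \<notin> set la" "sum_list la = n" by (auto simp: partition_of_def)
    have "length la \<le> sum_list la" using la(1)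
      by (induction la) auto
    then show "la \<in> {xs. set xs \<subseteq> {..n} \<and> length xs \<le> n}"
      using la(2) member_le_sum_list by auto
  qed
qed (rule finite_lists_length_le, simp)

lemma card_diagram_partition: "la \<turnstile>\<^sub>p n \<Longrightarrow> card (diagram la) = n"
  by (simp add: card_diagram partition_of_def)

lemma row_len_mono: "la \<turnstile>\<^sub>p n \<Longrightarrow> i \<le> i' \<Longrightarrow> row_len la i' \<le> row_len la i"
  unfolding row_len_def using partition_nth_mono by auto

lemma young_row: "young D \<Longrightarrow> {j. (i, j) \<in> D} = {..<card {j. (i, j) \<in> D}}"
proof (rule downclosed_nat)
  assume "young D"
  then have "finite (snd ` D)" by (simp add: young_def)
  then show "finite {j. (i, j) \<in> D}" by (rule rev_finite_subset) force
qed (use youngD in blast)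

lemma young_col: "young D \<Longrightarrow> {i. (i, j) \<in> D} = {..<card {i. (i, j) \<in> D}}"
proof (rule downclosed_nat)
  assume "young D"
  then have "finite (fst ` D)" by (simp add: young_def)
  then show "finite {i. (i, j) \<in> D}" by (rule rev_finite_subset) force
qed (use youngD in blast)

lemma young_ex_partition:
  assumes "young D"
  shows "\<exists>la. la \<turnstile>\<^sub>p card D \<and> diagram la = D"
proof -
  define l where "l = (\<lambda>i. card {j. (i, j) \<in> D})"
  define k where "k = card {i. (i, 0) \<in> D}"
  have l: "(i, j) \<in> D \<longleftrightarrow> j < l i" for i j
    using young_row[OF assms, of i] unfolding l_def by blast
  have k: "(i, 0) \<in> D \<longleftrightarrow> i < k" for i
    using young_col[OF assms, of 0] unfolding k_def by blast
  have mono: "l i' \<le> l i" if "i \<le> i'" for i i'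
  proof (rule ccontr)
    assume "\<not> l i' \<le> l i"
    then have "(i', l i) \<in> D" by (simp add: l)
    then have "(i, l i) \<in> D" using youngD[OF assms _ that] by blast
    then show False by (simp add: l)
  qed
  define la where "la = map l [0..<k]"
  have kl: "i < k" if "j < l i" for i j
    using k[of i] l[of i 0] that by simp
  have D: "diagram la = D"
  proof (rule set_eqI, clarify)
    fix i j show "(i, j) \<in> diagram la \<longleftrightarrow> (i, j) \<in> D"
      using kl[of j i] by (auto simp: diagram_def la_def l)
  qed
  have "l i \<noteq> 0" if "i < k" for i
    using that k[of i] l[of i 0] by simp
  then have "0 \<notin> set la" by (force simp: la_def)
  moreover have "sorted_wrt (\<ge>) la"
    unfolding la_def sorted_wrt_iff_nth_less using mono by simp
  ultimately have "la \<turnstile>\<^sub>p card D"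
    unfolding partition_of_def using card_diagram[of la] D by simp
  then show ?thesis using D by blast
qed

lemma youngI: "finite D \<Longrightarrow> (\<And>i j i' j'. (i, j) \<in> D \<Longrightarrow> i' \<le> i \<Longrightarrow> j' \<le> j \<Longrightarrow> (i', j') \<in> D) \<Longrightarrow> young D"
  unfolding young_def by blast

lemma young_finite: "young D \<Longrightarrow> finite D"
  unfolding young_def by blast

lemma young_Un: "young D \<Longrightarrow> young D' \<Longrightarrow> young (D \<union> D')"
proof (rule youngI)
  fix i j i' j' assume "young D" "young D'" "(i, j) \<in> D \<union> D'" "i' \<le> i" "j' \<le> j"
  then show "(i', j') \<in> D \<union> D'" using youngD[of D i j i' j'] youngD[of D' i j i' j'] by blast
qed (simp add: young_finite)

lemma young_Int: "young D \<Longrightarrow> young D' \<Longrightarrow> young (D \<inter> D')"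
proof (rule youngI)
  fix i j i' j' assume "young D" "young D'" "(i, j) \<in> D \<inter> D'" "i' \<le> i" "j' \<le> j"
  then show "(i', j') \<in> D \<inter> D'" using youngD[of D i j i' j'] youngD[of D' i j i' j'] by blast
qed (simp add: young_finite)

lemma add_box_subset: "mu \<nearrow> la \<Longrightarrow> diagram mu \<subseteq> diagram la"
  unfolding add_box_def by auto

lemma add_box_iff:
  assumes "mu \<turnstile>\<^sub>p m" "la \<turnstile>\<^sub>p Suc m"
  shows "mu \<nearrow> la \<longleftrightarrow> diagram mu \<subseteq> diagram la"
proof
  assume sub: "diagram mu \<subseteq> diagram la"
  have "card (diagram la - diagram mu) = 1"
    using sub assms by (simp add: card_Diff_subset card_diagram_partition)
  then obtain b where "diagram la - diagram mu = {b}" by (rule card_1_singletonE)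
  then show "mu \<nearrow> la" unfolding add_box_def using sub by blast
qed (rule add_box_subset)

lemma add_box_size: "mu \<nearrow> la \<Longrightarrow> mu \<turnstile>\<^sub>p m \<Longrightarrow> la \<turnstile>\<^sub>p n \<Longrightarrow> n = Suc m"
proof -
  assume "mu \<nearrow> la" "mu \<turnstile>\<^sub>p m" "la \<turnstile>\<^sub>p n"
  then obtain b where b: "b \<notin> diagram mu" "diagram la = insert b (diagram mu)"
    unfolding add_box_def by blast
  then have "card (diagram la) = Suc (card (diagram mu))" by simp
  then show ?thesis using \<open>mu \<turnstile>\<^sub>p m\<close> \<open>la \<turnstile>\<^sub>p n\<close> by (simp add: card_diagram_partition)
qed

definition new_box :: "nat list \<Rightarrow> nat list \<Rightarrow> nat \<times> nat" where
  "new_box la mu = the_elem (skew la mu)"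

lemma new_box:
  assumes "mu \<nearrow> la"
  shows "new_box la mu \<notin> diagram mu" "diagram la = insert (new_box la mu) (diagram mu)"
proof -
  obtain b where b: "b \<notin> diagram mu" "diagram la = insert b (diagram mu)"
    using assms unfolding add_box_def by blast
  then have "skew la mu = {b}" by (auto simp: skew_def)
  then show "new_box la mu \<notin> diagram mu" "diagram la = insert (new_box la mu) (diagram mu)"
    using b by (simp_all add: new_box_def)
qed

lemma new_box_unique: "b \<notin> diagram mu \<Longrightarrow> diagram la = insert b (diagram mu) \<Longrightarrow> new_box la mu = b"
  using new_box[of mu la] unfolding add_box_def by blast

lemma new_box_row:
  assumes "mu \<nearrow> la" "la \<turnstile>\<^sub>p n"
  shows "new_box la mu = (fst (new_box la mu), row_len mu (fst (new_box la mu)))"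
proof -
  obtain i j where ij: "new_box la mu = (i, j)" by (cases "new_box la mu")
  note b = new_box[OF assms(1), unfolded ij]
  have "row_len mu i \<le> j" using b(1) by (simp add: diagram_iff)
  moreover have "\<not> row_len mu i < j"
  proof
    assume lt: "row_len mu i < j"
    have "(i, row_len mu i) \<in> diagram la"
      using youngD[OF young_diagram[OF assms(2)], of i j i "row_len mu i"] b(2) lt by auto
    then show False using b(2) lt by (auto simp: diagram_iff)
  qed
  ultimately show ?thesis using ij by simp
qed

section \<open>Corners of a diagram and the covers they define\<close>

definition addable :: "nat list \<Rightarrow> nat set" where
  "addable mu = {i. i = 0 \<or> row_len mu i < row_len mu (i - 1)}"

definition removable :: "nat list \<Rightarrow> nat set" where
  "removable mu = {i. row_len mu (Suc i) < row_len mu i}"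

lemma finite_removable [simp]: "finite (removable mu)"
  by (rule finite_subset[of _ "{..<length mu}"]) (auto simp: removable_def row_len_def split: if_splits)

text \<open>A box can be added in row 0 or directly below a removable row. The extra row 0 is the 1
  in the commutation relation of the Young graph.\<close>

lemma addable_eq: "addable mu = insert 0 (Suc ` removable mu)"
proof (rule set_eqI)
  fix i show "i \<in> addable mu \<longleftrightarrow> i \<in> insert 0 (Suc ` removable mu)"
    by (cases i) (auto simp: addable_def removable_def)
qed

lemma card_addable: "card (addable mu) = Suc (card (removable mu))"
  unfolding addable_eq by (subst card_insert_disjoint) (auto simp: card_image)

lemma young_insert:
  assumes mu: "mu \<turnstile>\<^sub>p m" and i: "i \<in> addable mu"
  shows "young (insert (i, row_len mu i) (diagram mu))"
  unfolding young_def
proof (intro conjI allI impI)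
  fix a b a' b'
  assume "(a, b) \<in> insert (i, row_len mu i) (diagram mu)" and le: "a' \<le> a" "b' \<le> b"
  then consider "(a, b) \<in> diagram mu" | "a = i" "b = row_len mu i" by auto
  then show "(a', b') \<in> insert (i, row_len mu i) (diagram mu)"
  proof cases
    case 1
    then show ?thesis using youngD[OF young_diagram[OF mu]] le by blast
  next
    case 2
    have "b' < row_len mu a'" if "a' < i"
    proof -
      have "row_len mu i < row_len mu (i - 1)" using i that by (auto simp: addable_def)
      also have "\<dots> \<le> row_len mu a'" using row_len_mono[OF mu] that by simp
      finally show ?thesis using le 2 by simp
    qed
    then show ?thesis using le 2 by (auto simp: diagram_iff le_less)
  qed
qed auto

lemma card_up_covers:
  assumes mu: "mu \<turnstile>\<^sub>p m"
  shows "card {la \<in> parts (Suc m). mu \<nearrow> la} = card (addable mu)"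
proof (rule bij_betw_same_card[of "\<lambda>la. fst (new_box la mu)"])
  show "bij_betw (\<lambda>la. fst (new_box la mu)) {la \<in> parts (Suc m). mu \<nearrow> la} (addable mu)"
    unfolding bij_betw_def
  proof
    show "inj_on (\<lambda>la. fst (new_box la mu)) {la \<in> parts (Suc m). mu \<nearrow> la}"
    proof (rule inj_onI, clarsimp)
      fix la la' assume *: "la \<turnstile>\<^sub>p Suc m" "la' \<turnstile>\<^sub>p Suc m" "mu \<nearrow> la" "mu \<nearrow> la'"
        "fst (new_box la mu) = fst (new_box la' mu)"
      then have "new_box la mu = new_box la' mu"
        using new_box_row by metis
      then have "diagram la = diagram la'" using new_box(2) * by metis
      then show "la = la'" using diagram_inj * by blast
    qed
    show "(\<lambda>la. fst (new_box la mu)) ` {la \<in> parts (Suc m). mu \<nearrow> la} = addable mu"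
    proof (intro equalityI subsetI)
      fix i assume "i \<in> (\<lambda>la. fst (new_box la mu)) ` {la \<in> parts (Suc m). mu \<nearrow> la}"
      then obtain la where la: "la \<turnstile>\<^sub>p Suc m" "mu \<nearrow> la" "i = fst (new_box la mu)" by auto
      then have nb: "new_box la mu = (i, row_len mu i)" using new_box_row by metis
      have "row_len mu i < row_len mu (i - 1)" if "i \<noteq> 0"
      proof -
        have "(i - 1, row_len mu i) \<in> diagram la"
          using youngD[OF young_diagram[OF la(1)]] new_box(2)[OF la(2)] nb
          by (metis diff_le_self insertI1 le_refl)
        then have "(i - 1, row_len mu i) \<in> diagram mu"
          using new_box(2)[OF la(2)] nb that by auto
        then show ?thesis by (simp add: diagram_iff)
      qed
      then show "i \<in> addable mu" by (auto simp: addable_def)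
    next
      fix i assume i: "i \<in> addable mu"
      have notin: "(i, row_len mu i) \<notin> diagram mu" by (simp add: diagram_iff)
      obtain la where la: "la \<turnstile>\<^sub>p card (insert (i, row_len mu i) (diagram mu))"
        "diagram la = insert (i, row_len mu i) (diagram mu)"
        using young_ex_partition[OF young_insert[OF mu i]] by blast
      then have "la \<turnstile>\<^sub>p Suc m" using notin card_diagram_partition[OF mu] by simp
      moreover have "mu \<nearrow> la" using la notin unfolding add_box_def by blast
      moreover have "new_box la mu = (i, row_len mu i)" using la notin by (intro new_box_unique)
      ultimately show "i \<in> (\<lambda>la. fst (new_box la mu)) ` {la \<in> parts (Suc m). mu \<nearrow> la}"
        by force
    qed
  qed
qed

lemma add_box_row_len:
  assumes "ka \<nearrow> mu" "mu \<turnstile>\<^sub>p n"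
  defines "i \<equiv> fst (new_box mu ka)"
  shows "row_len mu i = Suc (row_len ka i)" "i' \<noteq> i \<Longrightarrow> row_len mu i' = row_len ka i'"
    "new_box mu ka = (i, row_len mu i - 1)"
proof -
  have nb: "new_box mu ka = (i, row_len ka i)" using new_box_row assms by metis
  have D: "diagram mu = insert (i, row_len ka i) (diagram ka)" using new_box(2)[OF assms(1)] nb by simp
  have eq: "j < row_len mu a \<longleftrightarrow> (a = i \<and> j = row_len ka i) \<or> j < row_len ka a" for a j
    using D diagram_iff[of a j mu] diagram_iff[of a j ka] by auto
  show 1: "row_len mu i = Suc (row_len ka i)"
    using eq[of "row_len ka i" i] eq[of "Suc (row_len ka i)" i] by auto
  show "row_len mu i' = row_len ka i'" if "i' \<noteq> i"
    using eq[of _ i'] that by (metis linorder_neqE_nat less_irrefl)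
  show "new_box mu ka = (i, row_len mu i - 1)" using nb 1 by simp
qed

lemma young_remove:
  assumes mu: "mu \<turnstile>\<^sub>p m" and i: "i \<in> removable mu"
  shows "young (diagram mu - {(i, row_len mu i - 1)})"
  unfolding young_def
proof (intro conjI allI impI)
  fix a b a' b'
  assume ab: "(a, b) \<in> diagram mu - {(i, row_len mu i - 1)}" and le: "a' \<le> a" "b' \<le> b"
  then have in_mu: "(a', b') \<in> diagram mu" using youngD[OF young_diagram[OF mu]] by blast
  moreover have "(a', b') \<noteq> (i, row_len mu i - 1)"
  proof
    assume "(a', b') = (i, row_len mu i - 1)"
    then have ab': "i \<le> a" "row_len mu i - 1 \<le> b" "b < row_len mu a" "(a, b) \<noteq> (i, row_len mu i - 1)"
      using le ab by (auto simp: diagram_iff)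
    show False
    proof (cases "a = i")
      case True then show False using ab' by auto
    next
      case False
      then have "row_len mu a \<le> row_len mu (Suc i)" using ab'(1) row_len_mono[OF mu] by simp
      then show False using ab' i by (auto simp: removable_def)
    qed
  qed
  ultimately show "(a', b') \<in> diagram mu - {(i, row_len mu i - 1)}" by blast
qed auto

lemma down_cover_removable:
  assumes "ka \<nearrow> mu" "ka \<turnstile>\<^sub>p n" "mu \<turnstile>\<^sub>p m"
  shows "fst (new_box mu ka) \<in> removable mu"
proof -
  let ?i = "fst (new_box mu ka)"
  note rl = add_box_row_len[OF assms(1,3)]
  have "row_len mu (Suc ?i) = row_len ka (Suc ?i)" using rl(2)[of "Suc ?i"] by simp
  also have "\<dots> \<le> row_len ka ?i" using row_len_mono[OF assms(2)] by simp
  finally show ?thesis using rl(1) by (simp add: removable_def)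
qed

lemma removable_down_cover:
  assumes mu: "mu \<turnstile>\<^sub>p m" and i: "i \<in> removable mu"
  obtains ka where "ka \<turnstile>\<^sub>p m - 1" "ka \<nearrow> mu" "new_box mu ka = (i, row_len mu i - 1)"
proof -
  have in_mu: "(i, row_len mu i - 1) \<in> diagram mu" using i by (auto simp: diagram_iff removable_def)
  obtain ka where ka: "ka \<turnstile>\<^sub>p card (diagram mu - {(i, row_len mu i - 1)})"
    "diagram ka = diagram mu - {(i, row_len mu i - 1)}"
    using young_ex_partition[OF young_remove[OF mu i]] by blast
  have "ka \<turnstile>\<^sub>p m - 1" using ka(1) in_mu card_diagram_partition[OF mu] by simp
  moreover have "ka \<nearrow> mu" unfolding add_box_def using ka in_mu by (intro exI[of _ "(i, row_len mu i - 1)"]) auto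
  moreover have "new_box mu ka = (i, row_len mu i - 1)" using ka in_mu by (intro new_box_unique) auto
  ultimately show thesis by (rule that)
qed

lemma bij_down_covers:
  assumes mu: "mu \<turnstile>\<^sub>p Suc m"
  shows "bij_betw (\<lambda>ka. fst (new_box mu ka)) {ka \<in> parts m. ka \<nearrow> mu} (removable mu)"
  unfolding bij_betw_def
proof
  show "inj_on (\<lambda>ka. fst (new_box mu ka)) {ka \<in> parts m. ka \<nearrow> mu}"
  proof (rule inj_onI, clarsimp)
    fix la la' assume *: "la \<turnstile>\<^sub>p m" "la' \<turnstile>\<^sub>p m" "la \<nearrow> mu" "la' \<nearrow> mu"
      "fst (new_box mu la) = fst (new_box mu la')"
    then have "new_box mu la = new_box mu la'"
      using add_box_row_len(3) mu by metis
    then have "diagram la = diagram la'" using new_box * by (metis Diff_insert_absorb)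
    then show "la = la'" using diagram_inj * by blast
  qed
  show "(\<lambda>ka. fst (new_box mu ka)) ` {ka \<in> parts m. ka \<nearrow> mu} = removable mu"
  proof (intro equalityI subsetI)
    fix i assume "i \<in> removable mu"
    then obtain ka where "ka \<turnstile>\<^sub>p m" "ka \<nearrow> mu" "new_box mu ka = (i, row_len mu i - 1)"
      using removable_down_cover[OF mu] by (metis diff_Suc_1)
    then show "i \<in> (\<lambda>ka. fst (new_box mu ka)) ` {ka \<in> parts m. ka \<nearrow> mu}" by force
  qed (auto intro: down_cover_removable mu)
qed

text \<open>The commutation relation of raising and lowering in the Young graph. For distinct shapes
  the only candidates are the union and the intersection, and one has the right size exactly when
  the other has. For equal shapes there is one more addable than removable row.\<close>

lemma card_common_covers:
  assumes mu: "mu \<turnstile>\<^sub>p Suc m" and mu': "mu' \<turnstile>\<^sub>p Suc m"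
  shows "card {la \<in> parts (Suc (Suc m)). mu \<nearrow> la \<and> mu' \<nearrow> la} =
    card {ka \<in> parts m. ka \<nearrow> mu \<and> ka \<nearrow> mu'} + (if mu = mu' then 1 else 0)"
proof (cases "mu = mu'")
  case True
  then show ?thesis
    using card_up_covers[OF mu] bij_betw_same_card[OF bij_down_covers[OF mu]] card_addable[of mu] by simp
next
  case False
  let ?D = "diagram mu" and ?D' = "diagram mu'"
  note Y = young_diagram[OF mu] young_diagram[OF mu']
  have c: "card ?D = Suc m" "card ?D' = Suc m" using card_diagram_partition mu mu' by auto
  have ne: "?D \<noteq> ?D'" using diagram_inj[OF mu mu'] False by blast
  then have ssub: "?D \<subset> ?D \<union> ?D'" "?D \<inter> ?D' \<subset> ?D"
    using card_subset_eq[of "?D" "?D'"] card_subset_eq[of "?D'" "?D"] c by auto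
  have cu: "Suc m < card (?D \<union> ?D')" using psubset_card_mono[OF _ ssub(1)] c by simp
  have ci: "card (?D \<inter> ?D') < Suc m" using psubset_card_mono[OF _ ssub(2)] c by simp
  \<comment> \<open>Hence the union exceeds the two shapes by one box exactly when the intersection
    lacks one.\<close>
  have cc: "card (?D \<union> ?D') + card (?D \<inter> ?D') = Suc m + Suc m"
    using card_Un_Int[of ?D ?D'] c by simp
  show ?thesis
  proof (cases "card (?D \<union> ?D') = Suc (Suc m)")
    case True
    then have i: "card (?D \<inter> ?D') = m" using cc by simp
    obtain la where la: "la \<turnstile>\<^sub>p Suc (Suc m)" "diagram la = ?D \<union> ?D'"
      using young_ex_partition[OF young_Un[OF Y]] True by metis
    obtain ka where ka: "ka \<turnstile>\<^sub>p m" "diagram ka = ?D \<inter> ?D'"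
      using young_ex_partition[OF young_Int[OF Y]] i by metis
    have "{la \<in> parts (Suc (Suc m)). mu \<nearrow> la \<and> mu' \<nearrow> la} = {la}"
    proof (intro equalityI subsetI)
      fix la' assume "la' \<in> {la \<in> parts (Suc (Suc m)). mu \<nearrow> la \<and> mu' \<nearrow> la}"
      then have la': "la' \<turnstile>\<^sub>p Suc (Suc m)" "?D \<union> ?D' \<subseteq> diagram la'" using add_box_subset by auto
      then have "?D \<union> ?D' = diagram la'" using True card_diagram_partition[OF la'(1)]
        by (intro card_subset_eq) auto
      then show "la' \<in> {la}" using diagram_inj[OF la'(1) la(1)] la(2) by simp
    qed (use la mu mu' in \<open>auto simp: add_box_iff\<close>)
    moreover have "{ka \<in> parts m. ka \<nearrow> mu \<and> ka \<nearrow> mu'} = {ka}"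
    proof (intro equalityI subsetI)
      fix ka' assume "ka' \<in> {ka \<in> parts m. ka \<nearrow> mu \<and> ka \<nearrow> mu'}"
      then have ka': "ka' \<turnstile>\<^sub>p m" "diagram ka' \<subseteq> ?D \<inter> ?D'" using add_box_subset by auto
      then have "diagram ka' = ?D \<inter> ?D'" using i card_diagram_partition[OF ka'(1)]
        by (intro card_subset_eq) auto
      then show "ka' \<in> {ka}" using diagram_inj[OF ka'(1) ka(1)] ka(2) by simp
    qed (use ka mu mu' in \<open>auto simp: add_box_iff\<close>)
    ultimately show ?thesis using False by simp
  next
    case neq: False
    have "la \<notin> {la \<in> parts (Suc (Suc m)). mu \<nearrow> la \<and> mu' \<nearrow> la}" for la
    proof
      assume "la \<in> {la \<in> parts (Suc (Suc m)). mu \<nearrow> la \<and> mu' \<nearrow> la}"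
      then have la: "la \<turnstile>\<^sub>p Suc (Suc m)" "?D \<union> ?D' \<subseteq> diagram la" using add_box_subset by auto
      then have "card (?D \<union> ?D') \<le> Suc (Suc m)" using card_mono[OF _ la(2)] card_diagram_partition[OF la(1)] by simp
      then show False using cu neq by simp
    qed
    then have "{la \<in> parts (Suc (Suc m)). mu \<nearrow> la \<and> mu' \<nearrow> la} = {}" by blast
    moreover have "ka \<notin> {ka \<in> parts m. ka \<nearrow> mu \<and> ka \<nearrow> mu'}" for ka
    proof
      assume "ka \<in> {ka \<in> parts m. ka \<nearrow> mu \<and> ka \<nearrow> mu'}"
      then have ka: "ka \<turnstile>\<^sub>p m" "diagram ka \<subseteq> ?D \<inter> ?D'" using add_box_subset by auto
      then have "m \<le> card (?D \<inter> ?D')" using card_mono[OF _ ka(2)] card_diagram_partition[OF ka(1)] by simp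
      then show False using cc cu neq by simp
    qed
    then have "{ka \<in> parts m. ka \<nearrow> mu \<and> ka \<nearrow> mu'} = {}" by blast
    ultimately show ?thesis using False by (simp del: Collect_empty_eq parts_iff)
  qed
qed

section \<open>Counting standard tableaux as paths in the Young graph\<close>

fun num_syt :: "nat \<Rightarrow> nat list \<Rightarrow> nat" where
  "num_syt 0 la = 1"
| "num_syt (Suc m) la = (\<Sum>mu | mu \<in> parts m \<and> mu \<nearrow> la. num_syt m mu)"

lemma parts_0: "parts 0 = {[]}"
proof (intro equalityI subsetI)
  fix la assume "la \<in> parts 0"
  then show "la \<in> {[]}" by (cases la) (auto simp: partition_of_def)
qed (simp add: partition_of_def)

lemma finite_parts_filter [simp]: "finite {la. la \<turnstile>\<^sub>p n \<and> P la}"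
  by (rule finite_subset[OF _ finite_parts[of n]]) auto

lemma sum_if_filter: "finite A \<Longrightarrow> (\<Sum>x\<in>A. if P x then g x else 0) = (\<Sum>x | x \<in> A \<and> P x. g x)"
  by (rule sum.inter_filter[symmetric])

text \<open>In the double sum, common upper covers are exchanged for common lower covers plus one
  diagonal term. The lower covers are summed by the induction hypothesis, and the diagonal term
  raises the factor by one.\<close>

lemma num_syt_up: "mu \<turnstile>\<^sub>p m \<Longrightarrow> (\<Sum>la | la \<in> parts (Suc m) \<and> mu \<nearrow> la. num_syt (Suc m) la) = Suc m * num_syt m mu"
proof (induction m arbitrary: mu)
  case 0
  have mu: "mu = []" using parts_iff[of mu 0] 0 unfolding parts_0 by simp
  have "card {la \<in> parts (Suc 0). mu \<nearrow> la} = 1"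
    using card_up_covers[OF 0] unfolding card_addable by (simp add: mu removable_def row_len_def)
  moreover have "num_syt (Suc 0) la = 1" if "la \<in> parts (Suc 0) \<and> mu \<nearrow> la" for la
  proof -
    have "{mu. mu \<in> parts 0 \<and> mu \<nearrow> la} = {[]}" using that mu unfolding parts_0 by auto
    then show ?thesis unfolding num_syt.simps(2) by simp
  qed
  ultimately show ?case by simp
next
  case (Suc m)
  let ?U = "{la \<in> parts (Suc (Suc m)). mu \<nearrow> la}"
  have "(\<Sum>la\<in>?U. num_syt (Suc (Suc m)) la) = (\<Sum>la\<in>?U. \<Sum>mu'\<in>parts (Suc m). if mu' \<nearrow> la then num_syt (Suc m) mu' else 0)"
    by (intro sum.cong refl) (simp only: sum_if_filter[OF finite_parts] num_syt.simps(2)[of "Suc m"])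
  also have "\<dots> = (\<Sum>mu'\<in>parts (Suc m). \<Sum>la\<in>?U. if mu' \<nearrow> la then num_syt (Suc m) mu' else 0)"
    by (rule sum.swap)
  also have "\<dots> = (\<Sum>mu'\<in>parts (Suc m). num_syt (Suc m) mu' * card {la \<in> parts (Suc (Suc m)). mu \<nearrow> la \<and> mu' \<nearrow> la})"
  proof (rule sum.cong[OF refl])
    fix mu' :: "nat list"
    have "{la \<in> ?U. mu' \<nearrow> la} = {la \<in> parts (Suc (Suc m)). mu \<nearrow> la \<and> mu' \<nearrow> la}" by auto
    then show "(\<Sum>la\<in>?U. if mu' \<nearrow> la then num_syt (Suc m) mu' else 0) =
      num_syt (Suc m) mu' * card {la \<in> parts (Suc (Suc m)). mu \<nearrow> la \<and> mu' \<nearrow> la}"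
      by (subst sum_if_filter) (simp_all del: num_syt.simps add: mult.commute)
  qed
  also have "\<dots> = (\<Sum>mu'\<in>parts (Suc m). num_syt (Suc m) mu' * card {ka \<in> parts m. ka \<nearrow> mu \<and> ka \<nearrow> mu'} +
      (if mu = mu' then num_syt (Suc m) mu' else 0))"
  proof (rule sum.cong[OF refl])
    fix mu' assume "mu' \<in> parts (Suc m)"
    then have mu': "mu' \<turnstile>\<^sub>p Suc m" by simp
    show "num_syt (Suc m) mu' * card {la \<in> parts (Suc (Suc m)). mu \<nearrow> la \<and> mu' \<nearrow> la} =
      num_syt (Suc m) mu' * card {ka \<in> parts m. ka \<nearrow> mu \<and> ka \<nearrow> mu'} +
      (if mu = mu' then num_syt (Suc m) mu' else 0)"
      unfolding card_common_covers[OF Suc.prems mu'] distrib_left by (simp del: num_syt.simps)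
  qed
  also have "\<dots> = (\<Sum>mu'\<in>parts (Suc m). num_syt (Suc m) mu' * card {ka \<in> parts m. ka \<nearrow> mu \<and> ka \<nearrow> mu'}) + num_syt (Suc m) mu"
    using Suc.prems by (simp add: sum.distrib del: num_syt.simps)
  also have "(\<Sum>mu'\<in>parts (Suc m). num_syt (Suc m) mu' * card {ka \<in> parts m. ka \<nearrow> mu \<and> ka \<nearrow> mu'}) =
     (\<Sum>mu'\<in>parts (Suc m). \<Sum>ka\<in>{ka \<in> parts m. ka \<nearrow> mu}. if ka \<nearrow> mu' then num_syt (Suc m) mu' else 0)"
  proof (rule sum.cong[OF refl])
    fix mu' :: "nat list"
    have "{ka \<in> {ka \<in> parts m. ka \<nearrow> mu}. ka \<nearrow> mu'} = {ka \<in> parts m. ka \<nearrow> mu \<and> ka \<nearrow> mu'}" by auto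
    then show "num_syt (Suc m) mu' * card {ka \<in> parts m. ka \<nearrow> mu \<and> ka \<nearrow> mu'} =
      (\<Sum>ka\<in>{ka \<in> parts m. ka \<nearrow> mu}. if ka \<nearrow> mu' then num_syt (Suc m) mu' else 0)"
      by (subst sum_if_filter) (simp_all del: num_syt.simps add: mult.commute)
  qed
  also have "\<dots> = (\<Sum>ka\<in>{ka \<in> parts m. ka \<nearrow> mu}. \<Sum>mu'\<in>parts (Suc m). if ka \<nearrow> mu' then num_syt (Suc m) mu' else 0)"
    by (rule sum.swap)
  also have "\<dots> = (\<Sum>ka\<in>{ka \<in> parts m. ka \<nearrow> mu}. Suc m * num_syt m ka)"
  proof (rule sum.cong[OF refl])
    fix ka assume "ka \<in> {ka \<in> parts m. ka \<nearrow> mu}"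
    then show "(\<Sum>mu'\<in>parts (Suc m). if ka \<nearrow> mu' then num_syt (Suc m) mu' else 0) = Suc m * num_syt m ka"
      unfolding sum_if_filter[OF finite_parts] by (intro Suc.IH) simp
  qed
  also have "\<dots> = Suc m * num_syt (Suc m) mu"
    by (simp add: sum_distrib_left)
  finally show ?case by simp
qed

text \<open>Summing over the edges between two levels, once grouped by the upper and once by the
  lower shape, gives \<open>Suc m\<close> times the sum one level down.\<close>

lemma sum_num_syt_squares: "(\<Sum>la\<in>parts n. (num_syt n la)\<^sup>2) = fact n"
proof (induction n)
  case 0 then show ?case by (simp add: parts_0)
next
  case (Suc m)
  have "(\<Sum>la\<in>parts (Suc m). (num_syt (Suc m) la)\<^sup>2) =
      (\<Sum>la\<in>parts (Suc m). \<Sum>mu\<in>parts m. if mu \<nearrow> la then num_syt m mu * num_syt (Suc m) la else 0)"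
    by (intro sum.cong refl)
       (simp only: power2_eq_square sum_distrib_right sum_if_filter[OF finite_parts] num_syt.simps(2)[of m])
  also have "\<dots> = (\<Sum>mu\<in>parts m. \<Sum>la\<in>parts (Suc m). if mu \<nearrow> la then num_syt m mu * num_syt (Suc m) la else 0)"
    by (rule sum.swap)
  also have "\<dots> = (\<Sum>mu\<in>parts m. num_syt m mu * (\<Sum>la | la \<in> parts (Suc m) \<and> mu \<nearrow> la. num_syt (Suc m) la))"
    by (intro sum.cong refl) (simp only: sum_distrib_left sum_if_filter[OF finite_parts])
  also have "\<dots> = (\<Sum>mu\<in>parts m. Suc m * (num_syt m mu)\<^sup>2)"
  proof (rule sum.cong[OF refl])
    fix mu assume "mu \<in> parts m"
    then show "num_syt m mu * (\<Sum>la | la \<in> parts (Suc m) \<and> mu \<nearrow> la. num_syt (Suc m) la) = Suc m * (num_syt m mu)\<^sup>2"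
      by (subst num_syt_up) (simp_all only: parts_iff power2_eq_square ac_simps)
  qed
  also have "\<dots> = fact (Suc m)" unfolding sum_distrib_left[symmetric] Suc.IH by simp
  finally show ?case .
qed

section \<open>Orthogonality\<close>

lemma ctr_avg_commute:
  assumes "class_fun n x" shows "ctr (avg n y * x) = fact n * ctr (y * x)"
proof -
  have "ctr (\<delta> g * y * \<delta> (inv g) * x) = ctr (y * x)" if g: "g permutes {1..n}" for g
  proof -
    have "ctr (\<delta> g * y * \<delta> (inv g) * x) = ctr (\<delta> g * y * (x * \<delta> (inv g)))"
      using assms g by (simp add: class_fun_def mult.assoc permutes_inv)
    also have "\<dots> = ctr (y * x * \<delta> (inv g) * \<delta> g)"
      by (subst ctr_commute) (simp add: mult.assoc ctr_commute[of "\<delta> g"])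
    also have "\<dots> = ctr (y * x)" using g by (simp add: mult.assoc)
    finally show ?thesis .
  qed
  then have "ctr (avg n y * x) = (\<Sum>g\<in>Sym n. ctr (y * x))"
    unfolding avg_def sum_distrib_right coef_sum by (intro sum.cong) auto
  then show ?thesis by (simp add: card_Sym)
qed

lemma class_fun_mult_avg:
  assumes "class_fun n x" shows "x * avg n y = avg n (x * y)"
proof -
  have "x * (\<delta> g * y * \<delta> (inv g)) = \<delta> g * (x * y) * \<delta> (inv g)" if "g \<in> Sym n" for g
    using assms that by (simp add: class_fun_def mult.assoc[symmetric])
  then show ?thesis unfolding avg_def sum_distrib_left by (intro sum.cong) auto
qed

lemma sum_list_partition: "la \<turnstile>\<^sub>p n \<Longrightarrow> sum_list la = n"
  by (simp add: partition_of_def)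

lemma chi_eq_avg: "la \<turnstile>\<^sub>p n \<Longrightarrow> chi la = avg n (yidem la)"
  by (simp add: chi_def sum_list_partition)

lemma ctr_yidem_nonzero: "la \<turnstile>\<^sub>p n \<Longrightarrow> ctr (yidem la) \<noteq> 0"
  using ctr_row_col[OF tableau_box_of[of la]] yscal_nonzero[of la n]
  by (simp add: yidem_def ysym_def)

text \<open>The value at the identity is the rank of right multiplication by the idempotent, which
  is not 0.\<close>

lemma chi_dim_ex:
  assumes la: "la \<turnstile>\<^sub>p n" shows "\<exists>k::nat. ctr (chi la) = of_nat k \<and> k > 0"
proof -
  obtain k :: nat where k: "ctr (1 * avg n (yidem la)) = of_nat k"
    "k = 0 \<longrightarrow> (\<forall>x. supp_in n x \<longrightarrow> 1 * x * yidem la = 0)"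
    using trace_idempotents[of n 1 "yidem la"] supp_in_yidem[OF la] yidem_idem[OF la] by auto
  have "k \<noteq> 0"
  proof
    assume "k = 0"
    with k(2) have "1 * 1 * yidem la = 0" by blast
    then show False using ctr_yidem_nonzero[OF la] by simp
  qed
  then show ?thesis using k(1) by (auto simp: chi_eq_avg[OF la])
qed

text \<open>The dimension as a natural number, recovered from a complex coefficient.\<close>

definition fdim :: "nat list \<Rightarrow> nat" where
  "fdim la = (SOME k. ctr (chi la) = of_nat k \<and> k > 0)"

lemma fdim: "la \<turnstile>\<^sub>p n \<Longrightarrow> ctr (chi la) = of_nat (fdim la)" "la \<turnstile>\<^sub>p n \<Longrightarrow> fdim la > 0"
  using someI_ex[OF chi_dim_ex[of la n]] unfolding fdim_def by auto

text \<open>The trace of \<open>x \<mapsto> e x e\<close>, a projection onto the line spanned by the Young idempotent \<open>e\<close>.\<close>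

lemma ctr_yidem_chi: assumes la: "la \<turnstile>\<^sub>p n" shows "ctr (yidem la * chi la) = 1"
proof -
  let ?e = "yidem la"
  obtain f where f: "?e * x * ?e = f x \<cdot>\<^sub>g ?e" if "supp_in n x" for x
    using yidem_sandwich[OF la] by metis
  have e0: "?e \<noteq> 0" using ctr_yidem_nonzero[OF la] by auto
  have "ctr (?e * chi la) = (\<Sum>g\<in>Sym n. coef (?e * \<delta> g * ?e) g)"
    by (simp add: chi_eq_avg[OF la] sum_coef_sandwich)
  also have "\<dots> = (\<Sum>g\<in>Sym n. f (\<delta> g) * coef ?e g)"
    by (intro sum.cong refl) (simp add: f)
  finally have eq: "ctr (?e * chi la) = (\<Sum>g\<in>Sym n. f (\<delta> g) * coef ?e g)" .
  have "?e = ?e * ?e * ?e" by (simp add: yidem_idem[OF la])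
  also have "\<dots> = ?e * (\<Sum>g\<in>Sym n. coef ?e g \<cdot>\<^sub>g \<delta> g) * ?e"
    by (simp only: galg_expand[OF supp_in_yidem[OF la], symmetric])
  also have "\<dots> = (\<Sum>g\<in>Sym n. coef ?e g \<cdot>\<^sub>g (?e * \<delta> g * ?e))"
    by (simp add: sum_distrib_left sum_distrib_right)
  also have "\<dots> = (\<Sum>g\<in>Sym n. (f (\<delta> g) * coef ?e g) \<cdot>\<^sub>g ?e)"
    by (intro sum.cong refl) (simp add: f mult.commute)
  also have "\<dots> = ctr (?e * chi la) \<cdot>\<^sub>g ?e"
    unfolding eq gscale_sum ..
  finally have "ctr ?e = ctr (ctr (?e * chi la) \<cdot>\<^sub>g ?e)" by (rule arg_cong)
  then show ?thesis using ctr_yidem_nonzero[OF la] by simp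
qed

text \<open>Schur's lemma in this setting: a central element acts on the primitive idempotent by a
  scalar, and by the same scalar on all its conjugates, hence on \<open>chi la\<close>.\<close>

lemma class_fun_yidem:
  assumes la: "la \<turnstile>\<^sub>p n" and x: "class_fun n x"
  obtains c where "x * yidem la = c \<cdot>\<^sub>g yidem la" "x * chi la = c \<cdot>\<^sub>g chi la"
proof -
  let ?e = "yidem la"
  have xs: "supp_in n x" using x by (simp add: class_fun_def)
  obtain c where c: "?e * x * ?e = c \<cdot>\<^sub>g ?e" using yidem_sandwich[OF la xs] by blast
  have 1: "x * ?e = c \<cdot>\<^sub>g ?e"
    using c class_fun_commute[OF x supp_in_yidem[OF la]] yidem_idem[OF la] by (metis mult.assoc)
  then have "x * chi la = c \<cdot>\<^sub>g chi la"
    by (simp add: chi_eq_avg[OF la] class_fun_mult_avg[OF x] avg_gscale)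
  with 1 show thesis by (rule that)
qed

lemma class_fun_chi_scalar:
  assumes la: "la \<turnstile>\<^sub>p n" and x: "class_fun n x"
  shows "x * chi la = (ctr (x * chi la) / of_nat (fdim la)) \<cdot>\<^sub>g chi la"
proof -
  obtain c where 1: "x * chi la = c \<cdot>\<^sub>g chi la" using class_fun_yidem[OF la x] by blast
  then have "ctr (x * chi la) = c * of_nat (fdim la)"
    using fdim(1)[OF la] by simp
  then have c: "c = ctr (x * chi la) / of_nat (fdim la)" using fdim(2)[OF la] by simp
  show ?thesis by (subst c[symmetric]) (rule 1)
qed

text \<open>The scalar is read off at the identity: one factor is a sum of \<open>fact n\<close>
  conjugates of the idempotent, each of which has trace 1 against the other factor.\<close>

lemma chi_square: assumes la: "la \<turnstile>\<^sub>p n" shows "chi la * chi la = (fact n / of_nat (fdim la)) \<cdot>\<^sub>g chi la"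
proof -
  have "ctr (chi la * chi la) = fact n * ctr (yidem la * chi la)"
    using ctr_avg_commute[OF class_fun_chi[OF la], of "yidem la"] by (simp add: chi_eq_avg[OF la])
  then have "ctr (chi la * chi la) = fact n" by (simp add: ctr_yidem_chi[OF la])
  then show ?thesis using class_fun_chi_scalar[OF la class_fun_chi[OF la]] by simp
qed

lemma rows_below_row_len: "rows_below (diagram la) (Suc k) = rows_below (diagram la) k + row_len la k"
proof -
  have "{b \<in> diagram la. fst b < Suc k} = {b \<in> diagram la. fst b < k} \<union> Pair k ` {..<row_len la k}"
    by (auto simp: diagram_iff less_Suc_eq)
  then show ?thesis unfolding rows_below_def
    by (simp only:) (subst card_Un_disjoint, auto simp: card_image inj_on_def)
qed

lemma rows_below_inj:
  assumes "la \<turnstile>\<^sub>p n" "la' \<turnstile>\<^sub>p n'" "\<And>k. rows_below (diagram la) k = rows_below (diagram la') k"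
  shows "la = la'"
  using rows_below_row_len[of la] rows_below_row_len[of la'] assms
  by (intro partition_eqI[OF assms(1,2)]) (metis add_left_cancel)

text \<open>Between the two idempotents stands a column sum, an arbitrary element and a row sum of
  the other shape, which vanishes without dominance.\<close>

lemma chi_orthogonal_aux:
  assumes la: "la \<turnstile>\<^sub>p n" and la': "la' \<turnstile>\<^sub>p n"
    and "\<not> (\<forall>k. rows_below (diagram la') k \<le> rows_below (diagram la) k)"
  shows "chi la * chi la' = 0"
proof -
  have z: "yidem la * x * yidem la' = 0" if "supp_in n x" for x
  proof -
    have "col_sum n (col_of la) * x * row_sum n (row_of la') = 0"
      using col_row_zero[OF young_diagram[OF la] _ _ assms(3) that, of "row_of la" "col_of la" "row_of la'" "col_of la'"]
        tableau_box_of[of la] tableau_box_of[of la'] sum_list_partition[OF la] sum_list_partition[OF la'] by simp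
    moreover have "ysym la * x * ysym la' = row_sum n (row_of la) *
        (col_sum n (col_of la) * x * row_sum n (row_of la')) * col_sum n (col_of la')"
      by (simp only: ysym_def sum_list_partition[OF la] sum_list_partition[OF la'] mult.assoc)
    ultimately have "ysym la * x * ysym la' = 0" by simp
    then show ?thesis by (simp add: yidem_def)
  qed
  have "yidem la * chi la' = 0"
  proof -
    have "yidem la * (\<delta> g * yidem la' * \<delta> (inv g)) = 0" if "g \<in> Sym n" for g
      using z[of "\<delta> g"] that by (simp add: mult.assoc[symmetric])
    then show ?thesis unfolding chi_eq_avg[OF la'] avg_def sum_distrib_left by (intro sum.neutral) auto
  qed
  then have "chi la' * yidem la = 0"
    using class_fun_commute[OF class_fun_chi[OF la'] supp_in_yidem[OF la]] by simp
  then have "chi la' * chi la = 0"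
    unfolding chi_eq_avg[OF la] class_fun_mult_avg[OF class_fun_chi[OF la']] by (simp add: avg_def)
  then show ?thesis
    using class_fun_commute[OF class_fun_chi[OF la'] supp_in_chi[OF la]] by simp
qed

text \<open>Dominance is antisymmetric, so for distinct shapes it fails in at least one direction;
  the factors commute.\<close>

lemma chi_orthogonal:
  assumes la: "la \<turnstile>\<^sub>p n" and la': "la' \<turnstile>\<^sub>p n" and "la \<noteq> la'"
  shows "chi la * chi la' = 0"
proof -
  have "\<exists>k. rows_below (diagram la) k \<noteq> rows_below (diagram la') k"
    using rows_below_inj[OF la la'] assms(3) by blast
  then consider "\<not> (\<forall>k. rows_below (diagram la') k \<le> rows_below (diagram la) k)"
    | "\<not> (\<forall>k. rows_below (diagram la) k \<le> rows_below (diagram la') k)"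
    by (meson le_antisym)
  then show ?thesis
  proof cases
    case 1 then show ?thesis using chi_orthogonal_aux[OF la la'] by blast
  next
    case 2
    then have "chi la' * chi la = 0" using chi_orthogonal_aux[OF la' la] by blast
    then show ?thesis using class_fun_commute[OF class_fun_chi[OF la'] supp_in_chi[OF la]] by simp
  qed
qed

section \<open>Central idempotents and Bessel's inequality\<close>

definition cidem :: "nat list \<Rightarrow> galg" where
  "cidem la = (of_nat (fdim la) / fact (sum_list la)) \<cdot>\<^sub>g chi la"

lemma cidem_eq: "la \<turnstile>\<^sub>p n \<Longrightarrow> cidem la = (of_nat (fdim la) / fact n) \<cdot>\<^sub>g chi la"
  by (simp add: cidem_def sum_list_partition)

lemma class_fun_gscale: "class_fun n x \<Longrightarrow> class_fun n (a \<cdot>\<^sub>g x)"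
  by (auto simp: class_fun_def)

lemma class_fun_cidem: "la \<turnstile>\<^sub>p n \<Longrightarrow> class_fun n (cidem la)"
  unfolding cidem_def by (intro class_fun_gscale class_fun_chi)

lemma supp_in_cidem: "la \<turnstile>\<^sub>p n \<Longrightarrow> supp_in n (cidem la)"
  using class_fun_cidem by (simp add: class_fun_def)

lemma real_cidem: "real_galg (cidem la)"
  unfolding cidem_def by (intro real_galg_simps real_chi Reals_divide Reals_of_nat fact_in_Reals)

lemma star_cidem: "la \<turnstile>\<^sub>p n \<Longrightarrow> star (cidem la) = cidem la"
  by (simp add: cidem_def star_linear star_chi)

lemma chi_cidem: "la \<turnstile>\<^sub>p n \<Longrightarrow> chi la * cidem la = chi la"
  using fdim(2)[of la n] by (simp add: cidem_eq chi_square)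

lemma chi_cidem_ne: "la \<turnstile>\<^sub>p n \<Longrightarrow> la' \<turnstile>\<^sub>p n \<Longrightarrow> la \<noteq> la' \<Longrightarrow> chi la * cidem la' = 0"
  by (simp add: cidem_eq chi_orthogonal)

lemma cidem_mult: "la \<turnstile>\<^sub>p n \<Longrightarrow> la' \<turnstile>\<^sub>p n \<Longrightarrow> cidem la * cidem la' = (if la = la' then cidem la else 0)"
proof -
  assume la: "la \<turnstile>\<^sub>p n" and la': "la' \<turnstile>\<^sub>p n"
  have "cidem la * cidem la' = (of_nat (fdim la) / fact n) \<cdot>\<^sub>g (chi la * cidem la')"
    by (simp add: cidem_eq[OF la])
  then show ?thesis
    using chi_cidem[OF la] chi_cidem_ne[OF la la'] cidem_eq[OF la] by (cases "la = la'") simp_all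
qed

lemma ctr_cidem: "la \<turnstile>\<^sub>p n \<Longrightarrow> ctr (cidem la) = (of_nat (fdim la))\<^sup>2 / fact n"
  using fdim(1)[of la n] by (simp add: cidem_eq power2_eq_square)

text \<open>Here \<open>x = x * star x\<close>, so the trace of \<open>x\<close> is a squared
  norm.\<close>

lemma real_star_idem_ctr:
  assumes "supp_in n x" "real_galg x" "star x = x" "x * x = x"
  shows "Re (ctr x) \<ge> 0" "ctr x = 0 \<longleftrightarrow> x = 0"
  using ctr_mult_star_real(2,3)[OF assms(1,2)] assms(3,4) by auto

text \<open>The complement of orthogonal self-adjoint idempotents is again a self-adjoint
  idempotent. Its trace is nonnegative and vanishes only if the idempotents exhaust the
  identity.\<close>

lemma one_minus_cidems:
  defines "d n \<equiv> 1 - (\<Sum>la\<in>parts n. cidem la)"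
  shows "Re (ctr (d n)) \<ge> 0" "ctr (d n) = 0 \<Longrightarrow> (\<Sum>la\<in>parts n. cidem la) = 1"
proof -
  let ?s = "\<Sum>la\<in>parts n. cidem la"
  have "?s * ?s = (\<Sum>la\<in>parts n. \<Sum>la'\<in>parts n. cidem la * cidem la')"
    by (simp add: sum_distrib_left sum_distrib_right) (rule sum.swap)
  also have "\<dots> = (\<Sum>la\<in>parts n. \<Sum>la'\<in>parts n. if la = la' then cidem la else 0)"
    by (intro sum.cong refl) (auto simp: cidem_mult)
  also have "\<dots> = ?s" by simp
  finally have "d n * d n = d n" by (simp add: d_def algebra_simps)
  moreover have "supp_in n (d n)" unfolding d_def by (intro supp_in_intros supp_in_sum supp_in_cidem) simp
  moreover have "real_galg (d n)" unfolding d_def by (intro real_galg_simps real_galg_sum real_cidem)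
  moreover have "star (d n) = d n"
  proof -
    have "star 1 = 1" using star_delta[of id 0] by simp
    moreover have "star ?s = ?s" unfolding star_sum by (intro sum.cong refl star_cidem) simp
    moreover have "star (x - y) = star x - star y" for x y
      by transfer auto
    ultimately show ?thesis by (simp add: d_def)
  qed
  ultimately show "Re (ctr (d n)) \<ge> 0" "ctr (d n) = 0 \<Longrightarrow> ?s = 1"
    using real_star_idem_ctr[of n "d n"] by (auto simp: d_def)
qed

lemma ctr_one_minus_cidems:
  "ctr (1 - (\<Sum>la\<in>parts n. cidem la)) = of_real (1 - real (\<Sum>la\<in>parts n. (fdim la)\<^sup>2) / fact n)"
proof -
  have "(\<Sum>la\<in>parts n. ctr (cidem la)) = (\<Sum>la\<in>parts n. (of_nat (fdim la))\<^sup>2 / fact n)"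
    by (intro sum.cong refl ctr_cidem) simp
  also have "\<dots> = of_nat (\<Sum>la\<in>parts n. (fdim la)\<^sup>2) / fact n"
    by (simp add: sum_divide_distrib)
  finally show ?thesis by simp
qed

text \<open>Bessel's inequality: the traces of the central idempotents add up to at most the trace
  of the identity.\<close>

lemma sum_fdim_squares_le: "(\<Sum>la\<in>parts n. (fdim la)\<^sup>2) \<le> fact n"
proof -
  have "0 \<le> 1 - real (\<Sum>la\<in>parts n. (fdim la)\<^sup>2) / fact n"
    using one_minus_cidems(1)[of n] unfolding ctr_one_minus_cidems Re_complex_of_real .
  then have "real (\<Sum>la\<in>parts n. (fdim la)\<^sup>2) \<le> real (fact n)" by (simp add: field_simps)
  then show ?thesis by (simp only: of_nat_le_iff)
qed

lemma cidem_complete_if: "(\<Sum>la\<in>parts n. (fdim la)\<^sup>2) = fact n \<Longrightarrow> (\<Sum>la\<in>parts n. cidem la) = 1"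
  by (rule one_minus_cidems(2)) (simp only: ctr_one_minus_cidems, simp)

section \<open>Branching\<close>

lift_definition restr :: "nat \<Rightarrow> galg \<Rightarrow> galg" is "\<lambda>m f w. if w permutes {1..m} then f w else 0"
  by auto

lemma coef_restr: "coef (restr m x) w = (if w permutes {1..m} then coef x w else 0)"
  by transfer simp

lemma supp_in_restr [simp, intro]: "supp_in m (restr m x)"
  by (simp add: supp_in_def coef_restr)

lemma restr_linear: "restr m (x + y) = restr m x + restr m y" "restr m (a \<cdot>\<^sub>g x) = a \<cdot>\<^sub>g restr m x"
  "restr m 0 = 0"
  by (auto intro!: galg_eqI simp: coef_restr)

lemma restr_sum: "restr m (\<Sum>i\<in>I. f i) = (\<Sum>i\<in>I. restr m (f i))"
  by (auto intro!: galg_eqI simp: coef_restr)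

lemma ctr_restr [simp]: "ctr (restr m x) = ctr x"
  by (simp add: coef_restr permutes_id)

lemma Sym_comp_iff: "u permutes {1..m} \<Longrightarrow> w \<circ> u permutes {1..m} \<longleftrightarrow> w permutes {1..m}"
  by (metis Sym_comp_cancel(1) permutes_compose permutes_inv)

text \<open>Restriction behaves as a conditional expectation. Since it also preserves
  \<open>ctr\<close>, traces against elements of S(m) may be computed inside S(m).\<close>

lemma restr_mult_right: assumes "supp_in m y" shows "restr m (x * y) = restr m x * y"
proof -
  have "restr m (x * \<delta> u) = restr m x * \<delta> u" if "u permutes {1..m}" for u
    by (rule galg_eqI) (use that in \<open>simp add: coef_restr coef_mult_delta Sym_comp_iff[OF permutes_inv]\<close>)
  then show ?thesis
    by (subst (1 2) galg_expand[OF assms]) (simp add: sum_distrib_left restr_sum restr_linear)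
qed

lemma restr_id: "supp_in m x \<Longrightarrow> restr m x = x"
  by (rule supp_in_eqI[of m]) (auto simp: coef_restr)

lemma class_fun_restr: "class_fun n x \<Longrightarrow> m \<le> n \<Longrightarrow> class_fun m (restr m x)"
  unfolding class_fun_iff
  by (auto simp: coef_restr intro!: permutes_compose permutes_inv dest: Sym_mono[of _ m n])

section \<open>Conjugate tableaux and the multiplicities in a restriction\<close>

lemma stab_cong: "(\<And>x. x \<in> {1..n} \<Longrightarrow> f x = g x) \<Longrightarrow> stab n f = stab n g"
  unfolding stab_def using permutes_in_image by fastforce

lemma bij_betw_stab_comp:
  assumes "g permutes {1..n}"
  shows "bij_betw (\<lambda>p. inv g \<circ> p \<circ> g) (stab n f) (stab n (f \<circ> g))"
proof (rule bij_betw_byWitness[of _ "\<lambda>p. g \<circ> p \<circ> inv g"])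
  show "(\<lambda>p. inv g \<circ> p \<circ> g) ` stab n f \<subseteq> stab n (f \<circ> g)"
    using assms permutes_in_image[OF assms]
    by (auto simp: stab_def permutes_inverses intro!: permutes_compose permutes_inv)
  show "(\<lambda>p. g \<circ> p \<circ> inv g) ` stab n (f \<circ> g) \<subseteq> stab n f"
    using assms permutes_in_image[OF permutes_inv[OF assms]]
    by (auto simp: stab_def permutes_inverses intro!: permutes_compose permutes_inv)
qed (use assms in \<open>auto simp: Sym_inv_comp permutes_inv_o o_assoc[symmetric]\<close>)

lemma delta_conj:
  "g permutes {1..n} \<Longrightarrow> p permutes {1..n} \<Longrightarrow> \<delta> (inv g \<circ> p \<circ> g) = \<delta> (inv g) * \<delta> p * \<delta> g"
  by (simp add: delta_mult[of _ n] permutes_inv permutes_compose)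

lemma row_sum_comp: "g permutes {1..n} \<Longrightarrow> row_sum n (f \<circ> g) = \<delta> (inv g) * row_sum n f * \<delta> g"
  unfolding row_sum_def sum_distrib_left sum_distrib_right
  by (subst sum.reindex_bij_betw[OF bij_betw_stab_comp, symmetric])
     (auto intro!: sum.cong delta_conj dest: stabD)

lemma sign_conj: "g permutes {1..n::nat} \<Longrightarrow> p permutes {1..n} \<Longrightarrow> sign (inv g \<circ> p \<circ> g) = sign p"
  by (simp add: Sym_sign_comp[of _ n] permutes_inv permutes_compose sign_inv_Sym)

lemma col_sum_comp: "g permutes {1..n} \<Longrightarrow> col_sum n (f \<circ> g) = \<delta> (inv g) * col_sum n f * \<delta> g"
  unfolding col_sum_def sum_distrib_left sum_distrib_right
  by (subst sum.reindex_bij_betw[OF bij_betw_stab_comp, symmetric])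
     (auto intro!: sum.cong simp: delta_conj sign_conj dest!: stabD)

lemma tableaux_conj:
  assumes "tableau n D r c" "tableau n D r' c'"
  obtains g where "g permutes {1..n}" "\<And>x. x \<in> {1..n} \<Longrightarrow> r (g x) = r' x" "\<And>x. x \<in> {1..n} \<Longrightarrow> c (g x) = c' x"
proof -
  define T where "T = (\<lambda>x. (r x, c x))"
  define T' where "T' = (\<lambda>x. (r' x, c' x))"
  have T: "bij_betw T {1..n} D" "bij_betw T' {1..n} D"
    using assms by (simp_all add: tableau_def T_def T'_def)
  define g where "g = (\<lambda>x. if x \<in> {1..n} then inv_into {1..n} T (T' x) else x)"
  have "bij_betw (inv_into {1..n} T \<circ> T') {1..n} {1..n}"
    using T by (blast intro: bij_betw_trans bij_betw_inv_into)
  then have "bij_betw g {1..n} {1..n}"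
    by (rule bij_betw_cong[THEN iffD1, rotated]) (auto simp: g_def)
  then have g: "g permutes {1..n}"
    by (rule bij_imp_permutes) (auto simp: g_def)
  have "T (g x) = T' x" if x: "x \<in> {1..n}" for x
  proof -
    have "T' x \<in> D" using T(2) x by (rule bij_betwE[rule_format])
    then show ?thesis using x bij_betw_inv_into_right[OF T(1)] by (simp add: g_def)
  qed
  then have "\<And>x. x \<in> {1..n} \<Longrightarrow> r (g x) = r' x" "\<And>x. x \<in> {1..n} \<Longrightarrow> c (g x) = c' x"
    unfolding T_def T'_def by simp_all
  with g show thesis by (rule that)
qed

text \<open>With \<open>a\<^sub>\<mu>, b\<^sub>\<mu>\<close> the row and column sums of a tableau of shape \<open>\<mu>\<close> and \<open>a, b\<close> those of an
  extension of it by one box: \<open>b (b\<^sub>\<mu> a\<^sub>\<mu> a b)\<close> is a nonzero multiple of \<open>b a b \<noteq> 0\<close>.\<close>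

lemma branching_nonzero:
  assumes mu: "mu \<turnstile>\<^sub>p m" and la: "la \<turnstile>\<^sub>p Suc m" and cov: "mu \<nearrow> la"
  shows "\<exists>x. supp_in (Suc m) x \<and> star (yidem mu) * x * yidem la \<noteq> 0"
proof -
  let ?n = "Suc m"
  let ?b = "new_box la mu"
  \<comment> \<open>The tableau of \<open>mu\<close>, extended by the largest entry in the new
    box.\<close>
  define r where "r = (\<lambda>x. if x = ?n then fst ?b else row_of mu x)"
  define c where "c = (\<lambda>x. if x = ?n then snd ?b else col_of mu x)"
  have tmu: "tableau m (diagram mu) (row_of mu) (col_of mu)"
    using tableau_box_of[of mu] sum_list_partition[OF mu] by simp
  have "bij_betw (\<lambda>x. (r x, c x)) {1..m} (diagram mu)"
    using tmu unfolding tableau_def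
    by (rule bij_betw_cong[THEN iffD1, rotated]) (auto simp: r_def c_def)
  moreover have "bij_betw (\<lambda>x. (r x, c x)) {?n} {?b}" by (simp add: bij_betw_def r_def c_def)
  ultimately have "bij_betw (\<lambda>x. (r x, c x)) ({1..m} \<union> {?n}) (diagram mu \<union> {?b})"
    using new_box(1)[OF cov] by (intro bij_betw_combine) auto
  moreover have "{1..m} \<union> {?n} = {1..?n}" by auto
  ultimately have t: "tableau ?n (diagram la) r c" using new_box(2)[OF cov] by (simp add: tableau_def)
  have sub: "stab m (row_of mu) \<subseteq> stab ?n r" "stab m (col_of mu) \<subseteq> stab ?n c"
  proof -
    have *: "stab m f \<subseteq> stab ?n g" if "\<And>x. x \<in> {1..m} \<Longrightarrow> g x = f x" for f g :: "nat \<Rightarrow> nat"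
    proof
      fix p assume p: "p \<in> stab m f"
      then have pp: "p permutes {1..m}" "\<And>x. x \<in> {1..m} \<Longrightarrow> f (p x) = f x" by (auto simp: stab_def)
      have "g (p x) = g x" if "x \<in> {1..?n}" for x
      proof (cases "x = ?n")
        case True then show ?thesis using pp(1) by (simp add: permutes_def)
      next
        case False
        then have "x \<in> {1..m}" using that by auto
        then show ?thesis using pp(2) permutes_in_image[OF pp(1)] \<open>\<And>x. x \<in> {1..m} \<Longrightarrow> g x = f x\<close> by simp
      qed
      then show "p \<in> stab ?n g" using Sym_mono[OF pp(1), of ?n] by (simp add: stab_def)
    qed
    show "stab m (row_of mu) \<subseteq> stab ?n r" by (rule *) (simp add: r_def)
    show "stab m (col_of mu) \<subseteq> stab ?n c" by (rule *) (simp add: c_def)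
  qed
  define a b where "a = row_sum ?n r" and "b = col_sum ?n c"
  define am bm where "am = row_sum m (row_of mu)" and "bm = col_sum m (col_of mu)"
  define A B where "A = (of_nat (card (stab m (row_of mu))) :: complex)" and "B = (of_nat (card (stab m (col_of mu))) :: complex)"
  have AB: "A \<noteq> 0" "B \<noteq> 0" using card_stab_pos[THEN less_imp_neq, THEN not_sym]
    unfolding A_def B_def of_nat_eq_0_iff by blast+
  have ama: "am * a = A \<cdot>\<^sub>g a" unfolding am_def a_def A_def by (rule row_sum_mult_sub[OF sub(1)])
  have bbm: "b * bm = B \<cdot>\<^sub>g b" unfolding bm_def b_def B_def by (rule col_sum_mult_sub[OF sub(2)])
  \<comment> \<open>The extended tableau need not be filled row by row, so its symmetrizer is only a
    conjugate of \<open>ysym la\<close>. The conjugating permutation also provides the witness for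
    \<open>x\<close>.\<close>
  obtain g where g: "g permutes {1..?n}" "\<And>x. x \<in> {1..?n} \<Longrightarrow> row_of la (g x) = r x"
    "\<And>x. x \<in> {1..?n} \<Longrightarrow> col_of la (g x) = c x"
    using tableaux_conj[OF _ t, of "row_of la" "col_of la"] tableau_box_of[of la] sum_list_partition[OF la] by metis
  have "a = row_sum ?n (row_of la \<circ> g)" unfolding a_def row_sum_def
    by (subst stab_cong[of ?n r "row_of la \<circ> g"]) (use g(2) in auto)
  then have a: "a = \<delta> (inv g) * row_sum ?n (row_of la) * \<delta> g" by (simp add: row_sum_comp[OF g(1)])
  have "b = col_sum ?n (col_of la \<circ> g)" unfolding b_def col_sum_def
    by (subst stab_cong[of ?n c "col_of la \<circ> g"]) (use g(3) in auto)
  then have b: "b = \<delta> (inv g) * col_sum ?n (col_of la) * \<delta> g" by (simp add: col_sum_comp[OF g(1)])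
  have y: "ysym la = row_sum ?n (row_of la) * col_sum ?n (col_of la)"
    by (simp add: ysym_def sum_list_partition[OF la])
  have gg: "\<delta> g * (\<delta> (inv g) * z) = z" "\<delta> (inv g) * (\<delta> g * z) = z" for z
    using g(1) by (simp_all add: mult.assoc[symmetric])
  have ab: "a * b = \<delta> (inv g) * ysym la * \<delta> g"
    by (simp add: a b y mult.assoc gg)
  have abab: "a * b * (a * b) = yscal la \<cdot>\<^sub>g (a * b)"
  proof -
    have "a * b * (a * b) = \<delta> (inv g) * (ysym la * ysym la) * \<delta> g" by (simp add: ab mult.assoc gg)
    then show ?thesis by (simp add: ysym_square[OF la] ab)
  qed
  have "a * b \<noteq> 0" using ctr_row_col[OF t] by (auto simp: a_def b_def)
  then have "a * b * (a * b) \<noteq> 0"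
    using yscal_nonzero[OF la] unfolding abab by (metis gscale_simps(1,2,4) left_inverse)
  then have bab: "b * (a * b) \<noteq> 0" by (auto simp: mult.assoc)
  have "b * (bm * am * (a * b)) = (b * bm) * (am * a) * b" by (simp add: mult.assoc)
  also have "\<dots> = (B * A) \<cdot>\<^sub>g (b * (a * b))" by (simp add: ama bbm mult.assoc mult.commute[of A])
  finally have "b * (bm * am * (a * b)) \<noteq> 0"
    using AB bab by (metis gscale_simps(1,2,4) left_inverse mult_eq_0_iff)
  then have nz: "bm * am * (a * b) \<noteq> 0" by auto
  have "star (yidem mu) * \<delta> (inv g) * yidem la * \<delta> g = (inverse (yscal mu) * inverse (yscal la)) \<cdot>\<^sub>g (bm * am * (a * b))"
    unfolding ab by (simp add: yidem_def ysym_def star_linear star_mult star_row_sum star_col_sum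
        sum_list_partition[OF mu] am_def bm_def mult.assoc mult.commute[of "inverse (yscal la)" "inverse (yscal mu)"])
  moreover have "inverse (yscal mu) * inverse (yscal la) \<noteq> 0"
    using yscal_nonzero[OF mu] yscal_nonzero[OF la] by simp
  ultimately have "star (yidem mu) * \<delta> (inv g) * yidem la * \<delta> g \<noteq> 0"
    using nz by (metis gscale_simps(1,2,4) left_inverse)
  then have "star (yidem mu) * \<delta> (inv g) * yidem la \<noteq> 0" by auto
  then show ?thesis using g(1) by (intro exI[of _ "\<delta> (inv g)"]) (auto intro: permutes_inv)
qed

text \<open>\<open>k\<close> is the multiplicity of \<open>\<chi>\<^sup>\<mu>\<close> in the restriction of \<open>\<chi>\<^sup>\<lambda>\<close>.\<close>

lemma branching_mult_ex:
  assumes mu: "mu \<turnstile>\<^sub>p m" and la: "la \<turnstile>\<^sub>p Suc m"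
  shows "\<exists>k::nat. ctr (chi la * chi mu) = of_nat k * fact m \<and> (mu \<nearrow> la \<longrightarrow> k > 0)"
proof -
  \<comment> \<open>The starred idempotent has the column sum on the left, the order that
    \<open>branching_nonzero\<close> provides; its average is still \<open>chi mu\<close>.\<close>
  let ?e = "star (yidem mu)"
  have e: "supp_in m ?e" "?e * ?e = ?e"
    using supp_in_yidem[OF mu] yidem_idem[OF mu] star_mult[of "yidem mu" "yidem mu"] by auto
  have e': "supp_in (Suc m) ?e" by (rule supp_in_mono[OF e(1)]) simp
  obtain k :: nat where k: "ctr (?e * avg (Suc m) (yidem la)) = of_nat k"
    "k = 0 \<longrightarrow> (\<forall>x. supp_in (Suc m) x \<longrightarrow> ?e * x * yidem la = 0)"
    using trace_idempotents[OF e' supp_in_yidem[OF la] e(2) yidem_idem[OF la]] by metis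
  have kpos: "mu \<nearrow> la \<longrightarrow> k > 0"
    using k(2) branching_nonzero[OF mu la] by blast
  have cl: "class_fun m (restr m (chi la))"
    by (rule class_fun_restr[OF class_fun_chi[OF la]]) simp
  have "ctr (chi la * chi mu) = ctr (restr m (chi la) * avg m ?e)"
    unfolding restr_mult_right[OF supp_in_avg[OF e(1)], symmetric]
    by (simp add: avg_star_yidem[OF mu] chi_eq_avg[OF mu])
  also have "\<dots> = fact m * ctr (?e * restr m (chi la))"
    using ctr_avg_commute[OF cl, of ?e] by (subst ctr_commute)
  also have "ctr (?e * restr m (chi la)) = ctr (restr m (chi la * ?e))"
    unfolding restr_mult_right[OF e(1)] by (rule ctr_commute)
  also have "\<dots> = ctr (?e * chi la)" by (simp add: ctr_commute[of ?e])
  also have "\<dots> = of_nat k" using k(1) by (simp add: chi_eq_avg[OF la])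
  finally have "ctr (chi la * chi mu) = of_nat k * fact m" by (simp only: mult.commute)
  then show ?thesis using kpos by blast
qed

text \<open>Fourier expansion of a class function. Completeness is a hypothesis because it is itself
  established by induction on the rank.\<close>

lemma class_fun_expand:
  assumes compl: "(\<Sum>mu\<in>parts m. cidem mu) = 1" and x: "class_fun m x"
  shows "x = (\<Sum>mu\<in>parts m. (ctr (x * chi mu) / fact m) \<cdot>\<^sub>g chi mu)"
proof -
  have "x = x * (\<Sum>mu\<in>parts m. cidem mu)" by (simp add: compl)
  also have "\<dots> = (\<Sum>mu\<in>parts m. (ctr (x * chi mu) / fact m) \<cdot>\<^sub>g chi mu)"
    unfolding sum_distrib_left
  proof (rule sum.cong[OF refl])
    fix mu assume "mu \<in> parts m"
    then have mu: "mu \<turnstile>\<^sub>p m" by simp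
    have "x * cidem mu = (of_nat (fdim mu) / fact m) \<cdot>\<^sub>g (x * chi mu)" by (simp add: cidem_eq[OF mu])
    also have "\<dots> = (ctr (x * chi mu) / fact m) \<cdot>\<^sub>g chi mu"
      using fdim(2)[OF mu] by (subst class_fun_chi_scalar[OF mu x]) simp
    finally show "x * cidem mu = (ctr (x * chi mu) / fact m) \<cdot>\<^sub>g chi mu" .
  qed
  finally show ?thesis .
qed

text \<open>The multiplicities come from \<open>branching_mult_ex\<close>; evaluating the expansion
  at the identity compares dimensions.\<close>

lemma restr_chi_if_complete:
  assumes compl: "(\<Sum>mu\<in>parts m. cidem mu) = 1" and la: "la \<turnstile>\<^sub>p Suc m"
  obtains k :: "nat list \<Rightarrow> nat" where
    "restr m (chi la) = (\<Sum>mu\<in>parts m. of_nat (k mu) \<cdot>\<^sub>g chi mu)"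
    "fdim la = (\<Sum>mu\<in>parts m. k mu * fdim mu)"
    "\<And>mu. mu \<in> parts m \<Longrightarrow> mu \<nearrow> la \<Longrightarrow> k mu > 0"
proof -
  obtain k :: "nat list \<Rightarrow> nat" where
    k: "ctr (chi la * chi mu) = of_nat (k mu) * fact m" "mu \<nearrow> la \<Longrightarrow> k mu > 0"
    if "mu \<in> parts m" for mu
    using branching_mult_ex[OF _ la] by (simp only: parts_iff) metis
  have "class_fun m (restr m (chi la))" by (rule class_fun_restr[OF class_fun_chi[OF la]]) simp
  from class_fun_expand[OF compl this]
  have "restr m (chi la) = (\<Sum>mu\<in>parts m. (ctr (restr m (chi la) * chi mu) / fact m) \<cdot>\<^sub>g chi mu)" .
  also have "\<dots> = (\<Sum>mu\<in>parts m. of_nat (k mu) \<cdot>\<^sub>g chi mu)"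
    by (intro sum.cong refl)
       (simp add: restr_mult_right[OF supp_in_chi, symmetric] k[unfolded parts_iff])
  finally have 1: "restr m (chi la) = (\<Sum>mu\<in>parts m. of_nat (k mu) \<cdot>\<^sub>g chi mu)" .
  have "of_nat (fdim la) = ctr (restr m (chi la))" using fdim(1)[OF la] by simp
  also have "\<dots> = (\<Sum>mu\<in>parts m. of_nat (k mu) * of_nat (fdim mu))"
    unfolding 1 by (simp add: fdim)
  finally have "(of_nat (fdim la) :: complex) = of_nat (\<Sum>mu\<in>parts m. k mu * fdim mu)" by simp
  then have "fdim la = (\<Sum>mu\<in>parts m. k mu * fdim mu)" by (simp only: of_nat_eq_iff)
  with 1 k(2) show thesis using that by blast
qed

text \<open>The restricted characters give \<open>f\<^sub>\<lambda> \<ge> num_syt \<lambda>\<close>. As the squares of the numbers of standard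
  tableaux sum to \<open>n!\<close>, while those of the \<open>f\<^sub>\<lambda>\<close> sum to at most \<open>n!\<close>, equality holds throughout.\<close>

lemma fdim_complete:
  "(\<forall>la\<in>parts n. fdim la = num_syt n la) \<and> (\<Sum>la\<in>parts n. (fdim la)\<^sup>2) = fact n"
proof (induction n)
  case 0
  have "(fdim [])\<^sup>2 \<le> 1" using sum_fdim_squares_le[of 0] by (simp add: parts_0)
  moreover have "fdim [] > 0" using fdim(2)[of "[]" 0] parts_0 parts_iff by blast
  moreover have "fdim [] \<le> (fdim [])\<^sup>2" by (simp add: power2_eq_square)
  ultimately have "fdim [] = 1" by linarith
  then show ?case by (simp add: parts_0)
next
  case (Suc m)
  have compl: "(\<Sum>mu\<in>parts m. cidem mu) = 1" using Suc by (intro cidem_complete_if) blast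
  have ge: "num_syt (Suc m) la \<le> fdim la" if "la \<in> parts (Suc m)" for la
  proof -
    from that have la: "la \<turnstile>\<^sub>p Suc m" by simp
    obtain k where k: "fdim la = (\<Sum>mu\<in>parts m. k mu * fdim mu)"
      "\<And>mu. mu \<in> parts m \<Longrightarrow> mu \<nearrow> la \<Longrightarrow> k mu > 0"
      using restr_chi_if_complete[OF compl la] by metis
    have "num_syt (Suc m) la = (\<Sum>mu\<in>parts m. if mu \<nearrow> la then fdim mu else 0)"
      unfolding sum_if_filter[OF finite_parts] num_syt.simps(2) using Suc by (intro sum.cong) auto
    also have "\<dots> \<le> (\<Sum>mu\<in>parts m. k mu * fdim mu)"
      using k(2) by (intro sum_mono) (auto simp: Suc_le_eq)
    finally show ?thesis using k(1) by simp
  qed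
  have eq: "(\<Sum>la\<in>parts (Suc m). (num_syt (Suc m) la)\<^sup>2) = (\<Sum>la\<in>parts (Suc m). (fdim la)\<^sup>2)"
    using sum_num_syt_squares[of "Suc m"] sum_fdim_squares_le[of "Suc m"]
      sum_mono[of "parts (Suc m)" "\<lambda>la. (num_syt (Suc m) la)\<^sup>2" "\<lambda>la. (fdim la)\<^sup>2"] ge
    by (simp add: power_mono del: num_syt.simps parts_iff)
  have "(num_syt (Suc m) la)\<^sup>2 = (fdim la)\<^sup>2" if "la \<in> parts (Suc m)" for la
    by (rule sum_mono_inv[OF eq _ that]) (auto intro!: power_mono ge simp del: num_syt.simps)
  then have "\<forall>la\<in>parts (Suc m). fdim la = num_syt (Suc m) la"
    by (metis power2_eq_iff_nonneg zero_le)
  then show ?case using eq sum_num_syt_squares[of "Suc m"] by (simp del: num_syt.simps parts_iff)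
qed

lemma sum_cidem: "(\<Sum>la\<in>parts n. cidem la) = 1"
  using fdim_complete by (intro cidem_complete_if) blast

text \<open>The dimensions of the lower covers already add up to \<open>fdim la\<close>. As the
  covers occur with positive multiplicity and all dimensions are positive, no multiplicity exceeds 1
  and nothing else occurs.\<close>

theorem restr_chi:
  assumes la: "la \<turnstile>\<^sub>p Suc m"
  shows "restr m (chi la) = (\<Sum>mu | mu \<in> parts m \<and> mu \<nearrow> la. chi mu)"
proof -
  obtain k where k: "restr m (chi la) = (\<Sum>mu\<in>parts m. of_nat (k mu) \<cdot>\<^sub>g chi mu)"
    "fdim la = (\<Sum>mu\<in>parts m. k mu * fdim mu)" "\<And>mu. mu \<in> parts m \<Longrightarrow> mu \<nearrow> la \<Longrightarrow> k mu > 0"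
    using restr_chi_if_complete[OF sum_cidem la] by metis
  have "(\<Sum>mu\<in>parts m. if mu \<nearrow> la then fdim mu else 0) = fdim la"
    unfolding sum_if_filter[OF finite_parts] using fdim_complete[of m] fdim_complete[of "Suc m"] la
    by (simp cong: sum.cong_simp)
  then have eq: "(\<Sum>mu\<in>parts m. if mu \<nearrow> la then fdim mu else 0) = (\<Sum>mu\<in>parts m. k mu * fdim mu)"
    using k(2) by simp
  have *: "(if mu \<nearrow> la then fdim mu else 0) = k mu * fdim mu" if "mu \<in> parts m" for mu
    by (rule sum_mono_inv[OF eq _ that]) (use k(3) in \<open>auto simp: Suc_le_eq\<close>)
  have "k mu = (if mu \<nearrow> la then 1 else 0)" if "mu \<in> parts m" for mu
    using fdim(2)[of mu m] *[OF that] that by (auto split: if_splits)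
  then have "restr m (chi la) = (\<Sum>mu\<in>parts m. if mu \<nearrow> la then chi mu else 0)"
    unfolding k(1) by (intro sum.cong refl) auto
  then show ?thesis by (simp only: sum_if_filter[OF finite_parts])
qed

section \<open>Jucys-Murphy elements\<close>

definition transp_sum :: "nat \<Rightarrow> galg" where
  "transp_sum n = (\<Sum>(i, j)\<in>{(i, j). 1 \<le> i \<and> i < j \<and> j \<le> n}. \<delta> (transpose i j))"

text \<open>The last Jucys-Murphy element of S(n). It is the difference of the central sums
  \<open>transp_sum\<close> of two consecutive ranks, which gives both its commutation and its
  eigenvalues.\<close>

definition jm :: "nat \<Rightarrow> galg" where
  "jm n = (\<Sum>i\<in>{1..<n}. \<delta> (transpose i n))"

lemma finite_pairs [simp]: "finite {(i, j). 1 \<le> i \<and> i < j \<and> j \<le> (n::nat)}"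
  by (rule finite_subset[of _ "{..n} \<times> {..n}"]) auto

lemma transpose_permutes: "i \<in> {1..n} \<Longrightarrow> j \<in> {1..n} \<Longrightarrow> transpose i j permutes {1..n::nat}"
  by (rule permutes_swap_id)

lemma supp_in_transp_sum [simp, intro]: "supp_in n (transp_sum n)"
  unfolding transp_sum_def by (auto intro!: supp_in_delta transpose_permutes)

lemma supp_in_jm [simp, intro]: "supp_in n (jm n)"
  unfolding jm_def by (auto intro!: supp_in_delta transpose_permutes)

lemma transp_sum_Suc: "transp_sum (Suc n) = transp_sum n + jm (Suc n)"
proof -
  have eq: "{(i, j). 1 \<le> i \<and> i < j \<and> j \<le> Suc n} =
    {(i, j). 1 \<le> i \<and> i < j \<and> j \<le> n} \<union> (\<lambda>i. (i, Suc n)) ` {1..<Suc n}"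
    by auto
  show ?thesis
    unfolding transp_sum_def jm_def eq
    by (subst sum.union_disjoint) (auto simp: sum.reindex inj_on_def)
qed

text \<open>Conjugation permutes ordered pairs of letters but does not preserve increasing ones;
  doubling the sum makes it a sum over ordered pairs.\<close>

lemma sum_unordered_pairs:
  "(\<Sum>i\<in>{1..n::nat}. \<Sum>j\<in>{1..n} - {i}. f (transpose i j)) =
   (\<Sum>(i, j)\<in>{(i, j). 1 \<le> i \<and> i < j \<and> j \<le> n}. f (transpose i j)) + (\<Sum>(i, j)\<in>{(i, j). 1 \<le> i \<and> i < j \<and> j \<le> n}. f (transpose i j))"
proof -
  have "(\<Sum>i\<in>{1..n}. \<Sum>j\<in>{1..n} - {i}. f (transpose i j)) = (\<Sum>(i, j)\<in>(SIGMA i:{1..n}. {1..n} - {i}). f (transpose i j))"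
    by (rule sum.Sigma) auto
  also have "(SIGMA i:{1..n}. {1..n} - {i}) = {(i, j). 1 \<le> i \<and> i < j \<and> j \<le> n} \<union> prod.swap ` {(i, j). 1 \<le> i \<and> i < j \<and> j \<le> n}"
    by (auto simp: image_iff)
  also have "(\<Sum>(i, j)\<in>\<dots>. f (transpose i j)) = (\<Sum>(i, j)\<in>{(i, j). 1 \<le> i \<and> i < j \<and> j \<le> n}. f (transpose i j)) +
     (\<Sum>(i, j)\<in>prod.swap ` {(i, j). 1 \<le> i \<and> i < j \<and> j \<le> n}. f (transpose i j))"
    by (rule sum.union_disjoint) auto
  also have "(\<Sum>(i, j)\<in>prod.swap ` {(i, j). 1 \<le> i \<and> i < j \<and> j \<le> n}. f (transpose i j)) =
     (\<Sum>(i, j)\<in>{(i, j). 1 \<le> i \<and> i < j \<and> j \<le> n}. f (transpose i j))"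
    by (subst sum.reindex) (auto simp: inj_on_def transpose_commute intro!: sum.cong)
  finally show ?thesis .
qed

lemma galg_double_cancel: "x + x = y + y \<Longrightarrow> x = (y :: galg)"
proof (rule galg_eqI)
  fix w assume "x + x = y + y"
  then have "coef (x + x) w = coef (y + y) w" by simp
  then show "coef x w = coef y w" by simp
qed

lemma class_fun_transp_sum: "class_fun n (transp_sum n)"
  unfolding class_fun_def
proof (intro conjI allI impI)
  fix w assume w: "w permutes {1..n}"
  have bij: "bij_betw w {1..n} {1..n}" using permutes_imp_bij[OF w] .
  have conj: "\<delta> w * \<delta> (transpose i j) * \<delta> (inv w) = \<delta> (transpose (w i) (w j))" if "i \<in> {1..n}" "j \<in> {1..n}" for i j
  proof -
    have "w \<circ> transpose i j = transpose (w i) (w j) \<circ> w"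
      using transpose_comp_eq[OF permutes_bij[OF w], of "w i" "w j"] permutes_inverses(2)[OF w] by simp
    then have "w \<circ> transpose i j \<circ> inv w = transpose (w i) (w j)"
      using Sym_comp_cancel(1)[OF w] by metis
    then show ?thesis
      using w that transpose_permutes[OF that] by (simp add: delta_mult[of _ n] permutes_inv permutes_compose)
  qed
  let ?D = "\<Sum>i\<in>{1..n}. \<Sum>j\<in>{1..n} - {i}. \<delta> (transpose i j)"
  have "\<delta> w * ?D * \<delta> (inv w) = (\<Sum>i\<in>{1..n}. \<Sum>j\<in>{1..n} - {i}. \<delta> (transpose (w i) (w j)))"
    by (auto simp: sum_distrib_left sum_distrib_right conj intro!: sum.cong)
  also have "\<dots> = (\<Sum>i\<in>{1..n}. \<Sum>j\<in>{1..n} - {w i}. \<delta> (transpose (w i) j))"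
  proof (rule sum.cong[OF refl])
    fix i assume i: "i \<in> {1..n}"
    have "bij_betw w ({1..n} - {i}) ({1..n} - {w i})"
      using image_set_diff[OF permutes_inj[OF w], of "{1..n}" "{i}"] permutes_image[OF w] permutes_inj_on[OF w]
      by (simp add: bij_betw_def)
    then show "(\<Sum>j\<in>{1..n} - {i}. \<delta> (transpose (w i) (w j))) = (\<Sum>j\<in>{1..n} - {w i}. \<delta> (transpose (w i) j))"
      by (rule sum.reindex_bij_betw)
  qed
  also have "\<dots> = ?D" by (rule sum.reindex_bij_betw[OF bij])
  finally have "\<delta> w * (transp_sum n + transp_sum n) * \<delta> (inv w) = transp_sum n + transp_sum n"
    unfolding sum_unordered_pairs[where f = \<delta>] transp_sum_def[symmetric] .
  then have "\<delta> w * transp_sum n * \<delta> (inv w) = transp_sum n"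
    by - (rule galg_double_cancel, simp add: distrib_left distrib_right)
  then have "\<delta> w * transp_sum n * (\<delta> (inv w) * \<delta> w) = transp_sum n * \<delta> w"
    by (simp only: mult.assoc[symmetric])
  then show "\<delta> w * transp_sum n = transp_sum n * \<delta> w" using w by simp
qed simp

section \<open>The transposition sum acts by the sum of contents\<close>

definition content_sum :: "nat list \<Rightarrow> int" where
  "content_sum la = (\<Sum>b\<in>diagram la. box_content b)"

lemma ysym_row_absorb: "p \<in> stab (sum_list la) (row_of la) \<Longrightarrow> \<delta> p * ysym la = ysym la"
  by (simp add: ysym_def mult.assoc[symmetric] row_sum_absorb)

lemma ysym_col_absorb: "q \<in> stab (sum_list la) (col_of la) \<Longrightarrow> ysym la * \<delta> q = of_int (sign q) \<cdot>\<^sub>g ysym la"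
  by (simp add: ysym_def mult.assoc col_sum_absorb)

lemma ctr_ysym: "ctr (ysym la) = 1"
  unfolding ysym_def by (rule ctr_row_col[OF tableau_box_of])

text \<open>The box in the row of \<open>i\<close> and the column of \<open>j\<close> belongs to the
  diagram because \<open>j\<close> lies in a lower row. Its entry shares a row with
  \<open>i\<close>, and the transposition puts \<open>i\<close> into the column of that entry, so
  this is an obstructing pair.\<close>

lemma coef_ysym_transpose_aux:
  assumes la: "la \<turnstile>\<^sub>p n" and ij: "i \<in> {1..n}" "j \<in> {1..n}" "row_of la i < row_of la j" "col_of la i \<noteq> col_of la j"
  shows "coef (ysym la) (transpose i j) = 0"
proof -
  let ?z = "row_tableau la (row_of la i, col_of la j)"
  note n = sum_list_partition[OF la]
  have "box_of la j \<in> diagram la" using box_of_in[of j la] ij n by simp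
  then have zD: "(row_of la i, col_of la j) \<in> diagram la"
    using youngD[OF young_diagram[OF la], of "row_of la j" "col_of la j"] ij by simp
  then have z: "?z \<in> {1..n}" "box_of la ?z = (row_of la i, col_of la j)"
    using row_tableau_in[OF zD] n box_of_row_tableau by auto
  have "row_of la ?z = row_of la i" "col_of la ?z = col_of la j" using z(2) by simp_all
  then have ne: "?z \<noteq> i" "?z \<noteq> j" using ij by (metis less_irrefl)+
  show ?thesis
  proof (rule pair_coef_zero[of "transpose i j" n "row_of la" "ysym la" "col_of la" i ?z])
    show "col_of la (inv (transpose i j) i) = col_of la (inv (transpose i j) ?z)"
      using ne z(2) by (simp add: transpose_apply_other)
  qed (use ij ne z n ysym_row_absorb ysym_col_absorb in \<open>auto intro: transpose_permutes\<close>)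
qed

text \<open>Row or column absorption relates the coefficient to that of the identity; in the
  remaining case an obstructing pair makes it vanish.\<close>

lemma coef_ysym_transpose:
  assumes la: "la \<turnstile>\<^sub>p n" and ij: "i \<in> {1..n}" "j \<in> {1..n}" "i \<noteq> j"
  shows "coef (ysym la) (transpose i j) =
    (if row_of la i = row_of la j then 1 else 0) - (if col_of la i = col_of la j then 1 else 0)"
proof -
  note n = sum_list_partition[OF la]
  let ?t = "transpose i j"
  have t: "?t permutes {1..n}" using ij by (intro transpose_permutes)
  have not_both: "\<not> (row_of la i = row_of la j \<and> col_of la i = col_of la j)"
    using tableau_inj[OF tableau_box_of[of la], of i j] ij n by auto
  consider "row_of la i = row_of la j" | "col_of la i = col_of la j"
    | "row_of la i \<noteq> row_of la j" "col_of la i \<noteq> col_of la j" by blast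
  then show ?thesis
  proof cases
    case 1
    then have "\<delta> ?t * ysym la = ysym la" using ij n by (intro ysym_row_absorb transpose_stab) auto
    then have "coef (ysym la) ?t = coef (\<delta> ?t * ysym la) ?t" by simp
    also have "\<dots> = 1" using t ctr_ysym by (simp add: coef_delta_mult)
    finally show ?thesis using 1 not_both by simp
  next
    case 2
    then have "ysym la * \<delta> ?t = of_int (sign ?t) \<cdot>\<^sub>g ysym la" using ij n by (intro ysym_col_absorb transpose_stab) auto
    then have eq: "ysym la * \<delta> ?t = (- 1) \<cdot>\<^sub>g ysym la" using ij(3) by (simp add: sign_swap_id)
    have "1 = coef (ysym la * \<delta> ?t) ?t" using t ctr_ysym by (simp add: coef_mult_delta)
    also have "\<dots> = - coef (ysym la) ?t" by (simp add: eq)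
    finally have "coef (ysym la) ?t = - 1" by (simp add: minus_equation_iff)
    then show ?thesis using 2 not_both by simp
  next
    case 3
    have "coef (ysym la) ?t = 0"
    proof (cases "row_of la i < row_of la j")
      case True then show ?thesis using coef_ysym_transpose_aux[OF la] ij 3 by blast
    next
      case False
      then have "row_of la j < row_of la i" using 3 by simp
      then show ?thesis using coef_ysym_transpose_aux[OF la, of j i] ij 3 by (simp add: transpose_commute)
    qed
    then show ?thesis using 3 by simp
  qed
qed

lemma row_tableau_col_less:
  assumes "(i, j) \<in> diagram la" "(i', j) \<in> diagram la" "i < i'"
  shows "row_tableau la (i, j) < row_tableau la (i', j)"
proof -
  have i: "i < length la" "j < la ! i" using assms(1) by (auto simp: diagram_def)
  have "sum_list (take (Suc i) la) \<le> sum_list (take i' la)"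
  proof -
    have "take i' la = take (Suc i) la @ take (i' - Suc i) (drop (Suc i) la)"
      using assms(3) by (metis Suc_leI le_add_diff_inverse take_add)
    then show ?thesis by simp
  qed
  then show ?thesis using i by (simp add: row_tableau_def take_Suc_conv_app_nth)
qed

lemma row_tableau_less_iff:
  assumes "x \<in> {1..sum_list la}" "y \<in> {1..sum_list la}"
  shows "row_of la x = row_of la y \<Longrightarrow> x < y \<longleftrightarrow> col_of la x < col_of la y"
    "col_of la x = col_of la y \<Longrightarrow> x < y \<longleftrightarrow> row_of la x < row_of la y"
proof -
  have xy: "x = row_tableau la (row_of la x, col_of la x)" "y = row_tableau la (row_of la y, col_of la y)"
    using row_tableau_box_of assms by simp_all
  have D: "(row_of la x, col_of la x) \<in> diagram la" "(row_of la y, col_of la y) \<in> diagram la"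
    using box_of_in assms by simp_all
  show "x < y \<longleftrightarrow> col_of la x < col_of la y" if eq: "row_of la x = row_of la y"
  proof -
    have "x = sum_list (take (row_of la y) la) + col_of la x + 1"
      "y = sum_list (take (row_of la y) la) + col_of la y + 1"
      using xy eq unfolding row_tableau_def by (metis (no_types, lifting) case_prod_conv)+
    then show ?thesis by linarith
  qed
  show "col_of la x = col_of la y \<Longrightarrow> x < y \<longleftrightarrow> row_of la x < row_of la y"
    using row_tableau_col_less[of "row_of la x" "col_of la x" la "row_of la y"]
      row_tableau_col_less[of "row_of la y" "col_of la x" la "row_of la x"] D xy
    by (metis linorder_neqE_nat less_asym less_irrefl)
qed

text \<open>Counting each pair of entries at its later member, the pairs in a common row minus those
  in a common column contribute exactly the content of the box of \<open>y\<close>.\<close>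

lemma card_same_row:
  assumes la: "la \<turnstile>\<^sub>p n" and y: "y \<in> {1..n}"
  shows "card {x \<in> {1..n}. x < y \<and> row_of la x = row_of la y} = col_of la y"
    "card {x \<in> {1..n}. x < y \<and> col_of la x = col_of la y} = row_of la y"
proof -
  note n = sum_list_partition[OF la]
  note t = tableau_box_of[of la, unfolded n]
  note less = row_tableau_less_iff[of _ la, unfolded n]
  have yD: "(row_of la y, col_of la y) \<in> diagram la" using tableau_in[OF t y] .
  have "bij_betw (col_of la) {x \<in> {1..n}. x < y \<and> row_of la x = row_of la y} {..<col_of la y}"
    unfolding bij_betw_def
  proof
    show "inj_on (col_of la) {x \<in> {1..n}. x < y \<and> row_of la x = row_of la y}"
      by (rule inj_onI) (auto intro: tableau_inj[OF t])
    show "col_of la ` {x \<in> {1..n}. x < y \<and> row_of la x = row_of la y} = {..<col_of la y}"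
    proof (intro equalityI subsetI)
      fix k assume k: "k \<in> {..<col_of la y}"
      then have "(row_of la y, k) \<in> diagram la" using youngD[OF young_diagram[OF la] yD] by simp
      then obtain x where "x \<in> {1..n}" "row_of la x = row_of la y" "col_of la x = k" by (rule tableau_ex[OF t])
      then show "k \<in> col_of la ` {x \<in> {1..n}. x < y \<and> row_of la x = row_of la y}"
        using less(1)[of x y] y k by blast
    qed (use less(1) y in auto)
  qed
  then show "card {x \<in> {1..n}. x < y \<and> row_of la x = row_of la y} = col_of la y"
    using bij_betw_same_card by force
  have "bij_betw (row_of la) {x \<in> {1..n}. x < y \<and> col_of la x = col_of la y} {..<row_of la y}"
    unfolding bij_betw_def
  proof
    show "inj_on (row_of la) {x \<in> {1..n}. x < y \<and> col_of la x = col_of la y}"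
      by (rule inj_onI) (auto intro: tableau_inj[OF t])
    show "row_of la ` {x \<in> {1..n}. x < y \<and> col_of la x = col_of la y} = {..<row_of la y}"
    proof (intro equalityI subsetI)
      fix k assume k: "k \<in> {..<row_of la y}"
      then have "(k, col_of la y) \<in> diagram la" using youngD[OF young_diagram[OF la] yD] by simp
      then obtain x where "x \<in> {1..n}" "row_of la x = k" "col_of la x = col_of la y" by (rule tableau_ex[OF t])
      then show "k \<in> row_of la ` {x \<in> {1..n}. x < y \<and> col_of la x = col_of la y}"
        using less(2)[of x y] y k by blast
    qed (use less(2) y in auto)
  qed
  then show "card {x \<in> {1..n}. x < y \<and> col_of la x = col_of la y} = row_of la y"
    using bij_betw_same_card by force
qed

text \<open>The scalar is the identity coefficient of \<open>transp_sum n * ysym la\<close>, as that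
  of \<open>ysym la\<close> is 1. It counts pairs of entries in a common row minus pairs in a common
  column.\<close>

lemma transp_sum_chi:
  assumes la: "la \<turnstile>\<^sub>p n"
  shows "transp_sum n * chi la = of_int (content_sum la) \<cdot>\<^sub>g chi la"
proof -
  note n = sum_list_partition[OF la]
  obtain c where c: "transp_sum n * yidem la = c \<cdot>\<^sub>g yidem la" "transp_sum n * chi la = c \<cdot>\<^sub>g chi la"
    using class_fun_yidem[OF la class_fun_transp_sum] by blast
  have "ysym la = yscal la \<cdot>\<^sub>g yidem la" using yscal_nonzero[OF la] by (simp add: yidem_def)
  then have "transp_sum n * ysym la = c \<cdot>\<^sub>g ysym la" using c(1) by (simp add: mult.commute)
  then have "c = ctr (transp_sum n * ysym la)" using ctr_ysym by simp
  also have "\<dots> = (\<Sum>(i, j)\<in>{(i, j). 1 \<le> i \<and> i < j \<and> j \<le> n}. coef (ysym la) (transpose i j))"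
    unfolding transp_sum_def sum_distrib_right coef_sum
  proof (intro sum.cong refl, clarsimp)
    fix i j :: nat assume "1 \<le> i" "i < j" "j \<le> n"
    then have "transpose i j permutes {1..n}" by (intro transpose_permutes) auto
    then show "ctr (\<delta> (transpose i j) * ysym la) = coef (ysym la) (transpose i j)"
      by (simp add: coef_delta_mult)
  qed
  also have "\<dots> = (\<Sum>(i, j)\<in>{(i, j). 1 \<le> i \<and> i < j \<and> j \<le> n}.
     (if row_of la i = row_of la j then 1 else 0) - (if col_of la i = col_of la j then 1 else 0))"
    by (intro sum.cong refl, clarify) (rule coef_ysym_transpose[OF la]; simp)
  also have "{(i, j). 1 \<le> i \<and> i < j \<and> j \<le> n} = prod.swap ` (SIGMA j:{1..n}. {i \<in> {1..n}. i < j})"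
    by (auto simp: image_iff)
  also have "(\<Sum>(i, j)\<in>\<dots>. (if row_of la i = row_of la j then 1 else 0) - (if col_of la i = col_of la j then 1 else 0)) =
     (\<Sum>j\<in>{1..n}. \<Sum>i\<in>{i \<in> {1..n}. i < j}. (if row_of la i = row_of la j then 1 else 0) - (if col_of la i = col_of la j then 1 else 0 :: complex))"
    by (subst sum.reindex) (auto simp: sum.Sigma intro!: sum.cong)
  also have "\<dots> = (\<Sum>j\<in>{1..n}. of_int (box_content (box_of la j)))"
  proof (rule sum.cong[OF refl])
    fix j assume j: "j \<in> {1..n}"
    have *: "(\<Sum>i\<in>{i \<in> {1..n}. i < j}. if f i = f j then 1 else 0 :: complex) = of_nat (card {i \<in> {1..n}. i < j \<and> f i = f j})"
      for f :: "nat \<Rightarrow> nat"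
      by (subst sum_if_filter) (auto intro!: arg_cong[where f = card])
    show "(\<Sum>i\<in>{i \<in> {1..n}. i < j}. (if row_of la i = row_of la j then 1 else 0) - (if col_of la i = col_of la j then 1 else 0 :: complex)) =
      of_int (box_content (box_of la j))"
      unfolding sum_subtractf *[of "row_of la"] *[of "col_of la"] card_same_row[OF la j] by (simp add: box_content_def)
  qed
  also have "\<dots> = of_int (content_sum la)"
  proof -
    have "bij_betw (box_of la) {1..n} (diagram la)"
      using tableau_box_of[of la] n by (simp add: tableau_def)
    from sum.reindex_bij_betw[OF this, of "\<lambda>b. of_int (box_content b) :: complex"] show ?thesis
      unfolding content_sum_def of_int_sum .
  qed
  finally show ?thesis using c(2) by simp
qed

definition cont :: "nat list \<Rightarrow> nat list \<Rightarrow> int" where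
  "cont la mu = box_content (new_box la mu)"

lemma content_sum_add_box: "mu \<nearrow> la \<Longrightarrow> content_sum la = content_sum mu + cont la mu"
  using new_box[of mu la] by (simp add: content_sum_def cont_def)

lemma cont_row: "mu \<nearrow> la \<Longrightarrow> la \<turnstile>\<^sub>p n \<Longrightarrow> cont la mu = int (row_len mu (fst (new_box la mu))) - int (fst (new_box la mu))"
  using new_box_row[of mu la n] unfolding cont_def box_content_def by (metis snd_conv)

lemma removable_less: "mu \<turnstile>\<^sub>p n \<Longrightarrow> i \<in> removable mu \<Longrightarrow> i < i' \<Longrightarrow> row_len mu i' < row_len mu i"
  using row_len_mono[of mu n "Suc i" i'] by (auto simp: removable_def)

text \<open>All rows below a removable row are strictly shorter, so a box added there has smaller
  content than the removed box; a box added in the same row or above has larger content. Hence the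
  denominators of the recursions do not vanish.\<close>

lemma cont_neq:
  assumes mu: "mu \<turnstile>\<^sub>p m" and la: "la \<turnstile>\<^sub>p n" and ka: "ka \<turnstile>\<^sub>p k" and "mu \<nearrow> la" "ka \<nearrow> mu"
  shows "cont la mu \<noteq> cont mu ka"
proof -
  define i where "i = fst (new_box la mu)"
  define i' where "i' = fst (new_box mu ka)"
  have 1: "cont la mu = int (row_len mu i) - int i" unfolding i_def by (rule cont_row[OF assms(4) la])
  have 2: "cont mu ka = int (row_len mu i') - 1 - int i'"
    using cont_row[OF assms(5) mu] add_box_row_len(1)[OF assms(5) mu] by (simp add: i'_def)
  have rem: "i' \<in> removable mu" unfolding i'_def by (rule down_cover_removable[OF assms(5) ka mu])
  consider "i = i'" | "i < i'" | "i' < i" by linarith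
  then show ?thesis
  proof cases
    case 2
    then show ?thesis using 1 \<open>cont mu ka = _\<close> row_len_mono[OF mu, of i i'] by linarith
  next
    case 3
    then show ?thesis using 1 2 removable_less[OF mu rem 3] by linarith
  qed (use 1 2 in auto)
qed

section \<open>The recursion for the generalized characters\<close>

definition gam :: "nat list \<Rightarrow> nat list \<Rightarrow> galg" where
  "gam la mu = chi la * cidem mu"

lemma supp_in_cidem_mono: "la \<turnstile>\<^sub>p n \<Longrightarrow> n \<le> m \<Longrightarrow> supp_in m (cidem la)"
  using supp_in_mono supp_in_cidem by blast

text \<open>Both terms of \<open>transp_sum (Suc m) - transp_sum m\<close> commute with the algebra
  of S(m).\<close>

lemma jm_commute:
  assumes "supp_in m y" shows "jm (Suc m) * y = y * jm (Suc m)"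
proof -
  have "jm (Suc m) = transp_sum (Suc m) - transp_sum m" by (simp add: transp_sum_Suc)
  moreover have "transp_sum (Suc m) * y = y * transp_sum (Suc m)"
    by (rule class_fun_commute[OF class_fun_transp_sum supp_in_mono[OF assms]]) simp
  moreover have "transp_sum m * y = y * transp_sum m"
    by (rule class_fun_commute[OF class_fun_transp_sum assms])
  ultimately show ?thesis by (simp only: left_diff_distrib right_diff_distrib)
qed

lemma transp_sum_cidem:
  "la \<turnstile>\<^sub>p n \<Longrightarrow> transp_sum n * cidem la = of_int (content_sum la) \<cdot>\<^sub>g cidem la"
  using transp_sum_chi[of la n] by (simp add: cidem_def mult.commute)

text \<open>Each of the two transposition sums acts by the content sum of its own shape; the
  difference is the content of the added box.\<close>

lemma jm_eigen:
  assumes la: "la \<turnstile>\<^sub>p Suc m" and mu: "mu \<turnstile>\<^sub>p m" and cov: "mu \<nearrow> la"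
  shows "jm (Suc m) * (chi la * cidem mu) = of_int (cont la mu) \<cdot>\<^sub>g (chi la * cidem mu)"
    "jm (Suc m) * (cidem la * cidem mu) = of_int (cont la mu) \<cdot>\<^sub>g (cidem la * cidem mu)"
proof -
  have X: "jm (Suc m) = transp_sum (Suc m) - transp_sum m" by (simp add: transp_sum_Suc)
  have "transp_sum m * (chi la * cidem mu) = chi la * (transp_sum m * cidem mu)"
    using class_fun_commute[OF class_fun_chi[OF la] supp_in_mono[OF supp_in_transp_sum[of m], of "Suc m"]]
    by (simp add: mult.assoc[symmetric])
  then have "jm (Suc m) * (chi la * cidem mu) = of_int (content_sum la - content_sum mu) \<cdot>\<^sub>g (chi la * cidem mu)"
    unfolding X left_diff_distrib
    by (simp add: mult.assoc[symmetric] transp_sum_chi[OF la] gscale_distrib)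
       (simp add: mult.assoc transp_sum_cidem[OF mu])
  then show 1: "jm (Suc m) * (chi la * cidem mu) = of_int (cont la mu) \<cdot>\<^sub>g (chi la * cidem mu)"
    by (simp add: content_sum_add_box[OF cov])
  have "cidem la * cidem mu = (of_nat (fdim la) / fact (Suc m)) \<cdot>\<^sub>g (chi la * cidem mu)"
    by (simp add: cidem_eq[OF la])
  then show "jm (Suc m) * (cidem la * cidem mu) = of_int (cont la mu) \<cdot>\<^sub>g (cidem la * cidem mu)"
    by (simp add: 1 mult.commute)
qed

lemma restr_chi_cidem:
  assumes la: "la \<turnstile>\<^sub>p Suc m" and mu: "mu \<turnstile>\<^sub>p m"
  shows "restr m (chi la) * cidem mu = (if mu \<nearrow> la then chi mu else 0)"
proof -
  have "restr m (chi la) * cidem mu = (\<Sum>mu' | mu' \<in> parts m \<and> mu' \<nearrow> la. chi mu' * cidem mu)"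
    by (simp only: restr_chi[OF la] sum_distrib_right)
  also have "\<dots> = (\<Sum>mu' | mu' \<in> parts m \<and> mu' \<nearrow> la. if mu' = mu then chi mu else 0)"
    by (intro sum.cong refl) (auto simp: chi_cidem[OF mu] chi_cidem_ne[OF _ mu])
  also have "\<dots> = (if mu \<nearrow> la then chi mu else 0)"
    using mu by (subst sum.delta) auto
  finally show ?thesis .
qed

lemma restr_gam: "la \<turnstile>\<^sub>p Suc m \<Longrightarrow> mu \<turnstile>\<^sub>p m \<Longrightarrow> mu \<nearrow> la \<Longrightarrow> restr m (gam la mu) = chi mu"
  unfolding gam_def by (subst restr_mult_right[OF supp_in_cidem], assumption) (simp only: restr_chi_cidem if_True)

text \<open>The product of the commuting idempotents is a real self-adjoint idempotent. Its
  restriction to S(m) vanishes by the branching rule, so its trace is 0, and positivity makes it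
  0.\<close>

lemma cidem_mult_not_cover:
  assumes la: "la \<turnstile>\<^sub>p Suc m" and mu: "mu \<turnstile>\<^sub>p m" and "\<not> mu \<nearrow> la"
  shows "cidem la * cidem mu = 0"
proof -
  let ?x = "cidem la * cidem mu"
  have comm: "cidem la * cidem mu = cidem mu * cidem la"
    by (rule class_fun_commute[OF class_fun_cidem[OF la] supp_in_cidem_mono[OF mu]]) simp
  have idem: "cidem la * cidem la = cidem la" "cidem mu * cidem mu = cidem mu"
    using cidem_mult[OF la la] cidem_mult[OF mu mu] by simp_all
  have "?x * ?x = cidem la * (cidem mu * cidem la) * cidem mu" by (simp add: mult.assoc)
  also have "\<dots> = cidem la * cidem la * (cidem mu * cidem mu)" unfolding comm[symmetric] by (simp add: mult.assoc)
  finally have "?x * ?x = ?x" by (simp add: idem)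
  moreover have "star ?x = ?x" by (simp add: star_mult star_cidem[OF la] star_cidem[OF mu] comm)
  moreover have "ctr ?x = ctr (restr m ?x)" by simp
  moreover have "restr m ?x = 0"
    using restr_chi_cidem[OF la mu] assms(3)
    by (simp add: restr_mult_right[OF supp_in_cidem[OF mu]] cidem_def[of la] restr_linear)
  ultimately show ?thesis
    using real_star_idem_ctr(2)[of "Suc m" ?x] supp_in_cidem[OF la] supp_in_cidem_mono[OF mu, of "Suc m"]
    by (simp add: real_galg_mult real_cidem del: ctr_restr)
qed

text \<open>Passing through the transposition turns the exchange of \<open>i\<close> with the last
  letter into that of \<open>i\<close> with the last but one. The remaining summand is the
  transposition itself, whose square is 1.\<close>

lemma transpose_jm:
  "\<delta> (transpose (Suc p) (Suc (Suc p))) * jm (Suc (Suc p)) = jm (Suc p) * \<delta> (transpose (Suc p) (Suc (Suc p))) + 1"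
proof -
  let ?n = "Suc (Suc p)" and ?s = "transpose (Suc p) (Suc (Suc p))"
  have s: "?s permutes {1..?n}" by (intro transpose_permutes) auto
  have "jm ?n = (\<Sum>i\<in>{1..<Suc p}. \<delta> (transpose i ?n)) + \<delta> ?s"
    unfolding jm_def by (subst atLeastLessThanSuc) (simp add: add.commute del: sum.op_ivl_Suc)
  then have "\<delta> ?s * jm ?n = (\<Sum>i\<in>{1..<Suc p}. \<delta> ?s * \<delta> (transpose i ?n)) + \<delta> ?s * \<delta> ?s"
    by (simp only: distrib_left sum_distrib_left)
  also have "\<delta> ?s * \<delta> ?s = 1" using s by (simp add: delta_mult)
  also have "(\<Sum>i\<in>{1..<Suc p}. \<delta> ?s * \<delta> (transpose i ?n)) = (\<Sum>i\<in>{1..<Suc p}. \<delta> (transpose i (Suc p)) * \<delta> ?s)"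
  proof (rule sum.cong[OF refl])
    fix i assume i: "i \<in> {1..<Suc p}"
    have "?s \<circ> transpose i ?n = transpose i (Suc p) \<circ> ?s"
      using i by (auto simp: fun_eq_iff transpose_def)
    moreover have "transpose i ?n permutes {1..?n}" "transpose i (Suc p) permutes {1..?n}"
      using i by (auto intro!: transpose_permutes)
    ultimately show "\<delta> ?s * \<delta> (transpose i ?n) = \<delta> (transpose i (Suc p)) * \<delta> ?s"
      using s by (simp add: delta_mult[of _ ?n])
  qed
  finally show ?thesis by (simp only: jm_def sum_distrib_right)
qed

theorem gam_step:
  assumes la: "la \<turnstile>\<^sub>p Suc (Suc p)" and mu: "mu \<turnstile>\<^sub>p Suc p" and cov: "mu \<nearrow> la" and y: "supp_in (Suc p) y"
  defines "s \<equiv> transpose (Suc p) (Suc (Suc p))"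
  shows "ctr (gam la mu * \<delta> s * y) =
    (\<Sum>ka | ka \<in> parts p \<and> ka \<nearrow> mu. ctr (gam mu ka * y) / of_int (cont la mu - cont mu ka))"
proof -
  let ?n = "Suc (Suc p)"
  define T where "T = (\<lambda>ka. ctr (gam la mu * cidem ka * \<delta> s * y))"
  have "gam la mu * \<delta> s * y = gam la mu * (\<Sum>ka\<in>parts p. cidem ka) * \<delta> s * y"
    by (simp only: sum_cidem mult_1_right)
  then have "ctr (gam la mu * \<delta> s * y) = (\<Sum>ka\<in>parts p. T ka)"
    by (simp add: T_def sum_distrib_left sum_distrib_right)
  also have "\<dots> = (\<Sum>ka\<in>parts p. if ka \<nearrow> mu then ctr (gam mu ka * y) / of_int (cont la mu - cont mu ka) else 0)"
  proof (rule sum.cong[OF refl])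
    fix ka assume "ka \<in> parts p"
    then have ka: "ka \<turnstile>\<^sub>p p" by simp
    show "T ka = (if ka \<nearrow> mu then ctr (gam mu ka * y) / of_int (cont la mu - cont mu ka) else 0)"
    proof (cases "ka \<nearrow> mu")
      case False
      then have "gam la mu * cidem ka = 0"
        using cidem_mult_not_cover[OF mu ka] by (simp add: gam_def mult.assoc)
      then show ?thesis using False by (simp add: T_def)
    next
      case True
      let ?G = "gam la mu * cidem ka"
      have G: "?G = chi la * (cidem mu * cidem ka)" by (simp add: gam_def mult.assoc)
      \<comment> \<open>One evaluation: the Jucys-Murphy element commutes with \<open>y\<close>,
        moves cyclically to the front and meets \<open>gam la mu\<close>.\<close>
      have "ctr (?G * \<delta> s * jm ?n * y) = ctr (?G * \<delta> s * y * jm ?n)"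
        using jm_commute[OF y] by (simp add: mult.assoc)
      also have "\<dots> = ctr (jm ?n * (chi la * cidem mu) * (cidem ka * \<delta> s * y))"
        by (subst ctr_commute) (simp add: gam_def mult.assoc)
      also have "\<dots> = of_int (cont la mu) * T ka"
        by (simp add: jm_eigen(1)[OF la mu cov] T_def gam_def mult.assoc)
      finally have 1: "ctr (?G * \<delta> s * jm ?n * y) = of_int (cont la mu) * T ka" .
      have "cidem mu * cidem ka * jm (Suc p) = jm (Suc p) * (cidem mu * cidem ka)"
      proof -
        have "cidem ka * jm (Suc p) = jm (Suc p) * cidem ka"
          using jm_commute[OF supp_in_cidem[OF ka]] by simp
        moreover have "cidem mu * jm (Suc p) = jm (Suc p) * cidem mu"
          by (rule class_fun_commute[OF class_fun_cidem[OF mu] supp_in_jm])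
        ultimately show ?thesis by (metis mult.assoc)
      qed
      then have Gj: "?G * jm (Suc p) = of_int (cont mu ka) \<cdot>\<^sub>g ?G"
        using jm_eigen(2)[OF mu ka True] by (simp add: G mult.assoc)
      \<comment> \<open>The other evaluation: moved left through \<open>s\<close>, it becomes the
        previous Jucys-Murphy element, which meets \<open>cidem mu * cidem ka\<close>, plus a term
        without \<open>s\<close>.\<close>
      have "ctr (?G * \<delta> s * jm ?n * y) = ctr (?G * (\<delta> s * jm ?n) * y)" by (simp add: mult.assoc)
      also have "\<dots> = ctr (?G * jm (Suc p) * \<delta> s * y) + ctr (?G * y)"
        unfolding s_def transpose_jm by (simp add: distrib_left distrib_right mult.assoc)
      also have "ctr (?G * jm (Suc p) * \<delta> s * y) = of_int (cont mu ka) * T ka"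
        unfolding Gj by (simp add: T_def)
      finally have 2: "ctr (?G * \<delta> s * jm ?n * y) = of_int (cont mu ka) * T ka + ctr (?G * y)" .
      \<comment> \<open>In the term without \<open>s\<close> all factors except
        \<open>chi la\<close> belong to the smaller group, so it can be computed after restriction,
        where \<open>chi la\<close> against \<open>cidem mu\<close> becomes
        \<open>chi mu\<close>.\<close>
      have "supp_in (Suc p) (cidem mu * cidem ka * y)"
        using supp_in_cidem[OF mu] supp_in_cidem_mono[OF ka, of "Suc p"] y by auto
      from restr_mult_right[OF this, of "chi la"]
      have "ctr (?G * y) = ctr (restr (Suc p) (chi la) * (cidem mu * cidem ka * y))"
        unfolding G by (metis ctr_restr mult.assoc)
      also have "\<dots> = ctr (restr (Suc p) (chi la) * cidem mu * (cidem ka * y))" by (simp only: mult.assoc)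
      also have "\<dots> = ctr (gam mu ka * y)"
        using cov by (simp add: restr_chi_cidem[OF la mu] gam_def mult.assoc)
      finally have 3: "ctr (?G * y) = ctr (gam mu ka * y)" .
      have ne: "(of_int (cont la mu - cont mu ka) :: complex) \<noteq> 0"
        using cont_neq[OF mu la ka cov True] by simp
      have "of_int (cont la mu - cont mu ka) * T ka = ctr (gam mu ka * y)"
        using 1 2 3 by (simp add: algebra_simps)
      then show ?thesis using ne True by (simp add: field_simps)
    qed
  qed
  finally show ?thesis by (simp only: sum_if_filter[OF finite_parts])
qed

section \<open>Partial fractions\<close>

definition lin_prod :: "('i \<Rightarrow> complex) \<Rightarrow> 'i set \<Rightarrow> complex poly" where
  "lin_prod f I = (\<Prod>i\<in>I. [:- f i, 1:])"

lemma poly_lin_prod: "poly (lin_prod f I) z = (\<Prod>i\<in>I. z - f i)"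
  by (simp add: lin_prod_def poly_prod algebra_simps)

lemma lin_prod_degree:
  "finite I \<Longrightarrow> degree (lin_prod f I) = card I" "finite I \<Longrightarrow> lead_coeff (lin_prod f I) = 1"
  unfolding lin_prod_def
  by (subst degree_prod_sum_eq; simp) (simp add: lead_coeff_prod)

lemma lin_prod_subleading: "finite I \<Longrightarrow> card I = Suc k \<Longrightarrow> coeff (lin_prod f I) k = - (\<Sum>i\<in>I. f i)"
proof (induction I arbitrary: k rule: finite_induct)
  case (insert i I)
  then have k: "card I = k" by simp
  have "lin_prod f (insert i I) = [:- f i, 1:] * lin_prod f I"
    using insert by (simp add: lin_prod_def)
  then have eq: "coeff (lin_prod f (insert i I)) k = - f i * coeff (lin_prod f I) k + (if k = 0 then 0 else coeff (lin_prod f I) (k - 1))"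
    by (cases k) (simp_all add: coeff_pCons)
  have lead: "coeff (lin_prod f I) k = 1"
    using lin_prod_degree[OF insert(1), of f] k by simp
  show ?case
  proof (cases k)
    case 0 then show ?thesis using eq lead insert k by simp
  next
    case (Suc k') then show ?thesis using eq lead insert k by simp
  qed
qed simp

lemma poly_eq_0_many_roots:
  assumes "finite A" "inj_on g A" "degree p < card A" "\<And>a. a \<in> A \<Longrightarrow> poly p (g a) = (0 :: complex)"
  shows "p = 0"
proof (rule ccontr)
  assume "p \<noteq> 0"
  have "card A = card (g ` A)" using assms(2) by (simp add: card_image)
  also have "\<dots> \<le> card {x. poly p x = 0}"
    using assms(4) poly_roots_finite[OF \<open>p \<noteq> 0\<close>] by (intro card_mono) auto
  also have "\<dots> \<le> degree p" by (rule card_poly_roots_bound[OF \<open>p \<noteq> 0\<close>])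
  finally show False using assms(3) by simp
qed

text \<open>The residue at the simple pole \<open>g a\<close> of \<open>p\<close> divided by the
  product of all factors \<open>z - g a\<close>.\<close>

definition residue_coeff :: "('i \<Rightarrow> complex) \<Rightarrow> 'i set \<Rightarrow> complex poly \<Rightarrow> 'i \<Rightarrow> complex" where
  "residue_coeff g A p a = poly p (g a) * (\<Prod>a'\<in>A - {a}. inverse (g a - g a'))"

text \<open>Both sides have degree below \<open>card A\<close> and agree at the
  \<open>card A\<close> nodes.\<close>

lemma lagrange_interpolation:
  assumes "finite A" "inj_on g A" "degree p < card A"
  shows "p = (\<Sum>a\<in>A. smult (residue_coeff g A p a) (lin_prod g (A - {a})))"
proof -
  let ?q = "\<Sum>a\<in>A. smult (residue_coeff g A p a) (lin_prod g (A - {a}))"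
  have "degree (smult (residue_coeff g A p a) (lin_prod g (A - {a}))) \<le> card A - 1" if "a \<in> A" for a
    using that assms(1) by (intro order.trans[OF degree_smult_le]) (simp add: lin_prod_degree)
  then have "degree ?q \<le> card A - 1" using assms(1) by (intro degree_sum_le) auto
  then have deg: "degree (p - ?q) < card A"
    using assms(3) by (intro le_less_trans[OF degree_diff_le_max]) auto
  have "poly (p - ?q) (g a) = 0" if a: "a \<in> A" for a
  proof -
    have "poly ?q (g a) = (\<Sum>a'\<in>A. if a' = a then poly p (g a) else 0)"
      unfolding poly_sum
    proof (rule sum.cong[OF refl])
      fix a' assume a': "a' \<in> A"
      show "poly (smult (residue_coeff g A p a') (lin_prod g (A - {a'}))) (g a) = (if a' = a then poly p (g a) else 0)"
      proof (cases "a' = a")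
        case True
        have "(\<Prod>x\<in>A - {a}. inverse (g a - g x)) * (\<Prod>x\<in>A - {a}. g a - g x) = (\<Prod>x\<in>A - {a}. 1)"
          unfolding prod.distrib[symmetric]
          using assms(2) a by (intro prod.cong refl left_inverse) (auto simp: inj_on_def)
        then show ?thesis using True by (simp add: residue_coeff_def poly_lin_prod mult.assoc)
      next
        case False
        then have "(\<Prod>x\<in>A - {a'}. g a - g x) = 0" using a assms(1) by (intro prod_zero) auto
        then show ?thesis using False by (simp add: poly_lin_prod)
      qed
    qed
    also have "\<dots> = poly p (g a)" using a assms(1) by simp
    finally show ?thesis by simp
  qed
  then have "p - ?q = 0" by (intro poly_eq_0_many_roots[OF assms(1,2) deg])
  then show ?thesis by simp
qed

lemma partial_fractions:
  assumes "finite A" "inj_on g A" "degree p < card A" "z \<notin> g ` A"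
  shows "(\<Sum>a\<in>A. residue_coeff g A p a / (z - g a)) = poly p z * (\<Prod>a\<in>A. inverse (z - g a))"
proof -
  have "poly p z * (\<Prod>a\<in>A. inverse (z - g a)) = (\<Sum>a\<in>A. residue_coeff g A p a * (\<Prod>x\<in>A - {a}. z - g x) * (\<Prod>a\<in>A. inverse (z - g a)))"
    by (subst (1) lagrange_interpolation[OF assms(1-3)]) (simp add: poly_sum poly_lin_prod sum_distrib_right)
  also have "\<dots> = (\<Sum>a\<in>A. residue_coeff g A p a / (z - g a))"
  proof (rule sum.cong[OF refl])
    fix a assume a: "a \<in> A"
    have "(\<Prod>x\<in>A - {a}. z - g x) * (\<Prod>x\<in>A - {a}. inverse (z - g x)) = (\<Prod>x\<in>A - {a}. 1)"
      unfolding prod.distrib[symmetric] using assms(4) by (intro prod.cong refl) (auto simp: image_iff)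
    then have "(\<Prod>x\<in>A - {a}. z - g x) * (\<Prod>x\<in>A. inverse (z - g x)) = inverse (z - g a)"
      using a assms(1) by (subst prod.remove[of A a]) (auto simp: mult.left_commute)
    then show "residue_coeff g A p a * (\<Prod>x\<in>A - {a}. z - g x) * (\<Prod>a\<in>A. inverse (z - g a)) = residue_coeff g A p a / (z - g a)"
      by (simp add: mult.assoc divide_inverse)
  qed
  finally show ?thesis by simp
qed

lemma partial_fractions_prod:
  fixes f :: "'s \<Rightarrow> complex" and g :: "'i \<Rightarrow> complex"
  assumes "finite S" "finite A" "inj_on g A" "card S < card A" "z \<notin> g ` A"
  shows "(\<Sum>a\<in>A. (\<Prod>s\<in>S. g a - f s) * (\<Prod>a'\<in>A - {a}. inverse (g a - g a')) / (z - g a)) =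
    (\<Prod>s\<in>S. z - f s) * (\<Prod>a\<in>A. inverse (z - g a))"
  using partial_fractions[OF assms(2,3) _ assms(5), of "lin_prod f S"] assms(1,4)
  by (simp add: residue_coeff_def poly_lin_prod lin_prod_degree)

text \<open>Numerator and denominator are monic of equal degree. Their difference has smaller degree
  and agrees with the numerator at the poles, which leaves the constant 1. Comparing the
  coefficients just below the leading ones gives the sum of the residues.\<close>

lemma partial_fractions_balanced:
  fixes f g :: "'i \<Rightarrow> complex"
  assumes "finite A" "inj_on g A"
    and r_def: "r = (\<lambda>a. (\<Prod>s\<in>A. g a - f s) * (\<Prod>a'\<in>A - {a}. inverse (g a - g a')))"
  shows "z \<notin> g ` A \<Longrightarrow> 1 + (\<Sum>a\<in>A. r a / (z - g a)) = (\<Prod>a\<in>A. (z - f a) * inverse (z - g a))"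
    and "(\<Sum>a\<in>A. r a) = (\<Sum>a\<in>A. g a - f a)"
proof -
  let ?p = "lin_prod f A - lin_prod g A"
  have r: "residue_coeff g A ?p a = r a" if "a \<in> A" for a
  proof -
    have "(\<Prod>x\<in>A. g a - g x) = 0" using that assms(1) by (intro prod_zero) auto
    then show ?thesis by (simp add: residue_coeff_def poly_lin_prod r_def)
  qed
  have deg: "degree ?p < card A" if ne: "A \<noteq> {}"
  proof -
    obtain k where k: "card A = Suc k" using ne assms(1) by (cases "card A") auto
    have "coeff ?p i = 0" if "i > k" for i
    proof (cases "i = card A")
      case True
      then show ?thesis using lin_prod_degree[OF assms(1), of f] lin_prod_degree[OF assms(1), of g] by simp
    next
      case False
      then have "i > card A" using that k by simp
      then show ?thesis
        using coeff_eq_0[of "lin_prod f A" i] coeff_eq_0[of "lin_prod g A" i] by (simp add: lin_prod_degree[OF assms(1)])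
    qed
    then have "degree ?p \<le> k" by (intro degree_le) auto
    then show ?thesis using k by simp
  qed
  show "1 + (\<Sum>a\<in>A. r a / (z - g a)) = (\<Prod>a\<in>A. (z - f a) * inverse (z - g a))" if z: "z \<notin> g ` A"
  proof (cases "A = {}")
    case False
    have "(\<Prod>x\<in>A. z - g x) * (\<Prod>x\<in>A. inverse (z - g x)) = (\<Prod>x\<in>A. 1)"
      unfolding prod.distrib[symmetric] using z by (intro prod.cong refl) (auto simp: image_iff)
    moreover have "(\<Sum>a\<in>A. r a / (z - g a)) = poly ?p z * (\<Prod>a\<in>A. inverse (z - g a))"
      using partial_fractions[OF assms(1,2) deg[OF False] z] r by simp
    ultimately show ?thesis
      unfolding prod.distrib by (simp add: poly_lin_prod left_diff_distrib)
  qed simp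
  show "(\<Sum>a\<in>A. r a) = (\<Sum>a\<in>A. g a - f a)"
  proof (cases "A = {}")
    case False
    then obtain k where k: "card A = Suc k" using assms(1) by (cases "card A") auto
    have "coeff ?p k = coeff (\<Sum>a\<in>A. smult (residue_coeff g A ?p a) (lin_prod g (A - {a}))) k"
      by (rule arg_cong[OF lagrange_interpolation[OF assms(1,2) deg[OF False]]])
    \<comment> \<open>Every Lagrange basis polynomial is monic of degree \<open>k\<close>, so this
      coefficient collects exactly the residues.\<close>
    also have "\<dots> = (\<Sum>a\<in>A. r a)"
      unfolding coeff_sum
    proof (rule sum.cong[OF refl])
      fix a assume a: "a \<in> A"
      then have "card (A - {a}) = k" using k assms(1) by simp
      then have "coeff (lin_prod g (A - {a})) k = 1"
        using lin_prod_degree[of "A - {a}" g] assms(1) by simp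
      then show "coeff (smult (residue_coeff g A ?p a) (lin_prod g (A - {a}))) k = r a"
        using r[OF a] by simp
    qed
    finally show ?thesis
      by (simp add: lin_prod_subleading[OF assms(1) k] sum_subtractf)
  qed simp
qed

section \<open>Broken border strips\<close>

definition no_block :: "(nat \<times> nat) set \<Rightarrow> bool" where
  "no_block D \<longleftrightarrow> (\<nexists>i j. {(i, j), (Suc i, j), (i, Suc j), (Suc i, Suc j)} \<subseteq> D)"

lemma broken_border_strip_skew:
  "la \<turnstile>\<^sub>p n \<Longrightarrow> nu \<turnstile>\<^sub>p k \<Longrightarrow> diagram nu \<subseteq> diagram la \<Longrightarrow> broken_border_strip (skew la nu) \<longleftrightarrow> no_block (skew la nu)"
  unfolding broken_border_strip_def no_block_def skew_diagram_def by blast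

definition row_convex :: "(nat \<times> nat) set \<Rightarrow> bool" where
  "row_convex D \<longleftrightarrow> (\<forall>i j k l. (i, j) \<in> D \<longrightarrow> (i, l) \<in> D \<longrightarrow> j \<le> k \<longrightarrow> k \<le> l \<longrightarrow> (i, k) \<in> D)"

lemma row_convexD: "row_convex D \<Longrightarrow> (i, j) \<in> D \<Longrightarrow> (i, l) \<in> D \<Longrightarrow> j \<le> k \<Longrightarrow> k \<le> l \<Longrightarrow> (i, k) \<in> D"
  unfolding row_convex_def by blast

lemma skew_iff: "(i, j) \<in> skew la nu \<longleftrightarrow> row_len nu i \<le> j \<and> j < row_len la i"
  by (auto simp: skew_def diagram_iff)

lemma row_convex_skew: "row_convex (skew la nu)"
  unfolding row_convex_def by (auto simp: skew_iff)

lemma finite_skew [simp]: "finite (skew la nu)"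
  by (simp add: skew_def)

text \<open>Their number is the height of a broken border strip by \<open>strip_height_eq\<close>,
  so connected components disappear from the later argument.\<close>

definition vertical_pairs :: "(nat \<times> nat) set \<Rightarrow> (nat \<times> nat) set" where
  "vertical_pairs D = {(i, j). (i, j) \<in> D \<and> (Suc i, j) \<in> D}"

text \<open>Between two such positions in one row, convexity would complete a 2 by 2 block.\<close>

lemma vertical_pairs_unique:
  assumes "row_convex D" "no_block D" "(i, j) \<in> vertical_pairs D" "(i, l) \<in> vertical_pairs D"
  shows "j = l"
proof -
  have *: "\<not> a < b" if "(i, a) \<in> vertical_pairs D" "(i, b) \<in> vertical_pairs D" for a b
  proof
    assume "a < b"
    then have "(i, Suc a) \<in> D" "(Suc i, Suc a) \<in> D"
      using that row_convexD[OF assms(1), of _ a b "Suc a"] by (auto simp: vertical_pairs_def)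
    then show False using assms(2) that unfolding no_block_def vertical_pairs_def by blast
  qed
  show ?thesis using *[OF assms(3,4)] *[OF assms(4,3)] by simp
qed

lemma adjacent_sym: "sym (adjacent D)"
  unfolding sym_def adjacent_def by blast

lemma adjacent_in: "(x, y) \<in> adjacent D \<Longrightarrow> x \<in> D \<and> y \<in> D"
  unfolding adjacent_def by blast

lemma adjacent_path_in: "(x, y) \<in> (adjacent D)\<^sup>* \<Longrightarrow> x \<in> D \<Longrightarrow> y \<in> D"
  by (induction rule: rtrancl_induct) (auto dest: adjacent_in)

text \<open>A path that gets below row \<open>i\<close> must leave it by a vertical step, and the
  box where it does so is still connected to \<open>x\<close>.\<close>

lemma adjacent_path_crossing:
  assumes "(x, y) \<in> (adjacent D)\<^sup>*" "fst x \<le> i" "i < fst y"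
  shows "\<exists>j. (x, (i, j)) \<in> (adjacent D)\<^sup>* \<and> (i, j) \<in> vertical_pairs D"
  using assms
proof (induction rule: rtrancl_induct)
  case (step y z)
  show ?case
  proof (cases "i < fst y")
    case True then show ?thesis using step by blast
  next
    case False
    obtain a b c d where yz: "y = (a, b)" "z = (c, d)" by (metis surj_pair)
    have "a \<le> i" "i < c" using False step.prems yz by auto
    then have "a = i" "c = Suc i" "b = d" using step.hyps(2) unfolding yz adjacent_def by auto
    then show ?thesis
      using step.hyps adjacent_in[OF step.hyps(2)] yz by (auto simp: vertical_pairs_def)
  qed
qed simp

text \<open>In each component every row except the lowest contains exactly one box with a box below
  it: existence by connectedness, uniqueness by the absence of blocks.\<close>

lemma strip_height_eq:
  assumes fin: "finite D" and conv: "row_convex D" and nb: "no_block D"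
  shows "strip_height D = card (vertical_pairs D)"
proof -
  let ?r = "(adjacent D)\<^sup>*"
  let ?V = "\<lambda>C. {x \<in> vertical_pairs D. x \<in> C}"
  have symr: "sym ?r" by (rule sym_rtrancl[OF adjacent_sym])
  have eqv: "(x, y) \<in> ?r \<Longrightarrow> ?r `` {x} = ?r `` {y}" for x y
    using symD[OF symr] by (blast intro: rtrancl_trans)
  have fin_comp: "finite (strip_components D)"
    unfolding strip_components_def quotient_def using fin by auto
  have VD: "vertical_pairs D \<subseteq> D" by (auto simp: vertical_pairs_def)
  then have finV: "finite (vertical_pairs D)" using fin finite_subset by blast
  have "vertical_pairs D = (\<Union>C\<in>strip_components D. ?V C)"
    using VD by (auto simp: strip_components_def quotient_def)
  moreover have "card (\<Union>C\<in>strip_components D. ?V C) = (\<Sum>C\<in>strip_components D. card (?V C))"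
  proof (rule card_UN_disjoint[OF fin_comp])
    show "\<forall>C\<in>strip_components D. \<forall>C'\<in>strip_components D. C \<noteq> C' \<longrightarrow> ?V C \<inter> ?V C' = {}"
    proof (intro ballI impI)
      fix C C' assume C: "C \<in> strip_components D" "C' \<in> strip_components D" "C \<noteq> C'"
      obtain x x' where x: "C = ?r `` {x}" "C' = ?r `` {x'}"
        using C(1,2) unfolding strip_components_def quotient_def by blast
      have "C \<inter> C' = {}"
      proof (rule ccontr)
        assume "C \<inter> C' \<noteq> {}"
        then obtain z where "(x, z) \<in> ?r" "(x', z) \<in> ?r" unfolding x by blast
        then have "C = C'" unfolding x using eqv by metis
        then show False using C(3) by simp
      qed
      then show "?V C \<inter> ?V C' = {}" by blast
    qed
  qed (use finV in auto)
  moreover have "card (?V C) = card (fst ` C) - 1" if C: "C \<in> strip_components D" for C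
  proof -
    obtain x where x: "x \<in> D" "C = ?r `` {x}" using C unfolding strip_components_def quotient_def by blast
    have CD: "C \<subseteq> D" using adjacent_path_in x by blast
    have xC: "x \<in> C" using x by auto
    have finC: "finite (fst ` C)" using CD fin finite_subset by blast
    have "inj_on fst (?V C)"
      by (rule inj_onI) (use vertical_pairs_unique[OF conv nb] in \<open>force simp: prod_eq_iff\<close>)
    then have "card (?V C) = card (fst ` ?V C)" by (simp add: card_image)
    \<comment> \<open>Rows are numbered downwards, so the maximal row of the component is its lowest
      one and the only one without a vertical step.\<close>
    also have "fst ` ?V C = fst ` C - {Max (fst ` C)}"
    proof (intro equalityI subsetI)
      fix i assume "i \<in> fst ` ?V C"
      then obtain j where ij: "(i, j) \<in> vertical_pairs D" "(i, j) \<in> C" by auto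
      have "((i, j), (Suc i, j)) \<in> adjacent D" using ij(1) unfolding vertical_pairs_def adjacent_def by blast
      then have "(Suc i, j) \<in> C" using ij(2) x(2) by (auto intro: rtrancl_into_rtrancl)
      then have "Suc i \<le> Max (fst ` C)" using finC by (intro Max_ge) force+
      then show "i \<in> fst ` C - {Max (fst ` C)}" using ij(2) by force
    next
      fix i assume i: "i \<in> fst ` C - {Max (fst ` C)}"
      have "Max (fst ` C) \<in> fst ` C" using finC xC by (intro Max_in) auto
      then obtain y where y: "y \<in> C" "fst y = Max (fst ` C)" by auto
      have "i \<le> Max (fst ` C)" using i finC by (intro Max_ge) auto
      then have lt: "i < fst y" using i y by auto
      obtain z where z: "z \<in> C" "fst z = i" using i by auto
      have "(z, y) \<in> ?r" using y(1) z(1) x(2) eqv by blast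
      from adjacent_path_crossing[OF this _ lt] z(2)
      obtain j where "(z, (i, j)) \<in> ?r" "(i, j) \<in> vertical_pairs D" by auto
      moreover from this(1) have "(i, j) \<in> C" using z(1) x(2) by (auto intro: rtrancl_trans)
      ultimately show "i \<in> fst ` ?V C" by force
    qed
    also have "card \<dots> = card (fst ` C) - 1"
      using finC xC by (subst card_Diff_singleton) (auto intro!: Max_in)
    finally show ?thesis .
  qed
  ultimately show ?thesis by (simp add: strip_height_def)
qed

section \<open>The recursion for the coefficients\<close>

definition cc :: "nat \<times> nat \<Rightarrow> complex" where
  "cc b = of_int (box_content b)"

text \<open>The two missing neighbours cannot be missing because they belong to \<open>nu\<close>,
  which is closed to the left and upwards. So they are missing from \<open>mu\<close>, and dull
  boxes are outer corners of \<open>mu\<close>.\<close>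

lemma dull_boxes_skew:
  assumes mu: "mu \<turnstile>\<^sub>p m" and nu: "nu \<turnstile>\<^sub>p k"
  shows "(i, j) \<in> dull_boxes (skew mu nu) \<longleftrightarrow> i \<in> removable mu \<and> j = row_len mu i - 1 \<and> (i, j) \<notin> diagram nu"
  using row_len_mono[OF nu, of i "Suc i"]
  by (auto simp: dull_boxes_def skew_iff removable_def diagram_iff)

lemma bij_dull_boxes:
  assumes mu: "mu \<turnstile>\<^sub>p Suc m" and nu: "nu \<turnstile>\<^sub>p k" and sub: "diagram nu \<subseteq> diagram mu"
  shows "bij_betw (new_box mu) {ka. ka \<in> parts m \<and> ka \<nearrow> mu \<and> diagram nu \<subseteq> diagram ka} (dull_boxes (skew mu nu))"
  unfolding bij_betw_def
proof
  show "inj_on (new_box mu) {ka. ka \<in> parts m \<and> ka \<nearrow> mu \<and> diagram nu \<subseteq> diagram ka}"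
  proof (rule inj_onI)
    fix a b assume "a \<in> {ka. ka \<in> parts m \<and> ka \<nearrow> mu \<and> diagram nu \<subseteq> diagram ka}"
      "b \<in> {ka. ka \<in> parts m \<and> ka \<nearrow> mu \<and> diagram nu \<subseteq> diagram ka}" "new_box mu a = new_box mu b"
    then show "a = b"
      using inj_onD[OF bij_betw_imp_inj_on[OF bij_down_covers[OF mu]], of a b] by simp
  qed
  show "new_box mu ` {ka. ka \<in> parts m \<and> ka \<nearrow> mu \<and> diagram nu \<subseteq> diagram ka} = dull_boxes (skew mu nu)"
  proof (intro equalityI subsetI)
    fix b assume "b \<in> new_box mu ` {ka. ka \<in> parts m \<and> ka \<nearrow> mu \<and> diagram nu \<subseteq> diagram ka}"
    then obtain ka where ka: "ka \<turnstile>\<^sub>p m" "ka \<nearrow> mu" "diagram nu \<subseteq> diagram ka" "b = new_box mu ka" by auto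
    have "b = (fst b, row_len mu (fst b) - 1)" using add_box_row_len(3)[OF ka(2) mu] ka(4) by simp
    moreover have "fst b \<in> removable mu" using down_cover_removable[OF ka(2,1) mu] ka(4) by simp
    moreover have "b \<notin> diagram nu" using new_box(1)[OF ka(2)] ka(3,4) by blast
    ultimately show "b \<in> dull_boxes (skew mu nu)"
      using dull_boxes_skew[OF mu nu, of "fst b" "snd b"] by (metis prod.collapse snd_conv)
  next
    fix b assume "b \<in> dull_boxes (skew mu nu)"
    then obtain i where b: "b = (i, row_len mu i - 1)" "i \<in> removable mu" "b \<notin> diagram nu"
      using dull_boxes_skew[OF mu nu] by (metis prod.collapse)
    obtain ka where ka: "ka \<turnstile>\<^sub>p m" "ka \<nearrow> mu" "new_box mu ka = b"
      using removable_down_cover[OF mu b(2)] b(1) by (metis diff_Suc_1)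
    then have "diagram nu \<subseteq> diagram ka" using new_box(2)[OF ka(2)] sub b(3) by auto
    then show "b \<in> new_box mu ` {ka. ka \<in> parts m \<and> ka \<nearrow> mu \<and> diagram nu \<subseteq> diagram ka}"
      using ka by auto
  qed
qed

text \<open>Contents of removable corners decrease strictly from top to bottom, so all poles are
  simple.\<close>

lemma inj_content_dull:
  assumes mu: "mu \<turnstile>\<^sub>p m" and nu: "nu \<turnstile>\<^sub>p k"
  shows "inj_on cc (dull_boxes (skew mu nu))"
proof (rule inj_onI, clarify)
  fix i j i' j' assume *: "(i, j) \<in> dull_boxes (skew mu nu)" "(i', j') \<in> dull_boxes (skew mu nu)" "cc (i, j) = cc (i', j')"
  note d = *(1,2)[unfolded dull_boxes_skew[OF mu nu]]
  have eq: "int j - int i = int j' - int i'" using *(3) unfolding cc_def of_int_eq_iff box_content_def by simp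
  have pos: "0 < row_len mu i" "0 < row_len mu i'" using d by (auto simp: removable_def)
  have j: "int j = int (row_len mu i) - 1" "int j' = int (row_len mu i') - 1"
    using d pos by (simp_all add: of_nat_diff)
  have "\<not> i < i'" using removable_less[OF mu, of i i'] d(1) eq j by auto
  moreover have "\<not> i' < i" using removable_less[OF mu, of i' i] d(2) eq j by auto
  ultimately show "i = i' \<and> j = j'" using eq by auto
qed

lemma finite_dull [simp]: "finite D \<Longrightarrow> finite (dull_boxes D)"
  by (rule finite_subset[of _ D]) (auto simp: dull_boxes_def)

lemma finite_sharp [simp]: "finite D \<Longrightarrow> finite (sharp_corners D)"
  by (rule finite_subset[of _ D]) (auto simp: sharp_corners_def)

lemma skew_down_closed:
  "nu \<turnstile>\<^sub>p k \<Longrightarrow> (i, j) \<in> skew mu nu \<Longrightarrow> i \<le> i' \<Longrightarrow> j \<le> j' \<Longrightarrow> (i', j') \<in> diagram mu \<Longrightarrow> (i', j') \<in> skew mu nu"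
  using row_len_mono[of nu k i i'] by (auto simp: skew_iff diagram_iff)

text \<open>The end of the row of a sharp corner is dull, and the lowest row of the strip contains a
  dull box but no sharp corner.\<close>

lemma card_sharp_less_dull:
  assumes mu: "mu \<turnstile>\<^sub>p m" and nu: "nu \<turnstile>\<^sub>p k" and nb: "no_block (skew mu nu)" and ne: "skew mu nu \<noteq> {}"
  shows "card (sharp_corners (skew mu nu)) < card (dull_boxes (skew mu nu))"
proof -
  let ?D = "skew mu nu"
  let ?f = "\<lambda>x::nat \<times> nat. (fst x, row_len mu (fst x) - 1)"
  have dull: "?f x \<in> dull_boxes ?D" if x: "x \<in> sharp_corners ?D" for x
  proof -
    obtain i j where ij: "x = (i, j)" by (cases x)
    have D: "(i, j) \<in> ?D" "(Suc i, j) \<in> ?D" "(i, Suc j) \<in> ?D" using x ij by (auto simp: sharp_corners_def)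
    \<comment> \<open>Otherwise the box diagonally below the sharp corner would complete a
      block.\<close>
    have "row_len mu (Suc i) \<le> row_len mu i - 1"
    proof (rule ccontr)
      assume "\<not> row_len mu (Suc i) \<le> row_len mu i - 1"
      then have "(Suc i, Suc j) \<in> ?D"
        using D skew_down_closed[OF nu D(3), of "Suc i" "Suc j"] by (auto simp: skew_iff diagram_iff)
      then show False using nb D unfolding no_block_def by blast
    qed
    then have "i \<in> removable mu" using D by (auto simp: removable_def skew_iff)
    moreover have "(i, row_len mu i - 1) \<notin> diagram nu" using D by (auto simp: skew_iff diagram_iff)
    ultimately show ?thesis using dull_boxes_skew[OF mu nu] ij by simp
  qed
  have inj: "inj_on ?f (sharp_corners ?D)"
  proof (rule inj_onI)
    fix x y assume xy: "x \<in> sharp_corners ?D" "y \<in> sharp_corners ?D" "?f x = ?f y"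
    then have "(fst x, snd x) \<in> vertical_pairs ?D" "(fst x, snd y) \<in> vertical_pairs ?D"
      by (auto simp: sharp_corners_def vertical_pairs_def)
    then have "snd x = snd y" by (rule vertical_pairs_unique[OF row_convex_skew nb])
    then show "x = y" using xy(3) by (simp add: prod_eq_iff)
  qed
  define M where "M = Max (fst ` ?D)"
  have "M \<in> fst ` ?D" unfolding M_def using ne by (intro Max_in) auto
  then obtain j where Mj: "(M, j) \<in> ?D" by auto
  have Max: "i \<le> M" if "(i, l) \<in> ?D" for i l
    unfolding M_def using that by (intro Max_ge) force+
  have "row_len mu (Suc M) \<le> j"
  proof (rule ccontr)
    assume "\<not> row_len mu (Suc M) \<le> j"
    then have "(Suc M, j) \<in> ?D" using skew_down_closed[OF nu Mj, of "Suc M" j] by (simp add: diagram_iff)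
    then show False using Max by fastforce
  qed
  then have last: "(M, row_len mu M - 1) \<in> dull_boxes ?D"
    using Mj by (auto simp: dull_boxes_skew[OF mu nu] removable_def skew_iff diagram_iff)
  have "?f ` sharp_corners ?D \<subseteq> dull_boxes ?D - {(M, row_len mu M - 1)}"
  proof
    fix y assume "y \<in> ?f ` sharp_corners ?D"
    then obtain x where x: "x \<in> sharp_corners ?D" "y = ?f x" by blast
    then have "(Suc (fst x), snd x) \<in> ?D" by (auto simp: sharp_corners_def)
    then have "Suc (fst x) \<le> M" by (rule Max)
    then show "y \<in> dull_boxes ?D - {(M, row_len mu M - 1)}" using dull[OF x(1)] x(2) by auto
  qed
  then have "card (sharp_corners ?D) \<le> card (dull_boxes ?D - {(M, row_len mu M - 1)})"
    using inj by (intro card_inj_on_le) auto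
  also have "\<dots> < card (dull_boxes ?D)"
    using last by (intro psubset_card_mono) auto
  finally show ?thesis .
qed

text \<open>The rational function that has coefficients \<open>phi\<close> both as residues at the
  dull boxes of the strip and as value at the content of an added box.\<close>

definition strip_fun :: "(nat \<times> nat) set \<Rightarrow> complex \<Rightarrow> complex" where
  "strip_fun D z = (-1) ^ card (vertical_pairs D) * (\<Prod>s\<in>sharp_corners D. z - cc s) * (\<Prod>d\<in>dull_boxes D. inverse (z - cc d))"

lemma phi_eq:
  assumes "la \<turnstile>\<^sub>p n" "nu \<turnstile>\<^sub>p k" "diagram nu \<subseteq> diagram la"
  shows "phi la mu nu = (if no_block (skew la nu) then
     (-1) ^ card (vertical_pairs (skew la nu)) * (\<Prod>s\<in>sharp_corners (skew la nu). cc (new_box la mu) - cc s)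
     * (\<Prod>d\<in>dull_boxes (skew la nu) - {new_box la mu}. inverse (cc (new_box la mu) - cc d)) else 0)"
  using strip_height_eq[OF finite_skew row_convex_skew[of la nu]]
  by (simp add: phi_def Let_def new_box_def[symmetric] broken_border_strip_skew[OF assms] cc_def)

lemma skew_add_box:
  assumes "mu \<nearrow> la" "diagram nu \<subseteq> diagram mu"
  shows "skew la nu = insert (new_box la mu) (skew mu nu)" "new_box la mu \<notin> skew mu nu"
  using new_box[OF assms(1)] assms(2) by (auto simp: skew_def)

lemma new_box_corner:
  assumes mu: "mu \<turnstile>\<^sub>p m" and la: "la \<turnstile>\<^sub>p n" and cov: "mu \<nearrow> la"
  shows "(Suc (fst (new_box la mu)), snd (new_box la mu)) \<notin> diagram la"
    "(fst (new_box la mu), Suc (snd (new_box la mu))) \<notin> diagram la"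
proof -
  note r = add_box_row_len[OF cov la]
  have s: "snd (new_box la mu) = row_len la (fst (new_box la mu)) - 1" using r(3) by (metis snd_conv)
  have "row_len la (Suc (fst (new_box la mu))) = row_len mu (Suc (fst (new_box la mu)))" using r(2) by simp
  also have "\<dots> \<le> row_len mu (fst (new_box la mu))" using row_len_mono[OF mu] by simp
  finally show "(Suc (fst (new_box la mu)), snd (new_box la mu)) \<notin> diagram la"
    "(fst (new_box la mu), Suc (snd (new_box la mu))) \<notin> diagram la"
    using s r(1) by (auto simp: diagram_iff)
qed

text \<open>Adding the corner \<open>b\<close> changes the status only of its left and upper
  neighbours. The left one contributes the factor 1; the upper one contributes -1, which the
  additional vertical pair compensates.\<close>

lemma strip_fun_add_box:
  assumes D: "D = insert b D'" "b \<notin> D'" "finite D'"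
    and corner: "(Suc (fst b), snd b) \<notin> D" "(fst b, Suc (snd b)) \<notin> D"
  shows "(-1) ^ card (vertical_pairs D) * (\<Prod>s\<in>sharp_corners D. cc b - cc s)
     * (\<Prod>d\<in>dull_boxes D - {b}. inverse (cc b - cc d)) = strip_fun D' (cc b)"
proof -
  define below where "below = (\<lambda>x::nat \<times> nat. (Suc (fst x), snd x))"
  define right where "right = (\<lambda>x::nat \<times> nat. (fst x, Suc (snd x)))"
  \<comment> \<open>A left neighbour with a box below becomes sharp (\<open>L1\<close>); one without
    was dull and ceases to be so (\<open>L2\<close>). \<open>U1\<close> and \<open>U2\<close> play
    these roles for the upper neighbour and the box to its right.\<close>
  define L1 where "L1 = {x \<in> D'. right x = b \<and> below x \<in> D'}"
  define L2 where "L2 = {x \<in> D'. right x = b \<and> below x \<notin> D'}"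
  define U1 where "U1 = {x \<in> D'. below x = b \<and> right x \<in> D'}"
  define U2 where "U2 = {x \<in> D'. below x = b \<and> right x \<notin> D'}"
  have SC: "sharp_corners A = {x \<in> A. below x \<in> A \<and> right x \<in> A}" for A
    by (auto simp: sharp_corners_def below_def right_def)
  have DB: "dull_boxes A = {x \<in> A. below x \<notin> A \<and> right x \<notin> A}" for A
    by (auto simp: dull_boxes_def below_def right_def)
  have VP: "vertical_pairs A = {x \<in> A. below x \<in> A}" for A
    by (auto simp: vertical_pairs_def below_def)
  have b: "below b \<notin> D" "right b \<notin> D" using corner by (auto simp: below_def right_def)
  have ne: "below x \<noteq> right x" for x by (simp add: below_def right_def)
  have ne2: "\<not> (right x = b \<and> below x = b)" for x using ne by metis
  have fin: "finite L1" "finite L2" "finite U1" "finite U2" "finite (sharp_corners D')"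
    "finite (dull_boxes D - {b})" "finite (vertical_pairs D')"
    using D(3) by (auto simp: L1_def L2_def U1_def U2_def SC DB VP D(1))
  have sc: "sharp_corners D = sharp_corners D' \<union> L1 \<union> U1"
    using b ne D(2) unfolding SC L1_def U1_def D(1) by auto metis+
  have db: "dull_boxes D' = (dull_boxes D - {b}) \<union> L2 \<union> U2"
    using b ne D(2) unfolding DB L2_def U2_def D(1) by auto
  have vp: "vertical_pairs D = vertical_pairs D' \<union> U1 \<union> U2"
    using b D(2) unfolding VP U1_def U2_def D(1) by auto
  have L: "cc b - cc x = 1" if "right x = b" for x
    using that by (auto simp: right_def cc_def box_content_def)
  have U: "cc b - cc x = - 1" if "below x = b" for x
    using that by (auto simp: below_def cc_def box_content_def)
  have 1: "(\<Prod>s\<in>sharp_corners D. cc b - cc s) = (\<Prod>s\<in>sharp_corners D'. cc b - cc s) * (-1) ^ card U1"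
  proof -
    have "(\<Prod>s\<in>sharp_corners D. cc b - cc s) =
      (\<Prod>s\<in>sharp_corners D'. cc b - cc s) * (\<Prod>s\<in>L1. cc b - cc s) * (\<Prod>s\<in>U1. cc b - cc s)"
    proof -
      have "(sharp_corners D' \<union> L1) \<inter> U1 = {}" "sharp_corners D' \<inter> L1 = {}"
        using ne2 D(2) unfolding SC L1_def U1_def by auto
      then show ?thesis unfolding sc using fin by (simp add: prod.union_disjoint)
    qed
    moreover have "(\<Prod>s\<in>L1. cc b - cc s) = 1" using L by (intro prod.neutral) (auto simp: L1_def)
    moreover have "(\<Prod>s\<in>U1. cc b - cc s) = (\<Prod>s\<in>U1. -1)" using U by (intro prod.cong) (auto simp: U1_def)
    ultimately show ?thesis by simp
  qed
  have 2: "(\<Prod>d\<in>dull_boxes D'. inverse (cc b - cc d)) = (\<Prod>d\<in>dull_boxes D - {b}. inverse (cc b - cc d)) * (-1) ^ card U2"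
  proof -
    have "(\<Prod>d\<in>dull_boxes D'. inverse (cc b - cc d)) = (\<Prod>d\<in>dull_boxes D - {b}. inverse (cc b - cc d))
       * (\<Prod>d\<in>L2. inverse (cc b - cc d)) * (\<Prod>d\<in>U2. inverse (cc b - cc d))"
    proof -
      have "((dull_boxes D - {b}) \<union> L2) \<inter> U2 = {}" "(dull_boxes D - {b}) \<inter> L2 = {}"
        using ne2 unfolding DB L2_def U2_def D(1) by auto
      then show ?thesis unfolding db using fin by (simp add: prod.union_disjoint)
    qed
    moreover have "(\<Prod>d\<in>L2. inverse (cc b - cc d)) = 1" using L by (intro prod.neutral) (auto simp: L2_def)
    moreover have "(\<Prod>d\<in>U2. inverse (cc b - cc d)) = (\<Prod>d\<in>U2. -1)" using U by (intro prod.cong) (auto simp: U2_def)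
    ultimately show ?thesis by simp
  qed
  have 3: "card (vertical_pairs D) = card (vertical_pairs D') + card U1 + card U2"
  proof -
    have "(vertical_pairs D' \<union> U1) \<inter> U2 = {}" "vertical_pairs D' \<inter> U1 = {}"
      using D(2) unfolding VP U1_def U2_def by auto
    then show ?thesis unfolding vp using fin by (simp add: card_Un_disjoint)
  qed
  \<comment> \<open>For \<open>U1\<close> the sign occurs twice on the left, in the sharp corners
    and in the vertical pairs; for \<open>U2\<close> it occurs once on each side.\<close>
  have 4: "(-1 :: complex) ^ card U1 * (-1) ^ card U1 = 1"
    by (simp add: power_add[symmetric] flip: mult_2)
  show ?thesis
    unfolding strip_fun_def 1 2 3 power_add using 4 by (simp add: ac_simps)
qed

text \<open>Adding the box may create a block. Then the box diagonally above it is a sharp corner of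
  \<open>mu/nu\<close> on the same diagonal, and its factor makes the rational function vanish, in
  agreement with the zero case of \<open>phi\<close>.\<close>

lemma phi_strip_fun:
  assumes mu: "mu \<turnstile>\<^sub>p m" and la: "la \<turnstile>\<^sub>p n" and cov: "mu \<nearrow> la" and nu: "nu \<turnstile>\<^sub>p k"
    and sub: "diagram nu \<subseteq> diagram mu"
  shows "phi la mu nu = (if no_block (skew mu nu) then strip_fun (skew mu nu) (cc (new_box la mu)) else 0)"
proof -
  let ?D = "skew la nu" and ?D' = "skew mu nu" and ?b = "new_box la mu"
  note D = skew_add_box[OF cov sub]
  have sub': "diagram nu \<subseteq> diagram la" using sub add_box_subset[OF cov] by blast
  have corner: "(Suc (fst ?b), snd ?b) \<notin> ?D" "(fst ?b, Suc (snd ?b)) \<notin> ?D"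
    using new_box_corner[OF mu la cov] by (auto simp: skew_def)
  have eq: "phi la mu nu = (if no_block ?D then strip_fun ?D' (cc ?b) else 0)"
    unfolding phi_eq[OF la nu sub'] using strip_fun_add_box[OF D finite_skew corner] by simp
  show ?thesis
  proof (cases "no_block ?D'")
    case False
    then have "\<not> no_block ?D" unfolding no_block_def D(1) by blast
    then show ?thesis using eq False by simp
  next
    case nb: True
    show ?thesis
    proof (cases "no_block ?D")
      case True then show ?thesis using eq nb by simp
    next
      case False
      then obtain i j where ij: "{(i, j), (Suc i, j), (i, Suc j), (Suc i, Suc j)} \<subseteq> ?D"
        unfolding no_block_def by blast
      have "(i, j) \<noteq> ?b" "(Suc i, j) \<noteq> ?b" "(i, Suc j) \<noteq> ?b"
        using corner ij by (metis fst_conv snd_conv insert_subset)+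
      then have in': "(i, j) \<in> ?D'" "(Suc i, j) \<in> ?D'" "(i, Suc j) \<in> ?D'" using ij D(1) by auto
      then have "(Suc i, Suc j) \<notin> ?D'" using nb unfolding no_block_def by blast
      then have b: "?b = (Suc i, Suc j)" using ij D(1) by auto
      have "(i, j) \<in> sharp_corners ?D'" using in' by (auto simp: sharp_corners_def)
      moreover have "cc ?b - cc (i, j) = 0" unfolding b by (simp add: cc_def box_content_def)
      ultimately have "(\<Prod>s\<in>sharp_corners ?D'. cc ?b - cc s) = 0"
        by (intro prod_zero) auto
      then have "strip_fun ?D' (cc ?b) = 0" by (simp add: strip_fun_def)
      then show ?thesis using eq nb by simp
    qed
  qed
qed

text \<open>\<open>phi mu ka nu\<close> omits the factor of the removed box, so it is a residue,
  while \<open>phi la mu nu\<close> is a value of the same function. With a block in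
  \<open>mu/nu\<close> both sides are 0.\<close>

theorem phi_step:
  assumes mu: "mu \<turnstile>\<^sub>p Suc m" and la: "la \<turnstile>\<^sub>p n" and cov: "mu \<nearrow> la" and nu: "nu \<turnstile>\<^sub>p k"
    and sub: "diagram nu \<subseteq> diagram mu" and ne: "nu \<noteq> mu"
  shows "phi la mu nu = (\<Sum>ka | ka \<in> parts m \<and> ka \<nearrow> mu \<and> diagram nu \<subseteq> diagram ka.
    phi mu ka nu / of_int (cont la mu - cont mu ka))"
proof -
  let ?D' = "skew mu nu" and ?z = "cc (new_box la mu)"
  let ?K = "{ka. ka \<in> parts m \<and> ka \<nearrow> mu \<and> diagram nu \<subseteq> diagram ka}"
  note bij = bij_dull_boxes[OF mu nu sub]
  have contz: "of_int (cont la mu - cont mu ka) = ?z - cc (new_box mu ka)" for ka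
    by (simp add: cont_def cc_def)
  have nonempty: "?D' \<noteq> {}"
  proof
    assume "?D' = {}"
    then have "diagram mu = diagram nu" using sub by (auto simp: skew_def)
    then show False using ne diagram_inj[OF nu mu] by simp
  qed
  show ?thesis
  proof (cases "no_block ?D'")
    case False
    have "phi mu ka nu = 0" if "ka \<in> ?K" for ka
      using that False by (subst phi_eq[OF mu nu sub]) simp
    then show ?thesis using False phi_strip_fun[OF mu la cov nu sub] by simp
  next
    case True
    let ?r = "\<lambda>d. (\<Prod>s\<in>sharp_corners ?D'. cc d - cc s) * (\<Prod>d'\<in>dull_boxes ?D' - {d}. inverse (cc d - cc d'))"
    have z: "?z \<notin> cc ` dull_boxes ?D'"
    proof
      assume "?z \<in> cc ` dull_boxes ?D'"
      then obtain ka where "ka \<in> ?K" "?z = cc (new_box mu ka)"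
        using bij by (metis (no_types, lifting) bij_betw_def image_iff)
      then show False using cont_neq[OF mu la _ cov, of ka m] by (auto simp: cont_def cc_def)
    qed
    have "(\<Sum>ka\<in>?K. phi mu ka nu / of_int (cont la mu - cont mu ka)) =
      (\<Sum>ka\<in>?K. (-1) ^ card (vertical_pairs ?D') * (?r (new_box mu ka) / (?z - cc (new_box mu ka))))"
      using True by (intro sum.cong refl) (simp only: contz phi_eq[OF mu nu sub] if_True times_divide_eq_right mult.assoc)
    also have "\<dots> = (\<Sum>d\<in>dull_boxes ?D'. (-1) ^ card (vertical_pairs ?D') * (?r d / (?z - cc d)))"
      by (rule sum.reindex_bij_betw[OF bij])
    also have "\<dots> = (-1) ^ card (vertical_pairs ?D') * (\<Sum>d\<in>dull_boxes ?D'. ?r d / (?z - cc d))"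
      by (simp only: sum_distrib_left)
    also have "(\<Sum>d\<in>dull_boxes ?D'. ?r d / (?z - cc d)) =
      (\<Prod>s\<in>sharp_corners ?D'. ?z - cc s) * (\<Prod>d\<in>dull_boxes ?D'. inverse (?z - cc d))"
      by (rule partial_fractions_prod[OF _ _ inj_content_dull[OF mu nu] card_sharp_less_dull[OF mu nu True nonempty] z]) auto
    finally show ?thesis using True phi_strip_fun[OF mu la cov nu sub] by (simp add: strip_fun_def mult.assoc)
  qed
qed

lemma phi_self:
  assumes mu: "mu \<turnstile>\<^sub>p m" and la: "la \<turnstile>\<^sub>p n" and cov: "mu \<nearrow> la"
  shows "phi la mu mu = 1"
proof -
  have "skew mu mu = {}" by (simp add: skew_def)
  then show ?thesis
    using phi_strip_fun[OF mu la cov mu]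
    by (simp add: no_block_def strip_fun_def vertical_pairs_def sharp_corners_def dull_boxes_def)
qed

section \<open>The Pieri rule\<close>

text \<open>Injective on the letters up to \<open>m\<close> and constant on the later ones; the
  value 0 is free because letters start at 1. The stabilizer is the symmetric group of the later
  letters.\<close>

definition block_fun :: "nat \<Rightarrow> nat \<Rightarrow> nat" where
  "block_fun m x = (if m < x then 0 else x)"

lemma stab_block_fun: "stab (m + k) (block_fun m) = {p. p permutes {m<..m + k}}"
proof (intro equalityI subsetI CollectI)
  fix p assume "p \<in> stab (m + k) (block_fun m)"
  then have p: "p permutes {1..m + k}" "\<And>x. x \<in> {1..m + k} \<Longrightarrow> block_fun m (p x) = block_fun m x"
    by (auto simp: stab_def)
  have "p x = x" if "x \<notin> {m<..m + k}" for x
  proof (cases "x \<in> {1..m + k}")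
    case True
    then have "block_fun m (p x) = x" "x \<ge> 1" using p(2)[of x] that by (auto simp: block_fun_def)
    then show ?thesis by (auto simp: block_fun_def split: if_splits)
  next
    case False then show ?thesis using p(1) by (simp add: permutes_def)
  qed
  then show "p permutes {m<..m + k}"
    using p(1) by (simp add: permutes_def)
next
  fix p assume "p \<in> {p. p permutes {m<..m + k}}"
  then have p: "p permutes {m<..m + k}" by simp
  have "p permutes {1..m + k}" by (rule permutes_subset[OF p]) auto
  moreover have "block_fun m (p x) = block_fun m x" for x
    using permutes_in_image[OF p, of x] permutes_not_in[OF p, of x] by (cases "x \<in> {m<..m + k}") (auto simp: block_fun_def)
  ultimately show "p \<in> stab (m + k) (block_fun m)" by (simp add: stab_def)
qed

text \<open>The idempotent of the trivial representation of the group of the last \<open>k\<close>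
  letters.\<close>

definition symmetrizer :: "nat \<Rightarrow> nat \<Rightarrow> galg" where
  "symmetrizer m k = (1 / fact k) \<cdot>\<^sub>g row_sum (m + k) (block_fun m)"

lemma symmetrizer_eq: "symmetrizer m k = (1 / fact k) \<cdot>\<^sub>g (\<Sum>p | p permutes {m<..m + k}. \<delta> p)"
  by (simp add: symmetrizer_def row_sum_def stab_block_fun)

lemma supp_in_symmetrizer [simp, intro]: "supp_in (m + k) (symmetrizer m k)"
  by (auto simp: symmetrizer_def)

lemma symmetrizer_0 [simp]: "symmetrizer m 0 = 1"
  by (simp add: symmetrizer_eq)

lemma card_block: "card (stab (m + k) (block_fun m)) = fact k"
  unfolding stab_block_fun by (subst card_permutations[of _ k]) auto

lemma symmetrizer_idem: "symmetrizer m k * symmetrizer m k = symmetrizer m k"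
  unfolding symmetrizer_def
  by (simp add: row_sum_mult_sub[OF subset_refl] card_block)

lemma symmetrizer_absorb:
  "p permutes {m<..m + k} \<Longrightarrow> symmetrizer m k * \<delta> p = symmetrizer m k"
  "p permutes {m<..m + k} \<Longrightarrow> \<delta> p * symmetrizer m k = symmetrizer m k"
  using row_sum_absorb[of p "m + k" "block_fun m"] unfolding symmetrizer_def stab_block_fun by simp_all

lemma symmetrizer_commute:
  assumes "supp_in m y" shows "symmetrizer m k * y = y * symmetrizer m k"
proof -
  have "\<delta> p * \<delta> w = \<delta> w * \<delta> p" if w: "w permutes {1..m}" and p: "p permutes {m<..m + k}" for w p
  proof -
    have "p \<circ> w = w \<circ> p"
    proof
      fix x
      show "(p \<circ> w) x = (w \<circ> p) x"
        using permutes_in_image[OF w, of x] permutes_not_in[OF w] permutes_in_image[OF p, of x] permutes_not_in[OF p]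
        by (cases "x \<in> {1..m}"; cases "x \<in> {m<..m + k}") auto
    qed
    moreover have "w permutes {1..m + k}" "p permutes {1..m + k}"
      by (auto intro: permutes_subset[OF w] permutes_subset[OF p])
    ultimately show ?thesis by (simp add: delta_mult[of _ "m + k"])
  qed
  then have "symmetrizer m k * \<delta> w = \<delta> w * symmetrizer m k" if "w permutes {1..m}" for w
    unfolding symmetrizer_eq gscale_mult sum_distrib_left sum_distrib_right
    using that by (intro arg_cong2[where f = gscale] sum.cong refl) auto
  then show ?thesis
    by (subst (1 2) galg_expand[OF assms]) (simp add: sum_distrib_left sum_distrib_right)
qed

text \<open>Coset decomposition of the symmetric group on the last \<open>k + 1\<close> letters.\<close>

lemma symmetrizer_Suc:
  fixes m k :: nat
  assumes "k > 0"
  defines "s \<equiv> transpose (m + k) (Suc (m + k))"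
  shows "of_nat (Suc k) \<cdot>\<^sub>g symmetrizer m (Suc k) =
    symmetrizer m k + of_nat k \<cdot>\<^sub>g (symmetrizer m k * \<delta> s * symmetrizer m k)"
proof -
  let ?S = "{m<..m + k}" and ?n = "Suc (m + k)"
  let ?e = "symmetrizer m k" and ?e' = "symmetrizer m (Suc k)"
  have Q: "(\<Sum>p | p permutes ?S. \<delta> p) = fact k \<cdot>\<^sub>g ?e" by (simp add: symmetrizer_eq)
  have ins: "{m<..m + Suc k} = insert ?n ?S" by auto
  have "(\<Sum>p | p permutes {m<..m + Suc k}. \<delta> p) = (\<Sum>b\<in>insert ?n ?S. \<Sum>q | q permutes ?S. \<delta> (transpose ?n b \<circ> q))"
    unfolding ins by (rule sum_over_permutations_insert) auto
  also have "\<dots> = (\<Sum>b\<in>insert ?n ?S. \<delta> (transpose ?n b) * (fact k \<cdot>\<^sub>g ?e))"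
  proof (rule sum.cong[OF refl])
    fix b assume b: "b \<in> insert ?n ?S"
    have "transpose ?n b permutes {1..?n}" using b by (intro transpose_permutes) auto
    moreover have "q permutes {1..?n}" if "q permutes ?S" for q using that by (rule permutes_subset) auto
    ultimately show "(\<Sum>q | q permutes ?S. \<delta> (transpose ?n b \<circ> q)) = \<delta> (transpose ?n b) * (fact k \<cdot>\<^sub>g ?e)"
      unfolding Q[symmetric] sum_distrib_left by (intro sum.cong refl) (simp add: delta_mult[of _ ?n])
  qed
  also have "\<dots> = fact k \<cdot>\<^sub>g (?e + (\<Sum>b\<in>?S. \<delta> (transpose ?n b) * ?e))"
    by (simp add: gscale_distrib gscale_sum)
  moreover have "fact (Suc k) \<cdot>\<^sub>g ?e' = (\<Sum>p | p permutes {m<..m + Suc k}. \<delta> p)"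
    by (simp add: symmetrizer_eq del: fact_Suc)
  ultimately have W: "fact (Suc k) \<cdot>\<^sub>g ?e' = fact k \<cdot>\<^sub>g (?e + (\<Sum>b\<in>?S. \<delta> (transpose ?n b) * ?e))"
    by (simp only:)
  have "?e * ?e' = ?e'"
  proof -
    have "\<delta> p * ?e' = ?e'" if "p permutes ?S" for p
      by (rule symmetrizer_absorb(2), rule permutes_subset[OF that]) auto
    then have "fact k \<cdot>\<^sub>g (?e * ?e') = (\<Sum>p | p permutes ?S. ?e')"
      unfolding gscale_mult(1)[symmetric] Q[symmetric] sum_distrib_right by (intro sum.cong) auto
    also have "\<dots> = fact k \<cdot>\<^sub>g ?e'"
      by (simp add: of_nat_galg card_permutations[of ?S k])
    finally have "(1 / fact k) \<cdot>\<^sub>g fact k \<cdot>\<^sub>g (?e * ?e') = (1 / fact k) \<cdot>\<^sub>g fact k \<cdot>\<^sub>g ?e'" by simp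
    then show ?thesis by simp
  qed
  \<comment> \<open>Multiplying by the smaller symmetrizer from the left makes all nontrivial cosets
    contribute equally: \<open>transpose ?n b\<close> is conjugate to \<open>s\<close> by an element
    that the symmetrizer absorbs on both sides.\<close>
  then have "fact (Suc k) \<cdot>\<^sub>g ?e' = ?e * (fact (Suc k) \<cdot>\<^sub>g ?e')" by simp
  also have "\<dots> = fact k \<cdot>\<^sub>g (?e + (\<Sum>b\<in>?S. ?e * \<delta> (transpose ?n b) * ?e))"
    unfolding W by (simp add: distrib_left sum_distrib_left symmetrizer_idem mult.assoc)
  also have "(\<Sum>b\<in>?S. ?e * \<delta> (transpose ?n b) * ?e) = (\<Sum>b\<in>?S. ?e * \<delta> s * ?e)"
  proof (rule sum.cong[OF refl])
    fix b assume b: "b \<in> ?S"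
    let ?t = "transpose b (m + k)"
    have t: "?t permutes ?S" using b assms(1) by (intro permutes_swap_id) auto
    have t': "?t permutes {1..?n}" by (rule permutes_subset[OF t]) auto
    have s': "s permutes {1..?n}" unfolding s_def using assms(1) by (intro transpose_permutes) auto
    have "transpose ?n b = ?t \<circ> s \<circ> ?t"
      using b by (auto simp: fun_eq_iff transpose_def s_def)
    then have "\<delta> (transpose ?n b) = \<delta> ?t * \<delta> s * \<delta> ?t"
      using t' s' by (simp add: delta_mult[of _ ?n] permutes_compose)
    then have "?e * \<delta> (transpose ?n b) * ?e = (?e * \<delta> ?t) * \<delta> s * (\<delta> ?t * ?e)" by (simp add: mult.assoc)
    then show "?e * \<delta> (transpose ?n b) * ?e = ?e * \<delta> s * ?e" by (simp add: symmetrizer_absorb[OF t])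
  qed
  also have "\<dots> = of_nat k \<cdot>\<^sub>g (?e * \<delta> s * ?e)" by (simp add: of_nat_galg)
  finally have "(1 / fact k) \<cdot>\<^sub>g fact (Suc k) \<cdot>\<^sub>g ?e' = (1 / fact k) \<cdot>\<^sub>g fact k \<cdot>\<^sub>g (?e + of_nat k \<cdot>\<^sub>g (?e * \<delta> s * ?e))"
    by simp
  then show ?thesis by simp
qed

text \<open>A horizontal strip in interlacing form: no column contains two boxes of the
  difference.\<close>

definition hstrip :: "nat list \<Rightarrow> nat list \<Rightarrow> bool" where
  "hstrip la nu \<longleftrightarrow> (\<forall>i. row_len nu i \<le> row_len la i \<and> row_len la (Suc i) \<le> row_len nu i)"

definition strip_rows :: "nat list \<Rightarrow> nat list \<Rightarrow> nat set" where
  "strip_rows la nu = {i. row_len nu i < row_len la i}"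

text \<open>The content at the end of a row. For \<open>nu\<close> this is the position just before
  the first box of the strip, which also makes sense if the row is empty.\<close>

definition row_last :: "nat list \<Rightarrow> nat \<Rightarrow> complex" where
  "row_last nu i = of_int (int (row_len nu i) - int i - 1)"

text \<open>The residue at \<open>z = row_last la i\<close> of the rational function which has, for each row of the strip,
  a pole at the content of its last box and a zero at the content just before its first box.\<close>

definition hweight :: "nat list \<Rightarrow> nat list \<Rightarrow> nat \<Rightarrow> complex" where
  "hweight la nu i = (if hstrip la nu then
     (\<Prod>a\<in>strip_rows la nu. row_last la i - row_last nu a)
     * (\<Prod>a\<in>strip_rows la nu - {i}. inverse (row_last la i - row_last la a)) else 0)"

lemma finite_strip_rows [simp]: "finite (strip_rows la nu)"
  by (rule finite_subset[of _ "{..<length la}"]) (auto simp: strip_rows_def row_len_def split: if_splits)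

lemma diagram_subset_iff: "diagram nu \<subseteq> diagram la \<longleftrightarrow> (\<forall>i. row_len nu i \<le> row_len la i)"
proof
  assume "diagram nu \<subseteq> diagram la"
  then have "j < row_len nu i \<Longrightarrow> j < row_len la i" for i j by (auto simp: diagram_iff[symmetric])
  then show "\<forall>i. row_len nu i \<le> row_len la i" by (meson not_le less_irrefl)
next
  assume "\<forall>i. row_len nu i \<le> row_len la i"
  then show "diagram nu \<subseteq> diagram la" by (auto simp: diagram_iff) (meson less_le_trans)
qed

lemma hstrip_removable: "hstrip la nu \<Longrightarrow> i \<in> strip_rows la nu \<Longrightarrow> i \<in> removable la"
  unfolding hstrip_def strip_rows_def removable_def using le_less_trans by blast

lemma inj_row_last: "la \<turnstile>\<^sub>p n \<Longrightarrow> inj_on (row_last la) A"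
proof (rule inj_onI)
  fix i i' assume la: "la \<turnstile>\<^sub>p n" and eq: "row_last la i = row_last la i'"
  have "int (row_len la i) - int i = int (row_len la i') - int i'"
    using eq unfolding row_last_def of_int_eq_iff by simp
  then show "i = i'"
    using row_len_mono[OF la, of i i'] row_len_mono[OF la, of i' i] by (cases i i' rule: linorder_cases) auto
qed

text \<open>In a horizontal strip every row that contains boxes of it ends in a removable corner of
  \<open>la\<close>.\<close>

lemma bij_strip_rows:
  assumes la: "la \<turnstile>\<^sub>p Suc m" and h: "hstrip la nu"
  shows "bij_betw (\<lambda>mu. fst (new_box la mu)) {mu. mu \<in> parts m \<and> mu \<nearrow> la \<and> diagram nu \<subseteq> diagram mu} (strip_rows la nu)"
  unfolding bij_betw_def
proof
  show "inj_on (\<lambda>mu. fst (new_box la mu)) {mu. mu \<in> parts m \<and> mu \<nearrow> la \<and> diagram nu \<subseteq> diagram mu}"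
    by (rule inj_on_subset[OF bij_betw_imp_inj_on[OF bij_down_covers[OF la]]]) auto
  show "(\<lambda>mu. fst (new_box la mu)) ` {mu. mu \<in> parts m \<and> mu \<nearrow> la \<and> diagram nu \<subseteq> diagram mu} = strip_rows la nu"
  proof (intro equalityI subsetI)
    fix i assume "i \<in> (\<lambda>mu. fst (new_box la mu)) ` {mu. mu \<in> parts m \<and> mu \<nearrow> la \<and> diagram nu \<subseteq> diagram mu}"
    then obtain mu where mu: "mu \<nearrow> la" "diagram nu \<subseteq> diagram mu" "i = fst (new_box la mu)" by auto
    have "row_len nu i \<le> row_len mu i" using mu(2) by (simp add: diagram_subset_iff)
    then show "i \<in> strip_rows la nu" using add_box_row_len(1)[OF mu(1) la] mu(3) by (simp add: strip_rows_def)
  next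
    fix i assume i: "i \<in> strip_rows la nu"
    obtain mu where mu: "mu \<turnstile>\<^sub>p m" "mu \<nearrow> la" "new_box la mu = (i, row_len la i - 1)"
      using removable_down_cover[OF la hstrip_removable[OF h i]] by (metis diff_Suc_1)
    have "row_len nu a \<le> row_len mu a" for a
    proof (cases "a = i")
      case True
      then show ?thesis using add_box_row_len(1)[OF mu(2) la] mu(3) i by (simp add: strip_rows_def)
    next
      case False
      then have "row_len la a = row_len mu a" using add_box_row_len(2)[OF mu(2) la, of a] mu(3) by simp
      then show ?thesis using h unfolding hstrip_def by metis
    qed
    then show "i \<in> (\<lambda>mu. fst (new_box la mu)) ` {mu. mu \<in> parts m \<and> mu \<nearrow> la \<and> diagram nu \<subseteq> diagram mu}"
      using mu by (force simp: diagram_subset_iff)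
  qed
qed

text \<open>In the balanced case the residues add up to the differences of poles and zeros, and each
  difference is the length of the strip in its row.\<close>

lemma sum_hweight:
  assumes la: "la \<turnstile>\<^sub>p n" and nu: "nu \<turnstile>\<^sub>p m" and h: "hstrip la nu"
  shows "(\<Sum>i\<in>strip_rows la nu. hweight la nu i) = of_nat (n - m)"
proof -
  let ?A = "strip_rows la nu"
  have "(\<Sum>i\<in>?A. hweight la nu i) = (\<Sum>i\<in>?A. row_last la i - row_last nu i)"
    using partial_fractions_balanced(2)[OF finite_strip_rows inj_row_last[OF la] refl, of "row_last nu" la nu] h
    by (simp add: hweight_def)
  also have "\<dots> = (\<Sum>i\<in>?A. of_nat (row_len la i - row_len nu i))"
    by (intro sum.cong refl) (auto simp: row_last_def strip_rows_def of_nat_diff)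
  also have "\<dots> = of_nat (card (skew la nu))"
  proof -
    have "skew la nu = (SIGMA i:?A. {row_len nu i..<row_len la i})"
      by (auto simp: skew_iff strip_rows_def)
    then show ?thesis by simp
  qed
  also have "card (skew la nu) = n - m"
  proof -
    have "diagram nu \<subseteq> diagram la" using h by (auto simp: diagram_subset_iff hstrip_def)
    then show ?thesis by (simp add: skew_def card_Diff_subset card_diagram_partition[OF la] card_diagram_partition[OF nu])
  qed
  finally show ?thesis .
qed

text \<open>When \<open>mu/nu\<close> is a horizontal strip, the right side is the value of its
  balanced product at the content of the added box. If \<open>la/nu\<close> is a horizontal strip
  too, this value is a residue for it; otherwise one of the factors vanishes.\<close>

lemma hweight_step:
  assumes mu: "mu \<turnstile>\<^sub>p Suc p" and la: "la \<turnstile>\<^sub>p n" and cov: "mu \<nearrow> la" and nu: "nu \<turnstile>\<^sub>p m"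
    and sub: "diagram nu \<subseteq> diagram mu"
  shows "hweight la nu (fst (new_box la mu)) = (if hstrip mu nu then 1 else 0) +
    (\<Sum>ka | ka \<in> parts p \<and> ka \<nearrow> mu \<and> diagram nu \<subseteq> diagram ka.
       hweight mu nu (fst (new_box mu ka)) / of_int (cont la mu - cont mu ka))"
proof -
  define i where "i = fst (new_box la mu)"
  note r = add_box_row_len[OF cov la, folded i_def]
  let ?A = "strip_rows la nu" and ?A' = "strip_rows mu nu"
  let ?z = "row_last la i"
  have le: "row_len nu a \<le> row_len mu a" for a using sub by (simp add: diagram_subset_iff)
  have z: "?z = of_int (cont la mu)" using cont_row[OF cov la] r(1) by (simp add: row_last_def i_def)
  have g': "row_last mu (fst (new_box mu ka)) = of_int (cont mu ka)" if "ka \<nearrow> mu" for ka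
    using cont_row[OF that mu] add_box_row_len(1)[OF that mu] by (simp add: row_last_def)
  have rf: "row_last la a = row_last mu a" if "a \<noteq> i" for a using r(2)[OF that] by (simp add: row_last_def)
  \<comment> \<open>The added box lies one diagonal beyond the old end of its row.\<close>
  have rfi: "?z - row_last mu i = 1" using r(1) by (simp add: row_last_def)
  have h_imp: "hstrip mu nu" if "hstrip la nu"
    unfolding hstrip_def
  proof (intro allI conjI le)
    fix a
    have "row_len mu (Suc a) \<le> row_len la (Suc a)" using r(1) r(2)[of "Suc a"] by (cases "Suc a = i") auto
    also have "\<dots> \<le> row_len nu a" using that unfolding hstrip_def by blast
    finally show "row_len mu (Suc a) \<le> row_len nu a" .
  qed
  show ?thesis
  proof (cases "hstrip mu nu")
    case False
    then have "hweight mu nu a = 0" for a by (simp add: hweight_def)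
    moreover have "hweight la nu (fst (new_box la mu)) = 0" using False h_imp by (auto simp: hweight_def)
    ultimately show ?thesis using False by simp
  next
    case h: True
    note bij = bij_strip_rows[OF mu h]
    have zn: "?z \<notin> row_last mu ` ?A'"
    proof
      assume "?z \<in> row_last mu ` ?A'"
      then obtain ka where ka: "ka \<turnstile>\<^sub>p p" "ka \<nearrow> mu" "?z = row_last mu (fst (new_box mu ka))"
        using bij_betw_imp_surj_on[OF bij] by (smt (verit, best) image_iff mem_Collect_eq parts_iff)
      then show False using cont_neq[OF mu la ka(1) cov ka(2)] g'[OF ka(2)] z by simp
    qed
    have "(\<Sum>ka | ka \<in> parts p \<and> ka \<nearrow> mu \<and> diagram nu \<subseteq> diagram ka.
       hweight mu nu (fst (new_box mu ka)) / of_int (cont la mu - cont mu ka)) =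
      (\<Sum>ka | ka \<in> parts p \<and> ka \<nearrow> mu \<and> diagram nu \<subseteq> diagram ka.
       hweight mu nu (fst (new_box mu ka)) / (?z - row_last mu (fst (new_box mu ka))))"
      by (intro sum.cong refl) (simp add: z g')
    also have "\<dots> = (\<Sum>a\<in>?A'. hweight mu nu a / (?z - row_last mu a))"
      by (rule sum.reindex_bij_betw[OF bij])
    finally have "1 + (\<Sum>ka | ka \<in> parts p \<and> ka \<nearrow> mu \<and> diagram nu \<subseteq> diagram ka.
       hweight mu nu (fst (new_box mu ka)) / of_int (cont la mu - cont mu ka)) =
       1 + (\<Sum>a\<in>?A'. hweight mu nu a / (?z - row_last mu a))" by simp
    also have "\<dots> = (\<Prod>a\<in>?A'. (?z - row_last nu a) * inverse (?z - row_last mu a))"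
      using partial_fractions_balanced(1)[OF finite_strip_rows inj_row_last[OF mu] refl zn, of "row_last nu"] h
      by (simp add: hweight_def)
    also have "\<dots> = hweight la nu i"
    proof (cases "hstrip la nu")
      case True
      have A: "?A - {i} = ?A' - {i}" using r(2) by (auto simp: strip_rows_def)
      have iA: "i \<in> ?A" using r(1) le[of i] by (simp add: strip_rows_def)
      have "hweight la nu i = (?z - row_last nu i) * (\<Prod>a\<in>?A' - {i}. ?z - row_last nu a) * (\<Prod>a\<in>?A' - {i}. inverse (?z - row_last mu a))"
        using True iA rf by (simp add: hweight_def A prod.remove[OF finite_strip_rows iA])
      also have "\<dots> = (\<Prod>a\<in>?A'. (?z - row_last nu a) * inverse (?z - row_last mu a))"
      proof (cases "i \<in> ?A'")
        case True
        then show ?thesis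
          using rfi by (subst prod.remove[OF finite_strip_rows True]) (simp add: prod.distrib mult.assoc)
      next
        \<comment> \<open>The added box starts a new row of the strip, whose zero is one step before
          its pole.\<close>
        case False
        then have "row_len nu i = row_len mu i" using le[of i] by (simp add: strip_rows_def)
        then have "?z - row_last nu i = 1" using rfi by (simp add: row_last_def)
        then show ?thesis using False by (simp add: prod.distrib)
      qed
      finally show ?thesis by simp
    next
      case False
      then obtain a where "\<not> (row_len nu a \<le> row_len la a \<and> row_len la (Suc a) \<le> row_len nu a)"
        unfolding hstrip_def by blast
      moreover have "row_len nu a \<le> row_len la a" using le[of a] r(1) r(2)[of a] by (cases "a = i") auto
      ultimately have a: "row_len nu a < row_len la (Suc a)" by simp
      have h': "row_len mu (Suc a) \<le> row_len nu a" using h unfolding hstrip_def by blast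
      \<comment> \<open>The added box lies directly below the first box of the strip in row
        \<open>a\<close>, hence on the diagonal of the zero of that row.\<close>
      then have ai: "Suc a = i" using a r(2)[of "Suc a"] by (cases "Suc a = i") auto
      then have eq: "row_len nu a = row_len mu i" using a h' r(1) by simp
      have "row_len mu i < row_len mu a"
      proof -
        have "row_len la i \<le> row_len la a" using row_len_mono[OF la, of a i] ai by simp
        then show ?thesis using r(1) r(2)[of a] ai by simp
      qed
      then have "a \<in> ?A'" using eq by (simp add: strip_rows_def)
      moreover have "?z - row_last nu a = 0" using eq r(1) by (simp add: row_last_def flip: ai)
      ultimately have "(\<Prod>a\<in>?A'. (?z - row_last nu a) * inverse (?z - row_last mu a)) = 0"
        by (intro prod_zero) auto
      then show ?thesis using False by (simp add: hweight_def)
    qed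
    finally show ?thesis using h by (simp add: i_def)
  qed
qed

section \<open>The induction for the Pieri rule\<close>

lemma gam_commute:
  assumes la: "la \<turnstile>\<^sub>p Suc n" and mu: "mu \<turnstile>\<^sub>p n" and y: "supp_in n y"
  shows "gam la mu * y = y * gam la mu"
proof -
  have "chi la * y = y * chi la"
    by (rule class_fun_commute[OF class_fun_chi[OF la] supp_in_mono[OF y]]) simp
  moreover have "cidem mu * y = y * cidem mu" by (rule class_fun_commute[OF class_fun_cidem[OF mu] y])
  ultimately show ?thesis unfolding gam_def by (metis mult.assoc)
qed

lemma sum_gam:
  assumes la: "la \<turnstile>\<^sub>p Suc n" shows "chi la = (\<Sum>mu | mu \<in> parts n \<and> mu \<nearrow> la. gam la mu)"
proof -
  have "chi la = chi la * (\<Sum>mu\<in>parts n. cidem mu)" by (simp add: sum_cidem)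
  also have "\<dots> = (\<Sum>mu\<in>parts n. if mu \<nearrow> la then gam la mu else 0)"
    unfolding sum_distrib_left
  proof (rule sum.cong[OF refl])
    fix mu assume "mu \<in> parts n"
    then have mu: "mu \<turnstile>\<^sub>p n" by simp
    show "chi la * cidem mu = (if mu \<nearrow> la then gam la mu else 0)"
    proof (cases "mu \<nearrow> la")
      case False
      have "chi la * cidem mu = chi la * (cidem la * cidem mu)"
        by (simp add: mult.assoc[symmetric] chi_cidem[OF la])
      then show ?thesis using cidem_mult_not_cover[OF la mu False] False by simp
    qed (simp add: gam_def)
  qed
  finally show ?thesis by (simp only: sum_if_filter[OF finite_parts])
qed

lemma coef_restr_ctr: "w permutes {1..m} \<Longrightarrow> coef (restr m x) w = ctr (x * \<delta> (inv w))"
  unfolding coef_restr by (simp only: if_True) (rule coef_eq_ctr)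

text \<open>Summing \<open>refined_pieri_at m k\<close> over \<open>mu\<close> gives \<open>pieri_at m (Suc k)\<close>, since the weights of a strip add
  up to its size; then \<open>refined_pieri_at m (Suc k)\<close> follows from the recursion for \<open>gam\<close>, which matches
  the one for \<open>hweight\<close>.\<close>

definition pieri_at :: "nat \<Rightarrow> nat \<Rightarrow> bool" where
  "pieri_at m k \<longleftrightarrow> (\<forall>la. la \<turnstile>\<^sub>p m + k \<longrightarrow>
     restr m (chi la * symmetrizer m k) = (\<Sum>nu | nu \<in> parts m \<and> hstrip la nu. chi nu))"

definition refined_pieri_at :: "nat \<Rightarrow> nat \<Rightarrow> bool" where
  "refined_pieri_at m k \<longleftrightarrow> (\<forall>la mu. la \<turnstile>\<^sub>p Suc (m + k) \<longrightarrow> mu \<turnstile>\<^sub>p m + k \<longrightarrow> mu \<nearrow> la \<longrightarrow>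
     of_nat (Suc k) \<cdot>\<^sub>g restr m (gam la mu * symmetrizer m (Suc k)) =
     (\<Sum>nu | nu \<in> parts m \<and> diagram nu \<subseteq> diagram mu. hweight la nu (fst (new_box la mu)) \<cdot>\<^sub>g chi nu))"

lemma pieri_at_0: "pieri_at m 0"
  unfolding pieri_at_def
proof (intro allI impI)
  fix la assume "la \<turnstile>\<^sub>p m + 0"
  then have la: "la \<turnstile>\<^sub>p m" by simp
  have "hstrip la nu \<longleftrightarrow> nu = la" if nu: "nu \<turnstile>\<^sub>p m" for nu
  proof
    assume "hstrip la nu"
    then have "diagram nu \<subseteq> diagram la" by (auto simp: diagram_subset_iff hstrip_def)
    then have "diagram nu = diagram la"
      using card_diagram_partition[OF la] card_diagram_partition[OF nu] by (intro card_subset_eq) auto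
    then show "nu = la" using diagram_inj[OF nu la] by simp
  next
    assume "nu = la"
    then show "hstrip la nu" using row_len_mono[OF la] by (simp add: hstrip_def)
  qed
  then have "{nu. nu \<in> parts m \<and> hstrip la nu} = {la}" using la by auto
  then show "restr m (chi la * symmetrizer m 0) = (\<Sum>nu | nu \<in> parts m \<and> hstrip la nu. chi nu)" using la by (simp add: restr_id supp_in_chi)
qed

lemma refined_pieri_at_0: "refined_pieri_at m 0"
  unfolding refined_pieri_at_def
proof (intro allI impI)
  fix la mu assume "la \<turnstile>\<^sub>p Suc (m + 0)" "mu \<turnstile>\<^sub>p m + 0" and cov: "mu \<nearrow> la"
  then have la: "la \<turnstile>\<^sub>p Suc m" and mu: "mu \<turnstile>\<^sub>p m" by simp_all
  have "symmetrizer m (Suc 0) = 1"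
  proof -
    have "{m<..m + Suc 0} = {Suc m}" by auto
    then show ?thesis by (simp add: symmetrizer_eq)
  qed
  moreover have "{nu. nu \<in> parts m \<and> diagram nu \<subseteq> diagram mu} = {mu}"
  proof (intro equalityI subsetI)
    fix nu assume "nu \<in> {nu. nu \<in> parts m \<and> diagram nu \<subseteq> diagram mu}"
    then have nu: "nu \<turnstile>\<^sub>p m" "diagram nu \<subseteq> diagram mu" by auto
    then have "diagram nu = diagram mu"
      using card_diagram_partition[OF mu] card_diagram_partition[OF nu(1)] by (intro card_subset_eq) auto
    then show "nu \<in> {mu}" using diagram_inj[OF nu(1) mu] by simp
  qed (use mu in auto)
  moreover have "hweight la mu (fst (new_box la mu)) = 1"
  proof -
    note r = add_box_row_len[OF cov la]
    let ?i = "fst (new_box la mu)"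
    have "strip_rows la mu = {?i}" using r(1,2) by (force simp: strip_rows_def)
    moreover have "hstrip la mu" unfolding hstrip_def
    proof (intro allI conjI)
      fix a
      show "row_len mu a \<le> row_len la a" using r(1) r(2)[of a] by (cases "a = ?i") auto
      show "row_len la (Suc a) \<le> row_len mu a"
        using r(1) r(2)[of a] r(2)[of "Suc a"] row_len_mono[OF la, of a "Suc a"] row_len_mono[OF mu, of a "Suc a"]
        by (cases "a = ?i"; cases "Suc a = ?i") auto
    qed
    ultimately show ?thesis using r(1) by (simp add: hweight_def row_last_def)
  qed
  ultimately show "of_nat (Suc 0) \<cdot>\<^sub>g restr m (gam la mu * symmetrizer m (Suc 0)) =
   (\<Sum>nu | nu \<in> parts m \<and> diagram nu \<subseteq> diagram mu. hweight la nu (fst (new_box la mu)) \<cdot>\<^sub>g chi nu)" using restr_gam[OF la mu cov] by simp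
qed

lemma pieri_at_Suc:
  assumes "refined_pieri_at m k" shows "pieri_at m (Suc k)"
  unfolding pieri_at_def
proof (intro allI impI)
  fix la assume "la \<turnstile>\<^sub>p m + Suc k"
  then have la: "la \<turnstile>\<^sub>p Suc (m + k)" by simp
  let ?h = "\<lambda>mu nu. hweight la nu (fst (new_box la mu))"
  have "of_nat (Suc k) \<cdot>\<^sub>g restr m (chi la * symmetrizer m (Suc k)) =
    (\<Sum>mu | mu \<in> parts (m + k) \<and> mu \<nearrow> la. of_nat (Suc k) \<cdot>\<^sub>g restr m (gam la mu * symmetrizer m (Suc k)))"
    by (subst sum_gam[OF la]) (simp only: sum_distrib_right restr_sum gscale_sum)
  also have "\<dots> = (\<Sum>mu | mu \<in> parts (m + k) \<and> mu \<nearrow> la. \<Sum>nu\<in>parts m. if diagram nu \<subseteq> diagram mu then ?h mu nu \<cdot>\<^sub>g chi nu else 0)"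
    using assms[unfolded refined_pieri_at_def, rule_format, OF la]
    by (intro sum.cong refl) (simp only: sum_if_filter[OF finite_parts] mem_Collect_eq parts_iff)
  also have "\<dots> = (\<Sum>nu\<in>parts m. \<Sum>mu | mu \<in> parts (m + k) \<and> mu \<nearrow> la. if diagram nu \<subseteq> diagram mu then ?h mu nu \<cdot>\<^sub>g chi nu else 0)"
    by (rule sum.swap)
  also have "\<dots> = (\<Sum>nu\<in>parts m. if hstrip la nu then of_nat (Suc k) \<cdot>\<^sub>g chi nu else 0)"
  proof (rule sum.cong[OF refl])
    fix nu assume "nu \<in> parts m"
    then have nu: "nu \<turnstile>\<^sub>p m" by simp
    let ?K = "{mu. mu \<in> parts (m + k) \<and> mu \<nearrow> la \<and> diagram nu \<subseteq> diagram mu}"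
    have "(\<Sum>mu | mu \<in> parts (m + k) \<and> mu \<nearrow> la. if diagram nu \<subseteq> diagram mu then ?h mu nu \<cdot>\<^sub>g chi nu else 0)
      = (\<Sum>mu\<in>?K. ?h mu nu \<cdot>\<^sub>g chi nu)"
      by (subst sum_if_filter) (auto intro!: sum.cong)
    also have "\<dots> = (\<Sum>mu\<in>?K. ?h mu nu) \<cdot>\<^sub>g chi nu" by (simp only: gscale_sum)
    also have "\<dots> = (if hstrip la nu then of_nat (Suc k) \<cdot>\<^sub>g chi nu else 0)"
    proof (cases "hstrip la nu")
      case True
      have "(\<Sum>mu\<in>?K. ?h mu nu) = (\<Sum>i\<in>strip_rows la nu. hweight la nu i)"
        by (rule sum.reindex_bij_betw[OF bij_strip_rows[OF la True]])
      then show ?thesis using sum_hweight[OF la nu True] True by (simp add: Suc_diff_le)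
    next
      case False
      then show ?thesis by (simp add: hweight_def)
    qed
    finally show "(\<Sum>mu | mu \<in> parts (m + k) \<and> mu \<nearrow> la. if diagram nu \<subseteq> diagram mu then ?h mu nu \<cdot>\<^sub>g chi nu else 0)
      = (if hstrip la nu then of_nat (Suc k) \<cdot>\<^sub>g chi nu else 0)" .
  qed
  also have "\<dots> = of_nat (Suc k) \<cdot>\<^sub>g (\<Sum>nu | nu \<in> parts m \<and> hstrip la nu. chi nu)"
    by (simp only: sum_if_filter[OF finite_parts] gscale_sum)
  finally have "(1 / of_nat (Suc k)) \<cdot>\<^sub>g of_nat (Suc k) \<cdot>\<^sub>g restr m (chi la * symmetrizer m (Suc k)) =
    (1 / of_nat (Suc k)) \<cdot>\<^sub>g of_nat (Suc k) \<cdot>\<^sub>g (\<Sum>nu | nu \<in> parts m \<and> hstrip la nu. chi nu)" by (simp only:)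
  then show "restr m (chi la * symmetrizer m (Suc k)) = (\<Sum>nu | nu \<in> parts m \<and> hstrip la nu. chi nu)" by (simp del: of_nat_Suc)
qed

lemma refined_pieri_at_Suc:
  assumes A: "pieri_at m (Suc k)" and B: "refined_pieri_at m k" shows "refined_pieri_at m (Suc k)"
  unfolding refined_pieri_at_def
proof (intro allI impI)
  fix la mu assume "la \<turnstile>\<^sub>p Suc (m + Suc k)" "mu \<turnstile>\<^sub>p m + Suc k" and cov: "mu \<nearrow> la"
  then have la: "la \<turnstile>\<^sub>p Suc (Suc (m + k))" and mu: "mu \<turnstile>\<^sub>p Suc (m + k)" by simp_all
  let ?e = "symmetrizer m (Suc k)" and ?s = "\<delta> (transpose (Suc (m + k)) (Suc (Suc (m + k))))"
  let ?G = "gam la mu"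
  have eS: "supp_in (Suc (m + k)) ?e" using supp_in_symmetrizer[of m "Suc k"] by simp
  have rec: "of_nat (Suc (Suc k)) \<cdot>\<^sub>g symmetrizer m (Suc (Suc k)) = ?e + of_nat (Suc k) \<cdot>\<^sub>g (?e * ?s * ?e)"
    using symmetrizer_Suc[of "Suc k" m] by simp
  let ?R = "\<Sum>nu | nu \<in> parts m \<and> diagram nu \<subseteq> diagram mu. hweight la nu (fst (new_box la mu)) \<cdot>\<^sub>g chi nu"
  let ?K = "\<lambda>nu. {ka. ka \<in> parts (m + k) \<and> ka \<nearrow> mu \<and> diagram nu \<subseteq> diagram ka}"
  let ?t = "\<lambda>nu ka. hweight mu nu (fst (new_box mu ka)) / of_int (cont la mu - cont mu ka) :: complex"
  show "of_nat (Suc (Suc k)) \<cdot>\<^sub>g restr m (?G * symmetrizer m (Suc (Suc k))) = ?R"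
  proof (rule supp_in_eqI[of m])
    fix w assume w: "w permutes {1..m}"
    let ?y = "\<delta> (inv w)"
    have y: "supp_in m ?y" using w by (auto intro: permutes_inv)
    then have y': "supp_in (Suc (m + k)) ?y" by (rule supp_in_mono) simp
    have ye: "?e * ?y = ?y * ?e" by (rule symmetrizer_commute[OF y])
    have "coef (of_nat (Suc (Suc k)) \<cdot>\<^sub>g restr m (?G * symmetrizer m (Suc (Suc k)))) w =
      ctr (?G * (of_nat (Suc (Suc k)) \<cdot>\<^sub>g symmetrizer m (Suc (Suc k))) * ?y)"
      using coef_restr_ctr[OF w, of "?G * symmetrizer m (Suc (Suc k))"] by simp
    also have "\<dots> = ctr (?G * ?e * ?y) + of_nat (Suc k) * ctr (?G * (?e * ?s * ?e) * ?y)"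
      unfolding rec by (simp add: distrib_left distrib_right)
    \<comment> \<open>This term involves the last letter only through \<open>gam la mu\<close>,
      which restricts to \<open>chi mu\<close>; the Pieri rule for \<open>mu\<close> then
      applies.\<close>
    also have "ctr (?G * ?e * ?y) = ctr (restr (Suc (m + k)) ?G * (?e * ?y))"
      using restr_mult_right[of "Suc (m + k)" "?e * ?y" ?G] eS y' by (metis ctr_restr mult.assoc supp_in_mult)
    also have "\<dots> = ctr (chi mu * ?e * ?y)" by (simp add: restr_gam[OF la mu cov] mult.assoc)
    also have "\<dots> = coef (restr m (chi mu * ?e)) w" by (simp only: coef_restr_ctr[OF w])
    also have "restr m (chi mu * ?e) = (\<Sum>nu | nu \<in> parts m \<and> hstrip mu nu. chi nu)"
      using A[unfolded pieri_at_def, rule_format, of mu] mu by simp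
    \<comment> \<open>Cyclicity brings the left symmetrizer to the right end, where idempotence
      merges the two; \<open>gam_step\<close> then applies with \<open>?y * ?e\<close> in the place
      of its \<open>y\<close>.\<close>
    also have "ctr (?G * (?e * ?s * ?e) * ?y) = ctr (?G * ?s * (?y * ?e))"
    proof -
      have "?G * (?e * ?s * ?e) * ?y = ?e * (?G * ?s * ?e * ?y)"
        using gam_commute[OF la mu eS] by (metis mult.assoc)
      then have "ctr (?G * (?e * ?s * ?e) * ?y) = ctr (?G * ?s * ?e * ?y * ?e)"
        by (simp add: ctr_commute[of ?e])
      also have "?G * ?s * ?e * ?y * ?e = ?G * ?s * (?y * ?e)"
        using ye symmetrizer_idem[of m "Suc k"] by (metis mult.assoc)
      finally show ?thesis .
    qed
    also have "\<dots> = (\<Sum>ka | ka \<in> parts (m + k) \<and> ka \<nearrow> mu. ctr (gam mu ka * (?y * ?e)) / of_int (cont la mu - cont mu ka))"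
      by (rule gam_step[OF la mu cov]) (use y' eS in auto)
    also have "of_nat (Suc k) * \<dots> = (\<Sum>ka | ka \<in> parts (m + k) \<and> ka \<nearrow> mu.
        \<Sum>nu | nu \<in> parts m \<and> diagram nu \<subseteq> diagram ka. ?t nu ka * coef (chi nu) w)"
      unfolding sum_distrib_left
    proof (rule sum.cong[OF refl])
      fix ka assume "ka \<in> {ka. ka \<in> parts (m + k) \<and> ka \<nearrow> mu}"
      then have ka: "ka \<turnstile>\<^sub>p m + k" "ka \<nearrow> mu" by auto
      have "of_nat (Suc k) * ctr (gam mu ka * (?y * ?e)) = coef (of_nat (Suc k) \<cdot>\<^sub>g restr m (gam mu ka * ?e)) w"
        unfolding ye[symmetric] by (simp only: coef_simps coef_restr_ctr[OF w] mult.assoc)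
      also have "\<dots> = (\<Sum>nu | nu \<in> parts m \<and> diagram nu \<subseteq> diagram ka. hweight mu nu (fst (new_box mu ka)) * coef (chi nu) w)"
        using B[unfolded refined_pieri_at_def, rule_format, OF mu ka] by (simp only: coef_sum coef_simps)
      finally have "of_nat (Suc k) * (ctr (gam mu ka * (?y * ?e)) / of_int (cont la mu - cont mu ka)) =
        (\<Sum>nu | nu \<in> parts m \<and> diagram nu \<subseteq> diagram ka. hweight mu nu (fst (new_box mu ka)) * coef (chi nu) w) / of_int (cont la mu - cont mu ka)"
        by (simp only: times_divide_eq_right)
      then show "of_nat (Suc k) * (ctr (gam mu ka * (?y * ?e)) / of_int (cont la mu - cont mu ka)) =
        (\<Sum>nu | nu \<in> parts m \<and> diagram nu \<subseteq> diagram ka. ?t nu ka * coef (chi nu) w)"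
        by (simp only: sum_divide_distrib times_divide_eq_left)
    qed
    also have "\<dots> = (\<Sum>ka | ka \<in> parts (m + k) \<and> ka \<nearrow> mu.
        \<Sum>nu\<in>parts m. if diagram nu \<subseteq> diagram ka then ?t nu ka * coef (chi nu) w else 0)"
      by (simp only: sum_if_filter[OF finite_parts])
    also have "\<dots> = (\<Sum>nu\<in>parts m. \<Sum>ka | ka \<in> parts (m + k) \<and> ka \<nearrow> mu.
        if diagram nu \<subseteq> diagram ka then ?t nu ka * coef (chi nu) w else 0)"
      by (rule sum.swap)
    also have "\<dots> = (\<Sum>nu\<in>parts m. (\<Sum>ka\<in>?K nu. ?t nu ka) * coef (chi nu) w)"
    proof (rule sum.cong[OF refl])
      fix nu
      have "{ka \<in> {ka. ka \<in> parts (m + k) \<and> ka \<nearrow> mu}. diagram nu \<subseteq> diagram ka} = ?K nu" by blast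
      then show "(\<Sum>ka | ka \<in> parts (m + k) \<and> ka \<nearrow> mu. if diagram nu \<subseteq> diagram ka then ?t nu ka * coef (chi nu) w else 0)
        = (\<Sum>ka\<in>?K nu. ?t nu ka) * coef (chi nu) w"
        unfolding sum_distrib_right by (subst sum.inter_filter[symmetric]) simp_all
    qed
    also have "coef (\<Sum>nu | nu \<in> parts m \<and> hstrip mu nu. chi nu) w + \<dots> =
        (\<Sum>nu\<in>parts m. ((if hstrip mu nu then 1 else 0) + (\<Sum>ka\<in>?K nu. ?t nu ka)) * coef (chi nu) w)"
      unfolding coef_sum sum_if_filter[OF finite_parts, symmetric] sum.distrib[symmetric]
      by (intro sum.cong refl) (simp add: distrib_right)
    also have "\<dots> = (\<Sum>nu\<in>parts m. if diagram nu \<subseteq> diagram mu then hweight la nu (fst (new_box la mu)) * coef (chi nu) w else 0)"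
    proof (rule sum.cong[OF refl])
      fix nu assume "nu \<in> parts m"
      then have nu: "nu \<turnstile>\<^sub>p m" by simp
      show "((if hstrip mu nu then 1 else 0) + (\<Sum>ka\<in>?K nu. ?t nu ka)) * coef (chi nu) w =
        (if diagram nu \<subseteq> diagram mu then hweight la nu (fst (new_box la mu)) * coef (chi nu) w else 0)"
      proof (cases "diagram nu \<subseteq> diagram mu")
        case True
        then show ?thesis using hweight_step[OF mu la cov nu True] by (simp only: if_True)
      next
        case False
        have "?K nu = {}" using False add_box_subset by blast
        moreover have "\<not> hstrip mu nu" using False by (auto simp: hstrip_def diagram_subset_iff)
        ultimately show ?thesis using False by (simp only: sum.empty if_False) simp
      qed
    qed
    also have "\<dots> = coef ?R w" by (simp only: coef_sum coef_simps sum_if_filter[OF finite_parts])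
    finally show "coef (of_nat (Suc (Suc k)) \<cdot>\<^sub>g restr m (?G * symmetrizer m (Suc (Suc k)))) w = coef ?R w" .
  qed (auto intro!: supp_in_sum supp_in_chi)
qed

text \<open>The dual form of the rule: pairing the last \<open>k\<close> letters with the trivial
  representation is skewing by a complete symmetric function, which removes horizontal
  strips.\<close>

theorem pieri:
  assumes "la \<turnstile>\<^sub>p m + k"
  shows "restr m (chi la * symmetrizer m k) = (\<Sum>nu | nu \<in> parts m \<and> hstrip la nu. chi nu)"
proof -
  have "pieri_at m k \<and> refined_pieri_at m k" for k
    by (induction k) (auto intro: pieri_at_0 refined_pieri_at_0 pieri_at_Suc refined_pieri_at_Suc)
  then show ?thesis using assms unfolding pieri_at_def by blast
qed

section \<open>Cycle types and colourings\<close>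

lemma permutation_Sym: "w permutes {1..n::nat} \<Longrightarrow> permutation w"
  by (auto simp: permutation_permutes)

lemma in_orbit_self: "w permutes {1..n::nat} \<Longrightarrow> x \<in> orbit w x"
  by (rule permutation_self_in_orbit[OF permutation_Sym])

lemma orbit_eq: "w permutes {1..n::nat} \<Longrightarrow> y \<in> orbit w x \<Longrightarrow> orbit w y = orbit w x"
  by (rule orbit_cyclic_eq3[OF cyclic_on_orbit]) auto

lemma orbit_Sym_subset: "w permutes {1..n::nat} \<Longrightarrow> x \<in> {1..n} \<Longrightarrow> orbit w x \<subseteq> {1..n}"
  by (rule permutes_orbit_subset)

lemma finite_orbit_Sym: "w permutes {1..n::nat} \<Longrightarrow> finite (orbit w x)"
  by (rule finite_orbit[OF in_orbit_self])

lemma orbit_closed_subset: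
  assumes "f x \<in> A" "\<And>y. y \<in> A \<Longrightarrow> f y \<in> A" shows "orbit f x \<subseteq> A"
proof
  fix y assume "y \<in> orbit f x" then show "y \<in> A" by induction (use assms in auto)
qed

lemma orbit_conj:
  assumes "w permutes {1..n::nat}" "u permutes {1..n}"
  shows "orbit (u \<circ> w \<circ> inv u) (u x) = u ` orbit w x"
  by (rule orbit_inverse[symmetric, OF in_orbit_self[OF assms(1)]])
     (simp add: permutes_inverses(2)[OF assms(2)])

text \<open>Conjugation maps cycles to cycles of equal length, and \<open>u\<close> fixes the last
  letter, so the distinguished cycle stays distinguished.\<close>

lemma psi_conj:
  assumes w: "w permutes {1..Suc m}" and u: "u permutes {1..m}"
  shows "psi (Suc m) (u \<circ> w \<circ> inv u) = psi (Suc m) w"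
proof -
  let ?n = "Suc m" and ?w = "u \<circ> w \<circ> inv u"
  have u': "u permutes {1..?n}" by (rule Sym_mono[OF u]) simp
  have un: "u ?n = ?n" by (rule permutes_not_in[OF u]) simp
  note oc = orbit_conj[OF w u']
  have injI: "inj_on ((`) u) A" for A
    using permutes_inj[OF u'] by (auto simp: inj_on_def inj_image_eq_iff)
  have n: "orbit ?w ?n = u ` orbit w ?n" using oc[of ?n] un by simp
  have all: "orbit ?w ` {1..?n} = (`) u ` orbit w ` {1..?n}"
  proof -
    have "orbit ?w ` {1..?n} = orbit ?w ` u ` {1..?n}" by (simp only: permutes_image[OF u'])
    then show ?thesis by (simp only: image_image oc)
  qed
  have "orbit ?w ` {1..?n} - {orbit ?w ?n} = (`) u ` (orbit w ` {1..?n} - {orbit w ?n})"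
    unfolding all n by (subst inj_on_image_set_diff[OF injI[of UNIV]]) auto
  then have "other_cycle_type ?n ?w = image_mset card (image_mset ((`) u) (mset_set (orbit w ` {1..?n} - {orbit w ?n})))"
    unfolding other_cycle_type_def by (simp only: image_mset_mset_set[OF injI])
  also have "\<dots> = other_cycle_type ?n w"
    unfolding other_cycle_type_def multiset.map_comp
    by (rule image_mset_cong) (simp add: card_image permutes_inj_on[OF u'])
  finally have 1: "other_cycle_type ?n ?w = other_cycle_type ?n w" .
  have 2: "card (orbit ?w ?n) = card (orbit w ?n)"
    unfolding n by (simp add: card_image permutes_inj_on[OF u'])
  show ?thesis unfolding psi_def 1 2 ..
qed

definition cycle_type :: "nat \<Rightarrow> (nat \<Rightarrow> nat) \<Rightarrow> nat multiset" where
  "cycle_type m w = image_mset card (mset_set (orbit w ` {1..m}))"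

lemma orbit_fixed: "w x = x \<Longrightarrow> orbit w x = {x}"
  by (simp add: orbit_eq_singleton_iff)

lemma psi_fixed:
  assumes w: "w permutes {1..m}"
  shows "psi (Suc m) w = monom (power_sum_mset (cycle_type m w)) 0"
proof -
  have n: "orbit w (Suc m) = {Suc m}" by (rule orbit_fixed, rule permutes_not_in[OF w]) simp
  have ins: "{1..Suc m} = insert (Suc m) {1..m}" by auto
  have "{Suc m} \<notin> orbit w ` {1..m}"
  proof
    assume "{Suc m} \<in> orbit w ` {1..m}"
    then obtain x where x: "x \<in> {1..m}" "{Suc m} = orbit w x" by blast
    have "x \<in> {Suc m}" unfolding x(2) by (rule in_orbit_self[OF w])
    then show False using x(1) by simp
  qed
  then have "orbit w ` {1..Suc m} - {orbit w (Suc m)} = orbit w ` {1..m}"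
    unfolding ins n image_insert by auto
  then show ?thesis by (simp add: psi_def other_cycle_type_def cycle_type_def n)
qed

text \<open>Composition with the transposition inserts the last letter into the cycle of the
  preceding one. That cycle grows by one and the others are unchanged, so \<open>psi\<close> gains
  the factor \<open>t\<close>.\<close>

lemma psi_insert:
  assumes q: "q permutes {1..Suc p}"
  defines "s \<equiv> transpose (Suc (Suc p)) (Suc p)"
  shows "psi (Suc (Suc p)) (s \<circ> q) = monom 1 1 * psi (Suc p) q"
proof -
  let ?m = "Suc p" and ?n = "Suc (Suc p)" and ?w = "s \<circ> q"
  have q': "q permutes {1..?n}" by (rule Sym_mono[OF q]) simp
  have qn: "q ?n = ?n" by (rule permutes_not_in[OF q]) simp
  have s: "s permutes {1..?n}" unfolding s_def by (intro transpose_permutes) auto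
  have w: "?w permutes {1..?n}" by (rule permutes_compose[OF q' s])
  have qne: "q y \<noteq> ?n" if "y \<noteq> ?n" for y using that permutes_inj[OF q] qn by (metis injD)
  have w_eq: "?w y = q y" if "y \<noteq> ?n" "q y \<noteq> ?m" for y
    using that qne by (simp add: s_def transpose_def)
  have w_m: "?w y = ?n" if "q y = ?m" for y using that by (simp add: s_def)
  have w_n: "?w ?n = ?m" by (simp add: s_def qn)
  have om: "orbit q ?m \<subseteq> {1..?m}" by (rule orbit_Sym_subset[OF q]) simp
  have on: "orbit ?w ?n = insert ?n (orbit q ?m)"
  proof
    show "orbit ?w ?n \<subseteq> insert ?n (orbit q ?m)"
    proof (rule orbit_closed_subset)
      show "?w ?n \<in> insert ?n (orbit q ?m)" using w_n in_orbit_self[OF q] by simp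
      fix y assume y: "y \<in> insert ?n (orbit q ?m)"
      show "?w y \<in> insert ?n (orbit q ?m)"
      proof (cases "y = ?n")
        case True then show ?thesis using w_n in_orbit_self[OF q] by simp
      next
        case False
        then have "q y \<in> orbit q ?m" using y by (auto intro: orbit.step)
        then show ?thesis using w_eq[OF False] w_m[of y] by (cases "q y = ?m") auto
      qed
    qed
    have m_in: "?m \<in> orbit ?w ?n" using orbit.base[of ?w ?n] w_n by simp
    have "y \<in> orbit ?w ?n" if "y \<in> orbit q ?m" for y
      using that
    proof induction
      case base
      show ?case using w_eq[of ?m] m_in orbit.step[OF m_in] by (cases "q ?m = ?m") (simp_all del: o_apply)
    next
      case (step y)
      then have "y \<noteq> ?n" using om by auto
      then show ?case using w_eq[of y] m_in orbit.step[OF step.IH] by (cases "q y = ?m") (simp_all del: o_apply)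
    qed
    then show "insert ?n (orbit q ?m) \<subseteq> orbit ?w ?n" using in_orbit_self[OF w] by auto
  qed
  have other: "orbit ?w x = orbit q x" if x: "x \<in> {1..?m}" "x \<notin> orbit q ?m" for x
  proof (rule orbit_cong[OF in_orbit_self[OF q]])
    fix y assume y: "y \<in> orbit q x"
    have "y \<in> {1..?m}" using orbit_Sym_subset[OF q x(1)] y by blast
    moreover have "q y \<noteq> ?m"
    proof
      assume "q y = ?m"
      then have "?m \<in> orbit q x" using orbit.step[OF y] by simp
      then show False using orbit_eq[OF q] in_orbit_self[OF q, of x] x(2) by blast
    qed
    ultimately show "?w y = q y" by (intro w_eq) auto
  qed
  have same: "orbit ?w x = orbit ?w ?n" if "x \<in> orbit q ?m" for x
    using orbit_eq[OF w, of x ?n] on that by simp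
  have "orbit ?w ` {1..?n} - {orbit ?w ?n} = orbit q ` {1..?m} - {orbit q ?m}"
  proof (intro equalityI subsetI)
    fix B assume "B \<in> orbit ?w ` {1..?n} - {orbit ?w ?n}"
    then obtain x where x: "x \<in> {1..?n}" "B = orbit ?w x" "B \<noteq> orbit ?w ?n" by blast
    then have "x \<in> {1..?m}" "x \<notin> orbit q ?m" using same by (auto simp: le_Suc_eq)
    then show "B \<in> orbit q ` {1..?m} - {orbit q ?m}"
      using other x(2) in_orbit_self[OF q, of x] by auto
  next
    fix B assume "B \<in> orbit q ` {1..?m} - {orbit q ?m}"
    then obtain x where x: "x \<in> {1..?m}" "B = orbit q x" "B \<noteq> orbit q ?m" by blast
    then have "x \<notin> orbit q ?m" using orbit_eq[OF q] by metis
    then have B: "orbit ?w x = B" using other x by simp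
    moreover have "B \<noteq> orbit ?w ?n"
      using x orbit_Sym_subset[OF q x(1)] on by auto
    moreover have "x \<in> {1..?n}" using x(1) by auto
    ultimately show "B \<in> orbit ?w ` {1..?n} - {orbit ?w ?n}" by blast
  qed
  then have 1: "other_cycle_type ?n ?w = other_cycle_type ?m q" by (simp add: other_cycle_type_def)
  have "?n \<notin> orbit q ?m" using om by auto
  then have "card (orbit ?w ?n) = Suc (card (orbit q ?m))"
    unfolding on using finite_orbit_Sym[OF q] by simp
  moreover have "card (orbit q ?m) > 0"
    using finite_orbit_Sym[OF q] in_orbit_self[OF q] by (auto simp: card_gt_0_iff)
  ultimately have 2: "card (orbit ?w ?n) - 1 = Suc (card (orbit q ?m) - 1)" by simp
  show ?thesis unfolding psi_def 1 2 by (simp add: mult_monom Suc_eq_plus1_left)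
qed

section \<open>Power sums as counts of colourings\<close>

lemma mcoeff_simps:
  "mcoeff (f + g) M = mcoeff f M + mcoeff g M" "mcoeff 0 M = 0" "mcoeff 1 M = (if M = {#} then 1 else 0)"
  "mcoeff (f * g) M = (\<Sum>(a, b)\<in>{(a, b). a + b = M}. mcoeff f a * mcoeff g b)"
  "mcoeff (mfps_const c) M = (if M = {#} then c else 0)"
  by (transfer, rule refl)+

lemma mcoeff_const_mult [simp]: "mcoeff (mfps_const c * f) M = c * mcoeff f M"
proof -
  have "mcoeff (mfps_const c * f) M = (\<Sum>(a, b)\<in>{({#}, M)}. mcoeff (mfps_const c) a * mcoeff f b)"
    unfolding mcoeff_simps(4)
    by (rule sum.mono_neutral_right) (auto simp: finite_mset_splits mcoeff_simps split: if_splits)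
  then show ?thesis by (simp add: mcoeff_simps)
qed

lemma mcoeff_sum: "mcoeff (\<Sum>i\<in>I. f i) M = (\<Sum>i\<in>I. mcoeff (f i) M)"
  by (induction I rule: infinite_finite_induct) (auto simp: mcoeff_simps)

lemma mfps_const_arith:
  "mfps_const (a + b) = mfps_const a + mfps_const b" "mfps_const (a * b) = mfps_const a * mfps_const b"
  "mfps_const 0 = 0" "mfps_const 1 = 1"
  by (simp_all add: mfps_eq_iff mcoeff_simps(1,2,3,5))

lemma mfps_const_sum: "mfps_const (\<Sum>i\<in>I. f i) = (\<Sum>i\<in>I. mfps_const (f i))"
  by (induction I rule: infinite_finite_induct) (auto simp: mfps_const_arith)

lemma mcoeff_power_sum: "mcoeff (power_sum k) M = (if \<exists>i. M = replicate_mset k i then 1 else 0)"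
  by transfer simp

lemma content_PiE:
  assumes "finite A" "f \<in> extensional A" "image_mset f (mset_set A) = M"
  shows "f \<in> A \<rightarrow>\<^sub>E set_mset M"
proof -
  have "set_mset M = f ` A" using assms(1) unfolding assms(3)[symmetric] by simp
  then show ?thesis using assms(2) by (auto simp: PiE_def)
qed

text \<open>Choosing a variable for each block is choosing a term in each factor of a product of
  power sums. Extensionality makes each choice a unique function.\<close>

definition const_colourings :: "nat set set \<Rightarrow> nat multiset \<Rightarrow> (nat \<Rightarrow> nat) set" where
  "const_colourings P M = {f \<in> extensional (\<Union>P). (\<forall>B\<in>P. \<forall>x\<in>B. \<forall>y\<in>B. f x = f y)
     \<and> image_mset f (mset_set (\<Union>P)) = M}"

lemma finite_const_colourings:
  assumes "finite (\<Union>P)" shows "finite (const_colourings P M)"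
proof (rule finite_subset)
  show "const_colourings P M \<subseteq> \<Union>P \<rightarrow>\<^sub>E set_mset M"
    using content_PiE[OF assms] unfolding const_colourings_def by blast
  show "finite (\<Union>P \<rightarrow>\<^sub>E set_mset M)" using assms by (intro finite_PiE) auto
qed

lemma replicate_mset_in: "k > 0 \<Longrightarrow> replicate_mset k v \<subseteq># M \<Longrightarrow> v \<in># M"
  by (rule mset_subset_eqD) auto

text \<open>For positive \<open>k\<close> the monomial determines its variable, so the nonzero terms
  of the convolution are indexed by \<open>v\<close>.\<close>

lemma mcoeff_power_sum_mult:
  assumes "k > 0"
  shows "mcoeff (power_sum k * g) M = (\<Sum>v | replicate_mset k v \<subseteq># M. mcoeff g (M - replicate_mset k v))"
proof -
  have fin: "finite {v. replicate_mset k v \<subseteq># M}"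
  proof (rule finite_subset)
    show "{v. replicate_mset k v \<subseteq># M} \<subseteq> set_mset M"
      by (rule subsetI) (erule CollectE, rule replicate_mset_in[OF assms])
  qed simp
  have inj: "inj_on (\<lambda>v. (replicate_mset k v, M - replicate_mset k v)) {v. replicate_mset k v \<subseteq># M}"
  proof (rule inj_onI)
    fix v v' :: nat
    assume "(replicate_mset k v, M - replicate_mset k v) = (replicate_mset k v', M - replicate_mset k v')"
    then have "set_mset (replicate_mset k v) = set_mset (replicate_mset k v')" by simp
    then show "v = v'" using assms by simp
  qed
  have "mcoeff (power_sum k * g) M = (\<Sum>(a, b)\<in>{(a, b). a + b = M}. mcoeff (power_sum k) a * mcoeff g b)"
    by (rule mcoeff_simps(4))
  also have "\<dots> = (\<Sum>(a, b)\<in>(\<lambda>v. (replicate_mset k v, M - replicate_mset k v)) ` {v. replicate_mset k v \<subseteq># M}. mcoeff (power_sum k) a * mcoeff g b)"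
  proof (rule sum.mono_neutral_right)
    show "\<forall>ab\<in>{(a, b). a + b = M} - (\<lambda>v. (replicate_mset k v, M - replicate_mset k v)) ` {v. replicate_mset k v \<subseteq># M}.
        (case ab of (a, b) \<Rightarrow> mcoeff (power_sum k) a * mcoeff g b) = 0"
    proof
      fix ab assume ab: "ab \<in> {(a, b). a + b = M} - (\<lambda>v. (replicate_mset k v, M - replicate_mset k v)) ` {v. replicate_mset k v \<subseteq># M}"
      obtain a b where eq: "ab = (a, b)" by (cases ab)
      have "mcoeff (power_sum k) a = 0"
      proof (rule ccontr)
        assume "mcoeff (power_sum k) a \<noteq> 0"
        then obtain v where a: "a = replicate_mset k v" by (auto simp: mcoeff_power_sum split: if_splits)
        have M: "M = replicate_mset k v + b" using ab eq a by simp
        then have "ab = (replicate_mset k v, M - replicate_mset k v)" "replicate_mset k v \<subseteq># M"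
          using eq a by simp_all
        then show False using ab by blast
      qed
      then show "(case ab of (a, b) \<Rightarrow> mcoeff (power_sum k) a * mcoeff g b) = 0" by (simp add: eq)
    qed
  qed (auto simp: finite_mset_splits)
  also have "\<dots> = (\<Sum>v | replicate_mset k v \<subseteq># M. mcoeff g (M - replicate_mset k v))"
    by (subst sum.reindex[OF inj]) (auto simp: mcoeff_power_sum intro!: sum.cong)
  finally show ?thesis .
qed

text \<open>By induction on the blocks: a colouring is the colour of one block together with a
  colouring of the rest.\<close>

lemma mcoeff_prod_power_sum:
  assumes "finite P" "\<And>B. B \<in> P \<Longrightarrow> finite B \<and> B \<noteq> {}" "disjoint P"
  shows "mcoeff (\<Prod>B\<in>P. power_sum (card B)) M = of_nat (card (const_colourings P M))"
  using assms
proof (induction P arbitrary: M rule: finite_induct)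
  case empty
  have "const_colourings {} M = (if M = {#} then {\<lambda>_. undefined} else {})"
    by (auto simp: const_colourings_def)
  then show ?case by (simp add: mcoeff_simps)
next
  case (insert B P)
  have B: "finite B" "B \<noteq> {}" using insert.prems by auto
  have disjP: "disjoint P" using insert.prems(2) by (auto simp: pairwise_insert)
  have BP: "B \<inter> \<Union>P = {}" using insert.prems(2) insert.hyps(2) by (auto simp: pairwise_insert disjnt_def)
  have finP: "finite (\<Union>P)" using insert.hyps insert.prems by auto
  have cB: "card B > 0" using B by (simp add: card_gt_0_iff)
  obtain b where b: "b \<in> B" using B by auto
  let ?V = "{v. replicate_mset (card B) v \<subseteq># M}"
  let ?S = "SIGMA v:?V. const_colourings P (M - replicate_mset (card B) v)"
  have mset: "mset_set (\<Union>(insert B P)) = mset_set B + mset_set (\<Union>P)"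
    using BP B finP by (simp add: mset_set_Union)
  have const: "image_mset f (mset_set B) = replicate_mset (card B) v" if "\<And>x. x \<in> B \<Longrightarrow> f x = v" for f :: "nat \<Rightarrow> nat" and v
  proof -
    have "image_mset f (mset_set B) = image_mset (\<lambda>_. v) (mset_set B)"
      using B that by (intro image_mset_cong) auto
    then show ?thesis by (simp add: image_mset_const_eq)
  qed
  have "bij_betw (\<lambda>f. (f b, restrict f (\<Union>P))) (const_colourings (insert B P) M) ?S"
  proof (rule bij_betw_byWitness[where f' = "\<lambda>(v, g) x. if x \<in> B then v else g x"])
    show "\<forall>f\<in>const_colourings (insert B P) M. (\<lambda>(v, g) x. if x \<in> B then v else g x) (f b, restrict f (\<Union>P)) = f"
    proof
      fix f assume f: "f \<in> const_colourings (insert B P) M"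
      have fb: "f x = f b" if "x \<in> B" for x
        using f that b unfolding const_colourings_def by blast
      have ext: "f x = undefined" if "x \<notin> B" "x \<notin> \<Union>P" for x
        using f that unfolding const_colourings_def by (auto dest: extensional_arb)
      show "(\<lambda>(v, g) x. if x \<in> B then v else g x) (f b, restrict f (\<Union>P)) = f"
      proof
        fix x show "(case (f b, restrict f (\<Union>P)) of (v, g) \<Rightarrow> \<lambda>x. if x \<in> B then v else g x) x = f x"
          using fb[of x] ext[of x] by (cases "x \<in> B"; cases "x \<in> \<Union>P") simp_all
      qed
    qed
    show "\<forall>vg\<in>?S. (\<lambda>f. (f b, restrict f (\<Union>P))) ((\<lambda>(v, g) x. if x \<in> B then v else g x) vg) = vg"
    proof
      fix vg assume "vg \<in> ?S"
      then obtain v g where vg: "vg = (v, g)" and g: "g \<in> const_colourings P (M - replicate_mset (card B) v)" by blast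
      have "restrict (\<lambda>x. if x \<in> B then v else g x) (\<Union>P) = g"
      proof
        fix x
        have "x \<notin> B" if "x \<in> \<Union>P" using that BP by blast
        moreover have "g x = undefined" if "x \<notin> \<Union>P"
          using g that unfolding const_colourings_def by (auto dest: extensional_arb)
        ultimately show "restrict (\<lambda>x. if x \<in> B then v else g x) (\<Union>P) x = g x"
          by (cases "x \<in> \<Union>P") simp_all
      qed
      then show "(\<lambda>f. (f b, restrict f (\<Union>P))) ((\<lambda>(v, g) x. if x \<in> B then v else g x) vg) = vg"
        using b by (simp add: vg)
    qed
    show "(\<lambda>f. (f b, restrict f (\<Union>P))) ` const_colourings (insert B P) M \<subseteq> ?S"
    proof (rule image_subsetI)
      fix f assume f: "f \<in> const_colourings (insert B P) M"
      have "f x = f b" if "x \<in> B" for x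
        using f that b unfolding const_colourings_def by blast
      then have "image_mset f (mset_set B) = replicate_mset (card B) (f b)" by (rule const)
      then have M: "M = replicate_mset (card B) (f b) + image_mset f (mset_set (\<Union>P))"
        using f mset unfolding const_colourings_def by simp
      have "image_mset (restrict f (\<Union>P)) (mset_set (\<Union>P)) = image_mset f (mset_set (\<Union>P))"
        using finP by (intro image_mset_cong) auto
      then have "image_mset (restrict f (\<Union>P)) (mset_set (\<Union>P)) = M - replicate_mset (card B) (f b)"
        unfolding M by simp
      moreover have "\<forall>C\<in>P. \<forall>x\<in>C. \<forall>y\<in>C. restrict f (\<Union>P) x = restrict f (\<Union>P) y"
      proof (intro ballI)
        fix C x y assume C: "C \<in> P" "x \<in> C" "y \<in> C"
        then have "f x = f y" using f unfolding const_colourings_def by blast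
        moreover have "x \<in> \<Union>P" "y \<in> \<Union>P" using C by blast+
        ultimately show "restrict f (\<Union>P) x = restrict f (\<Union>P) y" by simp
      qed
      ultimately have "restrict f (\<Union>P) \<in> const_colourings P (M - replicate_mset (card B) (f b))"
        unfolding const_colourings_def by blast
      moreover have "replicate_mset (card B) (f b) \<subseteq># M" by (subst M) simp
      ultimately show "(f b, restrict f (\<Union>P)) \<in> ?S" by blast
    qed
    show "(\<lambda>(v, g) x. if x \<in> B then v else g x) ` ?S \<subseteq> const_colourings (insert B P) M"
    proof (rule image_subsetI)
      fix vg assume "vg \<in> ?S"
      then obtain v g where vg: "vg = (v, g)" and v: "replicate_mset (card B) v \<subseteq># M"
        and g: "g \<in> const_colourings P (M - replicate_mset (card B) v)" by blast
      let ?f = "\<lambda>x. if x \<in> B then v else g x"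
      have "image_mset ?f (mset_set B) = replicate_mset (card B) v" by (rule const) simp
      moreover have "image_mset ?f (mset_set (\<Union>P)) = image_mset g (mset_set (\<Union>P))"
        using finP BP by (intro image_mset_cong) auto
      ultimately have "image_mset ?f (mset_set (\<Union>(insert B P))) = M"
        using g v mset unfolding const_colourings_def by simp
      moreover have "?f \<in> extensional (\<Union>(insert B P))" using g by (auto simp: const_colourings_def extensional_def)
      moreover have "\<forall>C\<in>insert B P. \<forall>x\<in>C. \<forall>y\<in>C. ?f x = ?f y"
      proof (intro ballI)
        fix C x y assume C: "C \<in> insert B P" "x \<in> C" "y \<in> C"
        show "?f x = ?f y"
        proof (cases "C = B")
          case False
          then have "C \<in> P" using C by simp
          then have "x \<notin> B" "y \<notin> B" "g x = g y" using BP C g unfolding const_colourings_def by blast+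
          then show ?thesis by simp
        qed (use C in simp)
      qed
      ultimately have "?f \<in> const_colourings (insert B P) M" unfolding const_colourings_def by blast
      then show "(\<lambda>(v, g) x. if x \<in> B then v else g x) vg \<in> const_colourings (insert B P) M" by (simp add: vg)
    qed
  qed
  then have "card (const_colourings (insert B P) M) = card ?S" by (rule bij_betw_same_card)
  also have "\<dots> = (\<Sum>v\<in>?V. card (const_colourings P (M - replicate_mset (card B) v)))"
  proof (rule card_SigmaI)
    have "?V \<subseteq> set_mset M" by (rule subsetI) (erule CollectE, rule replicate_mset_in[OF cB])
    then show "finite ?V" using finite_subset by blast
  qed (use finite_const_colourings[OF finP] in auto)
  finally have "of_nat (card (const_colourings (insert B P) M)) =
     (\<Sum>v\<in>?V. of_nat (card (const_colourings P (M - replicate_mset (card B) v))) :: complex)" by simp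
  also have "\<dots> = (\<Sum>v\<in>?V. mcoeff (\<Prod>B\<in>P. power_sum (card B)) (M - replicate_mset (card B) v))"
    using insert.IH insert.prems disjP by (intro sum.cong refl) simp
  also have "\<dots> = mcoeff (\<Prod>B\<in>insert B P. power_sum (card B)) M"
    using insert.hyps by (simp add: mcoeff_power_sum_mult[OF cB])
  finally show ?case by simp
qed

definition colourings :: "nat \<Rightarrow> nat multiset \<Rightarrow> (nat \<Rightarrow> nat) set" where
  "colourings m M = {f \<in> extensional {1..m}. image_mset f (mset_set {1..m}) = M}"

lemma finite_colourings [simp]: "finite (colourings m M)"
proof (rule finite_subset)
  show "colourings m M \<subseteq> {1..m} \<rightarrow>\<^sub>E set_mset M"
    using content_PiE[of "{1..m}"] unfolding colourings_def by blast
  show "finite ({1..m} \<rightarrow>\<^sub>E set_mset M)" by (intro finite_PiE) auto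
qed

text \<open>The cycles of \<open>w\<close> are the blocks, and being constant on them means being
  fixed by \<open>w\<close>.\<close>

lemma mcoeff_cycle_type:
  assumes w: "w permutes {1..m}"
  shows "mcoeff (power_sum_mset (cycle_type m w)) M = of_nat (card {f \<in> colourings m M. w \<in> stab m f})"
proof -
  let ?P = "orbit w ` {1..m}"
  have un: "\<Union>?P = {1..m}" using orbit_Sym_subset[OF w] in_orbit_self[OF w] by blast
  have disj: "disjoint ?P"
  proof (rule pairwiseI)
    fix B C assume BC: "B \<in> ?P" "C \<in> ?P" "B \<noteq> C"
    then obtain x y where "B = orbit w x" "C = orbit w y" by auto
    then show "disjnt B C" using orbit_eq[OF w] BC(3) unfolding disjnt_def by blast
  qed
  have "power_sum_mset (cycle_type m w) = (\<Prod>B\<in>?P. power_sum (card B))"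
    by (simp add: power_sum_mset_def cycle_type_def prod_unfold_prod_mset multiset.map_comp o_def)
  then have "mcoeff (power_sum_mset (cycle_type m w)) M = of_nat (card (const_colourings ?P M))"
    using finite_orbit_Sym[OF w] orbit_nonempty[of w] disj by (subst mcoeff_prod_power_sum[symmetric]) auto
  also have "const_colourings ?P M = {f \<in> colourings m M. w \<in> stab m f}"
  proof -
    have "(\<forall>B\<in>?P. \<forall>x\<in>B. \<forall>y\<in>B. f x = f y) \<longleftrightarrow> w \<in> stab m f" for f :: "nat \<Rightarrow> nat"
    proof
      assume *: "\<forall>B\<in>?P. \<forall>x\<in>B. \<forall>y\<in>B. f x = f y"
      have "f (w x) = f x" if "x \<in> {1..m}" for x
        using * that orbit.base[of w x] in_orbit_self[OF w, of x] by blast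
      then show "w \<in> stab m f" using w by (simp add: stab_def)
    next
      assume s: "w \<in> stab m f"
      have const: "f y = f x" if y: "y \<in> orbit w x" and x: "x \<in> {1..m}" for x y
        using y
      proof induction
        case base then show ?case using s x by (simp add: stab_def)
      next
        case (step y)
        then have "y \<in> {1..m}" using orbit_Sym_subset[OF w x] by blast
        then show ?case using s step by (simp add: stab_def)
      qed
      show "\<forall>B\<in>?P. \<forall>x\<in>B. \<forall>y\<in>B. f x = f y" using const by fastforce
    qed
    then show ?thesis unfolding const_colourings_def colourings_def un by blast
  qed
  finally show ?thesis .
qed

section \<open>Semistandard tableaux\<close>

definition ssyt_content :: "nat list \<Rightarrow> nat multiset \<Rightarrow> (nat \<times> nat \<Rightarrow> nat) set" where
  "ssyt_content nu M = {T \<in> ssyt nu. image_mset T (mset_set (diagram nu)) = M}"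

lemma mcoeff_schur: "mcoeff (schur nu) M = of_nat (card (ssyt_content nu M))"
  unfolding ssyt_content_def by transfer simp

lemma ssyt_content_in: "T \<in> ssyt_content nu M \<Longrightarrow> b \<in> diagram nu \<Longrightarrow> T b \<in># M"
  unfolding ssyt_content_def by auto

lemma ssyt_content_out: "T \<in> ssyt_content nu M \<Longrightarrow> b \<notin> diagram nu \<Longrightarrow> T b = 0"
  unfolding ssyt_content_def ssyt_def by blast

lemma finite_ssyt_content: "finite (ssyt_content nu M)"
proof (rule finite_subset)
  show "ssyt_content nu M \<subseteq> {T. \<forall>b. (b \<in> diagram nu \<longrightarrow> T b \<in> set_mset M) \<and> (b \<notin> diagram nu \<longrightarrow> T b = 0)}"
    using ssyt_content_in by (fastforce simp: ssyt_content_def ssyt_def)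
  show "finite {T. \<forall>b. (b \<in> diagram nu \<longrightarrow> T b \<in> set_mset M) \<and> (b \<notin> diagram nu \<longrightarrow> T b = (0::nat))}"
    by (rule finite_set_of_finite_funs) auto
qed

lemma ssyt_mono:
  assumes nu: "nu \<turnstile>\<^sub>p n" and T: "T \<in> ssyt nu" and ij: "(i, j) \<in> diagram nu" and le: "i' \<le> i" "j' \<le> j"
  shows "T (i', j') \<le> T (i, j)"
proof -
  have row: "T (a, b) \<le> T (a, b + k)" if "(a, b + k) \<in> diagram nu" for a b k
    using that
  proof (induction k)
    case (Suc k)
    have in': "(a, Suc (b + k)) \<in> diagram nu" using Suc.prems by simp
    then have "(a, b + k) \<in> diagram nu" using youngD[OF young_diagram[OF nu]] by (meson le_refl lessI less_imp_le)
    then have "T (a, b) \<le> T (a, b + k)" by (rule Suc.IH)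
    also have "\<dots> \<le> T (a, Suc (b + k))" using T in' unfolding ssyt_def by blast
    finally show ?case by simp
  qed simp
  have col: "T (a, b) \<le> T (a + k, b)" if "(a + k, b) \<in> diagram nu" for a b k
    using that
  proof (induction k)
    case (Suc k)
    have in': "(Suc (a + k), b) \<in> diagram nu" using Suc.prems by simp
    then have "(a + k, b) \<in> diagram nu" using youngD[OF young_diagram[OF nu]] by (meson le_refl lessI less_imp_le)
    then have "T (a, b) \<le> T (a + k, b)" by (rule Suc.IH)
    also have "\<dots> < T (Suc (a + k), b)" using T in' unfolding ssyt_def by blast
    finally show ?case by simp
  qed simp
  have "(i', j) \<in> diagram nu" using youngD[OF young_diagram[OF nu] ij] le by simp
  then have "T (i', j') \<le> T (i', j)" using row[of i' j' "j - j'"] le by simp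
  also have "\<dots> \<le> T (i, j)" using col[of i' "i - i'" j] ij le by simp
  finally show ?thesis .
qed

text \<open>The boxes containing the largest entry form a horizontal strip, and are removed.\<close>

lemma card_ssyt_step:
  assumes nu: "nu \<turnstile>\<^sub>p m + k" and lt: "\<And>x. x \<in># M \<Longrightarrow> x < r" and sz: "size M = m"
  shows "card (ssyt_content nu (M + replicate_mset k r)) =
    (\<Sum>ka | ka \<in> parts m \<and> hstrip nu ka. card (ssyt_content ka M))"
proof -
  let ?K = "{ka. ka \<in> parts m \<and> hstrip nu ka}"
  let ?S = "SIGMA ka:?K. ssyt_content ka M"
  let ?M = "M + replicate_mset k r"
  \<comment> \<open>The inverse construction: boxes outside the smaller shape receive the largest
    entry \<open>r\<close>, and boxes outside \<open>nu\<close> the default 0 that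
    \<open>ssyt\<close> demands.\<close>
  define ext where "ext = (\<lambda>(ka, S) b. if b \<in> diagram ka then S b else if b \<in> diagram nu then r else 0 :: nat)"
  have sub: "diagram ka \<subseteq> diagram nu" if "ka \<in> ?K" for ka
    using that by (auto simp: hstrip_def diagram_subset_iff)
  have restr: "{b \<in> diagram nu. ext (ka, S) b < r} = diagram ka" if "ka \<in> ?K" "S \<in> ssyt_content ka M" for ka S
    using sub[OF that(1)] lt[OF ssyt_content_in[OF that(2)]] by (auto simp: ext_def split: if_splits)
  have "bij_betw ext ?S (ssyt_content nu ?M)"
    unfolding bij_betw_def
  proof
    show "inj_on ext ?S"
    proof (rule inj_onI)
      fix p q assume pq: "p \<in> ?S" "q \<in> ?S" "ext p = ext q"
      obtain ka S where p: "p = (ka, S)" by (cases p)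
      obtain ka' S' where q: "q = (ka', S')" by (cases q)
      have K: "ka \<in> ?K" "S \<in> ssyt_content ka M" "ka' \<in> ?K" "S' \<in> ssyt_content ka' M" using pq p q by auto
      have "diagram ka = diagram ka'" using restr[OF K(1,2)] restr[OF K(3,4)] pq(3) p q by simp
      then have ka: "ka = ka'" using K diagram_inj[of ka m ka' m] by auto
      have "S = S'"
      proof
        fix b
        show "S b = S' b"
        proof (cases "b \<in> diagram ka")
          case True
          then show ?thesis using fun_cong[OF pq(3), of b] p q ka by (simp add: ext_def)
        next
          case False
          then show ?thesis using ssyt_content_out[OF K(2)] ssyt_content_out[OF K(4)] ka by simp
        qed
      qed
      then show "p = q" using p q ka by simp
    qed
    show "ext ` ?S = ssyt_content nu ?M"
    proof (intro equalityI subsetI)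
      fix T assume "T \<in> ext ` ?S"
      then obtain ka S where K: "ka \<in> ?K" and S: "S \<in> ssyt_content ka M" and T: "T = ext (ka, S)" by auto
      have ka: "ka \<turnstile>\<^sub>p m" and h: "hstrip nu ka" using K by auto
      have Sss: "S \<in> ssyt ka" using S by (simp add: ssyt_content_def)
      have T_in: "T b = S b" if "b \<in> diagram ka" for b using that by (simp add: T ext_def)
      have T_out: "T b = r" if "b \<in> diagram nu" "b \<notin> diagram ka" for b using that by (simp add: T ext_def)
      have T_lt: "T b < r" if "b \<in> diagram ka" for b using T_in[OF that] lt[OF ssyt_content_in[OF S that]] by simp
      have "T \<in> ssyt nu"
        unfolding ssyt_def
      proof (intro CollectI conjI allI impI)
        fix b assume "b \<notin> diagram nu"
        then show "T b = 0" using sub[OF K] by (auto simp: T ext_def)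
      next
        fix i j assume in': "(i, Suc j) \<in> diagram nu"
        then have in0: "(i, j) \<in> diagram nu" using youngD[OF young_diagram[OF nu]] by (meson le_refl lessI less_imp_le)
        show "T (i, j) \<le> T (i, Suc j)"
        proof (cases "(i, Suc j) \<in> diagram ka")
          case True
          then have "(i, j) \<in> diagram ka" using youngD[OF young_diagram[OF ka]] by (meson le_refl lessI less_imp_le)
          moreover have "S (i, j) \<le> S (i, Suc j)" using True Sss unfolding ssyt_def by blast
          ultimately show ?thesis using True T_in by simp
        next
          case False
          then show ?thesis using T_out[OF in' False] T_out[OF in0] T_lt[of "(i, j)"] by (cases "(i, j) \<in> diagram ka") auto
        qed
      next
        fix i j assume in': "(Suc i, j) \<in> diagram nu"
        have "row_len nu (Suc i) \<le> row_len ka i" using h unfolding hstrip_def by blast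
        then have in0: "(i, j) \<in> diagram ka" using in' by (simp add: diagram_iff)
        show "T (i, j) < T (Suc i, j)"
        proof (cases "(Suc i, j) \<in> diagram ka")
          case True
          have "S (i, j) < S (Suc i, j)" using True Sss unfolding ssyt_def by blast
          then show ?thesis using True in0 T_in by simp
        next
          case False
          then show ?thesis using T_out[OF in' False] T_lt[OF in0] by simp
        qed
      qed
      moreover have "image_mset T (mset_set (diagram nu)) = ?M"
      proof -
        have split: "mset_set (diagram nu) = mset_set (diagram ka) + mset_set (diagram nu - diagram ka)"
          using sub[OF K] by (subst mset_set_Union[symmetric]) (auto intro!: arg_cong[where f = mset_set])
        have "image_mset T (mset_set (diagram ka)) = image_mset S (mset_set (diagram ka))"
          by (intro image_mset_cong) (simp add: T_in)
        then have 1: "image_mset T (mset_set (diagram ka)) = M" using S by (simp add: ssyt_content_def)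
        have "image_mset T (mset_set (diagram nu - diagram ka)) = image_mset (\<lambda>_. r) (mset_set (diagram nu - diagram ka))"
          by (intro image_mset_cong) (simp add: T_out)
        also have "\<dots> = replicate_mset (card (diagram nu - diagram ka)) r" by (simp add: image_mset_const_eq)
        also have "card (diagram nu - diagram ka) = k"
          using sub[OF K] by (simp add: card_Diff_subset card_diagram_partition[OF nu] card_diagram_partition[OF ka])
        finally show ?thesis unfolding split using 1 by simp
      qed
      ultimately show "T \<in> ssyt_content nu ?M" by (simp add: ssyt_content_def)
    next
      fix T assume T: "T \<in> ssyt_content nu ?M"
      then have Tss: "T \<in> ssyt nu" and Tc: "image_mset T (mset_set (diagram nu)) = ?M" by (simp_all add: ssyt_content_def)
      have le: "T b \<le> r" if "b \<in> diagram nu" for b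
        using ssyt_content_in[OF T that] lt[of "T b"] by (auto simp: in_replicate_mset split: if_splits)
      \<comment> \<open>The boxes with entries below \<open>r\<close> form a diagram by
        monotonicity, and column strictness makes the rest a horizontal strip.\<close>
      define D where "D = {b \<in> diagram nu. T b < r}"
      have "young D"
      proof (rule youngI)
        fix i j i' j' assume a: "(i, j) \<in> D" "i' \<le> i" "j' \<le> j"
        then show "(i', j') \<in> D"
          using youngD[OF young_diagram[OF nu], of i j i' j'] ssyt_mono[OF nu Tss, of i j i' j'] by (simp add: D_def)
      qed (simp add: D_def)
      then obtain ka where ka': "ka \<turnstile>\<^sub>p card D" "diagram ka = D" using young_ex_partition by blast
      have Dc: "image_mset T (mset_set D) = M"
      proof -
        have "image_mset T (mset_set D) = image_mset T (filter_mset (\<lambda>b. T b < r) (mset_set (diagram nu)))"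
          by (simp add: D_def)
        also have "\<dots> = filter_mset (\<lambda>x. x < r) ?M"
          unfolding Tc[symmetric] by (simp add: filter_mset_image_mset)
        also have "\<dots> = M"
        proof -
          have "filter_mset (\<lambda>x. x < r) M = filter_mset (\<lambda>x. True) M" by (rule filter_mset_cong) (simp_all add: lt)
          moreover have "filter_mset (\<lambda>x. x < r) (replicate_mset k r) = {#}" by (induction k) auto
          ultimately show ?thesis by simp
        qed
        finally show ?thesis .
      qed
      have "card D = m" using arg_cong[OF Dc, of size] sz by simp
      then have ka: "ka \<turnstile>\<^sub>p m" using ka' by simp
      have D_iff: "(i, j) \<in> D \<longleftrightarrow> j < row_len ka i" for i j using ka'(2) diagram_iff by metis
      have h: "hstrip nu ka"
        unfolding hstrip_def
      proof (intro allI conjI)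
        fix i
        have "diagram ka \<subseteq> diagram nu" using ka'(2) by (auto simp: D_def)
        then show "row_len ka i \<le> row_len nu i" by (simp add: diagram_subset_iff)
        show "row_len nu (Suc i) \<le> row_len ka i"
        proof (rule ccontr)
          assume "\<not> row_len nu (Suc i) \<le> row_len ka i"
          then have in': "(Suc i, row_len ka i) \<in> diagram nu" by (simp add: diagram_iff)
          then have "T (i, row_len ka i) < T (Suc i, row_len ka i)" using Tss unfolding ssyt_def by blast
          also have "\<dots> \<le> r" by (rule le[OF in'])
          finally have "(i, row_len ka i) \<in> D"
            using youngD[OF young_diagram[OF nu] in', of i "row_len ka i"] by (simp add: D_def)
          then show False by (simp add: D_iff)
        qed
      qed
      define S where "S = (\<lambda>b. if b \<in> D then T b else 0)"
      have "S \<in> ssyt ka"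
        unfolding ssyt_def ka'(2)
      proof (intro CollectI conjI allI impI)
        fix i j assume in': "(i, Suc j) \<in> D"
        then have "(i, j) \<in> D" using youngD[OF \<open>young D\<close>] by (meson le_refl lessI less_imp_le)
        moreover have "T (i, j) \<le> T (i, Suc j)" using in' Tss unfolding ssyt_def D_def by blast
        ultimately show "S (i, j) \<le> S (i, Suc j)" using in' by (simp add: S_def)
      next
        fix i j assume in': "(Suc i, j) \<in> D"
        then have "(i, j) \<in> D" using youngD[OF \<open>young D\<close>] by (meson le_refl lessI less_imp_le)
        moreover have "T (i, j) < T (Suc i, j)" using in' Tss unfolding ssyt_def D_def by blast
        ultimately show "S (i, j) < S (Suc i, j)" using in' by (simp add: S_def)
      qed (simp add: S_def)
      moreover have "image_mset S (mset_set D) = image_mset T (mset_set D)"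
        by (intro image_mset_cong) (auto simp: S_def D_def)
      ultimately have S: "S \<in> ssyt_content ka M" by (simp add: ssyt_content_def ka'(2) Dc)
      have "ext (ka, S) = T"
      proof
        fix b
        consider "b \<in> D" | "b \<in> diagram nu" "b \<notin> D" | "b \<notin> diagram nu" by blast
        then show "ext (ka, S) b = T b"
        proof cases
          case 1 then show ?thesis by (simp add: ext_def ka'(2) S_def)
        next
          case 2
          then have "T b = r" using le[of b] by (auto simp: D_def)
          then show ?thesis using 2 by (simp add: ext_def ka'(2))
        next
          case 3
          then have "T b = 0" "b \<notin> D" using ssyt_content_out[OF T] by (auto simp: D_def)
          then show ?thesis using 3 by (simp add: ext_def ka'(2))
        qed
      qed
      then show "T \<in> ext ` ?S" using S ka h by force
    qed
  qed
  then have "card (ssyt_content nu ?M) = card ?S" by (rule bij_betw_same_card[symmetric])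
  also have "\<dots> = (\<Sum>ka\<in>?K. card (ssyt_content ka M))"
    by (rule card_SigmaI) (auto simp: finite_ssyt_content)
  finally show ?thesis .
qed

section \<open>The characteristic of an irreducible character\<close>

lemma permutes_part:
  assumes w: "w permutes S" and fin: "finite S" and A: "A \<subseteq> S" "\<And>x. x \<in> A \<Longrightarrow> w x \<in> A"
  shows "(\<lambda>x. if x \<in> A then w x else x) permutes A"
proof (rule bij_imp_permutes)
  have "inj_on w A" using permutes_inj_on[OF w] .
  moreover have "w ` A = A" using A(2) finite_subset[OF A(1) fin] \<open>inj_on w A\<close> by (intro endo_inj_surj) auto
  ultimately have "bij_betw w A A" by (simp add: bij_betw_def)
  then show "bij_betw (\<lambda>x. if x \<in> A then w x else x) A A"
    by (rule bij_betw_cong[THEN iffD1, rotated]) simp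
qed simp

text \<open>Among the first \<open>m + k\<close> letters the colour \<open>r\<close> occurs exactly
  beyond \<open>m\<close>, so a colour-preserving permutation preserves both parts.\<close>

lemma stab_split:
  assumes g: "\<And>x. x \<in> {1..m} \<Longrightarrow> g x \<noteq> (r::nat)"
  defines "f \<equiv> \<lambda>x. if x \<le> m then g x else r"
  shows "bij_betw (\<lambda>(u, y). u \<circ> y) (stab m g \<times> stab (m + k) (block_fun m)) (stab (m + k) f)"
  unfolding bij_betw_def stab_block_fun
proof
  let ?n = "m + k" and ?B = "{m<..m + k}"
  have perm: "u permutes {1..?n}" "y permutes {1..?n}" "\<And>x. x \<le> m \<Longrightarrow> y x = x" "\<And>x. m < x \<Longrightarrow> u x = x"
    if "u \<in> stab m g" "y permutes ?B" for u y
  proof -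
    have "?B \<subseteq> {1..?n}" by auto
    then show "y permutes {1..?n}" by (rule permutes_subset[OF that(2)])
    show "u permutes {1..?n}" by (rule Sym_mono[OF stabD[OF that(1)]]) simp
    show "y x = x" if "x \<le> m" for x using permutes_not_in[OF \<open>y permutes ?B\<close>, of x] that by simp
    show "u x = x" if "m < x" for x using permutes_not_in[OF stabD[OF \<open>u \<in> stab m g\<close>], of x] that by simp
  qed
  show "inj_on (\<lambda>(u, y). u \<circ> y) (stab m g \<times> {p. p permutes ?B})"
  proof (rule inj_onI)
    fix a b assume a: "a \<in> stab m g \<times> {p. p permutes ?B}" and b: "b \<in> stab m g \<times> {p. p permutes ?B}"
      and eq: "(\<lambda>(u, y). u \<circ> y) a = (\<lambda>(u, y). u \<circ> y) b"
    obtain u y u' y' where ab: "a = (u, y)" "b = (u', y')" by (cases a, cases b)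
    have 1: "u \<in> stab m g" "y permutes ?B" and 2: "u' \<in> stab m g" "y' permutes ?B" using a b ab by auto
    have eq': "u \<circ> y = u' \<circ> y'" using eq ab by simp
    have "u = u'"
    proof
      fix x
      show "u x = u' x"
      proof (cases "x \<le> m")
        case True then show ?thesis using fun_cong[OF eq', of x] perm(3)[OF 1] perm(3)[OF 2] by simp
      next
        case False then show ?thesis using perm(4)[OF 1] perm(4)[OF 2] by simp
      qed
    qed
    moreover have "y = y'" using eq' \<open>u = u'\<close> Sym_inv_comp(1)[OF perm(1)[OF 1]] by metis
    ultimately show "a = b" using ab by simp
  qed
  show "(\<lambda>(u, y). u \<circ> y) ` (stab m g \<times> {p. p permutes ?B}) = stab ?n f"
  proof (intro equalityI subsetI)
    fix w assume "w \<in> (\<lambda>(u, y). u \<circ> y) ` (stab m g \<times> {p. p permutes ?B})"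
    then obtain u y where uy: "u \<in> stab m g" "y permutes ?B" "w = u \<circ> y" by auto
    have "f (u (y x)) = f x" if x: "x \<in> {1..?n}" for x
    proof (cases "x \<le> m")
      case True
      then have "x \<in> {1..m}" using x by simp
      then have "u x \<in> {1..m}" "g (u x) = g x" using uy(1) permutes_in_image[OF stabD[OF uy(1)]] by (auto simp: stab_def)
      then show ?thesis using True perm(3)[OF uy(1,2)] by (simp add: f_def)
    next
      case False
      then have "y x \<in> ?B" using permutes_in_image[OF uy(2)] x by simp
      then show ?thesis using False perm(4)[OF uy(1,2)] by (simp add: f_def)
    qed
    then show "w \<in> stab ?n f"
      using perm(1,2)[OF uy(1,2)] by (auto simp: stab_def uy(3) intro!: permutes_compose)
  next
    fix w assume "w \<in> stab ?n f"
    then have w: "w permutes {1..?n}" "\<And>x. x \<in> {1..?n} \<Longrightarrow> f (w x) = f x" by (auto simp: stab_def)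
    have f_iff: "f x \<noteq> r \<longleftrightarrow> x \<le> m" if "x \<in> {1..?n}" for x using g[of x] that by (auto simp: f_def)
    have w_iff: "w x \<le> m \<longleftrightarrow> x \<le> m" if "x \<in> {1..?n}" for x
      using f_iff[OF that] f_iff[of "w x"] w(2)[OF that] permutes_in_image[OF w(1), of x] that by simp
    define u where "u = (\<lambda>x. if x \<in> {1..m} then w x else x)"
    define y where "y = (\<lambda>x. if x \<in> ?B then w x else x)"
    have wr: "w x \<in> {1..?n}" if "x \<in> {1..?n}" for x using permutes_in_image[OF w(1), of x] that by simp
    have "u permutes {1..m}" unfolding u_def
      by (rule permutes_part[OF w(1)]) (use w_iff wr in force)+
    moreover have "g (u x) = g x" if "x \<in> {1..m}" for x
      using w(2)[of x] w_iff[of x] that by (simp add: u_def f_def)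
    ultimately have u: "u \<in> stab m g" by (simp add: stab_def)
    have y: "y permutes ?B" unfolding y_def
    proof (rule permutes_part[OF w(1)])
      fix x assume x: "x \<in> ?B"
      then have "x \<in> {1..?n}" by auto
      then show "w x \<in> ?B" using w_iff[of x] wr[of x] x by auto
    qed auto
    have "w = u \<circ> y"
    proof
      fix x
      consider "x \<in> {1..m}" | "x \<in> ?B" | "x \<notin> {1..?n}" by fastforce
      then show "w x = (u \<circ> y) x"
      proof cases
        case 1 then show ?thesis by (simp add: u_def y_def)
      next
        case 2
        then have "w x \<notin> {1..m}" using w_iff[of x] by auto
        moreover have "(u \<circ> y) x = u (w x)" using 2 by (simp add: y_def)
        ultimately show ?thesis unfolding u_def by presburger
      next
        case 3
        then show ?thesis using permutes_not_in[OF w(1) 3] by (auto simp: u_def y_def)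
      qed
    qed
    then show "w \<in> (\<lambda>(u, y). u \<circ> y) ` (stab m g \<times> {p. p permutes ?B})" using u y by force
  qed
qed

lemma
  assumes "\<And>x. x \<in> {1..m} \<Longrightarrow> g x \<noteq> (r::nat)"
  defines "f \<equiv> \<lambda>x. if x \<le> m then g x else r"
  shows row_sum_split: "row_sum (m + k) f = fact k \<cdot>\<^sub>g (row_sum m g * symmetrizer m k)"
    and card_stab_split: "card (stab (m + k) f) = card (stab m g) * fact k"
proof -
  note bij = stab_split[where m = m and k = k and g = g and r = r, OF assms(1), folded f_def]
  have "row_sum (m + k) f = (\<Sum>(u, y)\<in>stab m g \<times> stab (m + k) (block_fun m). \<delta> (u \<circ> y))"
    unfolding row_sum_def using sum.reindex_bij_betw[OF bij, of \<delta>] by (simp add: split_def)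
  also have "\<dots> = (\<Sum>(u, y)\<in>stab m g \<times> stab (m + k) (block_fun m). \<delta> u * \<delta> y)"
  proof (intro sum.cong refl, clarify)
    fix u y assume "u \<in> stab m g" "y \<in> stab (m + k) (block_fun m)"
    then show "\<delta> (u \<circ> y) = \<delta> u * \<delta> y"
      using delta_mult[OF Sym_mono[OF stabD] stabD, of u m g "m + k" y "block_fun m"] by simp
  qed
  also have "\<dots> = row_sum m g * row_sum (m + k) (block_fun m)"
    by (simp add: row_sum_def sum_product sum.cartesian_product)
  finally show "row_sum (m + k) f = fact k \<cdot>\<^sub>g (row_sum m g * symmetrizer m k)"
    by (simp add: symmetrizer_def)
  show "card (stab (m + k) f) = card (stab m g) * fact k"
    using bij_betw_same_card[OF bij] by (simp add: card_cartesian_product card_block)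
qed

text \<open>The two colourings differ by a relabelling, which conjugates the row sum;
  \<open>chi nu\<close> is central.\<close>

lemma ctr_chi_row_sum_conj:
  assumes nu: "nu \<turnstile>\<^sub>p n" and s: "s permutes {1..n}" and f: "\<And>x. x \<in> {1..n} \<Longrightarrow> f x = f' (s x)"
  shows "ctr (chi nu * row_sum n f) = ctr (chi nu * row_sum n f')" "card (stab n f) = card (stab n f')"
proof -
  have st: "stab n f = stab n (f' \<circ> s)" by (rule stab_cong) (simp add: f)
  have "row_sum n f = \<delta> (inv s) * row_sum n f' * \<delta> s"
    using row_sum_comp[OF s, of f'] by (simp add: row_sum_def st)
  then have "ctr (chi nu * row_sum n f) = ctr (chi nu * \<delta> (inv s) * row_sum n f' * \<delta> s)"
    by (simp only: mult.assoc)
  also have "\<dots> = ctr (\<delta> s * (chi nu * \<delta> (inv s) * row_sum n f'))" by (rule ctr_commute)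
  also have "\<dots> = ctr (\<delta> s * chi nu * \<delta> (inv s) * row_sum n f')" by (simp only: mult.assoc)
  also have "\<delta> s * chi nu * \<delta> (inv s) = chi nu"
    using class_fun_chi[OF nu] s by (simp add: class_fun_def mult.assoc)
  finally show "ctr (chi nu * row_sum n f) = ctr (chi nu * row_sum n f')" .
  show "card (stab n f) = card (stab n f')"
    unfolding st by (rule bij_betw_same_card[OF bij_betw_stab_comp[OF s], symmetric])
qed

lemma ex_colouring: "size M = m \<Longrightarrow> \<exists>g. g \<in> colourings m M"
proof -
  assume sz: "size M = m"
  obtain xs where xs: "mset xs = M" using ex_mset by blast
  then have len: "length xs = m" using sz by auto
  let ?g = "restrict (\<lambda>x. xs ! (x - 1)) {1..m}"
  have set_eq: "mset_set {1..m} = image_mset Suc (mset_set {0..<m})"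
    by (subst image_mset_mset_set) (auto simp: image_Suc_atLeastLessThan atLeastLessThanSuc_atLeastAtMost One_nat_def)
  have "image_mset ?g (mset_set {1..m}) = image_mset (\<lambda>x. xs ! (x - 1)) (mset_set {1..m})"
    by (intro image_mset_cong) simp
  also have "\<dots> = image_mset ((!) xs) (mset_set {0..<m})"
    unfolding set_eq by (simp add: multiset.map_comp o_def)
  also have "\<dots> = M" unfolding xs[symmetric] len[symmetric] by (metis map_nth mset_map mset_upt)
  finally have *: "image_mset ?g (mset_set {1..m}) = M" .
  have "?g \<in> colourings m M"
    unfolding colourings_def by (intro CollectI conjI restrict_extensional *)
  then show ?thesis by (rule exI[where x = ?g])
qed

lemma colourings_conj:
  assumes "f \<in> colourings m M" "f' \<in> colourings m M"
  obtains s where "s permutes {1..m}" "\<And>x. x \<in> {1..m} \<Longrightarrow> f x = f' (s x)"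
proof -
  have eq: "image_mset f (mset_set {1..m}) = image_mset f' (mset_set {1..m})"
    using assms by (simp add: colourings_def)
  show thesis by (rule image_mset_eq_implies_permutes[OF _ eq]) (use that in blast)+
qed

text \<open>Divided by the order of the stabilizer, the left side is the multiplicity of the trivial
  representation of a Young subgroup in the Specht module, a Kostka number. When the largest colour
  is removed, the Pieri rule and the count of tableaux give the same recursion.\<close>

lemma ctr_chi_row_sum:
  "nu \<turnstile>\<^sub>p n \<Longrightarrow> f \<in> colourings n M \<Longrightarrow>
   ctr (chi nu * row_sum n f) = of_nat (card (stab n f)) * of_nat (card (ssyt_content nu M))"
proof (induction n arbitrary: nu f M rule: less_induct)
  case (less n)
  note nu = less.prems(1)
  have sz: "size M = n" using less.prems(2) by (auto simp: colourings_def)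
  show ?case
  proof (cases "n = 0")
    case True
    have "nu = []" using nu parts_iff[of nu 0] True unfolding parts_0 by simp
    moreover have "fdim [] = 1" using fdim_complete[of 0] by (simp add: parts_0)
    moreover have "ctr (chi []) = of_nat (fdim [])" by (rule fdim(1)[of _ 0]) (simp add: partition_of_def)
    moreover have "stab n f = {id}" using True by (auto simp: stab_def)
    moreover have "ssyt_content [] M = {\<lambda>_. 0}" using sz True by (auto simp: ssyt_content_def ssyt_def)
    moreover have "row_sum n f = 1" unfolding row_sum_def \<open>stab n f = {id}\<close> by simp
    ultimately show ?thesis by (simp only: mult_1_right) simp
  next
    case False
    define r where "r = Max (set_mset M)"
    define k where "k = count M r"
    define M' where "M' = filter_mset (\<lambda>x. x \<noteq> r) M"
    have ne: "set_mset M \<noteq> {}" using sz False by auto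
    have rM: "r \<in># M" unfolding r_def using ne by (intro Max_in) auto
    have M: "M = M' + replicate_mset k r"
      unfolding M'_def k_def by (subst multiset_partition[of M "\<lambda>x. x \<noteq> r"]) (simp add: filter_eq_replicate_mset)
    have kpos: "k > 0" using rM by (simp add: k_def)
    have lt: "x < r" if "x \<in># M'" for x
    proof -
      have "x \<in># M" "x \<noteq> r" using that by (auto simp: M'_def)
      then show ?thesis using Max_ge[of "set_mset M" x] unfolding r_def[symmetric] by simp
    qed
    define m where "m = size M'"
    have n: "n = m + k" using sz M by (simp add: m_def)
    obtain g where g: "g \<in> colourings m M'" using ex_colouring[of M' m] m_def by blast
    have gr: "g x \<noteq> r" if "x \<in> {1..m}" for x
    proof -
      have "g x \<in># M'" using content_PiE[of "{1..m}" g M'] g that unfolding colourings_def by auto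
      then show ?thesis using lt by blast
    qed
    \<comment> \<open>A colouring of the same content with the largest colour on the last
      \<open>k\<close> letters; relabelling changes neither the trace nor the order of the
      stabilizer.\<close>
    define f0 where "f0 = (\<lambda>x. if x \<le> m then g x else r)"
    have "image_mset f0 (mset_set {1..n}) = M"
    proof -
      have "{1..n} = {1..m} \<union> {m<..m + k}" unfolding n by auto
      then have "mset_set {1..n} = mset_set {1..m} + mset_set {m<..m + k}" by (subst mset_set_Union[symmetric]) auto
      moreover have "image_mset f0 (mset_set {1..m}) = image_mset g (mset_set {1..m})"
        by (intro image_mset_cong) (simp add: f0_def)
      moreover have "image_mset f0 (mset_set {m<..m + k}) = image_mset (\<lambda>_. r) (mset_set {m<..m + k})"
        by (intro image_mset_cong) (simp add: f0_def)
      ultimately show ?thesis using g M by (simp add: colourings_def image_mset_const_eq)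
    qed
    then have f0: "image_mset f (mset_set {1..n}) = image_mset f0 (mset_set {1..n})"
      using less.prems(2) by (simp add: colourings_def)
    obtain s where s: "s permutes {1..n}" "\<And>x. x \<in> {1..n} \<Longrightarrow> f x = f0 (s x)"
      by (rule image_mset_eq_implies_permutes[OF _ f0]) (simp, blast)
    have conj: "ctr (chi nu * row_sum n f) = ctr (chi nu * row_sum n f0)" "card (stab n f) = card (stab n f0)"
      using s(2) by (auto intro: ctr_chi_row_sum_conj[OF nu s(1)])
    have nu': "nu \<turnstile>\<^sub>p m + k" using nu n by simp
    have gS: "supp_in m (row_sum m g)" by simp
    have "row_sum n f0 = fact k \<cdot>\<^sub>g (row_sum m g * symmetrizer m k)"
      unfolding n f0_def by (rule row_sum_split) (rule gr)
    then have "ctr (chi nu * row_sum n f0) = fact k * ctr (chi nu * (row_sum m g * symmetrizer m k))"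
      by simp
    also have "row_sum m g * symmetrizer m k = symmetrizer m k * row_sum m g"
      by (rule symmetrizer_commute[OF gS, symmetric])
    also have "ctr (chi nu * (symmetrizer m k * row_sum m g)) = ctr (restr m (chi nu * symmetrizer m k) * row_sum m g)"
      unfolding restr_mult_right[OF gS, symmetric] by (simp add: mult.assoc)
    also have "\<dots> = (\<Sum>ka | ka \<in> parts m \<and> hstrip nu ka. ctr (chi ka * row_sum m g))"
      unfolding pieri[OF nu'] by (simp add: sum_distrib_right)
    also have "\<dots> = (\<Sum>ka | ka \<in> parts m \<and> hstrip nu ka. of_nat (card (stab m g)) * of_nat (card (ssyt_content ka M')))"
      by (intro sum.cong refl less.IH[OF _ _ g]) (use kpos n in auto)
    also have "\<dots> = of_nat (card (stab m g)) * of_nat (card (ssyt_content nu M))"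
      using card_ssyt_step[OF nu' _ m_def[symmetric], of r] lt by (simp add: M sum_distrib_left)
    finally have "ctr (chi nu * row_sum n f0) = of_nat (card (stab m g) * fact k) * of_nat (card (ssyt_content nu M))"
      by (simp only: of_nat_mult of_nat_fact mult_ac)
    also have "card (stab m g) * fact k = card (stab n f0)"
      unfolding n f0_def by (rule card_stab_split[symmetric]) (rule gr)
    finally show ?thesis unfolding conj .
  qed
qed

text \<open>Each permutation \<open>s\<close> yields the colouring \<open>f0 \<circ> s\<close>, and
  the permutations yielding a given \<open>f\<close> form a coset of its stabilizer.\<close>

lemma sum_card_stab:
  assumes sz: "size M = m" shows "(\<Sum>f\<in>colourings m M. card (stab m f)) = fact m"
proof -
  obtain f0 where f0: "f0 \<in> colourings m M" using ex_colouring[OF sz] by blast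
  let ?F = "\<lambda>f. {s \<in> Sym m. \<forall>x\<in>{1..m}. f x = f0 (s x)}"
  have "card (?F f) = card (stab m f)" if f: "f \<in> colourings m M" for f
  proof -
    obtain s0 where s0: "s0 permutes {1..m}" "\<And>x. x \<in> {1..m} \<Longrightarrow> f x = f0 (s0 x)"
      using colourings_conj[OF f f0] by blast
    have "bij_betw (\<lambda>t. s0 \<circ> t) (stab m f) (?F f)"
    proof (rule bij_betw_byWitness[of _ "\<lambda>s. inv s0 \<circ> s"])
      show "(\<lambda>t. s0 \<circ> t) ` stab m f \<subseteq> ?F f"
      proof (rule image_subsetI)
        fix t assume t: "t \<in> stab m f"
        have "f x = f0 (s0 (t x))" if "x \<in> {1..m}" for x
          using t that s0(2)[of "t x"] permutes_in_image[OF stabD[OF t], of x] by (simp add: stab_def)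
        then show "s0 \<circ> t \<in> ?F f" using permutes_compose[OF stabD[OF t] s0(1)] by simp
      qed
      show "(\<lambda>s. inv s0 \<circ> s) ` ?F f \<subseteq> stab m f"
      proof (rule image_subsetI)
        fix s assume s: "s \<in> ?F f"
        have "f (inv s0 (s x)) = f x" if x: "x \<in> {1..m}" for x
        proof -
          have "s x \<in> {1..m}" using s permutes_in_image[of s "{1..m}" x] x by simp
          then have "inv s0 (s x) \<in> {1..m}" using permutes_in_image[OF permutes_inv[OF s0(1)]] by simp
          then have "f (inv s0 (s x)) = f0 (s x)" using s0(2) permutes_inverses(1)[OF s0(1)] by simp
          then show ?thesis using s x by simp
        qed
        then show "inv s0 \<circ> s \<in> stab m f" using s permutes_compose[OF _ permutes_inv[OF s0(1)]] by (simp add: stab_def)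
      qed
    qed (use s0(1) in \<open>auto simp: Sym_inv_comp\<close>)
    then show ?thesis by (rule bij_betw_same_card[symmetric])
  qed
  then have "(\<Sum>f\<in>colourings m M. card (stab m f)) = (\<Sum>f\<in>colourings m M. card (?F f))" by simp
  also have "\<dots> = card (\<Union>f\<in>colourings m M. ?F f)"
  proof (rule card_UN_disjoint[symmetric])
    show "\<forall>f\<in>colourings m M. \<forall>f'\<in>colourings m M. f \<noteq> f' \<longrightarrow> ?F f \<inter> ?F f' = {}"
    proof (intro ballI impI)
      fix f f' assume ff: "f \<in> colourings m M" "f' \<in> colourings m M" "f \<noteq> f'"
      show "?F f \<inter> ?F f' = {}"
      proof (rule ccontr)
        assume "?F f \<inter> ?F f' \<noteq> {}"
        then obtain s where "\<forall>x\<in>{1..m}. f x = f0 (s x)" "\<forall>x\<in>{1..m}. f' x = f0 (s x)" by blast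
        then have "f = f'" using ff(1,2) unfolding colourings_def by (auto intro: extensionalityI)
        then show False using ff(3) by simp
      qed
    qed
  qed (auto intro: finite_subset[OF _ finite_Sym[of m]])
  also have "(\<Union>f\<in>colourings m M. ?F f) = Sym m"
  proof (intro equalityI subsetI)
    fix s assume "s \<in> Sym m"
    then have s: "s permutes {1..m}" by simp
    let ?f = "restrict (f0 \<circ> s) {1..m}"
    have "image_mset ?f (mset_set {1..m}) = image_mset f0 (image_mset s (mset_set {1..m}))"
      unfolding multiset.map_comp by (intro image_mset_cong) simp
    also have "image_mset s (mset_set {1..m}) = mset_set {1..m}"
      using image_mset_mset_set[OF permutes_inj_on[OF s], of "{1..m}"] permutes_image[OF s] by simp
    also have "image_mset f0 (mset_set {1..m}) = M" using f0 unfolding colourings_def by simp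
    finally have *: "image_mset ?f (mset_set {1..m}) = M" .
    have "?f \<in> colourings m M"
      unfolding colourings_def by (intro CollectI conjI restrict_extensional *)
    moreover have "s \<in> ?F ?f" using s by simp
    ultimately show "s \<in> (\<Union>f\<in>colourings m M. ?F f)" by blast
  qed auto
  finally show ?thesis by (simp add: card_Sym)
qed

text \<open>The coefficient at \<open>M\<close> is a sum over pairs of a permutation and a colouring
  fixed by it. For each colouring the character sums to a Kostka number times the order of the
  stabilizer, and these orders add up to \<open>fact m\<close>.\<close>

theorem frobenius:
  assumes nu: "nu \<turnstile>\<^sub>p m"
  shows "mfps_const (1 / fact m) * (\<Sum>w\<in>Sym m. mfps_const (coef (chi nu) w) * power_sum_mset (cycle_type m w)) = schur nu"
  unfolding mfps_eq_iff
proof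
  fix M
  let ?K = "of_nat (card (ssyt_content nu M)) :: complex"
  have "(\<Sum>w\<in>Sym m. coef (chi nu) w * of_nat (card {f \<in> colourings m M. w \<in> stab m f})) =
    (\<Sum>w\<in>Sym m. \<Sum>f\<in>colourings m M. if w \<in> stab m f then coef (chi nu) w else 0)"
  proof (rule sum.cong[OF refl])
    fix w
    show "coef (chi nu) w * of_nat (card {f \<in> colourings m M. w \<in> stab m f}) =
      (\<Sum>f\<in>colourings m M. if w \<in> stab m f then coef (chi nu) w else 0)"
      by (subst sum_if_filter) (simp_all add: mult.commute)
  qed
  also have "\<dots> = (\<Sum>f\<in>colourings m M. \<Sum>w\<in>Sym m. if w \<in> stab m f then coef (chi nu) w else 0)"
    by (rule sum.swap)
  also have "\<dots> = (\<Sum>f\<in>colourings m M. of_nat (card (stab m f)) * ?K)"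
  proof (rule sum.cong[OF refl])
    fix f assume f: "f \<in> colourings m M"
    have "{w. w \<in> Sym m \<and> w \<in> stab m f} = stab m f" using stabD by blast
    then have "(\<Sum>w\<in>Sym m. if w \<in> stab m f then coef (chi nu) w else 0) = (\<Sum>w\<in>stab m f. coef (chi nu) w)"
      by (simp only: sum_if_filter[OF finite_Sym])
    \<comment> \<open>The identity coefficient of a product pairs each element with its
      inverse.\<close>
    also have "\<dots> = (\<Sum>w\<in>stab m f. coef (chi nu) (inv w))"
      by (rule sum.reindex_bij_witness[of _ inv inv]) (auto simp: stab_inv permutes_inv_inv[OF stabD])
    also have "\<dots> = ctr (chi nu * row_sum m f)"
      unfolding row_sum_def sum_distrib_left coef_sum
      by (intro sum.cong refl) (simp add: coef_mult_delta[OF stabD])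
    finally show "(\<Sum>w\<in>Sym m. if w \<in> stab m f then coef (chi nu) w else 0) = of_nat (card (stab m f)) * ?K"
      using ctr_chi_row_sum[OF nu f] by simp
  qed
  also have "\<dots> = of_nat (\<Sum>f\<in>colourings m M. card (stab m f)) * ?K"
    by (simp add: sum_distrib_right)
  \<comment> \<open>In degrees other than \<open>m\<close> there are neither colourings nor
    tableaux.\<close>
  also have "\<dots> = fact m * ?K"
  proof (cases "size M = m")
    case True then show ?thesis by (simp add: sum_card_stab)
  next
    case False
    have "colourings m M = {}" using False by (auto simp: colourings_def)
    moreover have "ssyt_content nu M = {}"
      using False card_diagram_partition[OF nu] by (auto simp: ssyt_content_def)
    ultimately show ?thesis by simp
  qed
  finally have "(\<Sum>w\<in>Sym m. coef (chi nu) w * of_nat (card {f \<in> colourings m M. w \<in> stab m f})) = fact m * ?K" .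
  moreover have "mcoeff (\<Sum>w\<in>Sym m. mfps_const (coef (chi nu) w) * power_sum_mset (cycle_type m w)) M =
    (\<Sum>w\<in>Sym m. coef (chi nu) w * of_nat (card {f \<in> colourings m M. w \<in> stab m f}))"
    unfolding mcoeff_sum mcoeff_const_mult by (intro sum.cong refl) (simp add: mcoeff_cycle_type)
  ultimately show "mcoeff (mfps_const (1 / fact m) * (\<Sum>w\<in>Sym m. mfps_const (coef (chi nu) w) * power_sum_mset (cycle_type m w))) M = mcoeff (schur nu) M"
    by (simp add: mcoeff_schur)
qed

section \<open>The generalized Schur functions\<close>

text \<open>The prefactor of the generalized character, a dimension over a factorial, is the one
  that turns \<open>chi mu\<close> into its central idempotent.\<close>

lemma gen_char_eq:
  assumes la: "la \<turnstile>\<^sub>p Suc m" and mu: "mu \<turnstile>\<^sub>p m" and w: "w permutes {1..Suc m}"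
  shows "gen_char (Suc m) la mu w = coef (gam la mu) w"
proof -
  have fd: "irr_char mu id = of_nat (fdim mu)"
    using irr_char_eq[OF mu, of id] fdim(1)[OF mu] by (simp add: permutes_id)
  have "gam la mu = (\<Sum>y\<in>Sym m. coef (cidem mu) y \<cdot>\<^sub>g (chi la * \<delta> y))"
    unfolding gam_def by (subst galg_expand[OF supp_in_cidem[OF mu]]) (simp add: sum_distrib_left)
  then have "coef (gam la mu) w = (\<Sum>y\<in>Sym m. coef (cidem mu) y * coef (chi la * \<delta> y) w)"
    by simp
  also have "\<dots> = (\<Sum>y\<in>Sym m. irr_char mu id / fact m * (irr_char la (w \<circ> inv y) * irr_char mu y))"
  proof (rule sum.cong[OF refl])
    fix y assume "y \<in> Sym m"
    then have y: "y permutes {1..m}" "y permutes {1..Suc m}" using Sym_mono[of y m "Suc m"] by auto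
    have "w \<circ> inv y permutes {1..Suc m}" using permutes_compose[OF permutes_inv[OF y(2)] w] .
    then show "coef (cidem mu) y * coef (chi la * \<delta> y) w = irr_char mu id / fact m * (irr_char la (w \<circ> inv y) * irr_char mu y)"
      using y by (simp add: coef_mult_delta irr_char_eq[OF la] irr_char_eq[OF mu y(1)] cidem_eq[OF mu] fd)
  qed
  finally show ?thesis by (simp add: gen_char_def sum_distrib_left)
qed

lemma smult_sum_right: "smult c (\<Sum>i\<in>A. f i) = (\<Sum>i\<in>A. smult c (f i))"
  by (induction A rule: infinite_finite_induct) (simp_all add: smult_add_right)

definition gterm :: "nat \<Rightarrow> nat list \<Rightarrow> nat list \<Rightarrow> (nat \<Rightarrow> nat) \<Rightarrow> complex mfps poly" where
  "gterm m la mu w = smult (mfps_const (coef (gam la mu) w)) (psi (Suc m) w)"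

lemma gen_schur_eq:
  assumes la: "la \<turnstile>\<^sub>p Suc m" and mu: "mu \<turnstile>\<^sub>p m"
  shows "gen_schur (Suc m) la mu = smult (mfps_const (1 / fact m)) (\<Sum>w\<in>Sym (Suc m). gterm m la mu w)"
  unfolding gen_schur_def Ch'_def gterm_def
  by (simp add: gen_char_eq[OF la mu] cong: sum.cong_simp)

lemma gterm_conj:
  assumes la: "la \<turnstile>\<^sub>p Suc m" and mu: "mu \<turnstile>\<^sub>p m" and w: "w permutes {1..Suc m}" and u: "u permutes {1..m}"
  shows "gterm m la mu (u \<circ> w \<circ> inv u) = gterm m la mu w"
proof -
  have u': "u permutes {1..Suc m}" by (rule Sym_mono[OF u]) simp
  have "\<delta> u * gam la mu = gam la mu * \<delta> u" using gam_commute[OF la mu, of "\<delta> u"] u by simp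
  then have "coef (\<delta> u * gam la mu) (u \<circ> w) = coef (gam la mu * \<delta> u) (u \<circ> w)" by simp
  then have "coef (gam la mu) (u \<circ> w \<circ> inv u) = coef (gam la mu) w"
    using u' by (simp add: coef_delta_mult coef_mult_delta Sym_inv_comp)
  then show ?thesis unfolding gterm_def psi_conj[OF w u] by simp
qed

text \<open>On permutations fixing the last letter the generalized character is
  \<open>chi mu\<close> and \<open>psi\<close> carries no \<open>t\<close>, so this is the ordinary
  characteristic.\<close>

lemma sum_gterm_fixed:
  assumes la: "la \<turnstile>\<^sub>p Suc m" and mu: "mu \<turnstile>\<^sub>p m" and cov: "mu \<nearrow> la"
  shows "smult (mfps_const (1 / fact m)) (\<Sum>w\<in>Sym m. gterm m la mu w) = monom (schur mu) 0"
proof -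
  have "gterm m la mu w = monom (mfps_const (coef (chi mu) w) * power_sum_mset (cycle_type m w)) 0"
    if "w \<in> Sym m" for w
  proof -
    have w: "w permutes {1..m}" using that by simp
    have "coef (gam la mu) w = coef (restr m (gam la mu)) w" using w by (simp add: coef_restr)
    then show ?thesis by (simp add: gterm_def psi_fixed[OF w] restr_gam[OF la mu cov] smult_monom)
  qed
  then have "(\<Sum>w\<in>Sym m. gterm m la mu w) = (\<Sum>w\<in>Sym m. monom (mfps_const (coef (chi mu) w) * power_sum_mset (cycle_type m w)) 0)"
    by simp
  also have "\<dots> = monom (\<Sum>w\<in>Sym m. mfps_const (coef (chi mu) w) * power_sum_mset (cycle_type m w)) 0"
    by (rule monom_sum[symmetric])
  finally show ?thesis by (simp add: smult_monom frobenius[OF mu])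
qed

text \<open>\<open>psi_insert\<close> supplies the factor \<open>t\<close>, and
  \<open>gam_step\<close> expands the generalized character over the lower covers of
  \<open>mu\<close>.\<close>

lemma gterm_insert:
  assumes la: "la \<turnstile>\<^sub>p Suc (Suc p)" and mu: "mu \<turnstile>\<^sub>p Suc p" and cov: "mu \<nearrow> la" and q: "q permutes {1..Suc p}"
  shows "gterm (Suc p) la mu (transpose (Suc (Suc p)) (Suc p) \<circ> q) =
    monom 1 1 * (\<Sum>ka | ka \<in> parts p \<and> ka \<nearrow> mu. smult (mfps_const (1 / of_int (cont la mu - cont mu ka))) (gterm p mu ka q))"
proof -
  let ?s = "transpose (Suc p) (Suc (Suc p))"
  have s: "?s permutes {1..Suc (Suc p)}" by (intro transpose_permutes) auto
  have q': "q permutes {1..Suc (Suc p)}" by (rule Sym_mono[OF q]) simp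
  have qi: "supp_in (Suc p) (\<delta> (inv q))" using q by (auto intro: permutes_inv)
  have "coef (gam la mu) (?s \<circ> q) = ctr (gam la mu * \<delta> (inv (?s \<circ> q)))"
    by (rule coef_eq_ctr[OF permutes_compose[OF q' s]])
  also have "inv (?s \<circ> q) = inv q \<circ> ?s"
    using s q' by (simp add: o_inv_distrib permutes_bij)
  also have "\<delta> (inv q \<circ> ?s) = \<delta> (inv q) * \<delta> ?s"
    using s q' by (simp add: delta_mult[of _ "Suc (Suc p)"] permutes_inv)
  also have "ctr (gam la mu * (\<delta> (inv q) * \<delta> ?s)) = ctr (\<delta> (inv q) * (gam la mu * \<delta> ?s))"
    using gam_commute[OF la mu qi] by (simp add: mult.assoc[symmetric])
  also have "\<dots> = ctr (gam la mu * \<delta> ?s * \<delta> (inv q))" by (rule ctr_commute)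
  also have "\<dots> = (\<Sum>ka | ka \<in> parts p \<and> ka \<nearrow> mu. ctr (gam mu ka * \<delta> (inv q)) / of_int (cont la mu - cont mu ka))"
    by (rule gam_step[OF la mu cov qi])
  also have "\<dots> = (\<Sum>ka | ka \<in> parts p \<and> ka \<nearrow> mu. 1 / of_int (cont la mu - cont mu ka) * coef (gam mu ka) q)"
    by (intro sum.cong refl) (simp add: coef_eq_ctr[OF q, symmetric])
  finally have c: "coef (gam la mu) (?s \<circ> q) = (\<Sum>ka | ka \<in> parts p \<and> ka \<nearrow> mu. 1 / of_int (cont la mu - cont mu ka) * coef (gam mu ka) q)" .
  have "gterm (Suc p) la mu (transpose (Suc (Suc p)) (Suc p) \<circ> q) = smult (mfps_const (coef (gam la mu) (?s \<circ> q))) (monom 1 1 * psi (Suc p) q)"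
    unfolding gterm_def psi_insert[OF q] by (simp add: transpose_commute)
  also have "\<dots> = monom 1 1 * smult (mfps_const (coef (gam la mu) (?s \<circ> q))) (psi (Suc p) q)" by simp
  also have "smult (mfps_const (coef (gam la mu) (?s \<circ> q))) (psi (Suc p) q) =
     (\<Sum>ka | ka \<in> parts p \<and> ka \<nearrow> mu. smult (mfps_const (1 / of_int (cont la mu - cont mu ka))) (gterm p mu ka q))"
    unfolding c mfps_const_sum mfps_const_arith(2) smult_sum gterm_def smult_smult ..
  finally show ?thesis .
qed

text \<open>S(n) is split into cosets by the transpositions (n b). The coset b = n gives the Schur
  function; conjugation makes the others agree with b = n-1, where \<open>gterm_insert\<close>
  applies.\<close>

theorem gen_schur_step:
  assumes la: "la \<turnstile>\<^sub>p Suc (Suc p)" and mu: "mu \<turnstile>\<^sub>p Suc p" and cov: "mu \<nearrow> la"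
  shows "gen_schur (Suc (Suc p)) la mu = monom (schur mu) 0 + monom 1 1 *
    (\<Sum>ka | ka \<in> parts p \<and> ka \<nearrow> mu. smult (mfps_const (1 / of_int (cont la mu - cont mu ka))) (gen_schur (Suc p) mu ka))"
proof -
  let ?n = "Suc (Suc p)" and ?m = "Suc p"
  let ?g = "gterm ?m la mu"
  let ?c = "\<lambda>ka. mfps_const (1 / of_int (cont la mu - cont mu ka)) :: complex mfps"
  have ins: "{1..?n} = insert ?n {1..?m}" by auto
  \<comment> \<open>Conjugation by the transposition of \<open>b\<close> and \<open>?m\<close> fixes
    the last letter and carries one coset to the other.\<close>
  have moved: "(\<Sum>q\<in>Sym ?m. ?g (transpose ?n b \<circ> q)) = (\<Sum>q\<in>Sym ?m. ?g (transpose ?n ?m \<circ> q))"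
    if b: "b \<in> {1..?m}" for b
  proof -
    let ?t = "transpose b ?m"
    have t: "?t permutes {1..?m}" using b by (intro transpose_permutes) auto
    have t': "?t permutes {1..?n}" by (rule Sym_mono[OF t]) simp
    have eq: "?g (transpose ?n b \<circ> q) = ?g (transpose ?n ?m \<circ> (?t \<circ> q \<circ> inv ?t))" if q: "q permutes {1..?m}" for q
    proof -
      have "transpose ?n b permutes {1..?n}" using b by (intro transpose_permutes) auto
      then have w: "transpose ?n b \<circ> q permutes {1..?n}"
        using permutes_compose[OF Sym_mono[OF q]] by simp
      have "?t \<circ> transpose ?n b = transpose ?n ?m \<circ> ?t"
        using b by (auto simp: fun_eq_iff transpose_def)
      then have "?t \<circ> (transpose ?n b \<circ> q) \<circ> inv ?t = transpose ?n ?m \<circ> (?t \<circ> q \<circ> inv ?t)"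
        by (metis o_assoc)
      then show ?thesis using gterm_conj[OF la mu w t] by simp
    qed
    have "(\<Sum>q\<in>Sym ?m. ?g (transpose ?n b \<circ> q)) = (\<Sum>q\<in>Sym ?m. ?g (transpose ?n ?m \<circ> (?t \<circ> q \<circ> inv ?t)))"
      by (intro sum.cong refl eq) simp
    also have "\<dots> = (\<Sum>q\<in>Sym ?m. ?g (transpose ?n ?m \<circ> q))"
      by (rule sum.reindex_bij_witness[of _ "\<lambda>q. inv ?t \<circ> q \<circ> ?t" "\<lambda>q. ?t \<circ> q \<circ> inv ?t"])
         (use t in \<open>auto simp del: inv_transpose_eq transpose_comp_involutory intro!: permutes_compose permutes_inv
            simp: o_assoc[symmetric] Sym_inv_comp permutes_inv_o\<close>)
    finally show ?thesis .
  qed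
  have "(\<Sum>w\<in>Sym ?n. ?g w) = (\<Sum>b\<in>insert ?n {1..?m}. \<Sum>q\<in>Sym ?m. ?g (transpose ?n b \<circ> q))"
    unfolding ins by (rule sum_over_permutations_insert) auto
  also have "\<dots> = (\<Sum>q\<in>Sym ?m. ?g q) + (\<Sum>b\<in>{1..?m}. \<Sum>q\<in>Sym ?m. ?g (transpose ?n b \<circ> q))"
    by simp
  also have "(\<Sum>b\<in>{1..?m}. \<Sum>q\<in>Sym ?m. ?g (transpose ?n b \<circ> q)) = (\<Sum>b\<in>{1..?m}. \<Sum>q\<in>Sym ?m. ?g (transpose ?n ?m \<circ> q))"
    by (intro sum.cong refl moved)
  also have "\<dots> = smult (mfps_const (of_nat ?m)) (\<Sum>q\<in>Sym ?m. ?g (transpose ?n ?m \<circ> q))"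
  proof -
    have "(of_nat k :: complex mfps) = mfps_const (of_nat k)" for k
      by (induction k) (simp_all add: mfps_const_arith)
    then show ?thesis by (simp add: of_nat_poly del: of_nat_Suc)
  qed
  also have "(\<Sum>q\<in>Sym ?m. ?g (transpose ?n ?m \<circ> q)) = monom 1 1 * (\<Sum>ka | ka \<in> parts p \<and> ka \<nearrow> mu. smult (?c ka) (\<Sum>q\<in>Sym ?m. gterm p mu ka q))"
  proof -
    have "(\<Sum>q\<in>Sym ?m. ?g (transpose ?n ?m \<circ> q)) = (\<Sum>q\<in>Sym ?m. monom 1 1 * (\<Sum>ka | ka \<in> parts p \<and> ka \<nearrow> mu. smult (?c ka) (gterm p mu ka q)))"
      by (intro sum.cong refl gterm_insert[OF la mu cov]) simp
    also have "\<dots> = monom 1 1 * (\<Sum>ka | ka \<in> parts p \<and> ka \<nearrow> mu. \<Sum>q\<in>Sym ?m. smult (?c ka) (gterm p mu ka q))"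
      unfolding sum_distrib_left[symmetric] by (subst sum.swap) (rule refl)
    also have "(\<lambda>ka. \<Sum>q\<in>Sym ?m. smult (?c ka) (gterm p mu ka q)) = (\<lambda>ka. smult (?c ka) (\<Sum>q\<in>Sym ?m. gterm p mu ka q))"
      by (simp only: smult_sum_right)
    finally show ?thesis .
  qed
  finally have sum: "(\<Sum>w\<in>Sym ?n. ?g w) = (\<Sum>q\<in>Sym ?m. ?g q) + smult (mfps_const (of_nat ?m))
    (monom 1 1 * (\<Sum>ka | ka \<in> parts p \<and> ka \<nearrow> mu. smult (?c ka) (\<Sum>q\<in>Sym ?m. gterm p mu ka q)))" .
  \<comment> \<open>The \<open>?m\<close> equal cosets cancel the last factor of the factorial and
    leave the normalization of the previous rank.\<close>
  have fac: "mfps_const (1 / fact ?m) * mfps_const (of_nat ?m) = (mfps_const (1 / fact p) :: complex mfps)"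
    unfolding mfps_const_arith(2)[symmetric] by (simp del: of_nat_Suc add: fact_Suc)
  have "gen_schur ?n la mu = monom (schur mu) 0 + smult (mfps_const (1 / fact p))
    (monom 1 1 * (\<Sum>ka | ka \<in> parts p \<and> ka \<nearrow> mu. smult (?c ka) (\<Sum>q\<in>Sym ?m. gterm p mu ka q)))"
    unfolding gen_schur_eq[OF la mu] sum smult_add_right sum_gterm_fixed[OF la mu cov] smult_smult fac ..
  also have "smult (mfps_const (1 / fact p)) (monom 1 1 * (\<Sum>ka | ka \<in> parts p \<and> ka \<nearrow> mu. smult (?c ka) (\<Sum>q\<in>Sym ?m. gterm p mu ka q))) =
    monom 1 1 * (\<Sum>ka | ka \<in> parts p \<and> ka \<nearrow> mu. smult (?c ka) (smult (mfps_const (1 / fact p)) (\<Sum>q\<in>Sym ?m. gterm p mu ka q)))"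
    unfolding mult_smult_right[symmetric] smult_sum_right smult_smult by (simp only: mult.commute)
  also have "(\<Sum>ka | ka \<in> parts p \<and> ka \<nearrow> mu. smult (?c ka) (smult (mfps_const (1 / fact p)) (\<Sum>q\<in>Sym ?m. gterm p mu ka q))) =
    (\<Sum>ka | ka \<in> parts p \<and> ka \<nearrow> mu. smult (?c ka) (gen_schur ?m mu ka))"
    by (intro sum.cong refl) (simp only: mem_Collect_eq parts_iff gen_schur_eq[OF mu])
  finally show ?thesis .
qed

section \<open>Solving the recursion\<close>

definition sub_parts :: "nat list \<Rightarrow> nat list set" where
  "sub_parts mu = {nu. (\<exists>k. nu \<turnstile>\<^sub>p k) \<and> diagram nu \<subseteq> diagram mu}"

lemma sub_partsD: "nu \<in> sub_parts mu \<Longrightarrow> \<exists>k. nu \<turnstile>\<^sub>p k" "nu \<in> sub_parts mu \<Longrightarrow> diagram nu \<subseteq> diagram mu"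
  by (auto simp: sub_parts_def)

lemma finite_sub_parts [simp]: "finite (sub_parts mu)"
proof (rule finite_subset)
  show "sub_parts mu \<subseteq> (\<Union>k\<le>card (diagram mu). parts k)"
  proof
    fix nu assume nu: "nu \<in> sub_parts mu"
    then obtain k where k: "nu \<turnstile>\<^sub>p k" using sub_partsD(1) by blast
    then have "k \<le> card (diagram mu)"
      using card_mono[OF finite_diagram sub_partsD(2)[OF nu]] card_diagram_partition[OF k] by simp
    then show "nu \<in> (\<Union>k\<le>card (diagram mu). parts k)" using k by auto
  qed
qed auto

lemma card_skew_add_box: "mu \<nearrow> la \<Longrightarrow> diagram nu \<subseteq> diagram mu \<Longrightarrow> card (skew la nu) - 1 = card (skew mu nu)"
  using skew_add_box[of mu la nu] by simp

text \<open>Induction along the lower covers. The term \<open>nu = mu\<close> is the Schur function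
  in the recursion; for smaller \<open>nu\<close> the sum over the covers containing
  \<open>nu\<close> is evaluated by \<open>phi_step\<close>.\<close>

theorem gen_schur_expansion:
  assumes "la \<turnstile>\<^sub>p Suc m" "mu \<turnstile>\<^sub>p m" "mu \<nearrow> la"
  shows "gen_schur (Suc m) la mu =
    (\<Sum>nu\<in>sub_parts mu. monom (mfps_const (phi la mu nu) * schur nu) (card (skew la nu) - 1))"
  using assms
proof (induction m arbitrary: la mu)
  case 0
  then have la: "la \<turnstile>\<^sub>p Suc 0" and mu: "mu \<turnstile>\<^sub>p 0" and cov: "mu \<nearrow> la" by auto
  have "mu = []" using mu parts_iff[of mu 0] unfolding parts_0 by simp
  have sub: "sub_parts mu = {mu}"
  proof (intro equalityI subsetI)
    fix nu assume nu: "nu \<in> sub_parts mu"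
    then obtain k where k: "nu \<turnstile>\<^sub>p k" using sub_partsD(1) by blast
    have "diagram nu = diagram mu" using sub_partsD(2)[OF nu] \<open>mu = []\<close> by simp
    then show "nu \<in> {mu}" using diagram_inj[OF k mu] by simp
  qed (use mu in \<open>auto simp: sub_parts_def\<close>)
  \<comment> \<open>With one letter the identity is the only permutation, and it fixes that
    letter.\<close>
  have "Sym (Suc 0) = Sym 0" by (auto simp: permutes_sing One_nat_def)
  then have "gen_schur (Suc 0) la mu = monom (schur mu) 0"
    using gen_schur_eq[OF la mu] sum_gterm_fixed[OF la mu cov] by simp
  moreover have "card (skew la mu) - 1 = 0" using card_skew_add_box[OF cov, of mu] by (simp add: skew_def)
  ultimately show ?case by (simp add: sub phi_self[OF mu la cov] mfps_const_arith)
next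
  case (Suc p)
  then have la: "la \<turnstile>\<^sub>p Suc (Suc p)" and mu: "mu \<turnstile>\<^sub>p Suc p" and cov: "mu \<nearrow> la" by auto
  let ?K = "{ka. ka \<in> parts p \<and> ka \<nearrow> mu}"
  let ?c = "\<lambda>ka. 1 / of_int (cont la mu - cont mu ka) :: complex"
  let ?d = "\<lambda>nu. card (skew mu nu) - 1"
  let ?N = "sub_parts mu - {mu}"
  have self: "mu \<in> sub_parts mu" using mu by (auto simp: sub_parts_def)
  have K_sub: "sub_parts ka \<subseteq> ?N" if "ka \<in> ?K" for ka
  proof
    fix nu assume nu: "nu \<in> sub_parts ka"
    have "diagram ka \<subset> diagram mu" using new_box[of ka mu] that by auto
    then show "nu \<in> ?N" using nu by (auto simp: sub_parts_def)
  qed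
  have "(\<Sum>ka\<in>?K. smult (mfps_const (?c ka)) (gen_schur (Suc p) mu ka)) =
    (\<Sum>ka\<in>?K. \<Sum>nu\<in>?N. if diagram nu \<subseteq> diagram ka then monom (mfps_const (phi mu ka nu / of_int (cont la mu - cont mu ka)) * schur nu) (?d nu) else 0)"
  proof (rule sum.cong[OF refl])
    fix ka assume ka: "ka \<in> ?K"
    have eq: "{nu \<in> ?N. diagram nu \<subseteq> diagram ka} = sub_parts ka"
      using K_sub[OF ka] by (auto simp: sub_parts_def)
    have "smult (mfps_const (?c ka)) (gen_schur (Suc p) mu ka) =
      (\<Sum>nu\<in>sub_parts ka. smult (mfps_const (?c ka)) (monom (mfps_const (phi mu ka nu) * schur nu) (?d nu)))"
      using Suc.IH[OF mu, of ka] ka by (simp only: mem_Collect_eq parts_iff smult_sum_right)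
    also have "\<dots> = (\<Sum>nu\<in>sub_parts ka. monom (mfps_const (phi mu ka nu / of_int (cont la mu - cont mu ka)) * schur nu) (?d nu))"
    proof (rule sum.cong[OF refl])
      fix nu
      have "mfps_const (?c ka) * (mfps_const (phi mu ka nu) * schur nu) = mfps_const (phi mu ka nu / of_int (cont la mu - cont mu ka)) * schur nu"
        unfolding mult.assoc[symmetric] mfps_const_arith(2)[symmetric] by simp
      then show "smult (mfps_const (?c ka)) (monom (mfps_const (phi mu ka nu) * schur nu) (?d nu)) =
        monom (mfps_const (phi mu ka nu / of_int (cont la mu - cont mu ka)) * schur nu) (?d nu)"
        by (simp only: smult_monom)
    qed
    finally show "smult (mfps_const (?c ka)) (gen_schur (Suc p) mu ka) =
      (\<Sum>nu\<in>?N. if diagram nu \<subseteq> diagram ka then monom (mfps_const (phi mu ka nu / of_int (cont la mu - cont mu ka)) * schur nu) (?d nu) else 0)"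
      by (subst sum_if_filter) (simp_all only: eq finite_sub_parts finite_Diff)
  qed
  also have "\<dots> = (\<Sum>nu\<in>?N. \<Sum>ka\<in>?K. if diagram nu \<subseteq> diagram ka then monom (mfps_const (phi mu ka nu / of_int (cont la mu - cont mu ka)) * schur nu) (?d nu) else 0)"
    by (rule sum.swap)
  also have "\<dots> = (\<Sum>nu\<in>?N. monom (mfps_const (phi la mu nu) * schur nu) (?d nu))"
  proof (rule sum.cong[OF refl])
    fix nu assume nu: "nu \<in> ?N"
    then obtain k where k: "nu \<turnstile>\<^sub>p k" using sub_partsD(1) by blast
    have sub: "diagram nu \<subseteq> diagram mu" and ne: "nu \<noteq> mu" using nu sub_partsD(2) by auto
    have eq: "{ka. ka \<in> ?K \<and> diagram nu \<subseteq> diagram ka} = {ka. ka \<in> parts p \<and> ka \<nearrow> mu \<and> diagram nu \<subseteq> diagram ka}" by auto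
    have fin: "finite ?K" by simp
    show "(\<Sum>ka\<in>?K. if diagram nu \<subseteq> diagram ka then monom (mfps_const (phi mu ka nu / of_int (cont la mu - cont mu ka)) * schur nu) (?d nu) else 0)
      = monom (mfps_const (phi la mu nu) * schur nu) (?d nu)"
      unfolding sum_if_filter[OF fin] eq phi_step[OF mu la cov k sub ne] mfps_const_sum sum_distrib_right monom_sum ..
  qed
  finally have "gen_schur (Suc (Suc p)) la mu = monom (schur mu) 0 + monom 1 1 * (\<Sum>nu\<in>?N. monom (mfps_const (phi la mu nu) * schur nu) (?d nu))"
    unfolding gen_schur_step[OF la mu cov] by simp
  also have "monom 1 1 * (\<Sum>nu\<in>?N. monom (mfps_const (phi la mu nu) * schur nu) (?d nu)) =
    (\<Sum>nu\<in>?N. monom (mfps_const (phi la mu nu) * schur nu) (card (skew la nu) - 1))"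
    unfolding sum_distrib_left
  proof (rule sum.cong[OF refl])
    fix nu assume nu: "nu \<in> ?N"
    then obtain k where k: "nu \<turnstile>\<^sub>p k" using sub_partsD(1) by blast
    have sub: "diagram nu \<subseteq> diagram mu" and ne: "nu \<noteq> mu" using nu sub_partsD(2) by auto
    \<comment> \<open>The exponent is a truncated difference, so only for a nonempty skew shape does
      multiplication by \<open>t\<close> give the exponent for \<open>la\<close>.\<close>
    have "skew mu nu \<noteq> {}"
    proof
      assume "skew mu nu = {}"
      then have "diagram mu = diagram nu" using sub by (auto simp: skew_def)
      then show False using ne diagram_inj[OF k mu] by simp
    qed
    then have "card (skew mu nu) > 0" by (simp add: card_gt_0_iff)
    then have "card (skew la nu) - 1 = Suc (?d nu)" using card_skew_add_box[OF cov sub] by simp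
    then show "monom 1 1 * monom (mfps_const (phi la mu nu) * schur nu) (?d nu) =
      monom (mfps_const (phi la mu nu) * schur nu) (card (skew la nu) - 1)"
      by (simp add: mult_monom Suc_eq_plus1_left)
  qed
  also have "monom (schur mu) 0 = monom (mfps_const (phi la mu mu) * schur mu) (card (skew la mu) - 1)"
    using card_skew_add_box[OF cov, of mu] by (simp add: phi_self[OF mu la cov] mfps_const_arith skew_def)
  also have "monom (mfps_const (phi la mu mu) * schur mu) (card (skew la mu) - 1) +
      (\<Sum>nu\<in>?N. monom (mfps_const (phi la mu nu) * schur nu) (card (skew la nu) - 1)) =
    (\<Sum>nu\<in>sub_parts mu. monom (mfps_const (phi la mu nu) * schur nu) (card (skew la nu) - 1))"
    by (rule sum.remove[OF finite_sub_parts self, symmetric])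
  finally show ?case .
qed

theorem theorem6p3:
  fixes la mu :: "nat list" and n :: nat
  assumes "la \<turnstile>\<^sub>p n" and "mu \<turnstile>\<^sub>p n - 1" and "mu \<nearrow> la"
  shows "gen_schur n la mu =
    (\<Sum>nu | (\<exists>k. nu \<turnstile>\<^sub>p k) \<and> diagram nu \<subseteq> diagram mu.
       monom (mfps_const (phi la mu nu) * schur nu) (card (skew la nu) - 1))"
proof -
  \<comment> \<open>Adding a box excludes \<open>n = 0\<close>, so the truncated
    \<open>n - 1\<close> is a true predecessor.\<close>
  have n: "n = Suc (n - 1)" by (rule add_box_size[OF assms(3,2,1)])
  then have "la \<turnstile>\<^sub>p Suc (n - 1)" using assms(1) by simp
  from gen_schur_expansion[OF this assms(2,3)] n show ?thesis by (simp add: sub_parts_def)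
qed

end
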